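(* For a category $\mathcal X$, the following conditions are equivalent: (a) $\mathcal X$ is a regular Mal'tsev category and has stable coequalizers of equivalence relations; (b) $\mathcal X$ is a semi-localization of an exact Mal'tsev category $\mathcal C$; (c) $\mathcal X$ is a semi-localization of an exact Mal'tsev category $\mathcal C$, and the units of the reflection are regular epimorphisms (i.e. every component $\eta_C$ is a regular epimorphism in $\mathcal C$); (d) $\mathcal X$ is a regular Mal'tsev category, and is a semi-localization of its exact completion $\mathcal X_{\mathrm{ex/reg}}$ as a regular category.
   Context: Regular category: has finite limits, coequalizers of kernel pairs, and pullback-stable regular epimorphisms. Exact (Barr-exact) category: a regular category in which every equivalence relation is a kernel pair. Mal'tsev category: a finitely complete category in which every reflexive relation is an equivalence relation (equivalently, every reflexive relation is symmetric). Stable coequalizers of equivalence relations: every equivalence relation $R\rightrightarrows X$ has a coequalizer $q\colon X\to Q$, and for every $f\colon Y\to Q$, if $q'\colon X'\to Y$ is the pullback of $q$ along $f$ and $S\rightrightarrows X'$ is the equivalence relation obtained by pulling back $R\to Q$ along $f$, then $q'$ is the coequalizer of $S\rightrightarrows X'$. Semi-localization: a full reflective subcategory $U\colon\mathcal X\to\mathcal C$, with reflector $L\colon\mathcal C\to\mathcal X$ and unit $\eta$, is a semi-localization of $\mathcal C$ if $L$ is semi-left-exact: for every object $Q$ of $\mathcal C$ and every $f\colon X\to LQ$ in $\mathcal X$, $L$ preserves the pullback of $Uf\colon UX\to ULQ$ along $\eta_Q\colon Q\to ULQ$. A category is said to be a semi-localization of $\mathcal C$ if it is equivalent to such a subcategory.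 Exact completion: for a regular category $\mathcal X$, $\mathcal X_{\mathrm{ex/reg}}$ is its exact completion as a regular category, i.e. the value at $\mathcal X$ of the left biadjoint to the inclusion of the 2-category of exact categories into that of regular categories, regular functors (preserving finite limits and regular epimorphisms) and natural transformations. Explicitly, objects are pairs $(X,R)$ with $R$ an equivalence relation on $X\in\mathcal X$; a morphism $(X,R)\to(Y,S)$ is a relation $\varphi$ from $X$ to $Y$ with $S\varphi R=\varphi$, $R\le\varphi^\circ\varphi$ and $\varphi\varphi^\circ\le S$, where $\varphi^\circ$ is the opposite relation; composition is that of relations, and the identity of $(X,R)$ is $R$. The category $\mathcal X$ is regarded as a full subcategory of $\mathcal X_{\mathrm{ex/reg}}$ via the fully faithful unit $X\mapsto (X,1_X)$; in (d), "is a semi-localization" refers to this embedding. *)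

theory Defs
  imports Main
begin

section \<open>Categories, functors, equivalences\<close>

text \<open>\<open>g \<cdot>\<^bsub>C\<^esub> f\<close> is \<open>g\<close> after \<open>f\<close>. The values of the
  operations outside the carriers, and on non-composable pairs, are irrelevant.\<close>

record ('o, 'm) cat =
  Obj :: "'o set"
  Arr :: "'m set"
  Dom :: "'m \<Rightarrow> 'o"
  Cod :: "'m \<Rightarrow> 'o"
  Id :: "'o \<Rightarrow> 'm"
  Comp :: "'m \<Rightarrow> 'm \<Rightarrow> 'm"  (infixr "\<cdot>\<index>" 70)

definition hom :: "('o, 'm) cat \<Rightarrow> 'o \<Rightarrow> 'o \<Rightarrow> 'm set" where
  "hom C A B = {f \<in> Arr C. Dom C f = A \<and> Cod C f = B}"

locale category =
  fixes C :: "('o, 'm) cat"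
  assumes dom_obj: "f \<in> Arr C \<Longrightarrow> Dom C f \<in> Obj C"
    and cod_obj: "f \<in> Arr C \<Longrightarrow> Cod C f \<in> Obj C"
    and id_hom: "A \<in> Obj C \<Longrightarrow> Id C A \<in> hom C A A"
    and comp_hom: "\<lbrakk>f \<in> hom C A B; g \<in> hom C B D\<rbrakk> \<Longrightarrow> g \<cdot>\<^bsub>C\<^esub> f \<in> hom C A D"
    and id_left: "f \<in> hom C A B \<Longrightarrow> Id C B \<cdot>\<^bsub>C\<^esub> f = f"
    and id_right: "f \<in> hom C A B \<Longrightarrow> f \<cdot>\<^bsub>C\<^esub> Id C A = f"
    and comp_assoc: "\<lbrakk>f \<in> hom C A B; g \<in> hom C B D; h \<in> hom C D E\<rbrakk>
      \<Longrightarrow> (h \<cdot>\<^bsub>C\<^esub> g) \<cdot>\<^bsub>C\<^esub> f = h \<cdot>\<^bsub>C\<^esub> (g \<cdot>\<^bsub>C\<^esub> f)"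

definition is_iso :: "('o, 'm) cat \<Rightarrow> 'm \<Rightarrow> bool" where
  "is_iso C f \<longleftrightarrow> f \<in> Arr C \<and>
     (\<exists>g \<in> hom C (Cod C f) (Dom C f). g \<cdot>\<^bsub>C\<^esub> f = Id C (Dom C f) \<and> f \<cdot>\<^bsub>C\<^esub> g = Id C (Cod C f))"

definition full_subcat :: "('o, 'm) cat \<Rightarrow> 'o set \<Rightarrow> ('o, 'm) cat" where
  "full_subcat C S = C\<lparr>Obj := S, Arr := {f \<in> Arr C. Dom C f \<in> S \<and> Cod C f \<in> S}\<rparr>"

record ('o, 'm, 'p, 'n) func =
  fob :: "'o \<Rightarrow> 'p"
  far :: "'m \<Rightarrow> 'n"

definition is_functor :: "('o, 'm) cat \<Rightarrow> ('p, 'n) cat \<Rightarrow> ('o, 'm, 'p, 'n) func \<Rightarrow> bool" where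
  "is_functor C D F \<longleftrightarrow>
     (\<forall>A \<in> Obj C. fob F A \<in> Obj D) \<and>
     (\<forall>A \<in> Obj C. \<forall>B \<in> Obj C. \<forall>f \<in> hom C A B. far F f \<in> hom D (fob F A) (fob F B)) \<and>
     (\<forall>A \<in> Obj C. far F (Id C A) = Id D (fob F A)) \<and>
     (\<forall>f \<in> Arr C. \<forall>g \<in> Arr C. Dom C g = Cod C f \<longrightarrow> far F (g \<cdot>\<^bsub>C\<^esub> f) = far F g \<cdot>\<^bsub>D\<^esub> far F f)"

definition fully_faithful :: "('o, 'm) cat \<Rightarrow> ('p, 'n) cat \<Rightarrow> ('o, 'm, 'p, 'n) func \<Rightarrow> bool" where
  "fully_faithful C D F \<longleftrightarrow> is_functor C D F \<and>
     (\<forall>A \<in> Obj C. \<forall>B \<in> Obj C. bij_betw (far F) (hom C A B) (hom D (fob F A) (fob F B)))"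

definition id_func :: "('o, 'm, 'o, 'm) func" where
  "id_func = \<lparr>fob = (\<lambda>A. A), far = (\<lambda>f. f)\<rparr>"

definition comp_func ::
    "('p, 'n, 'r, 'k) func \<Rightarrow> ('o, 'm, 'p, 'n) func \<Rightarrow> ('o, 'm, 'r, 'k) func" where
  "comp_func G F = \<lparr>fob = fob G \<circ> fob F, far = far G \<circ> far F\<rparr>"

definition natural_transformation ::
    "('o, 'm) cat \<Rightarrow> ('p, 'n) cat \<Rightarrow> ('o, 'm, 'p, 'n) func \<Rightarrow> ('o, 'm, 'p, 'n) func \<Rightarrow> ('o \<Rightarrow> 'n) \<Rightarrow> bool"
  where
  "natural_transformation C D F G \<alpha> \<longleftrightarrow>
     (\<forall>A \<in> Obj C. \<alpha> A \<in> hom D (fob F A) (fob G A)) \<and>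
     (\<forall>f \<in> Arr C. \<alpha> (Cod C f) \<cdot>\<^bsub>D\<^esub> far F f = far G f \<cdot>\<^bsub>D\<^esub> \<alpha> (Dom C f))"

definition naturally_isomorphic ::
    "('o, 'm) cat \<Rightarrow> ('p, 'n) cat \<Rightarrow> ('o, 'm, 'p, 'n) func \<Rightarrow> ('o, 'm, 'p, 'n) func \<Rightarrow> bool" where
  "naturally_isomorphic C D F G \<longleftrightarrow>
     (\<exists>\<alpha>. natural_transformation C D F G \<alpha> \<and> (\<forall>A \<in> Obj C. is_iso D (\<alpha> A)))"

definition equivalent_categories :: "('o, 'm) cat \<Rightarrow> ('p, 'n) cat \<Rightarrow> bool" where
  "equivalent_categories C D \<longleftrightarrow>
     (\<exists>F G. is_functor C D F \<and> is_functor D C G \<and>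
        naturally_isomorphic C C id_func (comp_func G F) \<and>
        naturally_isomorphic D D (comp_func F G) id_func)"


section \<open>Limits and coequalizers\<close>

definition is_cone ::
    "('j, 'u) cat \<Rightarrow> ('o, 'm) cat \<Rightarrow> ('j, 'u, 'o, 'm) func \<Rightarrow> 'o \<Rightarrow> ('j \<Rightarrow> 'm) \<Rightarrow> bool" where
  "is_cone J C F A c \<longleftrightarrow> A \<in> Obj C \<and>
     (\<forall>j \<in> Obj J. c j \<in> hom C A (fob F j)) \<and>
     (\<forall>u \<in> Arr J. far F u \<cdot>\<^bsub>C\<^esub> c (Dom J u) = c (Cod J u))"

definition is_limit ::
    "('j, 'u) cat \<Rightarrow> ('o, 'm) cat \<Rightarrow> ('j, 'u, 'o, 'm) func \<Rightarrow> 'o \<Rightarrow> ('j \<Rightarrow> 'm) \<Rightarrow> bool" where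
  "is_limit J C F A c \<longleftrightarrow> is_cone J C F A c \<and>
     (\<forall>B b. is_cone J C F B b \<longrightarrow> (\<exists>!h. h \<in> hom C B A \<and> (\<forall>j \<in> Obj J. c j \<cdot>\<^bsub>C\<^esub> h = b j)))"

text \<open>Every finite category is isomorphic to one whose objects and arrows are natural numbers, so
  these suffice as shapes of finite diagrams.\<close>

definition has_finite_limits :: "('o, 'm) cat \<Rightarrow> bool" where
  "has_finite_limits C \<longleftrightarrow>
     (\<forall>(J :: (nat, nat) cat) F.
        category J \<and> finite (Obj J) \<and> finite (Arr J) \<and> is_functor J C F \<longrightarrow>
        (\<exists>A c. is_limit J C F A c))"

text \<open>\<open>is_pullback C f g p q\<close>: the square \<open>f \<cdot> p = g \<cdot> q\<close> is a pullback; \<open>p\<close> is the projection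
  to the domain of \<open>f\<close> and \<open>q\<close> the projection to the domain of \<open>g\<close>.\<close>

definition is_pullback :: "('o, 'm) cat \<Rightarrow> 'm \<Rightarrow> 'm \<Rightarrow> 'm \<Rightarrow> 'm \<Rightarrow> bool" where
  "is_pullback C f g p q \<longleftrightarrow>
     f \<in> Arr C \<and> g \<in> Arr C \<and> p \<in> Arr C \<and> q \<in> Arr C \<and>
     Cod C f = Cod C g \<and> Dom C p = Dom C q \<and> Cod C p = Dom C f \<and> Cod C q = Dom C g \<and>
     f \<cdot>\<^bsub>C\<^esub> p = g \<cdot>\<^bsub>C\<^esub> q \<and>
     (\<forall>T \<in> Obj C. \<forall>a \<in> hom C T (Dom C f). \<forall>b \<in> hom C T (Dom C g). f \<cdot>\<^bsub>C\<^esub> a = g \<cdot>\<^bsub>C\<^esub> b \<longrightarrow>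
        (\<exists>!h. h \<in> hom C T (Dom C p) \<and> p \<cdot>\<^bsub>C\<^esub> h = a \<and> q \<cdot>\<^bsub>C\<^esub> h = b))"

abbreviation is_kernel_pair :: "('o, 'm) cat \<Rightarrow> 'm \<Rightarrow> 'm \<Rightarrow> 'm \<Rightarrow> bool" where
  "is_kernel_pair C f p q \<equiv> is_pullback C f f p q"

definition is_coequalizer :: "('o, 'm) cat \<Rightarrow> 'm \<Rightarrow> 'm \<Rightarrow> 'm \<Rightarrow> bool" where
  "is_coequalizer C f g q \<longleftrightarrow>
     f \<in> Arr C \<and> g \<in> Arr C \<and> q \<in> Arr C \<and>
     Dom C f = Dom C g \<and> Cod C f = Dom C q \<and> Cod C g = Dom C q \<and>
     q \<cdot>\<^bsub>C\<^esub> f = q \<cdot>\<^bsub>C\<^esub> g \<and>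
     (\<forall>Z \<in> Obj C. \<forall>h \<in> hom C (Dom C q) Z. h \<cdot>\<^bsub>C\<^esub> f = h \<cdot>\<^bsub>C\<^esub> g \<longrightarrow>
        (\<exists>!k. k \<in> hom C (Cod C q) Z \<and> k \<cdot>\<^bsub>C\<^esub> q = h))"

definition regular_epi :: "('o, 'm) cat \<Rightarrow> 'm \<Rightarrow> bool" where
  "regular_epi C q \<longleftrightarrow> (\<exists>f g. is_coequalizer C f g q)"


section \<open>Internal relations\<close>

definition is_relation :: "('o, 'm) cat \<Rightarrow> 'o \<Rightarrow> 'o \<Rightarrow> 'm \<Rightarrow> 'm \<Rightarrow> bool" where
  "is_relation C X Y r1 r2 \<longleftrightarrow>
     r1 \<in> Arr C \<and> r2 \<in> Arr C \<and> Dom C r1 = Dom C r2 \<and> Cod C r1 = X \<and> Cod C r2 = Y \<and>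
     (\<forall>T \<in> Obj C. \<forall>f \<in> hom C T (Dom C r1). \<forall>g \<in> hom C T (Dom C r1).
        r1 \<cdot>\<^bsub>C\<^esub> f = r1 \<cdot>\<^bsub>C\<^esub> g \<and> r2 \<cdot>\<^bsub>C\<^esub> f = r2 \<cdot>\<^bsub>C\<^esub> g \<longrightarrow> f = g)"

text \<open>The relation from \<open>hom C T X\<close> to \<open>hom C T Y\<close> represented by a relation from \<open>X\<close> to \<open>Y\<close>.
  As usual, an internal relation on \<open>X\<close> is reflexive, or an equivalence relation, when for every
  \<open>T\<close> the represented relation on the set \<open>hom C T X\<close> is.\<close>

definition rel_elements :: "('o, 'm) cat \<Rightarrow> 'o \<Rightarrow> 'm \<Rightarrow> 'm \<Rightarrow> ('m \<times> 'm) set" where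
  "rel_elements C T r1 r2 = {(r1 \<cdot>\<^bsub>C\<^esub> x, r2 \<cdot>\<^bsub>C\<^esub> x) | x. x \<in> hom C T (Dom C r1)}"

definition reflexive_relation :: "('o, 'm) cat \<Rightarrow> 'o \<Rightarrow> 'm \<Rightarrow> 'm \<Rightarrow> bool" where
  "reflexive_relation C X r1 r2 \<longleftrightarrow> is_relation C X X r1 r2 \<and>
     (\<forall>T \<in> Obj C. refl_on (hom C T X) (rel_elements C T r1 r2))"

definition equivalence_relation :: "('o, 'm) cat \<Rightarrow> 'o \<Rightarrow> 'm \<Rightarrow> 'm \<Rightarrow> bool" where
  "equivalence_relation C X r1 r2 \<longleftrightarrow> is_relation C X X r1 r2 \<and>
     (\<forall>T \<in> Obj C. equiv (hom C T X) (rel_elements C T r1 r2))"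


section \<open>Regular, exact and Mal'tsev categories\<close>

locale finitely_complete_category = category +
  assumes finite_limits: "has_finite_limits C"

locale regular_category = finitely_complete_category +
  assumes kernel_pair_coequalizer: "is_kernel_pair C f p q \<Longrightarrow> \<exists>e. is_coequalizer C p q e"
    and regular_epi_stable: "\<lbrakk>regular_epi C e; is_pullback C e f p q\<rbrakk> \<Longrightarrow> regular_epi C q"

locale exact_category = regular_category +
  assumes equivalence_effective:
    "equivalence_relation C X r1 r2 \<Longrightarrow> \<exists>f. is_kernel_pair C f r1 r2"

locale maltsev_category = finitely_complete_category +
  assumes reflexive_equivalence:
    "reflexive_relation C X r1 r2 \<Longrightarrow> equivalence_relation C X r1 r2"

text \<open>In the stability clause, \<open>(p, q')\<close> is the pullback of \<open>q\<close> along \<open>f\<close>, the pair \<open>(u, v)\<close> is the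
  pullback of the common composite \<open>R \<rightarrow> X \<rightarrow> Q\<close> along \<open>f\<close>, and \<open>s1, s2\<close> are the
  arrows induced by \<open>r1, r2\<close> between these pullbacks.\<close>

definition has_stable_coequalizers_of_equivalence_relations :: "('o, 'm) cat \<Rightarrow> bool" where
  "has_stable_coequalizers_of_equivalence_relations C \<longleftrightarrow>
     (\<forall>X r1 r2. equivalence_relation C X r1 r2 \<longrightarrow>
        (\<exists>q. is_coequalizer C r1 r2 q) \<and>
        (\<forall>q f p q' u v s1 s2.
           is_coequalizer C r1 r2 q \<and>
           is_pullback C q f p q' \<and>
           is_pullback C (q \<cdot>\<^bsub>C\<^esub> r1) f u v \<and>
           s1 \<in> hom C (Dom C u) (Dom C p) \<and> p \<cdot>\<^bsub>C\<^esub> s1 = r1 \<cdot>\<^bsub>C\<^esub> u \<and> q' \<cdot>\<^bsub>C\<^esub> s1 = v \<and>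
           s2 \<in> hom C (Dom C u) (Dom C p) \<and> p \<cdot>\<^bsub>C\<^esub> s2 = r2 \<cdot>\<^bsub>C\<^esub> u \<and> q' \<cdot>\<^bsub>C\<^esub> s2 = v \<longrightarrow>
           is_coequalizer C s1 s2 q'))"


section \<open>Semi-localizations\<close>

text \<open>The full subcategory on \<open>S\<close>, with its inclusion, is reflective with reflector \<open>L\<close> and
  unit \<open>\<eta>\<close>. The inclusion, being the identity on objects and arrows, is left implicit.\<close>

definition reflective_subcategory ::
    "('o, 'm) cat \<Rightarrow> 'o set \<Rightarrow> ('o, 'm, 'o, 'm) func \<Rightarrow> ('o \<Rightarrow> 'm) \<Rightarrow> bool" where
  "reflective_subcategory C S L \<eta> \<longleftrightarrow>
     S \<subseteq> Obj C \<and>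
     is_functor C (full_subcat C S) L \<and>
     natural_transformation C C id_func L \<eta> \<and>
     (\<forall>A \<in> Obj C. \<forall>B \<in> S. \<forall>f \<in> hom C A B. \<exists>!g. g \<in> hom C (fob L A) B \<and> g \<cdot>\<^bsub>C\<^esub> \<eta> A = f)"

definition semi_localization ::
    "('o, 'm) cat \<Rightarrow> 'o set \<Rightarrow> ('o, 'm, 'o, 'm) func \<Rightarrow> ('o \<Rightarrow> 'm) \<Rightarrow> bool" where
  "semi_localization C S L \<eta> \<longleftrightarrow>
     reflective_subcategory C S L \<eta> \<and>
     (\<forall>Q \<in> Obj C. \<forall>X \<in> S. \<forall>f \<in> hom C X (fob L Q). \<forall>p q.
        is_pullback C f (\<eta> Q) p q \<longrightarrow>
        is_pullback (full_subcat C S) (far L f) (far L (\<eta> Q)) (far L p) (far L q))"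

definition is_semi_localization_of :: "('o, 'm) cat \<Rightarrow> ('p, 'n) cat \<Rightarrow> bool" where
  "is_semi_localization_of X C \<longleftrightarrow>
     (\<exists>S L \<eta>. semi_localization C S L \<eta> \<and> equivalent_categories X (full_subcat C S))"

definition is_semi_localization_with_regular_epi_units_of ::
    "('o, 'm) cat \<Rightarrow> ('p, 'n) cat \<Rightarrow> bool" where
  "is_semi_localization_with_regular_epi_units_of X C \<longleftrightarrow>
     (\<exists>S L \<eta>. semi_localization C S L \<eta> \<and> (\<forall>A \<in> Obj C. regular_epi C (\<eta> A)) \<and>
        equivalent_categories X (full_subcat C S))"

text \<open>\<open>X\<close> is identified with the full subcategory of \<open>C\<close> on the image of a fully faithful
  functor \<open>U\<close>.\<close>

definition is_semi_localization_along ::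
    "('o, 'm) cat \<Rightarrow> ('p, 'n) cat \<Rightarrow> ('o, 'm, 'p, 'n) func \<Rightarrow> bool" where
  "is_semi_localization_along X C U \<longleftrightarrow>
     fully_faithful X C U \<and> (\<exists>L \<eta>. semi_localization C (fob U ` Obj X) L \<eta>)"


section \<open>Calculus of relations and the exact completion\<close>

text \<open>A relation as a morphism is the isomorphism class of a jointly monic span, so that equality
  of relations is equality of subobjects.\<close>

type_synonym 'm relation = "('m \<times> 'm) set"

definition rel_class :: "('o, 'm) cat \<Rightarrow> 'm \<Rightarrow> 'm \<Rightarrow> 'm relation" where
  "rel_class C r1 r2 = {(r1 \<cdot>\<^bsub>C\<^esub> i, r2 \<cdot>\<^bsub>C\<^esub> i) | i. is_iso C i \<and> Cod C i = Dom C r1}"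

definition Rel :: "('o, 'm) cat \<Rightarrow> 'o \<Rightarrow> 'o \<Rightarrow> 'm relation set" where
  "Rel C X Y = {rel_class C r1 r2 | r1 r2. is_relation C X Y r1 r2}"

definition rel_le :: "('o, 'm) cat \<Rightarrow> 'm relation \<Rightarrow> 'm relation \<Rightarrow> bool" where
  "rel_le C R S \<longleftrightarrow>
     (\<exists>(r1, r2) \<in> R. \<exists>(s1, s2) \<in> S. \<exists>k \<in> hom C (Dom C r1) (Dom C s1).
        s1 \<cdot>\<^bsub>C\<^esub> k = r1 \<and> s2 \<cdot>\<^bsub>C\<^esub> k = r2)"

definition rel_op :: "'m relation \<Rightarrow> 'm relation" where
  "rel_op R = prod.swap ` R"

text \<open>For \<open>R\<close> from \<open>X\<close> to \<open>Y\<close> and \<open>S\<close> from \<open>Y\<close> to \<open>Z\<close>, \<open>rel_comp C S R\<close> is the composite \<open>SR\<close> from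
  \<open>X\<close> to \<open>Z\<close>: the jointly monic part \<open>(t1, t2)\<close> of a (regular epi, jointly monic) factorization
  of the span obtained by pulling back over \<open>Y\<close>. In a regular category these spans form a single
  isomorphism class.\<close>

definition rel_comp :: "('o, 'm) cat \<Rightarrow> 'm relation \<Rightarrow> 'm relation \<Rightarrow> 'm relation" where
  "rel_comp C S R =
     {(t1, t2). is_relation C (Cod C t1) (Cod C t2) t1 t2 \<and>
        (\<exists>(r1, r2) \<in> R. \<exists>(s1, s2) \<in> S. \<exists>p q e.
           is_pullback C r2 s1 p q \<and> regular_epi C e \<and> Cod C e = Dom C t1 \<and>
           t1 \<cdot>\<^bsub>C\<^esub> e = r1 \<cdot>\<^bsub>C\<^esub> p \<and> t2 \<cdot>\<^bsub>C\<^esub> e = s2 \<cdot>\<^bsub>C\<^esub> q)}"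

type_synonym ('o, 'm) ex_obj = "'o \<times> 'm relation"
type_synonym ('o, 'm) ex_arr = "('o, 'm) ex_obj \<times> 'm relation \<times> ('o, 'm) ex_obj"

definition ex_objects :: "('o, 'm) cat \<Rightarrow> ('o, 'm) ex_obj set" where
  "ex_objects C = {(X, rel_class C r1 r2) | X r1 r2. X \<in> Obj C \<and> equivalence_relation C X r1 r2}"

definition ex_arrows :: "('o, 'm) cat \<Rightarrow> ('o, 'm) ex_arr set" where
  "ex_arrows C =
     {((X, R), \<phi>, (Y, S)) | X R \<phi> Y S.
        (X, R) \<in> ex_objects C \<and> (Y, S) \<in> ex_objects C \<and> \<phi> \<in> Rel C X Y \<and>
        rel_comp C S (rel_comp C \<phi> R) = \<phi> \<and>
        rel_le C R (rel_comp C (rel_op \<phi>) \<phi>) \<and>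
        rel_le C (rel_comp C \<phi> (rel_op \<phi>)) S}"

definition ex_reg :: "('o, 'm) cat \<Rightarrow> (('o, 'm) ex_obj, ('o, 'm) ex_arr) cat" where
  "ex_reg C =
     \<lparr>Obj = ex_objects C,
      Arr = ex_arrows C,
      Dom = (\<lambda>(A, \<phi>, B). A),
      Cod = (\<lambda>(A, \<phi>, B). B),
      Id = (\<lambda>(X, R). ((X, R), R, (X, R))),
      Comp = (\<lambda>(B', \<psi>, D) (A, \<phi>, B). (A, rel_comp C \<psi> \<phi>, D))\<rparr>"

text \<open>The unit sends \<open>X\<close> to \<open>(X, 1)\<close> and an arrow \<open>f\<close> to its graph, the class of the span
  \<open>(1, f)\<close>.\<close>

definition ex_reg_unit :: "('o, 'm) cat \<Rightarrow> ('o, 'm, ('o, 'm) ex_obj, ('o, 'm) ex_arr) func" where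
  "ex_reg_unit C =
     (let y = (\<lambda>X. (X, rel_class C (Id C X) (Id C X)))
      in \<lparr>fob = y,
          far = (\<lambda>f. (y (Dom C f), rel_class C (Id C (Dom C f)) f, y (Cod C f)))\<rparr>)"

end

theory Submission
  imports Defs
begin

text \<open>
  A relation in a regular category is handled through its generalized elements, the spans that factor
  through it, and existential statements hold after passing to a regular epimorphic cover of the stage.
  In these terms an arrow \<open>(X, R) \<rightarrow> (Y, S)\<close> of the exact completion is a locally total relation on
  generalized elements that is single-valued up to \<open>S\<close>, regular epimorphisms are the locally
  surjective arrows, and a relation on \<open>(X, R)\<close> amounts to a relation on \<open>X\<close> compatible with \<open>R\<close>; hence
  the completion is exact, and it is Mal'tsev when the base is.

  If equivalence relations have stable coequalizers, then \<open>(X, R) \<mapsto> X/R\<close> is a reflector of the exact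
  completion with regular epimorphic units. Semi-left-exactness says that the pullback of a unit
  along an arrow of the subcategory is again a universal arrow, and for the canonical pullback this
  is exactly the stability of the coequalizer.

  Conversely, let \<open>U\<close> embed \<open>\<X>\<close> as a semi-localization of an exact Mal'tsev category. The coequalizer in
  \<open>\<X>\<close> of an equivalence relation is the reflection \<open>m e\<close> of its quotient \<open>e\<close> upstairs, where the
  relation is the kernel pair of \<open>e\<close>. Pulling back preserves \<open>e\<close> and its kernel pair by
  regularity, and the universality of \<open>m\<close> by semi-left-exactness, so the coequalizer is stable.
\<close>


section \<open>Categories, pullbacks and coequalizers\<close>

text \<open>The reflector is hardly ever handled as a functor: reflections enter as universal
  arrows, one object at a time. These are unique up to isomorphism, so the argument passes freely
  through the equivalence in (b), whose image is only essentially the given subcategory, and through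
  the choice of pullbacks.

  In (b) nothing but \<open>category\<close> is known of the base, so its finite limits, its
  regularity and the Mal'tsev property have to be derived. Finite limits come from a retract
  argument: when a limit computed upstairs is reflected, the universal arrow at its vertex splits
  and is therefore invertible. Regularity is a consequence of the stable coequalizers, because
  kernel pairs are equivalence relations and a regular epimorphism is the coequalizer of its kernel
  pair.

  Maps of the completion are compared by a single inclusion, since an inclusion between total,
  single-valued relations is an equality; most identities between them are therefore chased in one
  direction only.\<close>

definition universal_arrow_to :: "('o, 'm) cat \<Rightarrow> 'o set \<Rightarrow> 'm \<Rightarrow> bool" where
  "universal_arrow_to C S m \<longleftrightarrow> m \<in> Arr C \<and> Cod C m \<in> S \<and>
     (\<forall>B \<in> S. \<forall>h \<in> hom C (Dom C m) B. \<exists>!k. k \<in> hom C (Cod C m) B \<and> k \<cdot>\<^bsub>C\<^esub> m = h)"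

context category
begin

abbreviation comp (infixr \<open>\<odot>\<close> 70) where "g \<odot> f \<equiv> g \<cdot>\<^bsub>C\<^esub> f"

lemma in_homI: "\<lbrakk>f \<in> Arr C; Dom C f = A; Cod C f = B\<rbrakk> \<Longrightarrow> f \<in> hom C A B"
  by (simp add: hom_def)

lemma comp_simps [simp]:
  assumes "f \<in> Arr C" "g \<in> Arr C" "Dom C g = Cod C f"
  shows "g \<odot> f \<in> Arr C" "Dom C (g \<odot> f) = Dom C f" "Cod C (g \<odot> f) = Cod C g"
  using comp_hom[of f "Dom C f" "Cod C f" g "Cod C g"] assms by (auto simp: hom_def)

lemma id_simps [simp]:
  assumes "A \<in> Obj C"
  shows "Id C A \<in> Arr C" "Dom C (Id C A) = A" "Cod C (Id C A) = A"
  using id_hom[OF assms] by (auto simp: hom_def)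

lemma comp_id_simps [simp]:
  assumes "f \<in> Arr C"
  shows "Cod C f = B \<Longrightarrow> Id C B \<odot> f = f" "Dom C f = A \<Longrightarrow> f \<odot> Id C A = f"
  using id_left[of f "Dom C f" "Cod C f"] id_right[of f "Dom C f" "Cod C f"] assms
  by (auto simp: hom_def)

lemma assoc [simp]:
  assumes "f \<in> Arr C" "g \<in> Arr C" "h \<in> Arr C" "Dom C g = Cod C f" "Dom C h = Cod C g"
  shows "(h \<odot> g) \<odot> f = h \<odot> (g \<odot> f)"
  using comp_assoc[of f "Dom C f" "Cod C f" g "Cod C g" h "Cod C h"] assms by (auto simp: hom_def)

text \<open>The simplifier keeps composites bracketed to the right, where the left side of a known
  equation no longer occurs as a subterm. Precomposing both sides with \<open>x\<close> brings the
  equation into that form.\<close>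

lemma extend:
  assumes "g \<odot> f = k \<odot> h" "x \<in> Arr C" "f \<in> Arr C" "g \<in> Arr C" "h \<in> Arr C" "k \<in> Arr C"
    "Dom C g = Cod C f" "Dom C k = Cod C h" "Cod C x = Dom C f" "Cod C x = Dom C h"
  shows "g \<odot> (f \<odot> x) = k \<odot> (h \<odot> x)"
  using assms assoc[of x f g] assoc[of x h k] by simp

lemma extend1:
  assumes "g \<odot> f = a" "x \<in> Arr C" "f \<in> Arr C" "g \<in> Arr C"
    "Dom C g = Cod C f" "Cod C x = Dom C f"
  shows "g \<odot> (f \<odot> x) = a \<odot> x"
  using assms assoc[of x f g] by simp

lemma isoE:
  assumes "is_iso C f"
  obtains g where "g \<in> Arr C" "Dom C g = Cod C f" "Cod C g = Dom C f"
    "g \<odot> f = Id C (Dom C f)" "f \<odot> g = Id C (Cod C f)"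
  using assms unfolding is_iso_def hom_def by blast

lemma isoI:
  assumes "f \<in> Arr C" "g \<in> Arr C" "Dom C g = Cod C f" "Cod C g = Dom C f"
    "g \<odot> f = Id C (Dom C f)" "f \<odot> g = Id C (Cod C f)"
  shows "is_iso C f"
  using assms unfolding is_iso_def hom_def by blast

lemma pullbackI:
  assumes "f \<in> Arr C" "g \<in> Arr C" "p \<in> Arr C" "q \<in> Arr C" "Cod C f = Cod C g"
    "Dom C p = Dom C q" "Cod C p = Dom C f" "Cod C q = Dom C g" "f \<odot> p = g \<odot> q"
    and ex: "\<And>a b. \<lbrakk>a \<in> Arr C; b \<in> Arr C; Dom C a = Dom C b; Cod C a = Dom C f; Cod C b = Dom C g;
       f \<odot> a = g \<odot> b\<rbrakk> \<Longrightarrow> \<exists>h. h \<in> Arr C \<and> Dom C h = Dom C b \<and> Cod C h = Dom C q \<and> p \<odot> h = a \<and> q \<odot> h = b"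
    and un: "\<And>h h'. \<lbrakk>h \<in> Arr C; h' \<in> Arr C; Dom C h = Dom C h'; Cod C h = Dom C q; Cod C h' = Dom C q;
       p \<odot> h = p \<odot> h'; q \<odot> h = q \<odot> h'\<rbrakk> \<Longrightarrow> h = h'"
  shows "is_pullback C f g p q"
  unfolding is_pullback_def
proof (intro conjI ballI impI)
  fix T a b assume T: "T \<in> Obj C" "a \<in> hom C T (Dom C f)" "b \<in> hom C T (Dom C g)" "f \<odot> a = g \<odot> b"
  then obtain h where "h \<in> hom C T (Dom C p)" "p \<odot> h = a" "q \<odot> h = b"
    using ex[of a b] assms by (auto simp: hom_def)
  then show "\<exists>!h. h \<in> hom C T (Dom C p) \<and> p \<odot> h = a \<and> q \<odot> h = b"
    using un assms(6) by (intro ex1I[of _ h]) (auto simp: hom_def)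
qed (use assms in auto)

lemma pullbackD:
  assumes "is_pullback C f g p q"
  shows "f \<in> Arr C" "g \<in> Arr C" "p \<in> Arr C" "q \<in> Arr C" "Cod C f = Cod C g"
    "Dom C p = Dom C q" "Cod C p = Dom C f" "Cod C q = Dom C g" "f \<odot> p = g \<odot> q"
  using assms unfolding is_pullback_def by auto

lemma pullback_ex:
  assumes "is_pullback C f g p q" "a \<in> Arr C" "b \<in> Arr C" "Dom C a = Dom C b" "Cod C a = Dom C f"
    "Cod C b = Dom C g" "f \<odot> a = g \<odot> b"
  obtains h where "h \<in> Arr C" "Dom C h = Dom C b" "Cod C h = Dom C q" "p \<odot> h = a" "q \<odot> h = b"
proof -
  have "\<And>T a b. \<lbrakk>T \<in> Obj C; a \<in> hom C T (Dom C f); b \<in> hom C T (Dom C g); f \<odot> a = g \<odot> b\<rbrakk>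
      \<Longrightarrow> \<exists>!h. h \<in> hom C T (Dom C p) \<and> p \<odot> h = a \<and> q \<odot> h = b"
    using assms(1) unfolding is_pullback_def by blast
  from this[of "Dom C a" a b] have "\<exists>!h. h \<in> hom C (Dom C a) (Dom C p) \<and> p \<odot> h = a \<and> q \<odot> h = b"
    using assms dom_obj[of a] by (auto simp: hom_def)
  then show ?thesis using that pullbackD(6)[OF assms(1)] assms(4) by (auto simp: hom_def)
qed

lemma pullback_unique:
  assumes "is_pullback C f g p q" "h \<in> Arr C" "h' \<in> Arr C" "Dom C h = Dom C h'" "Cod C h = Dom C q"
    "Cod C h' = Dom C q" "p \<odot> h = p \<odot> h'" "q \<odot> h = q \<odot> h'"
  shows "h = h'"
proof -
  note pb = pullbackD[OF assms(1)]
  have "\<And>T a b. \<lbrakk>T \<in> Obj C; a \<in> hom C T (Dom C f); b \<in> hom C T (Dom C g); f \<odot> a = g \<odot> b\<rbrakk>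
      \<Longrightarrow> \<exists>!h. h \<in> hom C T (Dom C p) \<and> p \<odot> h = a \<and> q \<odot> h = b"
    using assms(1) unfolding is_pullback_def by blast
  from this[of "Dom C h" "p \<odot> h" "q \<odot> h"]
  have "\<exists>!k. k \<in> hom C (Dom C h) (Dom C p) \<and> p \<odot> k = p \<odot> h \<and> q \<odot> k = q \<odot> h"
    using assms(2-) dom_obj[of h] pb extend[OF pb(9), of h] by (simp add: hom_def)
  then show ?thesis using assms pb by (auto simp: hom_def)
qed

lemma coequalizerI:
  assumes "f \<in> Arr C" "g \<in> Arr C" "q \<in> Arr C" "Dom C f = Dom C g" "Cod C f = Dom C q"
    "Cod C g = Dom C q" "q \<odot> f = q \<odot> g"
    and ex: "\<And>h. \<lbrakk>h \<in> Arr C; Dom C h = Dom C q; h \<odot> f = h \<odot> g\<rbrakk>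
      \<Longrightarrow> \<exists>k. k \<in> Arr C \<and> Dom C k = Cod C q \<and> Cod C k = Cod C h \<and> k \<odot> q = h"
    and un: "\<And>k k'. \<lbrakk>k \<in> Arr C; k' \<in> Arr C; Dom C k = Cod C q; Dom C k' = Cod C q; Cod C k = Cod C k';
      k \<odot> q = k' \<odot> q\<rbrakk> \<Longrightarrow> k = k'"
  shows "is_coequalizer C f g q"
  unfolding is_coequalizer_def
proof (intro conjI ballI impI)
  fix Z h assume "Z \<in> Obj C" "h \<in> hom C (Dom C q) Z" "h \<odot> f = h \<odot> g"
  then obtain k where "k \<in> hom C (Cod C q) Z" "k \<odot> q = h"
    using ex[of h] by (auto simp: hom_def)
  then show "\<exists>!k. k \<in> hom C (Cod C q) Z \<and> k \<odot> q = h"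
    using un by (intro ex1I[of _ k]) (auto simp: hom_def)
qed (use assms in auto)

lemma coequalizerD:
  assumes "is_coequalizer C f g q"
  shows "f \<in> Arr C" "g \<in> Arr C" "q \<in> Arr C" "Dom C f = Dom C g" "Cod C f = Dom C q"
    "Cod C g = Dom C q" "q \<odot> f = q \<odot> g"
  using assms unfolding is_coequalizer_def by auto

lemma coequalizer_ex:
  assumes "is_coequalizer C f g q" "h \<in> Arr C" "Dom C h = Dom C q" "h \<odot> f = h \<odot> g"
  obtains k where "k \<in> Arr C" "Dom C k = Cod C q" "Cod C k = Cod C h" "k \<odot> q = h"
proof -
  have "\<And>Z h. \<lbrakk>Z \<in> Obj C; h \<in> hom C (Dom C q) Z; h \<odot> f = h \<odot> g\<rbrakk>
      \<Longrightarrow> \<exists>!k. k \<in> hom C (Cod C q) Z \<and> k \<odot> q = h"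
    using assms(1) unfolding is_coequalizer_def by blast
  from this[of "Cod C h" h] have "\<exists>!k. k \<in> hom C (Cod C q) (Cod C h) \<and> k \<odot> q = h"
    using assms cod_obj[of h] by (simp add: hom_def)
  then show ?thesis using that by (auto simp: hom_def)
qed

lemma coequalizer_epi:
  assumes "is_coequalizer C f g q" "k \<in> Arr C" "k' \<in> Arr C" "Dom C k = Cod C q" "Dom C k' = Cod C q"
    "k \<odot> q = k' \<odot> q"
  shows "k = k'"
proof -
  note q = coequalizerD[OF assms(1)]
  have cod: "Cod C k = Cod C k'"
    using assms q by (metis comp_simps(3))
  have "\<And>Z h. \<lbrakk>Z \<in> Obj C; h \<in> hom C (Dom C q) Z; h \<odot> f = h \<odot> g\<rbrakk>
      \<Longrightarrow> \<exists>!k. k \<in> hom C (Cod C q) Z \<and> k \<odot> q = h"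
    using assms(1) unfolding is_coequalizer_def by blast
  from this[of "Cod C k" "k \<odot> q"] have "\<exists>!m. m \<in> hom C (Cod C q) (Cod C k) \<and> m \<odot> q = k \<odot> q"
    using assms(2-) cod cod_obj[of k] q by (simp add: hom_def)
  then show ?thesis using assms cod by (auto simp: hom_def)
qed

lemma regular_epi_arr: "regular_epi C e \<Longrightarrow> e \<in> Arr C"
  unfolding regular_epi_def is_coequalizer_def by auto

lemma regular_epi_epi:
  assumes "regular_epi C e" "k \<in> Arr C" "k' \<in> Arr C" "Dom C k = Cod C e" "Dom C k' = Cod C e"
    "k \<odot> e = k' \<odot> e"
  shows "k = k'"
  using assms coequalizer_epi unfolding regular_epi_def by metis

text \<open>If \<open>e\<close> is the coequalizer of \<open>f\<close> and \<open>g\<close>, this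
  pair factors through the kernel pair by some \<open>t\<close>. So an arrow with equal composites
  with \<open>p\<close> and \<open>q\<close> also has equal composites with \<open>f\<close> and
  \<open>g\<close>, and factors through \<open>e\<close>.\<close>

lemma regular_epi_coequalizer_kernel_pair:
  assumes e: "regular_epi C e" and k: "is_kernel_pair C e p q"
  shows "is_coequalizer C p q e"
proof -
  obtain f g where c: "is_coequalizer C f g e" using e unfolding regular_epi_def by auto
  note c' = coequalizerD[OF c] and k' = pullbackD[OF k]
  obtain t where t: "t \<in> Arr C" "Dom C t = Dom C g" "Cod C t = Dom C q" "p \<odot> t = f" "q \<odot> t = g"
    using pullback_ex[OF k, of f g] c' by metis
  show ?thesis
  proof (rule coequalizerI)
    fix h assume h: "h \<in> Arr C" "Dom C h = Dom C e" "h \<odot> p = h \<odot> q"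
    have "h \<odot> f = h \<odot> g"
      using extend[OF h(3), of t] t h k' by simp
    then show "\<exists>k. k \<in> Arr C \<and> Dom C k = Cod C e \<and> Cod C k = Cod C h \<and> k \<odot> e = h"
      using coequalizer_ex[OF c h(1,2)] by metis
  qed (use k' coequalizer_epi[OF c] in auto)
qed

text \<open>Here \<open>f\<close> factors as \<open>m\<close> after \<open>e\<close>. Arrows
  identified by \<open>e\<close> are therefore identified by \<open>f\<close> and factor through the
  given kernel pair.\<close>

lemma kernel_pair_of_coequalizer:
  assumes k: "is_kernel_pair C f p q" and e: "is_coequalizer C p q e"
  shows "is_kernel_pair C e p q"
proof -
  note k' = pullbackD[OF k] and e' = coequalizerD[OF e]
  obtain m where m: "m \<in> Arr C" "Dom C m = Cod C e" "Cod C m = Cod C f" "m \<odot> e = f"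
    using coequalizer_ex[OF e, of f] k' e' by metis
  show ?thesis
  proof (rule pullbackI)
    fix a b assume ab: "a \<in> Arr C" "b \<in> Arr C" "Dom C a = Dom C b" "Cod C a = Dom C e" "Cod C b = Dom C e"
      "e \<odot> a = e \<odot> b"
    have "f \<odot> a = m \<odot> (e \<odot> a)" "f \<odot> b = m \<odot> (e \<odot> b)"
      unfolding m(4)[symmetric] using m e' ab by auto
    then have "f \<odot> a = f \<odot> b" using ab by simp
    then show "\<exists>h. h \<in> Arr C \<and> Dom C h = Dom C b \<and> Cod C h = Dom C q \<and> p \<odot> h = a \<and> q \<odot> h = b"
      using pullback_ex[OF k ab(1-3)] ab k' e' by metis
  qed (use k' e' pullback_unique[OF k] in auto)
qed

lemma regular_epi_iso_comp:
  assumes e: "regular_epi C e" and i: "is_iso C i" and "Dom C i = Cod C e"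
  shows "regular_epi C (i \<odot> e)"
proof -
  obtain f g where c: "is_coequalizer C f g e" using e unfolding regular_epi_def by auto
  note c' = coequalizerD[OF c]
  have ia: "i \<in> Arr C" using i unfolding is_iso_def by auto
  obtain j where j: "j \<in> Arr C" "Dom C j = Cod C i" "Cod C j = Dom C i"
    "j \<odot> i = Id C (Dom C i)" "i \<odot> j = Id C (Cod C i)" using i by (rule isoE)
  have obs: "Dom C i \<in> Obj C" "Cod C i \<in> Obj C" using ia dom_obj cod_obj by auto
  have "is_coequalizer C f g (i \<odot> e)"
  proof (rule coequalizerI)
    show "(i \<odot> e) \<odot> f = (i \<odot> e) \<odot> g" using c' ia assms(3) by simp
  next
    fix h assume h: "h \<in> Arr C" "Dom C h = Dom C (i \<odot> e)" "h \<odot> f = h \<odot> g"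
    then obtain k where k: "k \<in> Arr C" "Dom C k = Cod C e" "Cod C k = Cod C h" "k \<odot> e = h"
      using coequalizer_ex[OF c, of h] c' ia assms(3) by auto
    have "(k \<odot> j) \<odot> (i \<odot> e) = h"
      using k j ia c' assms(3) extend1[OF j(4), of e] by simp
    then show "\<exists>k. k \<in> Arr C \<and> Dom C k = Cod C (i \<odot> e) \<and> Cod C k = Cod C h \<and> k \<odot> (i \<odot> e) = h"
      using k j ia c' assms(3) by (intro exI[of _ "k \<odot> j"]) auto
  next
    fix k k' assume k: "k \<in> Arr C" "k' \<in> Arr C" "Dom C k = Cod C (i \<odot> e)" "Dom C k' = Cod C (i \<odot> e)"
      "Cod C k = Cod C k'" "k \<odot> (i \<odot> e) = k' \<odot> (i \<odot> e)"
    have "k \<odot> i = k' \<odot> i"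
      using coequalizer_epi[OF c, of "k \<odot> i" "k' \<odot> i"] k ia c' assms(3) by simp
    then have "(k \<odot> i) \<odot> j = (k' \<odot> i) \<odot> j" by simp
    then show "k = k'" using k j ia c' assms(3) by simp
  qed (use c' ia assms(3) in auto)
  then show ?thesis unfolding regular_epi_def by auto
qed

section \<open>Universal arrows to a set of objects\<close>

lemma universal_arrowD:
  assumes "universal_arrow_to C S m"
  shows "m \<in> Arr C" "Cod C m \<in> S"
  using assms unfolding universal_arrow_to_def by auto

lemma universal_arrow_ex:
  assumes "universal_arrow_to C S m" "h \<in> Arr C" "Dom C h = Dom C m" "Cod C h \<in> S"
  obtains k where "k \<in> Arr C" "Dom C k = Cod C m" "Cod C k = Cod C h" "k \<odot> m = h"
proof -
  have "\<exists>!k. k \<in> hom C (Cod C m) (Cod C h) \<and> k \<odot> m = h"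
    using assms unfolding universal_arrow_to_def hom_def by blast
  then show ?thesis using that by (auto simp: hom_def)
qed

lemma universal_arrow_unique:
  assumes "universal_arrow_to C S m" "k \<in> Arr C" "k' \<in> Arr C" "Dom C k = Cod C m" "Dom C k' = Cod C m"
    "Cod C k \<in> S" "k \<odot> m = k' \<odot> m"
  shows "k = k'"
proof -
  have m: "m \<in> Arr C" using assms(1) by (rule universal_arrowD)
  have cod: "Cod C k = Cod C k'"
    using assms m by (metis comp_simps(3))
  have "\<exists>!l. l \<in> hom C (Cod C m) (Cod C k) \<and> l \<odot> m = k \<odot> m"
    using assms(1)[unfolded universal_arrow_to_def, THEN conjunct2, THEN conjunct2, rule_format, of "Cod C k" "k \<odot> m"]
      assms(2-) m cod by (simp add: hom_def)
  then show ?thesis using assms cod by (auto simp: hom_def)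
qed

lemma universal_arrowI:
  assumes "m \<in> Arr C" "Cod C m \<in> S"
    and ex: "\<And>h. \<lbrakk>h \<in> Arr C; Dom C h = Dom C m; Cod C h \<in> S\<rbrakk>
      \<Longrightarrow> \<exists>k. k \<in> Arr C \<and> Dom C k = Cod C m \<and> Cod C k = Cod C h \<and> k \<odot> m = h"
    and un: "\<And>k k'. \<lbrakk>k \<in> Arr C; k' \<in> Arr C; Dom C k = Cod C m; Dom C k' = Cod C m; Cod C k = Cod C k';
      Cod C k' \<in> S; k \<odot> m = k' \<odot> m\<rbrakk> \<Longrightarrow> k = k'"
  shows "universal_arrow_to C S m"
  unfolding universal_arrow_to_def
proof (intro conjI ballI)
  fix B h assume "B \<in> S" "h \<in> hom C (Dom C m) B"
  then obtain k where "k \<in> hom C (Cod C m) B" "k \<odot> m = h" using ex[of h] by (auto simp: hom_def)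
  then show "\<exists>!k. k \<in> hom C (Cod C m) B \<and> k \<odot> m = h"
    using un \<open>B \<in> S\<close> by (intro ex1I[of _ k]) (auto simp: hom_def)
qed (use assms in auto)

lemma universal_arrow_iso:
  assumes m: "universal_arrow_to C S m" and m': "universal_arrow_to C S m'" and d: "Dom C m = Dom C m'"
  obtains i where "is_iso C i" "Dom C i = Cod C m" "Cod C i = Cod C m'" "i \<odot> m = m'"
proof -
  note M = universal_arrowD[OF m] and M' = universal_arrowD[OF m']
  obtain i where i: "i \<in> Arr C" "Dom C i = Cod C m" "Cod C i = Cod C m'" "i \<odot> m = m'"
    using universal_arrow_ex[OF m, of m'] M' d by auto
  obtain j where j: "j \<in> Arr C" "Dom C j = Cod C m'" "Cod C j = Cod C m" "j \<odot> m' = m"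
    using universal_arrow_ex[OF m', of m] M d by auto
  have obs: "Cod C m \<in> Obj C" "Cod C m' \<in> Obj C" using M M' cod_obj by auto
  have "(j \<odot> i) \<odot> m = Id C (Cod C m) \<odot> m" using i j M by simp
  then have ji: "j \<odot> i = Id C (Cod C m)"
    using universal_arrow_unique[OF m, of "j \<odot> i" "Id C (Cod C m)"] i j M obs by simp
  have "(i \<odot> j) \<odot> m' = Id C (Cod C m') \<odot> m'" using i j M' by simp
  then have ij: "i \<odot> j = Id C (Cod C m')"
    using universal_arrow_unique[OF m', of "i \<odot> j" "Id C (Cod C m')"] i j M' obs by simp
  show ?thesis using that[of i] isoI[of i j] i j ij ji by auto
qed

lemma universal_arrow_comp_iso:
  assumes m: "universal_arrow_to C S m" and i: "is_iso C i" "Dom C i = Cod C m" "Cod C i \<in> S"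
  shows "universal_arrow_to C S (i \<odot> m)"
proof -
  note M = universal_arrowD[OF m]
  have ia: "i \<in> Arr C" using i unfolding is_iso_def by auto
  obtain j where j: "j \<in> Arr C" "Dom C j = Cod C i" "Cod C j = Dom C i"
    "j \<odot> i = Id C (Dom C i)" "i \<odot> j = Id C (Cod C i)" using i(1) by (rule isoE)
  have obs: "Dom C i \<in> Obj C" "Cod C i \<in> Obj C" using ia dom_obj cod_obj by auto
  show ?thesis
  proof (rule universal_arrowI)
    fix h assume h: "h \<in> Arr C" "Dom C h = Dom C (i \<odot> m)" "Cod C h \<in> S"
    then obtain k where k: "k \<in> Arr C" "Dom C k = Cod C m" "Cod C k = Cod C h" "k \<odot> m = h"
      using universal_arrow_ex[OF m, of h] M ia i by auto
    have "(k \<odot> j) \<odot> (i \<odot> m) = h"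
      using k j ia M i extend1[OF j(4), of m] by simp
    then show "\<exists>k. k \<in> Arr C \<and> Dom C k = Cod C (i \<odot> m) \<and> Cod C k = Cod C h \<and> k \<odot> (i \<odot> m) = h"
      using k j ia M i by (intro exI[of _ "k \<odot> j"]) auto
  next
    fix k k' assume k: "k \<in> Arr C" "k' \<in> Arr C" "Dom C k = Cod C (i \<odot> m)" "Dom C k' = Cod C (i \<odot> m)"
      "Cod C k = Cod C k'" "Cod C k' \<in> S" "k \<odot> (i \<odot> m) = k' \<odot> (i \<odot> m)"
    have "k \<odot> i = k' \<odot> i"
      using universal_arrow_unique[OF m, of "k \<odot> i" "k' \<odot> i"] k ia M i by simp
    then have "(k \<odot> i) \<odot> j = (k' \<odot> i) \<odot> j" by simp
    then show "k = k'" using k j ia M i by simp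
  qed (use M ia i in auto)
qed

lemma universal_arrow_precomp_iso:
  assumes m: "universal_arrow_to C S m" and i: "is_iso C i" "Cod C i = Dom C m"
  shows "universal_arrow_to C S (m \<odot> i)"
proof -
  note M = universal_arrowD[OF m]
  have ia: "i \<in> Arr C" using i unfolding is_iso_def by auto
  obtain j where j: "j \<in> Arr C" "Dom C j = Cod C i" "Cod C j = Dom C i"
    "j \<odot> i = Id C (Dom C i)" "i \<odot> j = Id C (Cod C i)" using i(1) by (rule isoE)
  have obs: "Dom C i \<in> Obj C" "Cod C i \<in> Obj C" using ia dom_obj cod_obj by auto
  have canc: "h \<odot> m = h' \<odot> m" if "h \<in> Arr C" "h' \<in> Arr C" "Dom C h = Cod C m" "Dom C h' = Cod C m"
    "h \<odot> m \<odot> i = h' \<odot> m \<odot> i" for h h'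
  proof -
    have "h \<odot> m \<odot> i \<odot> j = h' \<odot> m \<odot> i \<odot> j"
      using extend[of h "m \<odot> i" h' "m \<odot> i" j] that M ia i j by simp
    then show ?thesis using that M i j by simp
  qed
  show ?thesis
  proof (rule universal_arrowI)
    fix h assume h: "h \<in> Arr C" "Dom C h = Dom C (m \<odot> i)" "Cod C h \<in> S"
    then obtain k where k: "k \<in> Arr C" "Dom C k = Cod C m" "Cod C k = Cod C h" "k \<odot> m = h \<odot> j"
      using universal_arrow_ex[OF m, of "h \<odot> j"] M ia i j by auto
    have "k \<odot> m \<odot> i = h"
      using extend[OF k(4), of i] h k M ia i j by simp
    then show "\<exists>k. k \<in> Arr C \<and> Dom C k = Cod C (m \<odot> i) \<and> Cod C k = Cod C h \<and> k \<odot> (m \<odot> i) = h"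
      using k ia M i by (intro exI[of _ k]) auto
  next
    fix k k' assume k: "k \<in> Arr C" "k' \<in> Arr C" "Dom C k = Cod C (m \<odot> i)" "Dom C k' = Cod C (m \<odot> i)"
      "Cod C k = Cod C k'" "Cod C k' \<in> S" "k \<odot> (m \<odot> i) = k' \<odot> (m \<odot> i)"
    then have "k \<odot> m = k' \<odot> m" by (intro canc) (use k M ia i in auto)
    then show "k = k'" using universal_arrow_unique[OF m, of k k'] k M ia i by simp
  qed (use M ia i in auto)
qed

text \<open>Lets a property be checked on one constructed pullback and carried to an arbitrary one
  by precomposing with the comparison.\<close>

lemma pullback_comparison_iso:
  assumes pb: "is_pullback C f g p q" and pb': "is_pullback C f g p' q'"
  obtains i where "is_iso C i" "Dom C i = Dom C p'" "Cod C i = Dom C p" "p \<odot> i = p'" "q \<odot> i = q'"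
proof -
  note P = pullbackD[OF pb] and P' = pullbackD[OF pb']
  obtain i where i: "i \<in> Arr C" "Dom C i = Dom C q'" "Cod C i = Dom C q" "p \<odot> i = p'" "q \<odot> i = q'"
    using pullback_ex[OF pb, of p' q'] P' by auto
  obtain j where j: "j \<in> Arr C" "Dom C j = Dom C q" "Cod C j = Dom C q'" "p' \<odot> j = p" "q' \<odot> j = q"
    using pullback_ex[OF pb', of p q] P by auto
  have obs: "Dom C q \<in> Obj C" "Dom C q' \<in> Obj C" using P P' dom_obj by auto
  have "i \<odot> j = Id C (Dom C q)"
    using pullback_unique[OF pb, of "i \<odot> j" "Id C (Dom C q)"] i j P obs
      extend1[OF i(4) j(1)] extend1[OF i(5) j(1)] by simp
  moreover have "j \<odot> i = Id C (Dom C q')"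
    using pullback_unique[OF pb', of "j \<odot> i" "Id C (Dom C q')"] i j P' obs
      extend1[OF j(4) i(1)] extend1[OF j(5) i(1)] by simp
  ultimately show ?thesis using that[of i] isoI[of i j] i j P P' by auto
qed

lemma pullback_iso:
  assumes pb: "is_pullback C f g p q" and g: "is_iso C g"
  shows "is_iso C p"
proof -
  note P = pullbackD[OF pb]
  obtain j where j: "j \<in> Arr C" "Dom C j = Cod C g" "Cod C j = Dom C g"
    "j \<odot> g = Id C (Dom C g)" "g \<odot> j = Id C (Cod C g)" using g by (rule isoE)
  have obs: "Dom C f \<in> Obj C" "Dom C q \<in> Obj C" "Cod C g \<in> Obj C" "Dom C g \<in> Obj C" using P dom_obj cod_obj by auto
  have "g \<odot> j \<odot> f = f" using extend1[OF j(5), of f] P j by simp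
  then obtain i where i: "i \<in> Arr C" "Dom C i = Dom C f" "Cod C i = Dom C q" "p \<odot> i = Id C (Dom C f)" "q \<odot> i = j \<odot> f"
    using pullback_ex[OF pb, of "Id C (Dom C f)" "j \<odot> f"] P j obs by (metis comp_simps comp_id_simps id_simps)
  have "q \<odot> i \<odot> p = (j \<odot> f) \<odot> p" using extend1[OF i(5), of p] i P by simp
  also have "\<dots> = j \<odot> (g \<odot> q)" using P j by simp
  also have "\<dots> = q" using extend1[OF j(4), of q] P j by simp
  finally have "i \<odot> p = Id C (Dom C q)"
    using pullback_unique[OF pb, of "i \<odot> p" "Id C (Dom C q)"] i P obs
      extend1[OF i(4) ] by simp
  then show ?thesis using isoI[of p i] i P by auto
qed

text \<open>Supplies the preservation clause of \<open>semi_localization\<close>: there the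
  reflector turns both the unit and its pullback into isomorphisms.\<close>

lemma pullback_of_isos:
  assumes "f \<in> Arr C" "q \<in> Arr C" "is_iso C g" "is_iso C p" "Cod C f = Cod C g"
    "Dom C p = Dom C q" "Cod C p = Dom C f" "Cod C q = Dom C g" "f \<odot> p = g \<odot> q"
  shows "is_pullback C f g p q"
proof -
  obtain j where j: "j \<in> Arr C" "Dom C j = Cod C g" "Cod C j = Dom C g"
    "j \<odot> g = Id C (Dom C g)" "g \<odot> j = Id C (Cod C g)" using assms(3) by (rule isoE)
  obtain i where i: "i \<in> Arr C" "Dom C i = Cod C p" "Cod C i = Dom C p"
    "i \<odot> p = Id C (Dom C p)" "p \<odot> i = Id C (Cod C p)" using assms(4) by (rule isoE)
  have arr: "g \<in> Arr C" "p \<in> Arr C" using assms unfolding is_iso_def by auto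
  show ?thesis
  proof (rule pullbackI)
    fix a b assume ab: "a \<in> Arr C" "b \<in> Arr C" "Dom C a = Dom C b" "Cod C a = Dom C f" "Cod C b = Dom C g"
      "f \<odot> a = g \<odot> b"
    have pia: "p \<odot> i \<odot> a = a" using extend1[OF i(5), of a] assms arr i ab by simp
    have "g \<odot> q \<odot> i \<odot> a = f \<odot> p \<odot> i \<odot> a"
      by (rule extend[OF assms(9)[symmetric]]) (use assms(1-2,5-8) arr i(1-3) ab in simp_all)
    also have "\<dots> = g \<odot> b" using pia ab by simp
    finally have "j \<odot> g \<odot> q \<odot> i \<odot> a = j \<odot> g \<odot> b" by simp
    then have "q \<odot> i \<odot> a = b"
      using extend1[OF j(4), of "q \<odot> i \<odot> a"] extend1[OF j(4), of b] assms arr i j ab by simp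
    then show "\<exists>h. h \<in> Arr C \<and> Dom C h = Dom C b \<and> Cod C h = Dom C q \<and> p \<odot> h = a \<and> q \<odot> h = b"
      using pia assms arr i ab by (intro exI[of _ "i \<odot> a"]) simp
  next
    fix h h' assume h: "h \<in> Arr C" "h' \<in> Arr C" "Dom C h = Dom C h'" "Cod C h = Dom C q" "Cod C h' = Dom C q"
       "p \<odot> h = p \<odot> h'" "q \<odot> h = q \<odot> h'"
    have "k = i \<odot> p \<odot> k" if "k \<in> Arr C" "Cod C k = Dom C q" for k
      using extend1[OF i(4), of k] assms(6) arr i(1-3) that by simp
    then show "h = h'" using h by metis
  qed (use assms arr in auto)
qed

end


section \<open>Finite limits from a terminal object and pullbacks\<close>

definition is_product :: "('o, 'm) cat \<Rightarrow> 'm \<Rightarrow> 'm \<Rightarrow> bool" where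
  "is_product C p q \<longleftrightarrow> p \<in> Arr C \<and> q \<in> Arr C \<and> Dom C p = Dom C q \<and>
     (\<forall>T \<in> Obj C. \<forall>a \<in> hom C T (Cod C p). \<forall>b \<in> hom C T (Cod C q).
        \<exists>!h. h \<in> hom C T (Dom C q) \<and> p \<cdot>\<^bsub>C\<^esub> h = a \<and> q \<cdot>\<^bsub>C\<^esub> h = b)"

definition is_equalizer :: "('o, 'm) cat \<Rightarrow> 'm \<Rightarrow> 'm \<Rightarrow> 'm \<Rightarrow> bool" where
  "is_equalizer C f g e \<longleftrightarrow> f \<in> Arr C \<and> g \<in> Arr C \<and> e \<in> Arr C \<and>
     Cod C e = Dom C f \<and> Dom C f = Dom C g \<and> f \<cdot>\<^bsub>C\<^esub> e = g \<cdot>\<^bsub>C\<^esub> e \<and>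
     (\<forall>T \<in> Obj C. \<forall>a \<in> hom C T (Dom C f). f \<cdot>\<^bsub>C\<^esub> a = g \<cdot>\<^bsub>C\<^esub> a \<longrightarrow>
        (\<exists>!h. h \<in> hom C T (Dom C e) \<and> e \<cdot>\<^bsub>C\<^esub> h = a))"

definition monic :: "('o, 'm) cat \<Rightarrow> 'm \<Rightarrow> bool" where
  "monic C m \<longleftrightarrow> m \<in> Arr C \<and> (\<forall>a \<in> Arr C. \<forall>b \<in> Arr C. Dom C a = Dom C b \<longrightarrow> Cod C a = Dom C m \<longrightarrow>
     Cod C b = Dom C m \<longrightarrow> m \<cdot>\<^bsub>C\<^esub> a = m \<cdot>\<^bsub>C\<^esub> b \<longrightarrow> a = b)"

text \<open>The working form of finite completeness. \<open>has_finite_limits\<close> speaks of all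
  finite diagrams, whereas in a new category only these two kinds of limits have to be constructed;
  products and equalizers follow from them.\<close>

locale pullback_category = category +
  assumes terminal: "\<exists>t \<in> Obj C. \<forall>A \<in> Obj C. \<exists>!h. h \<in> hom C A t"
    and pullbacks: "\<lbrakk>f \<in> Arr C; g \<in> Arr C; Cod C f = Cod C g\<rbrakk> \<Longrightarrow> \<exists>p q. is_pullback C f g p q"

context category
begin

lemma productD:
  assumes "is_product C p q"
  shows "p \<in> Arr C" "q \<in> Arr C" "Dom C p = Dom C q"
  using assms unfolding is_product_def by auto

lemma product_ex:
  assumes "is_product C p q" "a \<in> Arr C" "b \<in> Arr C" "Dom C a = Dom C b" "Cod C a = Cod C p"
    "Cod C b = Cod C q"
  obtains h where "h \<in> Arr C" "Dom C h = Dom C b" "Cod C h = Dom C q" "p \<odot> h = a" "q \<odot> h = b"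
proof -
  have "\<And>T a b. \<lbrakk>T \<in> Obj C; a \<in> hom C T (Cod C p); b \<in> hom C T (Cod C q)\<rbrakk>
      \<Longrightarrow> \<exists>!h. h \<in> hom C T (Dom C q) \<and> p \<odot> h = a \<and> q \<odot> h = b"
    using assms(1) unfolding is_product_def by blast
  from this[of "Dom C b" a b] show ?thesis using that assms dom_obj[of b] by (auto simp: hom_def)
qed

lemma product_unique:
  assumes "is_product C p q" "h \<in> Arr C" "h' \<in> Arr C" "Dom C h = Dom C h'" "Cod C h = Dom C q"
    "Cod C h' = Dom C q" "p \<odot> h = p \<odot> h'" "q \<odot> h = q \<odot> h'"
  shows "h = h'"
proof -
  note P = productD[OF assms(1)]
  have "\<And>T a b. \<lbrakk>T \<in> Obj C; a \<in> hom C T (Cod C p); b \<in> hom C T (Cod C q)\<rbrakk>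
      \<Longrightarrow> \<exists>!h. h \<in> hom C T (Dom C q) \<and> p \<odot> h = a \<and> q \<odot> h = b"
    using assms(1) unfolding is_product_def by blast
  from this[of "Dom C h" "p \<odot> h" "q \<odot> h"]
  show ?thesis using assms(2-) dom_obj[of h] P by (auto simp: hom_def)
qed

end

text \<open>The cone condition restricted to the objects in \<open>S\<close> and the arrows in
  \<open>A\<close>, so that a limit can be built by adding one object or one arrow at a
  time.\<close>

definition partial_cone ::
  "('j, 'u) cat \<Rightarrow> ('o, 'm) cat \<Rightarrow> ('j, 'u, 'o, 'm) func \<Rightarrow> 'j set \<Rightarrow> 'u set \<Rightarrow> 'o \<Rightarrow> ('j \<Rightarrow> 'm) \<Rightarrow> bool" where
  "partial_cone J C F S A B b \<longleftrightarrow> B \<in> Obj C \<and> (\<forall>j \<in> S. b j \<in> hom C B (fob F j)) \<and>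
     (\<forall>u \<in> A. far F u \<cdot>\<^bsub>C\<^esub> b (Dom J u) = b (Cod J u))"

definition partial_limit ::
  "('j, 'u) cat \<Rightarrow> ('o, 'm) cat \<Rightarrow> ('j, 'u, 'o, 'm) func \<Rightarrow> 'j set \<Rightarrow> 'u set \<Rightarrow> 'o \<Rightarrow> ('j \<Rightarrow> 'm) \<Rightarrow> bool" where
  "partial_limit J C F S A L c \<longleftrightarrow> partial_cone J C F S A L c \<and>
     (\<forall>B b. partial_cone J C F S A B b \<longrightarrow> (\<exists>!h. h \<in> hom C B L \<and> (\<forall>j \<in> S. c j \<cdot>\<^bsub>C\<^esub> h = b j)))"

context pullback_category
begin

text \<open>Over a terminal object any two composites agree, so the pullback of the two arrows to it
  imposes no condition.\<close>

lemma products: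
  assumes "A \<in> Obj C" "B \<in> Obj C"
  obtains p q where "is_product C p q" "Cod C p = A" "Cod C q = B"
proof -
  obtain t where t: "t \<in> Obj C" "\<And>A. A \<in> Obj C \<Longrightarrow> \<exists>!h. h \<in> hom C A t" using terminal by auto
  obtain f g where fg: "f \<in> hom C A t" "g \<in> hom C B t" using t(2) assms by blast
  then obtain p q where pb: "is_pullback C f g p q" using pullbacks[of f g] by (auto simp: hom_def)
  note P = pullbackD[OF pb]
  have "is_product C p q"
    unfolding is_product_def
  proof (intro conjI ballI)
    fix T a b assume T: "T \<in> Obj C" "a \<in> hom C T (Cod C p)" "b \<in> hom C T (Cod C q)"
    have "f \<odot> a \<in> hom C T t" "g \<odot> b \<in> hom C T t" using T fg P by (auto simp: hom_def)
    then have "f \<odot> a = g \<odot> b" using t(2)[OF T(1)] by blast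
    then obtain h where "h \<in> hom C T (Dom C q)" "p \<odot> h = a" "q \<odot> h = b"
      using pullback_ex[OF pb, of a b] T P by (auto simp: hom_def)
    then show "\<exists>!h. h \<in> hom C T (Dom C q) \<and> p \<odot> h = a \<and> q \<odot> h = b"
      using pullback_unique[OF pb] by (intro ex1I[of _ h]) (auto simp: hom_def)
  qed (use P in auto)
  then show ?thesis using that P fg by (auto simp: hom_def)
qed

text \<open>The graphs \<open>k\<close> and \<open>l\<close> of \<open>f\<close> and
  \<open>g\<close>, as arrows into a product, meet exactly where \<open>f\<close> and
  \<open>g\<close> agree; the equalizer is a leg of their pullback.\<close>

lemma equalizers:
  assumes "f \<in> Arr C" "g \<in> Arr C" "Dom C f = Dom C g" "Cod C f = Cod C g"
  obtains e where "is_equalizer C f g e"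
proof -
  obtain p q where pq: "is_product C p q" "Cod C p = Dom C f" "Cod C q = Cod C f"
    using products[of "Dom C f" "Cod C f"] assms dom_obj cod_obj by auto
  note P = productD[OF pq(1)]
  have ob: "Dom C f \<in> Obj C" using assms dom_obj by auto
  obtain k where k: "k \<in> Arr C" "Dom C k = Dom C f" "Cod C k = Dom C q" "p \<odot> k = Id C (Dom C f)" "q \<odot> k = f"
    using product_ex[OF pq(1), of "Id C (Dom C f)" f] assms pq ob by auto
  obtain l where l: "l \<in> Arr C" "Dom C l = Dom C f" "Cod C l = Dom C q" "p \<odot> l = Id C (Dom C f)" "q \<odot> l = g"
    using product_ex[OF pq(1), of "Id C (Dom C f)" g] assms pq ob by auto
  obtain e e' where pb: "is_pullback C k l e e'" using pullbacks[of k l] k l by auto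
  note E = pullbackD[OF pb]
  have kx: "p \<odot> k \<odot> x = x" "q \<odot> k \<odot> x = f \<odot> x" "p \<odot> l \<odot> x = x" "q \<odot> l \<odot> x = g \<odot> x"
    if "x \<in> Arr C" "Cod C x = Dom C f" for x
    using extend1[OF k(4), of x] extend1[OF k(5), of x] extend1[OF l(4), of x] extend1[OF l(5), of x]
      that k(1-3) l(1-3) P by simp_all
  \<comment> \<open>Both graphs have the identity as first component, so the two legs
    coincide.\<close>
  have ee': "e = e'" using kx(1)[of e] kx(3)[of e'] E k l by simp
  have "f \<odot> e = g \<odot> e" using kx(2)[of e] kx(4)[of e'] E k l ee' by simp
  moreover have "\<exists>!h. h \<in> hom C T (Dom C e) \<and> e \<odot> h = a"
    if T: "T \<in> Obj C" "a \<in> hom C T (Dom C f)" "f \<odot> a = g \<odot> a" for T a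
  proof -
    have a: "a \<in> Arr C" "Cod C a = Dom C f" "Dom C a = T" using T by (auto simp: hom_def)
    have "k \<odot> a = l \<odot> a"
      using product_unique[OF pq(1), of "k \<odot> a" "l \<odot> a"] kx[OF a(1,2)] a k(1-3) l(1-3) T by simp
    then obtain h where "h \<in> hom C T (Dom C e)" "e \<odot> h = a"
      using pullback_ex[OF pb, of a a] a k(1-3) l(1-3) ee' by (auto simp: hom_def)
    then show ?thesis
      using pullback_unique[OF pb] ee' by (intro ex1I[of _ h]) (auto simp: hom_def)
  qed
  ultimately have "is_equalizer C f g e" using assms E k unfolding is_equalizer_def by auto
  then show ?thesis by (rule that)
qed

text \<open>Induction on the set of objects: the limit over none is a terminal object, and each new
  object adds a product factor.\<close>

lemma partial_limit_discrete:
  assumes "finite S" "\<And>j. j \<in> S \<Longrightarrow> fob F j \<in> Obj C"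
  shows "\<exists>L c. partial_limit J C F S {} L c"
  using assms
proof (induction S rule: finite_induct)
  case empty
  obtain t where "t \<in> Obj C" "\<And>A. A \<in> Obj C \<Longrightarrow> \<exists>!h. h \<in> hom C A t" using terminal by auto
  then show ?case unfolding partial_limit_def partial_cone_def by auto
next
  case (insert j S)
  then obtain L c where Lc: "partial_limit J C F S {} L c" by auto
  have L: "L \<in> Obj C" "\<And>i. i \<in> S \<Longrightarrow> c i \<in> hom C L (fob F i)"
    using Lc unfolding partial_limit_def partial_cone_def by auto
  obtain p q where pq: "is_product C p q" "Cod C p = L" "Cod C q = fob F j"
    using products[of L "fob F j"] L insert by auto
  note P = productD[OF pq(1)]
  let ?c = "\<lambda>i. if i = j then q else c i \<odot> p"
  have "partial_limit J C F (insert j S) {} (Dom C q) ?c"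
    unfolding partial_limit_def
  proof (intro conjI allI impI)
    show "partial_cone J C F (insert j S) {} (Dom C q) ?c"
      unfolding partial_cone_def using L P pq dom_obj[of q] by (auto simp: hom_def)
  next
    fix B b assume b: "partial_cone J C F (insert j S) {} B b"
    then have B: "B \<in> Obj C" "\<And>i. i \<in> insert j S \<Longrightarrow> b i \<in> hom C B (fob F i)" and "partial_cone J C F S {} B b"
      unfolding partial_cone_def by auto
    then have ex1: "\<exists>!h. h \<in> hom C B L \<and> (\<forall>i \<in> S. c i \<odot> h = b i)"
      using Lc unfolding partial_limit_def by blast
    then obtain k where k: "k \<in> hom C B L" "\<forall>i \<in> S. c i \<odot> k = b i" by blast
    obtain h where h: "h \<in> Arr C" "Dom C h = B" "Cod C h = Dom C q" "p \<odot> h = k" "q \<odot> h = b j"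
      using product_ex[OF pq(1), of k "b j"] k B(2)[of j] pq by (auto simp: hom_def)
    have cp: "(c i \<odot> p) \<odot> x = c i \<odot> p \<odot> x" if "i \<in> S" "x \<in> Arr C" "Cod C x = Dom C q" for i x
      using L(2)[OF that(1)] that P pq by (auto simp: hom_def)
    show "\<exists>!h. h \<in> hom C B (Dom C q) \<and> (\<forall>i \<in> insert j S. ?c i \<odot> h = b i)"
    proof (rule ex1I[of _ h])
      show "h \<in> hom C B (Dom C q) \<and> (\<forall>i \<in> insert j S. ?c i \<odot> h = b i)"
        using h k cp by (auto simp: hom_def)
    next
      fix h' assume h': "h' \<in> hom C B (Dom C q) \<and> (\<forall>i \<in> insert j S. ?c i \<odot> h' = b i)"
      have "\<forall>i \<in> S. c i \<odot> p \<odot> h' = b i"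
      proof
        fix i assume i: "i \<in> S"
        then have "i \<noteq> j" using insert.hyps by auto
        moreover have "?c i \<odot> h' = b i" using h' i by blast
        ultimately show "c i \<odot> p \<odot> h' = b i" using cp[OF i, of h'] h' by (simp add: hom_def)
      qed
      moreover have "p \<odot> h' \<in> hom C B L" using h' P pq by (auto simp: hom_def)
      ultimately have "p \<odot> h' = p \<odot> h" using ex1 k h by blast
      moreover have "q \<odot> h' = q \<odot> h" using h' h by auto
      ultimately show "h' = h" using product_unique[OF pq(1)] h h' by (auto simp: hom_def)
    qed
  qed
  then show ?case by blast
qed

text \<open>Every added arrow \<open>u\<close> cuts the limit obtained so far down to the equalizer
  of the two ways of reaching the codomain of \<open>u\<close>.\<close>

lemma partial_limit_arrows:
  assumes J: "category J" "finite (Obj J)" and F: "is_functor J C F"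
    and A: "finite A" "A \<subseteq> Arr J"
  shows "\<exists>L c. partial_limit J C F (Obj J) A L c"
  using A
proof (induction A rule: finite_induct)
  case empty
  then show ?case using partial_limit_discrete[OF J(2), of F J] F unfolding is_functor_def by blast
next
  case (insert u A)
  then obtain L c where Lc: "partial_limit J C F (Obj J) A L c" by auto
  have L: "L \<in> Obj C" "\<And>i. i \<in> Obj J \<Longrightarrow> c i \<in> hom C L (fob F i)"
    "\<And>v. v \<in> A \<Longrightarrow> far F v \<odot> c (Dom J v) = c (Cod J v)"
    using Lc unfolding partial_limit_def partial_cone_def by auto
  have u: "u \<in> Arr J" using insert by auto
  have FA: "far F v \<in> Arr C \<and> Dom C (far F v) = fob F (Dom J v) \<and> Cod C (far F v) = fob F (Cod J v)
      \<and> Dom J v \<in> Obj J \<and> Cod J v \<in> Obj J"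
    if "v \<in> Arr J" for v
    using F that category.dom_obj[OF J(1) that] category.cod_obj[OF J(1) that]
    unfolding is_functor_def hom_def by blast
  note Fu = FA[OF u]
  have cu: "c (Dom J u) \<in> hom C L (fob F (Dom J u))" "c (Cod J u) \<in> hom C L (fob F (Cod J u))"
    using L Fu by auto
  then obtain e where e: "is_equalizer C (far F u \<odot> c (Dom J u)) (c (Cod J u)) e"
    using equalizers[of "far F u \<odot> c (Dom J u)" "c (Cod J u)"] Fu by (auto simp: hom_def)
  have E: "e \<in> Arr C" "Cod C e = L" "(far F u \<odot> c (Dom J u)) \<odot> e = c (Cod J u) \<odot> e"
    "\<And>T a. \<lbrakk>T \<in> Obj C; a \<in> hom C T L; (far F u \<odot> c (Dom J u)) \<odot> a = c (Cod J u) \<odot> a\<rbrakk>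
      \<Longrightarrow> \<exists>!h. h \<in> hom C T (Dom C e) \<and> e \<odot> h = a"
    using e cu Fu unfolding is_equalizer_def by (auto simp: hom_def)
  have as: "(far F v \<odot> c (Dom J v)) \<odot> x = far F v \<odot> c (Dom J v) \<odot> x"
    if "v \<in> Arr J" "x \<in> Arr C" "Cod C x = L" for v x
    using FA[OF that(1)] L(2)[of "Dom J v"] that by (auto simp: hom_def)
  have ae: "(c i \<odot> e) \<odot> x = c i \<odot> e \<odot> x" if "i \<in> Obj J" "x \<in> Arr C" "Cod C x = Dom C e" for i x
    using L(2)[of i] that E by (auto simp: hom_def)
  have "partial_limit J C F (Obj J) (insert u A) (Dom C e) (\<lambda>i. c i \<odot> e)"
    unfolding partial_limit_def
  proof (intro conjI allI impI)
    have "far F v \<odot> c (Dom J v) \<odot> e = c (Cod J v) \<odot> e" if "v \<in> insert u A" for v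
    proof (cases "v = u")
      case True then show ?thesis using E(3) as[OF u E(1,2)] by simp
    next
      case False
      then have "v \<in> A" using that by auto
      then show ?thesis using L(3)[of v] as[of v e] E insert.prems by auto
    qed
    then show "partial_cone J C F (Obj J) (insert u A) (Dom C e) (\<lambda>i. c i \<odot> e)"
      unfolding partial_cone_def using L(2) E dom_obj[of e] by (auto simp: hom_def)
  next
    fix B b assume b: "partial_cone J C F (Obj J) (insert u A) B b"
    then have B: "B \<in> Obj C" "\<And>i. i \<in> Obj J \<Longrightarrow> b i \<in> hom C B (fob F i)" "far F u \<odot> b (Dom J u) = b (Cod J u)"
      and "partial_cone J C F (Obj J) A B b"
      unfolding partial_cone_def by auto
    then have ex1: "\<exists>!h. h \<in> hom C B L \<and> (\<forall>i \<in> Obj J. c i \<odot> h = b i)"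
      using Lc unfolding partial_limit_def by blast
    then obtain k where k: "k \<in> hom C B L" "\<forall>i \<in> Obj J. c i \<odot> k = b i" by blast
    have "(far F u \<odot> c (Dom J u)) \<odot> k = c (Cod J u) \<odot> k"
      using as[OF u, of k] k B(3) Fu by (auto simp: hom_def)
    then have ex1e: "\<exists>!h. h \<in> hom C B (Dom C e) \<and> e \<odot> h = k" using E(4)[OF B(1) k(1)] by blast
    then obtain h where h: "h \<in> hom C B (Dom C e)" "e \<odot> h = k" by blast
    show "\<exists>!h. h \<in> hom C B (Dom C e) \<and> (\<forall>i \<in> Obj J. (c i \<odot> e) \<odot> h = b i)"
    proof (rule ex1I[of _ h])
      show "h \<in> hom C B (Dom C e) \<and> (\<forall>i \<in> Obj J. (c i \<odot> e) \<odot> h = b i)"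
        using h k ae by (auto simp: hom_def)
    next
      fix h' assume h': "h' \<in> hom C B (Dom C e) \<and> (\<forall>i \<in> Obj J. (c i \<odot> e) \<odot> h' = b i)"
      then have "\<forall>i \<in> Obj J. c i \<odot> e \<odot> h' = b i" using ae by (auto simp: hom_def)
      moreover have "e \<odot> h' \<in> hom C B L" using h' E by (auto simp: hom_def)
      ultimately have "e \<odot> h' = k" using ex1 k by blast
      then show "h' = h" using ex1e h h' by blast
    qed
  qed
  then show ?case by blast
qed

lemma finite_limits_from_pullbacks: "has_finite_limits C"
  unfolding has_finite_limits_def
proof (intro allI impI)
  fix J :: "(nat, nat) cat" and F
  assume "category J \<and> finite (Obj J) \<and> finite (Arr J) \<and> is_functor J C F"
  then obtain L c where "partial_limit J C F (Obj J) (Arr J) L c"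
    using partial_limit_arrows[of J F "Arr J"] by auto
  then show "\<exists>A c. is_limit J C F A c"
    unfolding is_limit_def partial_limit_def is_cone_def partial_cone_def by blast
qed

lemma finitely_complete: "finitely_complete_category C"
  by unfold_locales (rule finite_limits_from_pullbacks)

end

text \<open>Arrows 0, 1, 2 are the identities; 3 and 4 are the legs from 0 and from 1 to 2. In a
  composable pair at least one factor is an identity, which is why \<open>Comp\<close> needs a
  single test.\<close>

definition cospan_shape :: "(nat, nat) cat" where
  "cospan_shape = \<lparr>Obj = {0, 1, 2}, Arr = {0, 1, 2, 3, 4},
     Dom = (\<lambda>n. if n < 3 then n else n - 3), Cod = (\<lambda>n. if n < 3 then n else 2), Id = (\<lambda>n. n),
     Comp = (\<lambda>n m. if n < 3 then m else n)\<rparr>"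

lemma cospan_shape_category: "category cospan_shape"
  by unfold_locales (auto simp: cospan_shape_def hom_def)

definition empty_shape :: "(nat, nat) cat" where
  "empty_shape = \<lparr>Obj = {}, Arr = {}, Dom = (\<lambda>n. n), Cod = (\<lambda>n. n), Id = (\<lambda>n. n), Comp = (\<lambda>n m. m)\<rparr>"

lemma empty_shape_category: "category empty_shape"
  by unfold_locales (auto simp: empty_shape_def hom_def)

text \<open>The terminal object is the limit of the empty diagram, and a pullback is the limit of a
  cospan.\<close>

sublocale finitely_complete_category \<subseteq> pullback_category
proof
  have "is_functor empty_shape C \<lparr>fob = undefined, far = undefined\<rparr>"
    by (simp add: is_functor_def empty_shape_def)
  then obtain A c where "is_limit empty_shape C \<lparr>fob = undefined, far = undefined\<rparr> A c"
    using finite_limits empty_shape_category unfolding has_finite_limits_def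
    by (metis (no_types, lifting) cat.select_convs(1,2) empty_shape_def finite.emptyI)
  then show "\<exists>t \<in> Obj C. \<forall>A \<in> Obj C. \<exists>!h. h \<in> hom C A t"
    unfolding is_limit_def is_cone_def empty_shape_def by simp blast
next
  fix f g assume fg: "f \<in> Arr C" "g \<in> Arr C" "Cod C f = Cod C g"
  define F where "F = \<lparr>fob = (\<lambda>n::nat. if n = 0 then Dom C f else if n = 1 then Dom C g else Cod C f),
    far = (\<lambda>n::nat. if n = 0 then Id C (Dom C f) else if n = 1 then Id C (Dom C g)
       else if n = 2 then Id C (Cod C f) else if n = 3 then f else g)\<rparr>"
  have obs: "Dom C f \<in> Obj C" "Dom C g \<in> Obj C" "Cod C f \<in> Obj C" "Cod C g \<in> Obj C" using fg dom_obj cod_obj by auto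
  have "is_functor cospan_shape C F"
    unfolding is_functor_def F_def cospan_shape_def hom_def using fg obs by auto
  then obtain A c where lim: "is_limit cospan_shape C F A c"
    using finite_limits cospan_shape_category unfolding has_finite_limits_def
    by (metis (no_types, lifting) cat.select_convs(1,2) cospan_shape_def finite.emptyI finite.insertI)
  \<comment> \<open>The component at 2 is the composite of either of the other two with its leg, so
    a cone amounts to a commuting square.\<close>
  have cone: "is_cone cospan_shape C F B b \<longleftrightarrow> B \<in> Obj C \<and> b 0 \<in> hom C B (Dom C f) \<and> b 1 \<in> hom C B (Dom C g) \<and>
     f \<odot> b 0 = b 2 \<and> g \<odot> b 1 = b 2" for B b
  proof -
    have "b 2 \<in> hom C B (Cod C f)" if "b 0 \<in> hom C B (Dom C f)" "f \<odot> b 0 = b 2"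
      using comp_hom[OF that(1), of f] fg that(2) by (auto simp: hom_def)
    then show ?thesis
      unfolding is_cone_def F_def cospan_shape_def using fg obs by (auto simp: hom_def)
  qed
  have A: "A \<in> Obj C" "c 0 \<in> hom C A (Dom C f)" "c 1 \<in> hom C A (Dom C g)" "f \<odot> c 0 = g \<odot> c 1" "f \<odot> c 0 = c 2"
    using lim unfolding is_limit_def cone by auto
  have uni: "\<exists>!h. h \<in> hom C T A \<and> c 0 \<odot> h = a \<and> c 1 \<odot> h = b"
    if "T \<in> Obj C" "a \<in> hom C T (Dom C f)" "b \<in> hom C T (Dom C g)" "f \<odot> a = g \<odot> b" for T a b
  proof -
    define d where "d = (\<lambda>n::nat. if n = 0 then a else if n = 1 then b else f \<odot> a)"
    have "is_cone cospan_shape C F T d" unfolding cone d_def using that by auto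
    then have "\<exists>!h. h \<in> hom C T A \<and> (\<forall>j \<in> Obj cospan_shape. c j \<odot> h = d j)"
      using lim unfolding is_limit_def by blast
    moreover have "(\<forall>j \<in> Obj cospan_shape. c j \<odot> h = d j) \<longleftrightarrow> c 0 \<odot> h = a \<and> c 1 \<odot> h = b"
      if "h \<in> hom C T A" for h
    proof -
      have "c 2 \<odot> h = f \<odot> c 0 \<odot> h"
        using extend1[OF A(5), of h] that A(2) fg(1) by (auto simp: hom_def)
      then show ?thesis unfolding cospan_shape_def d_def by auto
    qed
    ultimately show ?thesis by metis
  qed
  have "is_pullback C f g (c 0) (c 1)"
    unfolding is_pullback_def
  proof (intro conjI ballI impI)
    have "Dom C (c 0) = A" using A by (auto simp: hom_def)
    then show "\<exists>!h. h \<in> hom C T (Dom C (c 0)) \<and> c 0 \<odot> h = a \<and> c 1 \<odot> h = b"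
      if "T \<in> Obj C" "a \<in> hom C T (Dom C f)" "b \<in> hom C T (Dom C g)" "f \<odot> a = g \<odot> b" for T a b
      using uni[OF that] by simp
  qed (use fg A in \<open>auto simp: hom_def\<close>)
  then show "\<exists>p q. is_pullback C f g p q" by blast
qed


section \<open>Regular epimorphisms in a regular category\<close>

context regular_category
begin

text \<open>The kernel pair of \<open>f\<close> has a coequalizer \<open>e\<close>, and
  \<open>f\<close> factors through it as \<open>m\<close>. To see that \<open>m\<close> is monic,
  two arrows \<open>a\<close> and \<open>b\<close> with equal images are lifted along
  \<open>e\<close> on a common cover; the lifts have equal images under \<open>f\<close>, so they
  lie in the kernel pair and \<open>e\<close> identifies them.\<close>

lemma image_factorization:
  assumes f: "f \<in> Arr C"
  obtains e m where "regular_epi C e" "m \<in> Arr C" "Cod C e = Dom C m" "m \<odot> e = f" "monic C m"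
proof -
  obtain p q where pb: "is_kernel_pair C f p q" using pullbacks[of f f] f by auto
  note P = pullbackD[OF pb]
  obtain e where e: "is_coequalizer C p q e" using kernel_pair_coequalizer[OF pb] by auto
  note E = coequalizerD[OF e]
  have re: "regular_epi C e" using e unfolding regular_epi_def by auto
  obtain m where m: "m \<in> Arr C" "Dom C m = Cod C e" "Cod C m = Cod C f" "m \<odot> e = f"
    using coequalizer_ex[OF e, of f] P E by auto
  have "a = b" if ab: "a \<in> Arr C" "b \<in> Arr C" "Dom C a = Dom C b" "Cod C a = Dom C m" "Cod C b = Dom C m" "m \<odot> a = m \<odot> b"
    for a b
  proof -
    obtain x c where pc: "is_pullback C e a x c" using pullbacks[of e a] E ab m by auto
    note X = pullbackD[OF pc]
    have c: "regular_epi C c" by (rule regular_epi_stable[OF re pc])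
    obtain y d where pd: "is_pullback C e (b \<odot> c) y d" using pullbacks[of e "b \<odot> c"] E(3) X(4,8) ab m(2) by auto
    note Y = pullbackD[OF pd]
    have d: "regular_epi C d" by (rule regular_epi_stable[OF re pd])
    have ty: "x \<in> Arr C" "c \<in> Arr C" "y \<in> Arr C" "d \<in> Arr C" "e \<in> Arr C"
      "Dom C x = Dom C c" "Cod C x = Dom C e" "Cod C c = Dom C a" "Dom C y = Dom C d" "Cod C y = Dom C e"
      "Cod C d = Dom C c" "Cod C a = Cod C e" "Cod C b = Cod C e" "Dom C b = Dom C a" "Dom C m = Cod C e"
      using X(3,4,6-8) Y(3,4,6-8) ab(1-5) E(3) m(2) by auto
    have exd: "e \<odot> x \<odot> d = a \<odot> c \<odot> d" using extend[OF X(9), of d] ty ab(1) by simp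
    have eyd: "e \<odot> y = b \<odot> c \<odot> d" using Y(9) ty ab(2) by simp
    have fe: "m \<odot> e \<odot> z = f \<odot> z" if "z \<in> Arr C" "Cod C z = Dom C e" for z
      using extend1[OF m(4), of z] that m(1) ty by simp
    have "f \<odot> x \<odot> d = m \<odot> a \<odot> c \<odot> d" using fe[of "x \<odot> d"] exd ty by simp
    also have "\<dots> = m \<odot> b \<odot> c \<odot> d" using extend[OF ab(6), of "c \<odot> d"] ty ab(1,2) m(1) by simp
    also have "\<dots> = f \<odot> y" using fe[of y] eyd ty by simp
    finally have fxy: "f \<odot> x \<odot> d = f \<odot> y" .
    have "Dom C e = Dom C f" using P E by simp
    then obtain t where t: "t \<in> Arr C" "Cod C t = Dom C q" "p \<odot> t = x \<odot> d" "q \<odot> t = y"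
      using pullback_ex[OF pb _ _ _ _ _ fxy] ty by auto
    have "e \<odot> p \<odot> t = e \<odot> q \<odot> t"
      by (rule extend[OF E(7)]) (use t(1,2) E(1-6) P(6) in simp_all)
    then have "a \<odot> c \<odot> d = b \<odot> c \<odot> d"
      using t(3,4) exd eyd by metis
    then have "a \<odot> c = b \<odot> c"
      by (intro regular_epi_epi[OF d, of "a \<odot> c" "b \<odot> c"]) (use ab(1,2) ty in simp_all)
    show "a = b" by (rule regular_epi_epi[OF c]) (use ab(1,2) \<open>a \<odot> c = b \<odot> c\<close> ty in simp_all)
  qed
  then have "monic C m" unfolding monic_def using m(1) by blast
  then show ?thesis by (rule that[OF re m(1) m(2)[symmetric] m(4)])
qed

text \<open>The composite is factored as a regular epimorphism \<open>q\<close> followed by a monic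
  \<open>m\<close>. Then \<open>q\<close> factors through \<open>e\<close> as \<open>k\<close>,
  since \<open>m\<close> is monic; \<open>k\<close> factors through \<open>d\<close> as
  \<open>l\<close> for the same reason; and \<open>l\<close> is inverse to \<open>m\<close>.\<close>

lemma regular_epi_comp:
  assumes d: "regular_epi C d" and e: "regular_epi C e" and de: "Dom C d = Cod C e"
  shows "regular_epi C (d \<odot> e)"
proof -
  note arr = regular_epi_arr[OF d] regular_epi_arr[OF e]
  have "d \<odot> e \<in> Arr C" using arr de by simp
  then obtain q m where qm: "regular_epi C q" "m \<in> Arr C" "Cod C q = Dom C m" "m \<odot> q = d \<odot> e"
    and m: "monic C m"
    by (rule image_factorization)
  have mono: "\<And>a b. \<lbrakk>a \<in> Arr C; b \<in> Arr C; Dom C a = Dom C b; Cod C a = Dom C m; Cod C b = Dom C m; m \<odot> a = m \<odot> b\<rbrakk> \<Longrightarrow> a = b"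
    using m unfolding monic_def by blast
  note q = regular_epi_arr[OF qm(1)]
  have dq: "Dom C q = Dom C e" "Cod C m = Cod C d"
    using arg_cong[OF qm(4), of "Dom C"] arg_cong[OF qm(4), of "Cod C"] arr q qm(2,3) de by simp_all
  obtain f g where c: "is_coequalizer C f g e" using e unfolding regular_epi_def by auto
  note c' = coequalizerD[OF c]
  have "m \<odot> q \<odot> f = d \<odot> e \<odot> f" "m \<odot> q \<odot> g = d \<odot> e \<odot> g"
    using extend[OF qm(4), of f] extend[OF qm(4), of g] arr q qm(2,3) dq de c' by simp_all
  then have "q \<odot> f = q \<odot> g" using mono[of "q \<odot> f" "q \<odot> g"] q qm(2,3) dq c' by simp
  then obtain k where k: "k \<in> Arr C" "Dom C k = Cod C e" "Cod C k = Cod C q" "k \<odot> e = q"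
    using coequalizer_ex[OF c, of q] q dq by auto
  have "(m \<odot> k) \<odot> e = d \<odot> e" using k q qm arr by simp
  then have mk: "m \<odot> k = d" using coequalizer_epi[OF c, of "m \<odot> k" d] k qm arr de by simp
  obtain f' g' where b: "is_coequalizer C f' g' d" using d unfolding regular_epi_def by auto
  note b' = coequalizerD[OF b]
  have "m \<odot> k \<odot> f' = m \<odot> k \<odot> g'"
    using extend1[OF mk, of f'] extend1[OF mk, of g'] k qm arr de b' by simp
  then have "k \<odot> f' = k \<odot> g'" using mono[of "k \<odot> f'" "k \<odot> g'"] k qm(2,3) b' de by simp
  then obtain l where l: "l \<in> Arr C" "Dom C l = Cod C d" "Cod C l = Cod C k" "l \<odot> d = k"
    using coequalizer_ex[OF b, of k] k de by auto
  have obs: "Cod C d \<in> Obj C" "Dom C m \<in> Obj C" using arr qm dom_obj cod_obj by auto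
  have "(m \<odot> l) \<odot> d = Id C (Cod C d) \<odot> d" using l mk qm k arr by simp
  then have ml: "m \<odot> l = Id C (Cod C d)"
    using coequalizer_epi[OF b, of "m \<odot> l" "Id C (Cod C d)"] l qm k dq obs by simp
  have "m \<odot> l \<odot> m = m \<odot> Id C (Dom C m)"
    using extend1[OF ml, of m] l qm k dq obs by simp
  then have "l \<odot> m = Id C (Dom C m)"
    using mono[of "l \<odot> m" "Id C (Dom C m)"] l qm k dq obs by simp
  then have "is_iso C m" using isoI[of m l] ml l qm k dq by simp
  then show ?thesis using regular_epi_iso_comp[OF qm(1), of m] qm by simp
qed

lemma regular_epi_Id:
  assumes "A \<in> Obj C"
  shows "regular_epi C (Id C A)"
proof -
  have "is_coequalizer C (Id C A) (Id C A) (Id C A)"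
    by (rule coequalizerI) (use assms in auto)
  then show ?thesis unfolding regular_epi_def by blast
qed

text \<open>The form in which regular epimorphisms act on generalized elements: an element of the
  codomain has a preimage after a regular epimorphic cover \<open>d\<close> of its stage. Stability
  makes the pullback projection such a cover.\<close>

lemma cover_pullback:
  assumes "regular_epi C e" "a \<in> Arr C" "Cod C a = Cod C e"
  obtains d x where "regular_epi C d" "Cod C d = Dom C a" "x \<in> Arr C" "Dom C x = Dom C d"
    "Cod C x = Dom C e" "e \<odot> x = a \<odot> d"
proof -
  obtain x d where pb: "is_pullback C e a x d"
    using pullbacks[of e a] assms regular_epi_arr by auto
  then show ?thesis using that[of d x] regular_epi_stable[OF assms(1) pb] pullbackD[OF pb] by auto
qed

end


section \<open>Relations as sets of spans\<close>

text \<open>A relation is determined by the set of all spans that factor through it, that is, by its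
  generalized elements over all stages. Composition of relations becomes composition of sets of
  spans followed by closure under regular epimorphic covers of the stage.\<close>

definition spans :: "('o, 'm) cat \<Rightarrow> 'm \<Rightarrow> 'm \<Rightarrow> ('m \<times> 'm) set" where
  "spans C r1 r2 = {(r1 \<cdot>\<^bsub>C\<^esub> x, r2 \<cdot>\<^bsub>C\<^esub> x) | x. x \<in> Arr C \<and> Cod C x = Dom C r1}"

definition span_relation :: "('o, 'm) cat \<Rightarrow> 'o \<Rightarrow> 'o \<Rightarrow> ('m \<times> 'm) set \<Rightarrow> bool" where
  "span_relation C X Y \<rho> \<longleftrightarrow> (\<exists>r1 r2. is_relation C X Y r1 r2 \<and> \<rho> = spans C r1 r2)"

definition local_closure :: "('o, 'm) cat \<Rightarrow> ('m \<times> 'm) set \<Rightarrow> ('m \<times> 'm) set" where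
  "local_closure C \<rho> = {(a, b). a \<in> Arr C \<and> b \<in> Arr C \<and> Dom C a = Dom C b \<and>
     (\<exists>e. regular_epi C e \<and> Cod C e = Dom C a \<and> (a \<cdot>\<^bsub>C\<^esub> e, b \<cdot>\<^bsub>C\<^esub> e) \<in> \<rho>)}"

definition graph :: "('o, 'm) cat \<Rightarrow> 'm \<Rightarrow> ('m \<times> 'm) set" where
  "graph C f = {(a, f \<cdot>\<^bsub>C\<^esub> a) | a. a \<in> Arr C \<and> Cod C a = Dom C f}"

text \<open>Inverse to \<open>el\<close> on relations: leads from the set of generalized elements
  back to the isomorphism class of the jointly monic spans that tabulate it.\<close>

definition span_class :: "('o, 'm) cat \<Rightarrow> 'o \<Rightarrow> 'o \<Rightarrow> ('m \<times> 'm) set \<Rightarrow> 'm relation" where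
  "span_class C X Y \<rho> = {(t1, t2). is_relation C X Y t1 t2 \<and> spans C t1 t2 = \<rho>}"

definition el :: "('o, 'm) cat \<Rightarrow> 'm relation \<Rightarrow> ('m \<times> 'm) set" where
  "el C R = (\<Union>(r1, r2) \<in> R. spans C r1 r2)"

text \<open>Arrows into \<open>X\<close> at all stages are taken together, in place of the stagewise
  \<open>equiv\<close> of \<open>equivalence_relation\<close>.\<close>

definition span_equivalence :: "('o, 'm) cat \<Rightarrow> 'o \<Rightarrow> ('m \<times> 'm) set \<Rightarrow> bool" where
  "span_equivalence C X \<rho> \<longleftrightarrow> span_relation C X X \<rho> \<and>
     (\<forall>x \<in> Arr C. Cod C x = X \<longrightarrow> (x, x) \<in> \<rho>) \<and> sym \<rho> \<and> trans \<rho>"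

context category
begin

lemma relationD:
  assumes "is_relation C X Y r1 r2"
  shows "r1 \<in> Arr C" "r2 \<in> Arr C" "Dom C r1 = Dom C r2" "Cod C r1 = X" "Cod C r2 = Y"
    "X \<in> Obj C" "Y \<in> Obj C"
  using assms cod_obj unfolding is_relation_def by auto

lemma relation_unique:
  assumes "is_relation C X Y r1 r2" "x \<in> Arr C" "y \<in> Arr C" "Dom C x = Dom C y" "Cod C x = Dom C r2"
    "Cod C y = Dom C r2" "r1 \<odot> x = r1 \<odot> y" "r2 \<odot> x = r2 \<odot> y"
  shows "x = y"
proof -
  have "\<And>T f g. \<lbrakk>T \<in> Obj C; f \<in> hom C T (Dom C r1); g \<in> hom C T (Dom C r1);
      r1 \<odot> f = r1 \<odot> g; r2 \<odot> f = r2 \<odot> g\<rbrakk> \<Longrightarrow> f = g"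
    using assms(1) unfolding is_relation_def by blast
  from this[of "Dom C y" x y] show ?thesis
    using assms(2-) dom_obj[of y] relationD(3)[OF assms(1)] by (auto simp: hom_def)
qed

lemma relationI:
  assumes "r1 \<in> Arr C" "r2 \<in> Arr C" "Dom C r1 = Dom C r2" "Cod C r1 = X" "Cod C r2 = Y"
    "\<And>x y. \<lbrakk>x \<in> Arr C; y \<in> Arr C; Dom C x = Dom C y; Cod C x = Dom C r2;
       Cod C y = Dom C r2; r1 \<odot> x = r1 \<odot> y; r2 \<odot> x = r2 \<odot> y\<rbrakk> \<Longrightarrow> x = y"
  shows "is_relation C X Y r1 r2"
  unfolding is_relation_def
proof (intro conjI ballI impI)
  fix T f g assume "T \<in> Obj C" "f \<in> hom C T (Dom C r1)" "g \<in> hom C T (Dom C r1)"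
    "r1 \<odot> f = r1 \<odot> g \<and> r2 \<odot> f = r2 \<odot> g"
  then show "f = g" using assms(3) by - (rule assms(6), auto simp: hom_def)
qed (use assms in auto)

lemma spansI: "\<lbrakk>x \<in> Arr C; Cod C x = Dom C r1; a = r1 \<odot> x; b = r2 \<odot> x\<rbrakk> \<Longrightarrow> (a, b) \<in> spans C r1 r2"
  unfolding spans_def by auto

lemma spansE:
  assumes "(a, b) \<in> spans C r1 r2"
  obtains x where "x \<in> Arr C" "Cod C x = Dom C r1" "r1 \<odot> x = a" "r2 \<odot> x = b"
  using assms unfolding spans_def by auto

lemma span_relationE:
  assumes "span_relation C X Y \<rho>"
  obtains r1 r2 where "is_relation C X Y r1 r2" "\<rho> = spans C r1 r2"
  using assms unfolding span_relation_def by blast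

lemma span_relationI: "is_relation C X Y r1 r2 \<Longrightarrow> span_relation C X Y (spans C r1 r2)"
  unfolding span_relation_def by blast

lemma spansD:
  assumes "is_relation C X Y r1 r2" "(a, b) \<in> spans C r1 r2"
  shows "a \<in> Arr C" "b \<in> Arr C" "Dom C a = Dom C b" "Cod C a = X" "Cod C b = Y"
  using relationD[OF assms(1)] assms(2) by (auto elim!: spansE)

lemma span_relationD:
  assumes "span_relation C X Y \<rho>" "(a, b) \<in> \<rho>"
  shows "a \<in> Arr C" "b \<in> Arr C" "Dom C a = Dom C b" "Cod C a = X" "Cod C b = Y"
  using assms spansD by (auto elim!: span_relationE)

lemma span_relation_objs:
  assumes "span_relation C X Y \<rho>"
  shows "X \<in> Obj C" "Y \<in> Obj C"
  using assms relationD by (auto elim!: span_relationE)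

lemma span_relation_restrict:
  assumes "span_relation C X Y \<rho>" "(a, b) \<in> \<rho>" "x \<in> Arr C" "Cod C x = Dom C b"
  shows "(a \<odot> x, b \<odot> x) \<in> \<rho>"
proof -
  obtain r1 r2 where r: "is_relation C X Y r1 r2" "\<rho> = spans C r1 r2" using assms(1) by (rule span_relationE)
  note R = relationD[OF r(1)]
  obtain y where y: "y \<in> Arr C" "Cod C y = Dom C r1" "r1 \<odot> y = a" "r2 \<odot> y = b"
    using assms(2) r by (auto elim!: spansE)
  have "Dom C b = Dom C y" using y R by auto
  then show ?thesis unfolding r(2) using assms(3,4) R y
    by (intro spansI[of "y \<odot> x"]) auto
qed

text \<open>Membership in a relation is a local condition. The element \<open>y\<close> that
  represents the pair on the cover has equal composites with the two arrows coequalized by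
  \<open>e\<close>, by joint monicity, and so descends along \<open>e\<close>.\<close>

lemma span_relation_local:
  assumes "span_relation C X Y \<rho>" "regular_epi C e" "Cod C e = Dom C b" "a \<in> Arr C" "b \<in> Arr C"
    "Dom C a = Dom C b" "(a \<odot> e, b \<odot> e) \<in> \<rho>"
  shows "(a, b) \<in> \<rho>"
proof -
  obtain r1 r2 where r: "is_relation C X Y r1 r2" "\<rho> = spans C r1 r2" using assms(1) by (rule span_relationE)
  note R = relationD[OF r(1)]
  have e: "e \<in> Arr C" using assms(2) by (rule regular_epi_arr)
  obtain y where y: "y \<in> Arr C" "Cod C y = Dom C r2" "r1 \<odot> y = a \<odot> e" "r2 \<odot> y = b \<odot> e"
    using assms(7) r R(3) by (auto elim!: spansE)
  have dy: "Dom C y = Dom C e" using arg_cong[OF y(3), of "Dom C"] y(1,2) R(1,3) e assms(3,4,6) by simp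
  obtain f g where c: "is_coequalizer C f g e" using assms(2) unfolding regular_epi_def by auto
  note c' = coequalizerD[OF c]
  have aef: "a \<odot> e \<odot> f = a \<odot> e \<odot> g" "b \<odot> e \<odot> f = b \<odot> e \<odot> g" using c'(7) by simp_all
  have "r1 \<odot> y \<odot> f = a \<odot> e \<odot> f" "r1 \<odot> y \<odot> g = a \<odot> e \<odot> g" "r2 \<odot> y \<odot> f = b \<odot> e \<odot> f" "r2 \<odot> y \<odot> g = b \<odot> e \<odot> g"
    by (rule extend[OF y(3)] extend[OF y(4)]; use y(1,2) R dy e assms(3-6) c' in simp)+
  then have "y \<odot> f = y \<odot> g"
    using aef by - (rule relation_unique[OF r(1)], use y(1,2) dy c' in simp_all)
  then obtain k where k: "k \<in> Arr C" "Dom C k = Cod C e" "Cod C k = Cod C y" "k \<odot> e = y"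
    using coequalizer_ex[OF c y(1) dy] by metis
  have "(r1 \<odot> k) \<odot> e = a \<odot> e" "(r2 \<odot> k) \<odot> e = b \<odot> e" using k y R e by simp_all
  note eqs = this
  have "r1 \<odot> k = a" "r2 \<odot> k = b"
    by (rule regular_epi_epi[OF assms(2)], use eqs k(1-3) y(2) R assms(3-6) in simp_all)+
  then show ?thesis unfolding r(2) using k y R by (intro spansI[of k]) auto
qed

lemma span_relation_converse:
  assumes "span_relation C X Y \<rho>"
  shows "span_relation C Y X (\<rho>\<inverse>)"
proof -
  obtain r1 r2 where r: "is_relation C X Y r1 r2" "\<rho> = spans C r1 r2" using assms by (rule span_relationE)
  note R = relationD[OF r(1)]
  have "is_relation C Y X r2 r1"
    by (rule relationI) (use R relation_unique[OF r(1)] in auto)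
  moreover have "\<rho>\<inverse> = spans C r2 r1" unfolding r(2) spans_def using R by auto
  ultimately show ?thesis unfolding span_relation_def by blast
qed

lemma graph_eq_spans: "f \<in> Arr C \<Longrightarrow> graph C f = spans C (Id C (Dom C f)) f"
  unfolding graph_def spans_def using dom_obj[of f] by force

lemma graph_relation: "f \<in> Arr C \<Longrightarrow> is_relation C (Dom C f) (Cod C f) (Id C (Dom C f)) f"
  using dom_obj[of f] by (intro relationI) auto

lemma graph_iff: "(a, b) \<in> graph C f \<longleftrightarrow> a \<in> Arr C \<and> Cod C a = Dom C f \<and> b = f \<odot> a"
  unfolding graph_def by auto

lemma rel_elements_iff:
  assumes "is_relation C X Y r1 r2"
  shows "(a, b) \<in> rel_elements C T r1 r2 \<longleftrightarrow> (a, b) \<in> spans C r1 r2 \<and> Dom C a = T"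
  using relationD[OF assms] unfolding rel_elements_def spans_def hom_def by auto

lemma reflexive_relation_iff:
  "reflexive_relation C X r1 r2 \<longleftrightarrow>
     is_relation C X X r1 r2 \<and> (\<forall>x \<in> Arr C. Cod C x = X \<longrightarrow> (x, x) \<in> spans C r1 r2)"
proof (cases "is_relation C X X r1 r2")
  case True
  show ?thesis
    using rel_elements_iff[OF True] dom_obj True
    unfolding reflexive_relation_def refl_on_def hom_def by blast
next
  case False
  then show ?thesis unfolding reflexive_relation_def by blast
qed

lemma equivalence_relation_iff:
  "equivalence_relation C X r1 r2 \<longleftrightarrow> is_relation C X X r1 r2 \<and> span_equivalence C X (spans C r1 r2)"
proof (cases "is_relation C X X r1 r2")
  case True
  note iff = rel_elements_iff[OF True] and D = spansD[OF True]
  show ?thesis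
  proof
    assume "equivalence_relation C X r1 r2"
    then have eq: "\<And>T. T \<in> Obj C \<Longrightarrow> equiv (hom C T X) (rel_elements C T r1 r2)"
      unfolding equivalence_relation_def by blast
    have "(x, x) \<in> spans C r1 r2" if "x \<in> Arr C" "Cod C x = X" for x
      using eq[OF dom_obj[OF that(1)]] that iff unfolding equiv_def refl_on_def hom_def by blast
    moreover have "sym (spans C r1 r2)"
    proof (rule symI)
      fix a b assume ab: "(a, b) \<in> spans C r1 r2"
      then have "sym (rel_elements C (Dom C a) r1 r2)" using eq[OF dom_obj] D unfolding equiv_def by blast
      then show "(b, a) \<in> spans C r1 r2" using ab iff[of a b "Dom C a"] iff[of b a "Dom C a"] by (auto dest: symD)
    qed
    moreover have "trans (spans C r1 r2)"
    proof (rule transI)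
      fix a b c assume ab: "(a, b) \<in> spans C r1 r2" and bc: "(b, c) \<in> spans C r1 r2"
      then have "trans (rel_elements C (Dom C a) r1 r2)" using eq[OF dom_obj] D unfolding equiv_def by blast
      moreover have "(a, b) \<in> rel_elements C (Dom C a) r1 r2" "(b, c) \<in> rel_elements C (Dom C a) r1 r2"
        using iff ab bc D(3)[OF ab] by auto
      ultimately show "(a, c) \<in> spans C r1 r2" using iff[of a c "Dom C a"] by (auto dest: transD)
    qed
    ultimately show "is_relation C X X r1 r2 \<and> span_equivalence C X (spans C r1 r2)"
      unfolding span_equivalence_def using True span_relationI[OF True] by blast
  next
    assume "is_relation C X X r1 r2 \<and> span_equivalence C X (spans C r1 r2)"
    then have e: "\<And>x. x \<in> Arr C \<Longrightarrow> Cod C x = X \<Longrightarrow> (x, x) \<in> spans C r1 r2"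
      "sym (spans C r1 r2)" "trans (spans C r1 r2)" unfolding span_equivalence_def by auto
    have "equiv (hom C T X) (rel_elements C T r1 r2)" for T
    proof (rule equivI)
      show "rel_elements C T r1 r2 \<subseteq> hom C T X \<times> hom C T X"
        using iff D by (auto simp: hom_def)
      show "refl_on (hom C T X) (rel_elements C T r1 r2)"
        using iff e(1) unfolding refl_on_def hom_def by blast
      show "sym (rel_elements C T r1 r2)"
        using iff D symD[OF e(2)] by (metis symI)
      show "trans (rel_elements C T r1 r2)"
        using iff D transD[OF e(3)] by (metis (no_types) transI)
    qed
    then show "equivalence_relation C X r1 r2" unfolding equivalence_relation_def using True by blast
  qed
next
  case False
  then show ?thesis unfolding equivalence_relation_def by blast
qed

text \<open>Each tabulating span is itself an element, taken at the identity stage, and so factors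
  through the other one.\<close>

lemma relations_isomorphic:
  assumes r: "is_relation C X Y r1 r2" and t: "is_relation C X Y t1 t2" and eq: "spans C t1 t2 = spans C r1 r2"
  obtains i where "is_iso C i" "Cod C i = Dom C r1" "Dom C i = Dom C t1" "r1 \<odot> i = t1" "r2 \<odot> i = t2"
proof -
  note R = relationD[OF r] and T = relationD[OF t]
  have obs: "Dom C t1 \<in> Obj C" "Dom C r1 \<in> Obj C" using R T dom_obj by auto
  have "(t1, t2) \<in> spans C t1 t2" using T obs by (intro spansI[of "Id C (Dom C t1)"]) auto
  then obtain i where i: "i \<in> Arr C" "Cod C i = Dom C r1" "r1 \<odot> i = t1" "r2 \<odot> i = t2"
    unfolding eq by (rule spansE)
  have "(r1, r2) \<in> spans C r1 r2" using R obs by (intro spansI[of "Id C (Dom C r1)"]) auto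
  then obtain j where j: "j \<in> Arr C" "Cod C j = Dom C t1" "t1 \<odot> j = r1" "t2 \<odot> j = r2"
    unfolding eq[symmetric] by (rule spansE)
  have d: "Dom C i = Dom C t1" "Dom C j = Dom C r1"
    using arg_cong[OF i(3), of "Dom C"] arg_cong[OF j(3), of "Dom C"] i(1,2) j(1,2) R(1) T(1) by simp_all
  have "i \<odot> j = Id C (Dom C r1)"
    by (rule relation_unique[OF r])
      (use i j d R T obs extend1[OF i(3), of j] extend1[OF i(4), of j] in simp_all)
  moreover have "j \<odot> i = Id C (Dom C t1)"
    by (rule relation_unique[OF t])
      (use i j d R T obs extend1[OF j(3), of i] extend1[OF j(4), of i] in simp_all)
  ultimately show ?thesis using that[of i] isoI[of i j] i j d by simp
qed

lemma relation_comp_iso: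
  assumes r: "is_relation C X Y r1 r2" and i: "is_iso C i" "Cod C i = Dom C r1"
  shows "is_relation C X Y (r1 \<odot> i) (r2 \<odot> i)" "spans C (r1 \<odot> i) (r2 \<odot> i) = spans C r1 r2"
proof -
  note R = relationD[OF r]
  obtain j where j: "j \<in> Arr C" "Dom C j = Cod C i" "Cod C j = Dom C i"
    "j \<odot> i = Id C (Dom C i)" "i \<odot> j = Id C (Cod C i)" using i(1) by (rule isoE)
  have ia: "i \<in> Arr C" using i unfolding is_iso_def by auto
  show "is_relation C X Y (r1 \<odot> i) (r2 \<odot> i)"
  proof (rule relationI)
    fix x y assume xy: "x \<in> Arr C" "y \<in> Arr C" "Dom C x = Dom C y" "Cod C x = Dom C (r2 \<odot> i)" "Cod C y = Dom C (r2 \<odot> i)"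
      "(r1 \<odot> i) \<odot> x = (r1 \<odot> i) \<odot> y" "(r2 \<odot> i) \<odot> x = (r2 \<odot> i) \<odot> y"
    then have ix: "i \<odot> x = i \<odot> y" by - (rule relation_unique[OF r], use R i ia in simp_all)
    have "z = j \<odot> i \<odot> z" if "z \<in> Arr C" "Cod C z = Dom C i" for z
      using extend1[OF j(4), of z] that ia j by simp
    then show "x = y" using xy(1-5) R i ia ix by (metis comp_simps(2))
  qed (use R i ia in auto)
  show "spans C (r1 \<odot> i) (r2 \<odot> i) = spans C r1 r2"
  proof (intro set_eqI iffI; clarify)
    fix a b assume "(a, b) \<in> spans C (r1 \<odot> i) (r2 \<odot> i)"
    then obtain x where "x \<in> Arr C" "Cod C x = Dom C (r1 \<odot> i)" "(r1 \<odot> i) \<odot> x = a" "(r2 \<odot> i) \<odot> x = b" by (rule spansE)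
    then show "(a, b) \<in> spans C r1 r2" using R i ia by (intro spansI[of "i \<odot> x"]) auto
  next
    fix a b assume "(a, b) \<in> spans C r1 r2"
    then obtain x where x: "x \<in> Arr C" "Cod C x = Dom C r1" "r1 \<odot> x = a" "r2 \<odot> x = b" by (rule spansE)
    have "i \<odot> j \<odot> x = x" using extend1[OF j(5), of x] x i ia j by simp
    then show "(a, b) \<in> spans C (r1 \<odot> i) (r2 \<odot> i)" using x R i ia j by (intro spansI[of "j \<odot> x"]) auto
  qed
qed

lemma rel_class_eq:
  assumes r: "is_relation C X Y r1 r2"
  shows "rel_class C r1 r2 = span_class C X Y (spans C r1 r2)"
proof (intro set_eqI iffI; clarify)
  fix a b assume "(a, b) \<in> rel_class C r1 r2"
  then show "(a, b) \<in> span_class C X Y (spans C r1 r2)"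
    unfolding rel_class_def span_class_def using relation_comp_iso[OF r] by auto
next
  fix a b assume "(a, b) \<in> span_class C X Y (spans C r1 r2)"
  then show "(a, b) \<in> rel_class C r1 r2"
    unfolding rel_class_def span_class_def using relations_isomorphic[OF r] by (auto; metis)
qed

lemma el_span_class: "span_relation C X Y \<rho> \<Longrightarrow> el C (span_class C X Y \<rho>) = \<rho>"
  unfolding el_def span_class_def span_relation_def by auto

lemma el_rel_class: "is_relation C X Y r1 r2 \<Longrightarrow> el C (rel_class C r1 r2) = spans C r1 r2"
  using rel_class_eq el_span_class span_relationI by metis

text \<open>Makes \<open>el\<close> injective on relations, so that equality of isomorphism classes
  of spans can be checked on generalized elements.\<close>

lemma Rel_iff: "R \<in> Rel C X Y \<longleftrightarrow> span_relation C X Y (el C R) \<and> R = span_class C X Y (el C R)"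
proof
  assume "R \<in> Rel C X Y"
  then show "span_relation C X Y (el C R) \<and> R = span_class C X Y (el C R)"
    unfolding Rel_def using el_rel_class rel_class_eq span_relationI by auto
next
  assume "span_relation C X Y (el C R) \<and> R = span_class C X Y (el C R)"
  then show "R \<in> Rel C X Y" unfolding Rel_def span_relation_def using rel_class_eq
    by (metis (mono_tags, lifting) mem_Collect_eq)
qed

lemma span_class_Rel: "span_relation C X Y \<rho> \<Longrightarrow> span_class C X Y \<rho> \<in> Rel C X Y"
  unfolding Rel_iff by (simp add: el_span_class)

lemma Rel_member:
  assumes "R \<in> Rel C X Y" "(r1, r2) \<in> R"
  shows "is_relation C X Y r1 r2" "spans C r1 r2 = el C R"
  using assms Rel_iff[of R X Y] unfolding span_class_def by auto

lemma Rel_nonempty: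
  assumes "R \<in> Rel C X Y"
  obtains r1 r2 where "(r1, r2) \<in> R"
proof -
  have R: "R = span_class C X Y (el C R)" "span_relation C X Y (el C R)" using assms Rel_iff by auto
  from R(2) obtain r1 r2 where "is_relation C X Y r1 r2" "el C R = spans C r1 r2" by (rule span_relationE)
  then have "(r1, r2) \<in> span_class C X Y (el C R)" unfolding span_class_def by auto
  then show ?thesis using that R(1) by metis
qed

text \<open>An inclusion of subobjects is tested on the generic element \<open>(r1, r2)\<close>;
  factoring it yields the required \<open>k\<close>.\<close>

lemma rel_le_iff:
  assumes R: "R \<in> Rel C X Y" and S: "S \<in> Rel C X Y"
  shows "rel_le C R S \<longleftrightarrow> el C R \<subseteq> el C S"
proof
  assume "rel_le C R S"
  then obtain r1 r2 s1 s2 k where rs: "(r1, r2) \<in> R" "(s1, s2) \<in> S" "k \<in> hom C (Dom C r1) (Dom C s1)"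
    "s1 \<odot> k = r1" "s2 \<odot> k = r2" unfolding rel_le_def by auto
  note r = Rel_member[OF R rs(1)] and s = Rel_member[OF S rs(2)]
  show "el C R \<subseteq> el C S"
  proof clarify
    fix a b assume "(a, b) \<in> el C R"
    then obtain x where x: "x \<in> Arr C" "Cod C x = Dom C r1" "r1 \<odot> x = a" "r2 \<odot> x = b"
      unfolding r(2)[symmetric] by (rule spansE)
    have k: "k \<in> Arr C" "Dom C k = Dom C r1" "Cod C k = Dom C s1" using rs(3) by (auto simp: hom_def)
    have "s1 \<odot> k \<odot> x = r1 \<odot> x" "s2 \<odot> k \<odot> x = r2 \<odot> x"
      by (rule extend1[OF rs(4)] extend1[OF rs(5)]; use x(1,2) k relationD[OF s(1)] in simp)+
    then show "(a, b) \<in> el C S"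
      unfolding s(2)[symmetric] using x k by (intro spansI[of "k \<odot> x"]) simp_all
  qed
next
  assume le: "el C R \<subseteq> el C S"
  obtain r1 r2 where rr: "(r1, r2) \<in> R" using R by (rule Rel_nonempty)
  obtain s1 s2 where ss: "(s1, s2) \<in> S" using S by (rule Rel_nonempty)
  note r = Rel_member[OF R rr] and s = Rel_member[OF S ss]
  note r' = relationD[OF r(1)] and s' = relationD[OF s(1)]
  have "(r1, r2) \<in> spans C r1 r2" using r' dom_obj[of r1] by (intro spansI[of "Id C (Dom C r1)"]) auto
  then have "(r1, r2) \<in> spans C s1 s2" using le r s by auto
  then obtain k where "k \<in> Arr C" "Cod C k = Dom C s1" "s1 \<odot> k = r1" "s2 \<odot> k = r2" by (rule spansE)
  then have "k \<in> hom C (Dom C r1) (Dom C s1)" "s1 \<odot> k = r1" "s2 \<odot> k = r2"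
    using s' by (auto simp: hom_def)
  then show "rel_le C R S" unfolding rel_le_def using rr ss by blast
qed

lemma rel_op_Rel:
  assumes R: "R \<in> Rel C X Y"
  shows "rel_op R \<in> Rel C Y X" "el C (rel_op R) = (el C R)\<inverse>"
proof -
  have R': "R = span_class C X Y (el C R)" "span_relation C X Y (el C R)" using R Rel_iff by auto
  have conv: "is_relation C X Y a b \<and> spans C a b = \<rho> \<longleftrightarrow> is_relation C Y X b a \<and> spans C b a = \<rho>\<inverse>" for a b X Y \<rho>
  proof -
    have "is_relation C Y X b a \<and> spans C b a = \<rho>\<inverse>" if "is_relation C X Y a b" "spans C a b = \<rho>" for a b X Y \<rho>
    proof
      show "is_relation C Y X b a"
        by (rule relationI) (use relationD[OF that(1)] relation_unique[OF that(1)] in auto)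
      show "spans C b a = \<rho>\<inverse>"
        using that relationD[OF that(1)] unfolding spans_def by auto
    qed
    from this[of X Y a b \<rho>] this[of Y X b a "\<rho>\<inverse>"] show ?thesis by auto
  qed
  have eq: "rel_op (span_class C X Y \<rho>) = span_class C Y X (\<rho>\<inverse>)" for \<rho>
    unfolding rel_op_def span_class_def using conv[of X Y] by force
  show "rel_op R \<in> Rel C Y X"
    using eq[of "el C R"] R' span_class_Rel[OF span_relation_converse[OF R'(2)]] by simp
  show "el C (rel_op R) = (el C R)\<inverse>"
    using eq[of "el C R"] R' el_span_class[OF span_relation_converse[OF R'(2)]] by simp
qed

end

section \<open>Intersections and inverse images of relations\<close>

context pullback_category
begin

text \<open>Both relations are monic pairings into a product of \<open>X\<close> and
  \<open>Y\<close>; their intersection is tabulated by the pullback of these pairings.\<close>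

lemma span_relation_Int:
  assumes "span_relation C X Y \<rho>" "span_relation C X Y \<sigma>"
  shows "span_relation C X Y (\<rho> \<inter> \<sigma>)"
proof -
  obtain r1 r2 where r: "is_relation C X Y r1 r2" "\<rho> = spans C r1 r2" using assms(1) by (rule span_relationE)
  note R = relationD[OF r(1)]
  obtain s1 s2 where s: "is_relation C X Y s1 s2" "\<sigma> = spans C s1 s2" using assms(2) by (rule span_relationE)
  note S = relationD[OF s(1)]
  obtain p q where pq: "is_product C p q" "Cod C p = X" "Cod C q = Y"
    using products[of X Y] R by auto
  note P = productD[OF pq(1)]
  obtain k where k: "k \<in> Arr C" "Dom C k = Dom C r2" "Cod C k = Dom C q" "p \<odot> k = r1" "q \<odot> k = r2"
    by (rule product_ex[OF pq(1), of r1 r2]) (use R pq in auto)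
  obtain l where l: "l \<in> Arr C" "Dom C l = Dom C s2" "Cod C l = Dom C q" "p \<odot> l = s1" "q \<odot> l = s2"
    by (rule product_ex[OF pq(1), of s1 s2]) (use S pq in auto)
  obtain u v where pb: "is_pullback C k l u v" using pullbacks[of k l] k l by auto
  note U = pullbackD[OF pb]
  have us: "r1 \<odot> u = s1 \<odot> v" "r2 \<odot> u = s2 \<odot> v"
  proof -
    have "p \<odot> k \<odot> u = r1 \<odot> u" "q \<odot> k \<odot> u = r2 \<odot> u" "p \<odot> l \<odot> v = s1 \<odot> v" "q \<odot> l \<odot> v = s2 \<odot> v"
      by (rule extend1[OF k(4)] extend1[OF k(5)] extend1[OF l(4)] extend1[OF l(5)]; use k(1-3) l(1-3) U P in simp)+
    then show "r1 \<odot> u = s1 \<odot> v" "r2 \<odot> u = s2 \<odot> v" using U(9) by metis+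
  qed
  have ut: "u \<in> Arr C" "v \<in> Arr C" "Dom C u = Dom C v" "Cod C u = Dom C r2" "Cod C v = Dom C s2"
    using U k l by auto
  have t: "is_relation C X Y (r1 \<odot> u) (r2 \<odot> u)"
  proof (rule relationI)
    fix x y assume xy: "x \<in> Arr C" "y \<in> Arr C" "Dom C x = Dom C y" "Cod C x = Dom C (r2 \<odot> u)" "Cod C y = Dom C (r2 \<odot> u)"
      "(r1 \<odot> u) \<odot> x = (r1 \<odot> u) \<odot> y" "(r2 \<odot> u) \<odot> x = (r2 \<odot> u) \<odot> y"
    then have c: "Cod C x = Dom C u" "Cod C y = Dom C u" using R ut by simp_all
    have 1: "u \<odot> x = u \<odot> y" by (rule relation_unique[OF r(1)]) (use xy(1-3,6,7) c R ut in simp_all)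
    have "(s1 \<odot> v) \<odot> x = (s1 \<odot> v) \<odot> y" "(s2 \<odot> v) \<odot> x = (s2 \<odot> v) \<odot> y" using xy(6,7) us by simp_all
    then have 2: "v \<odot> x = v \<odot> y" by - (rule relation_unique[OF s(1)], use xy(1-3) c S ut in simp_all)
    show "x = y" by (rule pullback_unique[OF pb]) (use xy(1-3) c 1 2 ut in simp_all)
  qed (use R ut in auto)
  have "\<rho> \<inter> \<sigma> = spans C (r1 \<odot> u) (r2 \<odot> u)"
  proof (intro set_eqI iffI; clarify)
    fix a b assume ab: "(a, b) \<in> \<rho>" "(a, b) \<in> \<sigma>"
    obtain x where x: "x \<in> Arr C" "Cod C x = Dom C r1" "r1 \<odot> x = a" "r2 \<odot> x = b"
      using ab(1) unfolding r(2) by (rule spansE)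
    obtain y where y: "y \<in> Arr C" "Cod C y = Dom C s1" "s1 \<odot> y = a" "s2 \<odot> y = b"
      using ab(2) unfolding s(2) by (rule spansE)
    have "Dom C a = Dom C x" using x R by auto
    moreover have "Dom C a = Dom C y" using y S by auto
    ultimately have d: "Dom C x = Dom C y" by simp
    have "p \<odot> k \<odot> x = a" "q \<odot> k \<odot> x = b" "p \<odot> l \<odot> y = a" "q \<odot> l \<odot> y = b"
      using extend1[OF k(4), of x] extend1[OF k(5), of x] extend1[OF l(4), of y] extend1[OF l(5), of y]
        k(1-3) l(1-3) x y P R S by simp_all
    then have "k \<odot> x = l \<odot> y"
      by - (rule product_unique[OF pq(1)], use x y d k(1-3) l(1-3) R S P in simp_all)
    then obtain z where z: "z \<in> Arr C" "Cod C z = Dom C v" "u \<odot> z = x"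
      using pullback_ex[OF pb, of x y] x y d k(2) l(2) R S by metis
    then show "(a, b) \<in> spans C (r1 \<odot> u) (r2 \<odot> u)"
      using x R ut by (intro spansI[of z]) auto
  next
    fix a b assume "(a, b) \<in> spans C (r1 \<odot> u) (r2 \<odot> u)"
    then obtain x where x: "x \<in> Arr C" "Cod C x = Dom C (r1 \<odot> u)" "(r1 \<odot> u) \<odot> x = a" "(r2 \<odot> u) \<odot> x = b" by (rule spansE)
    then have c: "Cod C x = Dom C u" using R ut by simp
    have "(s1 \<odot> v) \<odot> x = a" "(s2 \<odot> v) \<odot> x = b" using x us by simp_all
    then have "(a, b) \<in> spans C s1 s2" using x(1) c S ut by (intro spansI[of "v \<odot> x"]) auto
    moreover have "(a, b) \<in> spans C r1 r2" using x c R ut by (intro spansI[of "u \<odot> x"]) auto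
    ultimately show "(a, b) \<in> \<rho> \<inter> \<sigma>" using r s by auto
  qed
  then show ?thesis using t unfolding span_relation_def by blast
qed

text \<open>Two pullbacks in succession: \<open>r1\<close> along \<open>f\<close>, and then the
  remaining leg \<open>r2 \<odot> v\<close> along \<open>g\<close>.\<close>

lemma span_relation_inverse_image:
  assumes "span_relation C X Y \<rho>" and f: "f \<in> Arr C" "Cod C f = X" and g: "g \<in> Arr C" "Cod C g = Y"
  shows "span_relation C (Dom C f) (Dom C g)
     {(a, b). a \<in> Arr C \<and> b \<in> Arr C \<and> Cod C a = Dom C f \<and> Cod C b = Dom C g \<and> (f \<odot> a, g \<odot> b) \<in> \<rho>}"
proof -
  obtain r1 r2 where r: "is_relation C X Y r1 r2" "\<rho> = spans C r1 r2" using assms(1) by (rule span_relationE)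
  note R = relationD[OF r(1)]
  obtain u v where pb: "is_pullback C f r1 u v" using pullbacks[of f r1] f R by auto
  note U = pullbackD[OF pb]
  obtain w z where pb2: "is_pullback C g (r2 \<odot> v) w z" using pullbacks[of g "r2 \<odot> v"] g R U by auto
  note W = pullbackD[OF pb2]
  have ty: "u \<in> Arr C" "v \<in> Arr C" "w \<in> Arr C" "z \<in> Arr C" "Dom C u = Dom C v" "Cod C u = Dom C f" "Cod C v = Dom C r2"
    "Dom C w = Dom C z" "Cod C w = Dom C g" "Cod C z = Dom C v"
    using U(3,4,6-8) W(3,4,6-8) R by auto
  have fu: "f \<odot> u \<odot> x = r1 \<odot> v \<odot> x" if "x \<in> Arr C" "Cod C x = Dom C v" for x
    by (rule extend[OF U(9)]) (use that ty f R in simp_all)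
  have gw: "g \<odot> w \<odot> x = r2 \<odot> v \<odot> z \<odot> x" if "x \<in> Arr C" "Cod C x = Dom C z" for x
    using extend[OF W(9), of x] that ty g R by simp
  have t: "is_relation C (Dom C f) (Dom C g) (u \<odot> z) w"
  proof (rule relationI)
    fix x y assume xy: "x \<in> Arr C" "y \<in> Arr C" "Dom C x = Dom C y" "Cod C x = Dom C w" "Cod C y = Dom C w"
      "(u \<odot> z) \<odot> x = (u \<odot> z) \<odot> y" "w \<odot> x = w \<odot> y"
    have "r1 \<odot> v \<odot> z \<odot> x = r1 \<odot> v \<odot> z \<odot> y"
      using fu[of "z \<odot> x"] fu[of "z \<odot> y"] xy ty by simp
    moreover have "r2 \<odot> v \<odot> z \<odot> x = r2 \<odot> v \<odot> z \<odot> y"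
      using gw[of x] gw[of y] xy ty by simp
    ultimately have "v \<odot> z \<odot> x = v \<odot> z \<odot> y"
      by - (rule relation_unique[OF r(1)], use xy(1-5) ty R in simp_all)
    then have "z \<odot> x = z \<odot> y"
      by - (rule pullback_unique[OF pb], use xy ty R in simp_all)
    then show "x = y" by - (rule pullback_unique[OF pb2], use xy ty R in simp_all)
  qed (use ty in auto)
  have "{(a, b). a \<in> Arr C \<and> b \<in> Arr C \<and> Cod C a = Dom C f \<and> Cod C b = Dom C g \<and> (f \<odot> a, g \<odot> b) \<in> \<rho>} = spans C (u \<odot> z) w"
  proof (intro set_eqI iffI; clarify)
    fix a b assume ab: "a \<in> Arr C" "b \<in> Arr C" "Cod C a = Dom C f" "Cod C b = Dom C g" "(f \<odot> a, g \<odot> b) \<in> \<rho>"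
    obtain x where x: "x \<in> Arr C" "Cod C x = Dom C r1" "r1 \<odot> x = f \<odot> a" "r2 \<odot> x = g \<odot> b"
      using ab(5) unfolding r(2) by (rule spansE)
    have d: "Dom C a = Dom C x" "Dom C b = Dom C x"
      using arg_cong[OF x(3), of "Dom C"] arg_cong[OF x(4), of "Dom C"] x(1,2) ab(1-4) f g R by simp_all
    obtain y where y: "y \<in> Arr C" "Dom C y = Dom C x" "Cod C y = Dom C v" "u \<odot> y = a" "v \<odot> y = x"
      using pullback_ex[OF pb ab(1) x(1) d(1) ab(3) x(2) x(3)[symmetric]] by metis
    have "g \<odot> b = (r2 \<odot> v) \<odot> y" using x y ty R by simp
    then obtain k where k: "k \<in> Arr C" "Cod C k = Dom C z" "w \<odot> k = b" "z \<odot> k = y"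
      using pullback_ex[OF pb2 ab(2) y(1) _ ab(4)] y d ty R by (metis comp_simps(2))
    show "(a, b) \<in> spans C (u \<odot> z) w"
      using k y ty by (intro spansI[of k]) auto
  next
    fix a b assume "(a, b) \<in> spans C (u \<odot> z) w"
    then obtain x where x: "x \<in> Arr C" "Cod C x = Dom C (u \<odot> z)" "(u \<odot> z) \<odot> x = a" "w \<odot> x = b" by (rule spansE)
    then have c: "Cod C x = Dom C z" and a: "a = u \<odot> z \<odot> x" using ty by simp_all
    have "(f \<odot> a, g \<odot> b) \<in> \<rho>"
      unfolding r(2) using fu[of "z \<odot> x"] gw[of x] x(1,4) a c ty R by (intro spansI[of "v \<odot> z \<odot> x"]) auto
    then show "a \<in> Arr C \<and> b \<in> Arr C \<and> Cod C a = Dom C f \<and> Cod C b = Dom C g \<and> (f \<odot> a, g \<odot> b) \<in> \<rho>"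
      using x(1,4) a c ty by auto
  qed
  then show ?thesis using t unfolding span_relation_def by auto
qed

end

section \<open>Composition of relations in a regular category\<close>

context regular_category
begin

lemma local_closureI:
  "\<lbrakk>a \<in> Arr C; b \<in> Arr C; Dom C a = Dom C b; regular_epi C e; Cod C e = Dom C b; (a \<odot> e, b \<odot> e) \<in> \<rho>\<rbrakk>
     \<Longrightarrow> (a, b) \<in> local_closure C \<rho>"
  unfolding local_closure_def by auto

lemma local_closureE:
  assumes "(a, b) \<in> local_closure C \<rho>"
  obtains e where "e \<in> Arr C" "regular_epi C e" "Cod C e = Dom C b" "(a \<odot> e, b \<odot> e) \<in> \<rho>"
    "a \<in> Arr C" "b \<in> Arr C" "Dom C a = Dom C b"
  using assms regular_epi_arr unfolding local_closure_def by auto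

lemma subset_local_closure:
  assumes "(a, b) \<in> \<rho>" "a \<in> Arr C" "b \<in> Arr C" "Dom C a = Dom C b"
  shows "(a, b) \<in> local_closure C \<rho>"
  using assms dom_obj[of b] by (intro local_closureI[of a b "Id C (Dom C b)"] regular_epi_Id) auto

lemma local_closure_subset:
  assumes "span_relation C X Y \<sigma>" "\<rho> \<subseteq> \<sigma>"
  shows "local_closure C \<rho> \<subseteq> \<sigma>"
proof clarify
  fix a b assume "(a, b) \<in> local_closure C \<rho>"
  then obtain e where "regular_epi C e" "Cod C e = Dom C b" "(a \<odot> e, b \<odot> e) \<in> \<rho>"
    "a \<in> Arr C" "b \<in> Arr C" "Dom C a = Dom C b" by (rule local_closureE)
  then show "(a, b) \<in> \<sigma>" using assms by (intro span_relation_local[OF assms(1), of e b a]) auto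
qed

text \<open>The image of the pairing of \<open>a\<close> and \<open>b\<close> in the product: the
  monic part of the pairing gives the jointly monic legs.\<close>

lemma span_factorization:
  assumes "a \<in> Arr C" "b \<in> Arr C" "Dom C a = Dom C b"
  obtains e t1 t2 where "regular_epi C e" "Cod C e = Dom C t1" "is_relation C (Cod C a) (Cod C b) t1 t2"
    "t1 \<odot> e = a" "t2 \<odot> e = b"
proof -
  obtain p q where pq: "is_product C p q" "Cod C p = Cod C a" "Cod C q = Cod C b"
    using products[of "Cod C a" "Cod C b"] assms cod_obj by auto
  note P = productD[OF pq(1)]
  obtain k where k: "k \<in> Arr C" "Dom C k = Dom C b" "Cod C k = Dom C q" "p \<odot> k = a" "q \<odot> k = b"
    by (rule product_ex[OF pq(1), of a b]) (use assms pq in auto)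
  obtain e m where em: "regular_epi C e" "m \<in> Arr C" "Cod C e = Dom C m" "m \<odot> e = k" and mono: "monic C m"
    using k(1) by (rule image_factorization)
  note e = regular_epi_arr[OF em(1)]
  have cm: "Cod C m = Dom C q" using arg_cong[OF em(4), of "Cod C"] em(2,3) e k(3) by simp
  have "is_relation C (Cod C a) (Cod C b) (p \<odot> m) (q \<odot> m)"
  proof (rule relationI)
    fix x y assume xy: "x \<in> Arr C" "y \<in> Arr C" "Dom C x = Dom C y" "Cod C x = Dom C (q \<odot> m)" "Cod C y = Dom C (q \<odot> m)"
      "(p \<odot> m) \<odot> x = (p \<odot> m) \<odot> y" "(q \<odot> m) \<odot> x = (q \<odot> m) \<odot> y"
    then have "m \<odot> x = m \<odot> y" by - (rule product_unique[OF pq(1)], use P em(2) cm in simp_all)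
    then show "x = y" using mono xy(1-5) P em(2) cm unfolding monic_def by simp
  qed (use P em(2) cm pq in auto)
  moreover have "(p \<odot> m) \<odot> e = a" "(q \<odot> m) \<odot> e = b"
    using em(2-4) cm e P k by simp_all
  ultimately show ?thesis by (intro that[of e "p \<odot> m" "q \<odot> m"]) (use em P cm in simp_all)
qed

text \<open>An element of the composite lifts along the cover \<open>e\<close> to the pullback,
  where it splits into an element of each factor. Conversely, two matching elements define an
  element of the pullback, and the passage to covers is absorbed because the composite is itself a
  relation.\<close>

lemma spans_composite:
  assumes r: "is_relation C X Y r1 r2" and s: "is_relation C Y Z s1 s2" and t: "is_relation C X' Z' t1 t2"
    and pb: "is_pullback C r2 s1 p q" and e: "regular_epi C e" "Cod C e = Dom C t1"
    and te: "t1 \<odot> e = r1 \<odot> p" "t2 \<odot> e = s2 \<odot> q"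
  shows "spans C t1 t2 = local_closure C (spans C r1 r2 O spans C s1 s2)"
proof -
  note R = relationD[OF r] and S = relationD[OF s] and T = relationD[OF t] and P = pullbackD[OF pb]
    and ea = regular_epi_arr[OF e(1)]
  have ty: "p \<in> Arr C" "q \<in> Arr C" "Dom C p = Dom C q" "Cod C p = Dom C r2" "Cod C q = Dom C s2"
    using P(3,4,6-8) S by auto
  have de: "Dom C e = Dom C q" using arg_cong[OF te(1), of "Dom C"] e(2) ea ty R T by simp
  have te1: "t1 \<odot> e \<odot> x = r1 \<odot> p \<odot> x" if "x \<in> Arr C" "Cod C x = Dom C q" for x
    by (rule extend[OF te(1)]) (use that ty R T e(2) ea de in simp_all)
  have te2: "t2 \<odot> e \<odot> x = s2 \<odot> q \<odot> x" if "x \<in> Arr C" "Cod C x = Dom C q" for x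
    by (rule extend[OF te(2)]) (use that ty S T e(2) ea de in simp_all)
  have pq: "r2 \<odot> p \<odot> x = s1 \<odot> q \<odot> x" if "x \<in> Arr C" "Cod C x = Dom C q" for x
    by (rule extend[OF P(9)]) (use that ty R S in simp_all)
  show ?thesis
  proof
    show "spans C t1 t2 \<subseteq> local_closure C (spans C r1 r2 O spans C s1 s2)"
    proof clarify
      fix a b assume "(a, b) \<in> spans C t1 t2"
      then obtain x where x: "x \<in> Arr C" "Cod C x = Dom C t1" "t1 \<odot> x = a" "t2 \<odot> x = b" by (rule spansE)
      obtain d y where d: "regular_epi C d" "Cod C d = Dom C x" "y \<in> Arr C" "Dom C y = Dom C d"
        "Cod C y = Dom C e" "e \<odot> y = x \<odot> d"
        by (rule cover_pullback[OF e(1) x(1)]) (use x e in auto)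
      note da = regular_epi_arr[OF d(1)]
      have "a \<odot> d = t1 \<odot> e \<odot> y" "b \<odot> d = t2 \<odot> e \<odot> y"
        using d(2,6) da x T by auto
      then have "a \<odot> d = r1 \<odot> p \<odot> y" "b \<odot> d = s2 \<odot> q \<odot> y"
        using te1[of y] te2[of y] d(3,5) de by simp_all
      moreover have "(r1 \<odot> p \<odot> y, r2 \<odot> p \<odot> y) \<in> spans C r1 r2"
        using d(3,5) de ty R by (intro spansI[of "p \<odot> y"]) auto
      moreover have "(r2 \<odot> p \<odot> y, s2 \<odot> q \<odot> y) \<in> spans C s1 s2"
        using d(3,5) de ty S pq[of y] by (intro spansI[of "q \<odot> y"]) auto
      ultimately have "(a \<odot> d, b \<odot> d) \<in> spans C r1 r2 O spans C s1 s2" by auto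
      moreover have "a \<in> Arr C" "b \<in> Arr C" "Dom C a = Dom C x" "Dom C b = Dom C x"
        using x T by auto
      ultimately show "(a, b) \<in> local_closure C (spans C r1 r2 O spans C s1 s2)"
        using d by (intro local_closureI[of a b d]) auto
    qed
    show "local_closure C (spans C r1 r2 O spans C s1 s2) \<subseteq> spans C t1 t2"
    proof (rule local_closure_subset[OF span_relationI[OF t]]; clarify)
      fix a b c assume ab: "(a, b) \<in> spans C r1 r2" and bc: "(b, c) \<in> spans C s1 s2"
      obtain x where x: "x \<in> Arr C" "Cod C x = Dom C r1" "r1 \<odot> x = a" "r2 \<odot> x = b"
        using ab by (rule spansE)
      obtain y where y: "y \<in> Arr C" "Cod C y = Dom C s1" "s1 \<odot> y = b" "s2 \<odot> y = c"
        using bc by (rule spansE)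
      have "Dom C b = Dom C x" using x R by auto
      moreover have "Dom C b = Dom C y" using y S by auto
      ultimately obtain z where z: "z \<in> Arr C" "Cod C z = Dom C q" "p \<odot> z = x" "q \<odot> z = y"
        using pullback_ex[OF pb, of x y] x y R by metis
      show "(a, c) \<in> spans C t1 t2"
        using z x y te1[of z] te2[of z] e(2) ea de T by (intro spansI[of "e \<odot> z"]) auto
    qed
  qed
qed

lemma composite_exists:
  assumes r: "is_relation C X Y r1 r2" and s: "is_relation C Y Z s1 s2"
  obtains p q e t1 t2 where "is_relation C X Z t1 t2" "is_pullback C r2 s1 p q" "regular_epi C e"
    "Cod C e = Dom C t1" "t1 \<odot> e = r1 \<odot> p" "t2 \<odot> e = s2 \<odot> q"
proof -
  note R = relationD[OF r] and S = relationD[OF s]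
  obtain p q where pb: "is_pullback C r2 s1 p q" using pullbacks[of r2 s1] R S by auto
  have ty: "p \<in> Arr C" "q \<in> Arr C" "Dom C p = Dom C q" "Cod C p = Dom C r2" "Cod C q = Dom C s2"
    using pullbackD[OF pb] S by auto
  obtain e t1 t2 where "regular_epi C e" "Cod C e = Dom C t1" "is_relation C (Cod C (r1 \<odot> p)) (Cod C (s2 \<odot> q)) t1 t2"
    "t1 \<odot> e = r1 \<odot> p" "t2 \<odot> e = s2 \<odot> q"
    by (rule span_factorization[of "r1 \<odot> p" "s2 \<odot> q"]) (use ty R S in auto)
  then show ?thesis using that pb ty R S by simp
qed

lemma span_relation_comp:
  assumes "span_relation C X Y \<rho>" "span_relation C Y Z \<sigma>"
  shows "span_relation C X Z (local_closure C (\<rho> O \<sigma>))"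
proof -
  obtain r1 r2 where r: "is_relation C X Y r1 r2" "\<rho> = spans C r1 r2" using assms(1) by (rule span_relationE)
  obtain s1 s2 where s: "is_relation C Y Z s1 s2" "\<sigma> = spans C s1 s2" using assms(2) by (rule span_relationE)
  obtain p q e t1 t2 where t: "is_relation C X Z t1 t2" "is_pullback C r2 s1 p q" "regular_epi C e"
    "Cod C e = Dom C t1" "t1 \<odot> e = r1 \<odot> p" "t2 \<odot> e = s2 \<odot> q" using r(1) s(1) by (rule composite_exists)
  then show ?thesis unfolding span_relation_def r(2) s(2) using spans_composite[OF r(1) s(1) t] by blast
qed

lemma rel_comp_Rel:
  assumes R: "R \<in> Rel C X Y" and S: "S \<in> Rel C Y Z"
  shows "rel_comp C S R \<in> Rel C X Z" "el C (rel_comp C S R) = local_closure C (el C R O el C S)"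
proof -
  let ?\<tau> = "local_closure C (el C R O el C S)"
  have sr: "span_relation C X Z ?\<tau>"
    using span_relation_comp R S Rel_iff by blast
  have "rel_comp C S R = span_class C X Z ?\<tau>"
  proof (intro set_eqI iffI; clarify)
    fix t1 t2 assume "(t1, t2) \<in> rel_comp C S R"
    then obtain r1 r2 s1 s2 p q e where t: "is_relation C (Cod C t1) (Cod C t2) t1 t2"
      and r: "(r1, r2) \<in> R" and s: "(s1, s2) \<in> S" and pb: "is_pullback C r2 s1 p q"
      and e: "regular_epi C e" "Cod C e = Dom C t1" "t1 \<odot> e = r1 \<odot> p" "t2 \<odot> e = s2 \<odot> q"
      unfolding rel_comp_def by blast
    note r' = Rel_member[OF R r] and s' = Rel_member[OF S s]
    have "Cod C t1 = X" "Cod C t2 = Z"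
      using arg_cong[OF e(3), of "Cod C"] arg_cong[OF e(4), of "Cod C"] e(2) regular_epi_arr[OF e(1)]
        relationD[OF t] relationD[OF r'(1)] relationD[OF s'(1)] pullbackD(3,4,7,8)[OF pb] by simp_all
    moreover have "spans C t1 t2 = ?\<tau>"
      using spans_composite[OF r'(1) s'(1) t pb e] r' s' by simp
    ultimately show "(t1, t2) \<in> span_class C X Z ?\<tau>"
      unfolding span_class_def using t by auto
  next
    fix t1 t2 assume "(t1, t2) \<in> span_class C X Z ?\<tau>"
    then have t: "is_relation C X Z t1 t2" "spans C t1 t2 = ?\<tau>" unfolding span_class_def by auto
    obtain r1 r2 where r: "(r1, r2) \<in> R" using R by (rule Rel_nonempty)
    obtain s1 s2 where s: "(s1, s2) \<in> S" using S by (rule Rel_nonempty)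
    note r' = Rel_member[OF R r] and s' = Rel_member[OF S s]
    obtain p q e u1 u2 where u: "is_relation C X Z u1 u2" and pb: "is_pullback C r2 s1 p q"
      and e: "regular_epi C e" "Cod C e = Dom C u1" "u1 \<odot> e = r1 \<odot> p" "u2 \<odot> e = s2 \<odot> q"
      using r'(1) s'(1) by (rule composite_exists)
    have "spans C u1 u2 = spans C t1 t2"
      using spans_composite[OF r'(1) s'(1) u pb e] r' s' t by simp
    then obtain i where i: "is_iso C i" "Cod C i = Dom C t1" "Dom C i = Dom C u1" "t1 \<odot> i = u1" "t2 \<odot> i = u2"
      by (rule relations_isomorphic[OF t(1) u])
    have ia: "i \<in> Arr C" using i unfolding is_iso_def by auto
    \<comment> \<open>The given tabulation \<open>t1, t2\<close> is reached from the constructed one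
      by correcting the regular epimorphism by the isomorphism \<open>i\<close>.\<close>
    have ie: "regular_epi C (i \<odot> e)" by (rule regular_epi_iso_comp) (use e i in auto)
    have "t1 \<odot> (i \<odot> e) = r1 \<odot> p" "t2 \<odot> (i \<odot> e) = s2 \<odot> q" "Cod C (i \<odot> e) = Dom C t1"
      using extend1[OF i(4), of e] extend1[OF i(5), of e] i(2,3) ia e(2-4) regular_epi_arr[OF e(1)] relationD[OF t(1)]
      by simp_all
    then show "(t1, t2) \<in> rel_comp C S R"
      unfolding rel_comp_def using t(1) relationD(4,5)[OF t(1)] r s pb ie by blast
  qed
  then show "rel_comp C S R \<in> Rel C X Z" "el C (rel_comp C S R) = ?\<tau>"
    using span_class_Rel[OF sr] el_span_class[OF sr] by simp_all
qed

end


section \<open>The exact completion\<close>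

text \<open>The conditions on a morphism in terms of elements: \<open>S \<phi> R = \<phi>\<close>
  becomes absorption of \<open>R\<close> and of \<open>S\<close>,
  \<open>\<phi> \<phi>\<^sup>o \<le> S\<close> becomes single-valuedness up to \<open>S\<close>, and
  \<open>R \<le> \<phi>\<^sup>o \<phi>\<close> becomes, in the presence of absorption, local
  totality.\<close>

definition span_map :: "('o, 'm) cat \<Rightarrow> 'o \<Rightarrow> ('m \<times> 'm) set \<Rightarrow> 'o \<Rightarrow> ('m \<times> 'm) set \<Rightarrow> ('m \<times> 'm) set \<Rightarrow> bool" where
  "span_map C X R Y S \<phi> \<longleftrightarrow> span_relation C X Y \<phi> \<and> R O \<phi> \<subseteq> \<phi> \<and> \<phi> O S \<subseteq> \<phi> \<and> \<phi>\<inverse> O \<phi> \<subseteq> S \<and>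
     (\<forall>x \<in> Arr C. Cod C x = X \<longrightarrow> (\<exists>e y. regular_epi C e \<and> Cod C e = Dom C x \<and> (x \<cdot>\<^bsub>C\<^esub> e, y) \<in> \<phi>))"

section \<open>Maps between objects carrying equivalence relations\<close>

context regular_category
begin

lemma span_mapD:
  assumes "span_map C X R Y S \<phi>"
  shows "span_relation C X Y \<phi>"
    "\<And>x x' y. \<lbrakk>(x, x') \<in> R; (x', y) \<in> \<phi>\<rbrakk> \<Longrightarrow> (x, y) \<in> \<phi>"
    "\<And>x y y'. \<lbrakk>(x, y) \<in> \<phi>; (y, y') \<in> S\<rbrakk> \<Longrightarrow> (x, y') \<in> \<phi>"
    "\<And>x y y'. \<lbrakk>(x, y) \<in> \<phi>; (x, y') \<in> \<phi>\<rbrakk> \<Longrightarrow> (y, y') \<in> S"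
  using assms unfolding span_map_def by blast+

lemma span_map_total:
  assumes "span_map C X R Y S \<phi>" "x \<in> Arr C" "Cod C x = X"
  obtains e y where "e \<in> Arr C" "regular_epi C e" "Cod C e = Dom C x" "(x \<odot> e, y) \<in> \<phi>"
  using assms regular_epi_arr unfolding span_map_def by blast

lemma span_mapI:
  assumes "span_relation C X Y \<phi>"
    "\<And>x x' y. \<lbrakk>(x, x') \<in> R; (x', y) \<in> \<phi>\<rbrakk> \<Longrightarrow> (x, y) \<in> \<phi>"
    "\<And>x y y'. \<lbrakk>(x, y) \<in> \<phi>; (y, y') \<in> S\<rbrakk> \<Longrightarrow> (x, y') \<in> \<phi>"
    "\<And>x y y'. \<lbrakk>(x, y) \<in> \<phi>; (x, y') \<in> \<phi>\<rbrakk> \<Longrightarrow> (y, y') \<in> S"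
    "\<And>x. \<lbrakk>x \<in> Arr C; Cod C x = X\<rbrakk> \<Longrightarrow> \<exists>e y. regular_epi C e \<and> Cod C e = Dom C x \<and> (x \<odot> e, y) \<in> \<phi>"
  shows "span_map C X R Y S \<phi>"
  using assms unfolding span_map_def by blast

lemma span_equivalenceD:
  assumes "span_equivalence C X R"
  shows "span_relation C X X R" "\<And>x. \<lbrakk>x \<in> Arr C; Cod C x = X\<rbrakk> \<Longrightarrow> (x, x) \<in> R"
    "\<And>x y. (x, y) \<in> R \<Longrightarrow> (y, x) \<in> R" "\<And>x y z. \<lbrakk>(x, y) \<in> R; (y, z) \<in> R\<rbrakk> \<Longrightarrow> (x, z) \<in> R"
  using assms unfolding span_equivalence_def by (auto dest: symD transD)

lemma relcomp_local_closureE: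
  assumes "(x, z) \<in> local_closure C (\<phi> O \<psi>)"
  obtains e y where "e \<in> Arr C" "regular_epi C e" "Cod C e = Dom C z" "(x \<odot> e, y) \<in> \<phi>" "(y, z \<odot> e) \<in> \<psi>"
    "x \<in> Arr C" "z \<in> Arr C" "Dom C x = Dom C z"
  using assms by (auto elim!: local_closureE)

lemma relcomp_local_closureI:
  assumes "(x, y) \<in> \<phi>" "(y, z) \<in> \<psi>" "span_relation C X Y \<phi>" "span_relation C Y' Z \<psi>"
  shows "(x, z) \<in> local_closure C (\<phi> O \<psi>)"
  using assms(1,2) span_relationD[OF assms(3,1)] span_relationD[OF assms(4,2)]
  by (intro subset_local_closure) auto

text \<open>A total relation inside a single-valued one already exhausts it: a value of
  \<open>\<psi>\<close> is compared with a local value of \<open>\<phi>\<close> at the same element,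
  and \<open>\<phi>\<close> absorbs the difference.\<close>

lemma span_map_eqI:
  assumes "span_map C X R Y S \<phi>" "span_map C X R Y S \<psi>" "\<phi> \<subseteq> \<psi>"
  shows "\<phi> = \<psi>"
proof (intro subset_antisym assms(3); clarify)
  fix x y assume xy: "(x, y) \<in> \<psi>"
  note p = span_mapD[OF assms(1)] and q = span_mapD[OF assms(2)]
  note xy' = span_relationD[OF q(1) xy]
  obtain e y' where e: "e \<in> Arr C" "regular_epi C e" "Cod C e = Dom C x" "(x \<odot> e, y') \<in> \<phi>"
    using span_map_total[OF assms(1) xy'(1,4)] .
  have "(x \<odot> e, y \<odot> e) \<in> \<psi>" using span_relation_restrict[OF q(1) xy e(1)] e xy' by simp
  then have "(y', y \<odot> e) \<in> S" using q(4) assms(3) e(4) by blast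
  then have "(x \<odot> e, y \<odot> e) \<in> \<phi>" using p(3) e(4) by blast
  then show "(x, y) \<in> \<phi>" using span_relation_local[OF p(1) e(2)] e xy' by simp
qed

text \<open>The composite provides some middle element, on a cover. By single-valuedness it is
  equivalent to the prescribed value \<open>y\<close> of \<open>\<phi>\<close> at \<open>x\<close>,
  and \<open>\<psi>\<close> does not distinguish the two.\<close>

lemma span_map_comp_elim:
  assumes p: "span_map C X R Y S \<phi>" and q: "span_map C Y S Z T \<psi>"
    and xz: "(x, z) \<in> local_closure C (\<phi> O \<psi>)" and xy: "(x, y) \<in> \<phi>"
  shows "(y, z) \<in> \<psi>"
proof -
  note p' = span_mapD[OF p] and q' = span_mapD[OF q] and ty = span_relationD[OF span_mapD(1)[OF p] xy]
  obtain e y' where e: "e \<in> Arr C" "regular_epi C e" "Cod C e = Dom C z" "(x \<odot> e, y') \<in> \<phi>" "(y', z \<odot> e) \<in> \<psi>"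
    "x \<in> Arr C" "z \<in> Arr C" "Dom C x = Dom C z" using xz by (rule relcomp_local_closureE)
  have "(x \<odot> e, y \<odot> e) \<in> \<phi>" using span_relation_restrict[OF p'(1) xy e(1)] e ty by simp
  then have "(y \<odot> e, y') \<in> S" using p'(4) e(4) by blast
  then have "(y \<odot> e, z \<odot> e) \<in> \<psi>" using q'(2) e(5) by blast
  then show ?thesis using span_relation_local[OF q'(1) e(2,3)] e(7,8) ty by simp
qed

lemma span_map_comp:
  assumes p: "span_map C X R Y S \<phi>" and q: "span_map C Y S Z T \<psi>"
    and R: "span_equivalence C X R" and T: "span_equivalence C Z T"
  shows "span_map C X R Z T (local_closure C (\<phi> O \<psi>))"
proof (rule span_mapI)
  note p' = span_mapD[OF p] and q' = span_mapD[OF q]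
  note R' = span_equivalenceD[OF R] and T' = span_equivalenceD[OF T]
  show "span_relation C X Z (local_closure C (\<phi> O \<psi>))" by (rule span_relation_comp[OF p'(1) q'(1)])
  {
    fix x x' z assume xx': "(x, x') \<in> R" and xz: "(x', z) \<in> local_closure C (\<phi> O \<psi>)"
    obtain e y where e: "e \<in> Arr C" "regular_epi C e" "Cod C e = Dom C z" "(x' \<odot> e, y) \<in> \<phi>" "(y, z \<odot> e) \<in> \<psi>"
      "x' \<in> Arr C" "z \<in> Arr C" "Dom C x' = Dom C z" using xz by (rule relcomp_local_closureE)
    have "(x \<odot> e, x' \<odot> e) \<in> R" using span_relation_restrict[OF R'(1) xx' e(1)] e by simp
    then have "(x \<odot> e, z \<odot> e) \<in> \<phi> O \<psi>" using p'(2) e(4,5) by blast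
    then show "(x, z) \<in> local_closure C (\<phi> O \<psi>)"
      using e span_relationD[OF R'(1) xx'] by (intro local_closureI[of x z e]) auto
  next
    fix x z z' assume zz': "(z, z') \<in> T" and xz: "(x, z) \<in> local_closure C (\<phi> O \<psi>)"
    obtain e y where e: "e \<in> Arr C" "regular_epi C e" "Cod C e = Dom C z" "(x \<odot> e, y) \<in> \<phi>" "(y, z \<odot> e) \<in> \<psi>"
      "x \<in> Arr C" "z \<in> Arr C" "Dom C x = Dom C z" using xz by (rule relcomp_local_closureE)
    note ty = span_relationD[OF T'(1) zz']
    have "(z \<odot> e, z' \<odot> e) \<in> T" using span_relation_restrict[OF T'(1) zz' e(1)] e ty by simp
    then have "(x \<odot> e, z' \<odot> e) \<in> \<phi> O \<psi>" using q'(3) e(4,5) by blast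
    then show "(x, z') \<in> local_closure C (\<phi> O \<psi>)"
      using e ty by (intro local_closureI[of x z' e]) auto
  next
    fix x z z' assume xz: "(x, z) \<in> local_closure C (\<phi> O \<psi>)" and xz': "(x, z') \<in> local_closure C (\<phi> O \<psi>)"
    obtain e y where e: "e \<in> Arr C" "regular_epi C e" "Cod C e = Dom C z" "(x \<odot> e, y) \<in> \<phi>" "(y, z \<odot> e) \<in> \<psi>"
      "x \<in> Arr C" "z \<in> Arr C" "Dom C x = Dom C z" using xz by (rule relcomp_local_closureE)
    have z': "z' \<in> Arr C" "Dom C x = Dom C z'" using xz' by (auto elim: local_closureE)
    note ty = span_relationD[OF p'(1) e(4)]
    have d: "Dom C y = Dom C e" using ty e by simp
    have "(x \<odot> e, z' \<odot> e) \<in> local_closure C (\<phi> O \<psi>)"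
      using span_relation_restrict[OF span_relation_comp[OF p'(1) q'(1)] xz' e(1)] z' e by simp
    then have "(y, z' \<odot> e) \<in> \<psi>" using span_map_comp_elim[OF p q _ e(4)] by blast
    then have "(z \<odot> e, z' \<odot> e) \<in> T" using q'(4) e(5) by blast
    then show "(z, z') \<in> T" using span_relation_local[OF T'(1) e(2), of z' z] e z' by simp
  next
    fix x assume x: "x \<in> Arr C" "Cod C x = X"
    obtain e y where e: "e \<in> Arr C" "regular_epi C e" "Cod C e = Dom C x" "(x \<odot> e, y) \<in> \<phi>"
      using span_map_total[OF p x] .
    note ty = span_relationD[OF p'(1) e(4)]
    obtain d z where d: "d \<in> Arr C" "regular_epi C d" "Cod C d = Dom C y" "(y \<odot> d, z) \<in> \<psi>"
      using span_map_total[OF q ty(2,5)] .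
    have "(x \<odot> e \<odot> d, y \<odot> d) \<in> \<phi>" using span_relation_restrict[OF p'(1) e(4) d(1)] e d ty x by simp
    then have "(x \<odot> e \<odot> d, z) \<in> local_closure C (\<phi> O \<psi>)" by (rule relcomp_local_closureI[OF _ d(4) p'(1) q'(1)])
    moreover have "Dom C d \<in> Obj C" "Dom C e = Cod C d" using d e ty x dom_obj by auto
    ultimately show "\<exists>e y. regular_epi C e \<and> Cod C e = Dom C x \<and> (x \<odot> e, y) \<in> local_closure C (\<phi> O \<psi>)"
      using regular_epi_comp[OF e(2) d(2)] e d by (intro exI[of _ "e \<odot> d"] exI[of _ z]) simp
  }
qed

lemma span_map_Id:
  assumes "span_equivalence C X R"
  shows "span_map C X R X R R"
proof (rule span_mapI)
  note R = span_equivalenceD[OF assms]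
  show "span_relation C X X R" by (rule R(1))
  show "(x, y) \<in> R" if "(x, x') \<in> R" "(x', y) \<in> R" for x x' y using R(4)[OF that] .
  then show "(x, y') \<in> R" if "(x, y) \<in> R" "(y, y') \<in> R" for x y y' using that .
  show "(y, y') \<in> R" if "(x, y) \<in> R" "(x, y') \<in> R" for x y y' using R(4)[OF R(3)[OF that(1)] that(2)] .
  show "\<exists>e y. regular_epi C e \<and> Cod C e = Dom C x \<and> (x \<odot> e, y) \<in> R" if "x \<in> Arr C" "Cod C x = X" for x
    using R(2)[OF that] regular_epi_Id[of "Dom C x"] dom_obj[OF that(1)] that
    by (intro exI[of _ "Id C (Dom C x)"] exI[of _ x]) simp
qed

lemma span_map_comp_Id:
  assumes p: "span_map C X R Y S \<phi>" and R: "span_equivalence C X R" and S: "span_equivalence C Y S"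
  shows "local_closure C (R O \<phi>) = \<phi>" "local_closure C (\<phi> O S) = \<phi>"
proof -
  note p' = span_mapD[OF p]
  show "local_closure C (R O \<phi>) = \<phi>"
    by (rule span_map_eqI[OF span_map_comp[OF span_map_Id[OF R] p R S] p])
      (rule local_closure_subset[OF p'(1)], use p'(2) in blast)
  show "local_closure C (\<phi> O S) = \<phi>"
    by (rule span_map_eqI[OF span_map_comp[OF p span_map_Id[OF S] R S] p])
      (rule local_closure_subset[OF p'(1)], use p'(3) in blast)
qed

text \<open>By \<open>span_map_eqI\<close> one inclusion suffices: the nested witness is taken apart
  on the left and rebuilt on the right.\<close>

lemma span_map_comp_assoc:
  assumes p: "span_map C X R Y S \<phi>" and q: "span_map C Y S Z T \<psi>" and r: "span_map C Z T W U \<chi>"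
    and R: "span_equivalence C X R" and S: "span_equivalence C Y S"
    and T: "span_equivalence C Z T" and U: "span_equivalence C W U"
  shows "local_closure C (local_closure C (\<phi> O \<psi>) O \<chi>) = local_closure C (\<phi> O local_closure C (\<psi> O \<chi>))"
proof (rule span_map_eqI)
  show "span_map C X R W U (local_closure C (local_closure C (\<phi> O \<psi>) O \<chi>))"
    by (rule span_map_comp[OF span_map_comp[OF p q R T] r R U])
  show 2: "span_map C X R W U (local_closure C (\<phi> O local_closure C (\<psi> O \<chi>)))"
    by (rule span_map_comp[OF p span_map_comp[OF q r S U] R U])
  note p' = span_mapD[OF p] and q' = span_mapD[OF q] and r' = span_mapD[OF r] and l = span_mapD[OF 2]
  show "local_closure C (local_closure C (\<phi> O \<psi>) O \<chi>) \<subseteq> local_closure C (\<phi> O local_closure C (\<psi> O \<chi>))"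
  proof (rule local_closure_subset[OF l(1)]; clarify)
    fix x z w assume xz: "(x, z) \<in> local_closure C (\<phi> O \<psi>)" and zw: "(z, w) \<in> \<chi>"
    obtain e y where e: "e \<in> Arr C" "regular_epi C e" "Cod C e = Dom C z" "(x \<odot> e, y) \<in> \<phi>" "(y, z \<odot> e) \<in> \<psi>"
      "x \<in> Arr C" "z \<in> Arr C" "Dom C x = Dom C z" using xz by (rule relcomp_local_closureE)
    note ty = span_relationD[OF r'(1) zw]
    have "(z \<odot> e, w \<odot> e) \<in> \<chi>" using span_relation_restrict[OF r'(1) zw e(1)] e ty by simp
    then have "(y, w \<odot> e) \<in> local_closure C (\<psi> O \<chi>)"
      by (rule relcomp_local_closureI[OF e(5) _ q'(1) r'(1)])
    then show "(x, w) \<in> local_closure C (\<phi> O local_closure C (\<psi> O \<chi>))"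
      using e ty by (intro local_closureI[of x w e]) auto
  qed
qed

lemma ex_objectsD:
  assumes "A \<in> ex_objects C"
  shows "span_equivalence C (fst A) (el C (snd A))" "snd A \<in> Rel C (fst A) (fst A)"
proof -
  obtain X r1 r2 where A: "A = (X, rel_class C r1 r2)" "equivalence_relation C X r1 r2"
    using assms unfolding ex_objects_def by auto
  then have r: "is_relation C X X r1 r2" "span_equivalence C X (spans C r1 r2)"
    using equivalence_relation_iff by auto
  then show "span_equivalence C (fst A) (el C (snd A))" "snd A \<in> Rel C (fst A) (fst A)"
    using A el_rel_class unfolding Rel_def by auto
qed

lemma ex_objectI:
  assumes "span_equivalence C X \<rho>"
  obtains A where "A \<in> ex_objects C" "fst A = X" "el C (snd A) = \<rho>"
proof -
  obtain r1 r2 where r: "is_relation C X X r1 r2" "\<rho> = spans C r1 r2"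
    using span_relationE[OF span_equivalenceD(1)[OF assms]] .
  have "equivalence_relation C X r1 r2" using equivalence_relation_iff r assms by auto
  then have "(X, rel_class C r1 r2) \<in> ex_objects C"
    unfolding ex_objects_def using relationD(6)[OF r(1)] by auto
  then show ?thesis using that el_rel_class[OF r(1)] r(2) by auto
qed

lemma ex_arrows_iff:
  "((X, R), \<phi>, (Y, S)) \<in> ex_arrows C \<longleftrightarrow> (X, R) \<in> ex_objects C \<and> (Y, S) \<in> ex_objects C \<and>
     \<phi> \<in> Rel C X Y \<and> span_map C X (el C R) Y (el C S) (el C \<phi>)"
proof (cases "(X, R) \<in> ex_objects C \<and> (Y, S) \<in> ex_objects C \<and> \<phi> \<in> Rel C X Y")
  case True
  then have R: "span_equivalence C X (el C R)" "R \<in> Rel C X X" and S: "span_equivalence C Y (el C S)" "S \<in> Rel C Y Y"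
    and \<phi>: "\<phi> \<in> Rel C X Y" using ex_objectsD[of "(X, R)"] ex_objectsD[of "(Y, S)"] by auto
  note R' = span_equivalenceD[OF R(1)] and S' = span_equivalenceD[OF S(1)]
  have sr: "span_relation C X Y (el C \<phi>)" using \<phi> Rel_iff by blast
  note ty = span_relationD[OF sr]
  note c1 = rel_comp_Rel[OF R(2) \<phi>] 
  note c2 = rel_comp_Rel[OF c1(1) S(2)]
  note op = rel_op_Rel[OF \<phi>]
  note c3 = rel_comp_Rel[OF \<phi> op(1)] and c4 = rel_comp_Rel[OF op(1) \<phi>]
  have i: "rel_comp C S (rel_comp C \<phi> R) = \<phi> \<longleftrightarrow>
      local_closure C (local_closure C (el C R O el C \<phi>) O el C S) = el C \<phi>"
    using c2 c1(2) \<phi> Rel_iff by metis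
  have ii: "rel_le C R (rel_comp C (rel_op \<phi>) \<phi>) \<longleftrightarrow> el C R \<subseteq> local_closure C (el C \<phi> O (el C \<phi>)\<inverse>)"
    using rel_le_iff[OF R(2) c3(1)] c3(2) op(2) by simp
  have iii: "rel_le C (rel_comp C \<phi> (rel_op \<phi>)) S \<longleftrightarrow> local_closure C ((el C \<phi>)\<inverse> O el C \<phi>) \<subseteq> el C S"
    using rel_le_iff[OF c4(1) S(2)] c4(2) op(2) by simp
  have cv: "span_relation C Y X ((el C \<phi>)\<inverse>)" by (rule span_relation_converse[OF sr])
  have lcR: "span_relation C X Y (local_closure C (el C R O el C \<phi>))" by (rule span_relation_comp[OF R'(1) sr])
  have "local_closure C (local_closure C (el C R O el C \<phi>) O el C S) = el C \<phi> \<and>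
      el C R \<subseteq> local_closure C (el C \<phi> O (el C \<phi>)\<inverse>) \<and> local_closure C ((el C \<phi>)\<inverse> O el C \<phi>) \<subseteq> el C S \<longleftrightarrow>
      span_map C X (el C R) Y (el C S) (el C \<phi>)"
  proof (intro iffI conjI)
    assume a: "local_closure C (local_closure C (el C R O el C \<phi>) O el C S) = el C \<phi> \<and>
      el C R \<subseteq> local_closure C (el C \<phi> O (el C \<phi>)\<inverse>) \<and> local_closure C ((el C \<phi>)\<inverse> O el C \<phi>) \<subseteq> el C S"
    \<comment> \<open>Both absorption laws at once; each follows by taking the other equivalence
      relation at a reflexive pair.\<close>
    have m: "(x, y') \<in> el C \<phi>" if "(x, x') \<in> el C R" "(x', y) \<in> el C \<phi>" "(y, y') \<in> el C S" for x x' y y'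
      using relcomp_local_closureI[OF relcomp_local_closureI[OF that(1,2) R'(1) sr] that(3) lcR S'(1)] a by blast
    show "span_map C X (el C R) Y (el C S) (el C \<phi>)"
    proof (rule span_mapI[OF sr])
      show "(x, y) \<in> el C \<phi>" if "(x, x') \<in> el C R" "(x', y) \<in> el C \<phi>" for x x' y
        using m[OF that S'(2)] ty[OF that(2)] by blast
      show "(x, y') \<in> el C \<phi>" if "(x, y) \<in> el C \<phi>" "(y, y') \<in> el C S" for x y y'
        using m[OF R'(2) that] ty[OF that(1)] by blast
      show "(y, y') \<in> el C S" if "(x, y) \<in> el C \<phi>" "(x, y') \<in> el C \<phi>" for x y y'
        using relcomp_local_closureI[OF _ that(2) cv sr, of y] that(1) a by blast
      show "\<exists>e y. regular_epi C e \<and> Cod C e = Dom C x \<and> (x \<odot> e, y) \<in> el C \<phi>" if "x \<in> Arr C" "Cod C x = X" for x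
      proof -
        have "(x, x) \<in> local_closure C (el C \<phi> O (el C \<phi>)\<inverse>)" using R'(2)[OF that] a by blast
        then show ?thesis by (rule relcomp_local_closureE) auto
      qed
    qed
  next
    assume p: "span_map C X (el C R) Y (el C S) (el C \<phi>)"
    note p' = span_mapD[OF p]
    show "local_closure C (local_closure C (el C R O el C \<phi>) O el C S) = el C \<phi>"
      using span_map_comp_Id[OF p R(1) S(1)] by simp
    show "local_closure C ((el C \<phi>)\<inverse> O el C \<phi>) \<subseteq> el C S"
      by (rule local_closure_subset[OF S'(1)]) (use p'(4) in auto)
    show "el C R \<subseteq> local_closure C (el C \<phi> O (el C \<phi>)\<inverse>)"
    proof clarify
      fix x x' assume xx': "(x, x') \<in> el C R"
      note tx = span_relationD[OF R'(1) xx']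
      obtain e y where e: "e \<in> Arr C" "regular_epi C e" "Cod C e = Dom C x" "(x \<odot> e, y) \<in> el C \<phi>"
        using span_map_total[OF p tx(1,4)] .
      have "(x' \<odot> e, x \<odot> e) \<in> el C R" using span_relation_restrict[OF R'(1) xx' e(1)] e tx R'(3) by simp
      then have "(x' \<odot> e, y) \<in> el C \<phi>" using p'(2) e(4) by blast
      then have "(x \<odot> e, x' \<odot> e) \<in> el C \<phi> O (el C \<phi>)\<inverse>" using e(4) by blast
      then show "(x, x') \<in> local_closure C (el C \<phi> O (el C \<phi>)\<inverse>)"
        using e tx by (intro local_closureI[of x x' e]) auto
    qed
  qed
  then show ?thesis unfolding ex_arrows_def using True i ii iii by simp
next
  case False
  then show ?thesis unfolding ex_arrows_def by auto
qed

section \<open>The exact completion as a category\<close>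

abbreviation EC where "EC \<equiv> ex_reg C"
abbreviation ex_compose (infixr \<open>\<star>\<close> 70) where "\<psi> \<star> \<phi> \<equiv> \<psi> \<cdot>\<^bsub>EC\<^esub> \<phi>"
abbreviation E where "E \<phi> \<equiv> el C (fst (snd \<phi>))"

lemma ex_reg_simps:
  "Obj EC = ex_objects C" "Arr EC = ex_arrows C" "Dom EC = fst" "Cod EC \<phi> = snd (snd \<phi>)"
  "Id EC A = (A, snd A, A)" "\<psi> \<star> \<phi> = (fst \<phi>, rel_comp C (fst (snd \<psi>)) (fst (snd \<phi>)), snd (snd \<psi>))"
  unfolding ex_reg_def by (auto simp: fun_eq_iff split: prod.splits)

lemma ex_arrD:
  assumes "\<phi> \<in> Arr EC"
  shows "Dom EC \<phi> \<in> Obj EC" "Cod EC \<phi> \<in> Obj EC" "fst (snd \<phi>) \<in> Rel C (fst (Dom EC \<phi>)) (fst (Cod EC \<phi>))"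
    "span_map C (fst (Dom EC \<phi>)) (el C (snd (Dom EC \<phi>))) (fst (Cod EC \<phi>)) (el C (snd (Cod EC \<phi>))) (E \<phi>)"
  using assms ex_arrows_iff unfolding ex_reg_simps by (cases \<phi>; force)+

text \<open>The usual way to produce an arrow of the completion is from a set of elements; the class
  of spans is recovered by \<open>span_class\<close>.\<close>

lemma ex_arr_exists:
  assumes "A \<in> Obj EC" "B \<in> Obj EC" "span_map C (fst A) (el C (snd A)) (fst B) (el C (snd B)) \<rho>"
  obtains \<phi> where "\<phi> \<in> Arr EC" "Dom EC \<phi> = A" "Cod EC \<phi> = B" "E \<phi> = \<rho>"
proof -
  let ?c = "span_class C (fst A) (fst B) \<rho>"
  have sr: "span_relation C (fst A) (fst B) \<rho>" using span_mapD(1)[OF assms(3)] .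
  have "(A, ?c, B) \<in> Arr EC"
    using assms el_span_class[OF sr] span_class_Rel[OF sr] ex_arrows_iff[of "fst A" "snd A" ?c "fst B" "snd B"]
    unfolding ex_reg_simps by simp
  then show ?thesis using that el_span_class[OF sr] unfolding ex_reg_simps by simp
qed

lemma ex_objD: "A \<in> Obj EC \<Longrightarrow> span_equivalence C (fst A) (el C (snd A))"
  using ex_objectsD unfolding ex_reg_simps by blast

lemma ex_obj_exists:
  assumes "span_equivalence C X \<rho>"
  obtains A where "A \<in> Obj EC" "fst A = X" "el C (snd A) = \<rho>"
  using ex_objectI[OF assms] unfolding ex_reg_simps by blast

lemma ex_arr_eqI:
  assumes "\<phi> \<in> Arr EC" "\<psi> \<in> Arr EC" "Dom EC \<phi> = Dom EC \<psi>" "Cod EC \<phi> = Cod EC \<psi>" "E \<phi> \<subseteq> E \<psi>"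
  shows "\<phi> = \<psi>"
proof -
  have "E \<phi> = E \<psi>" using span_map_eqI[OF ex_arrD(4)[OF assms(1)]] ex_arrD(4)[OF assms(2)] assms(3-5) by simp
  then have "fst (snd \<phi>) = fst (snd \<psi>)"
    using ex_arrD(3)[OF assms(1)] ex_arrD(3)[OF assms(2)] assms(3,4) Rel_iff by metis
  then show ?thesis using assms(3,4) unfolding ex_reg_simps by (simp add: prod_eq_iff)
qed

lemma ex_comp:
  assumes "\<phi> \<in> Arr EC" "\<psi> \<in> Arr EC" "Dom EC \<psi> = Cod EC \<phi>"
  shows "E (\<psi> \<star> \<phi>) = local_closure C (E \<phi> O E \<psi>)" "\<psi> \<star> \<phi> \<in> Arr EC"
    "Dom EC (\<psi> \<star> \<phi>) = Dom EC \<phi>" "Cod EC (\<psi> \<star> \<phi>) = Cod EC \<psi>"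
proof -
  note p = ex_arrD[OF assms(1)] and q = ex_arrD[OF assms(2)]
  have c: "rel_comp C (fst (snd \<psi>)) (fst (snd \<phi>)) \<in> Rel C (fst (Dom EC \<phi>)) (fst (Cod EC \<psi>))"
    "el C (rel_comp C (fst (snd \<psi>)) (fst (snd \<phi>))) = local_closure C (E \<phi> O E \<psi>)"
    using rel_comp_Rel[OF p(3)] q(3) assms(3) by auto
  show d: "Dom EC (\<psi> \<star> \<phi>) = Dom EC \<phi>" "Cod EC (\<psi> \<star> \<phi>) = Cod EC \<psi>"
    unfolding ex_reg_simps by simp_all
  show e: "E (\<psi> \<star> \<phi>) = local_closure C (E \<phi> O E \<psi>)" using c(2) unfolding ex_reg_simps by simp
  have "span_map C (fst (Dom EC \<phi>)) (el C (snd (Dom EC \<phi>))) (fst (Cod EC \<psi>)) (el C (snd (Cod EC \<psi>)))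
      (local_closure C (E \<phi> O E \<psi>))"
    using span_map_comp[OF p(4)] q(4) assms(3) ex_objD p(1) q(2) by simp
  then show "\<psi> \<star> \<phi> \<in> Arr EC"
    using c p(1) q(2) ex_arrows_iff[of "fst (fst \<phi>)" "snd (fst \<phi>)" _ "fst (snd (snd \<psi>))" "snd (snd (snd \<psi>))"]
    unfolding ex_reg_simps by simp
qed

lemma ex_Id:
  assumes "A \<in> Obj EC"
  shows "E (Id EC A) = el C (snd A)" "Id EC A \<in> Arr EC" "Dom EC (Id EC A) = A" "Cod EC (Id EC A) = A"
  using ex_objectsD[of A] assms ex_arrows_iff[of "fst A" "snd A" "snd A" "fst A" "snd A"] span_map_Id[of "fst A" "el C (snd A)"]
  unfolding ex_reg_simps by auto

lemma ex_category: "category EC"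
proof
  show "Dom EC \<phi> \<in> Obj EC" "Cod EC \<phi> \<in> Obj EC" if "\<phi> \<in> Arr EC" for \<phi> using ex_arrD[OF that] by auto
  show "Id EC A \<in> hom EC A A" if "A \<in> Obj EC" for A
    using ex_Id[OF that] unfolding hom_def by auto
  show "\<psi> \<star> \<phi> \<in> hom EC A D" if "\<phi> \<in> hom EC A B" "\<psi> \<in> hom EC B D" for A B D \<phi> \<psi>
    using ex_comp[of \<phi> \<psi>] that unfolding hom_def by auto
  show "Id EC B \<star> \<phi> = \<phi>" if "\<phi> \<in> hom EC A B" for \<phi> A B
  proof -
    have p: "\<phi> \<in> Arr EC" "Dom EC \<phi> = A" "Cod EC \<phi> = B" using that unfolding hom_def by auto
    note p' = ex_arrD[OF p(1)]
    note i = ex_Id[OF p'(2)]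
    show ?thesis
      using ex_comp[OF p(1) i(2)] i p span_map_comp_Id(2)[OF p'(4)] ex_objD p' by (intro ex_arr_eqI) auto
  qed
  show "\<phi> \<star> Id EC A = \<phi>" if "\<phi> \<in> hom EC A B" for \<phi> A B
  proof -
    have p: "\<phi> \<in> Arr EC" "Dom EC \<phi> = A" "Cod EC \<phi> = B" using that unfolding hom_def by auto
    note p' = ex_arrD[OF p(1)]
    note i = ex_Id[OF p'(1)]
    show ?thesis
      using ex_comp[OF i(2) p(1)] i p span_map_comp_Id(1)[OF p'(4)] ex_objD p' by (intro ex_arr_eqI) auto
  qed
  show "(\<chi> \<star> \<psi>) \<star> \<phi> = \<chi> \<star> (\<psi> \<star> \<phi>)"
    if "\<phi> \<in> hom EC A B" "\<psi> \<in> hom EC B D" "\<chi> \<in> hom EC D F" for \<phi> \<psi> \<chi> A B D F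
  proof -
    have a: "\<phi> \<in> Arr EC" "\<psi> \<in> Arr EC" "\<chi> \<in> Arr EC" and d: "Dom EC \<psi> = Cod EC \<phi>" "Dom EC \<chi> = Cod EC \<psi>"
      using that unfolding hom_def by auto
    note p = ex_comp[OF a(1,2) d(1)] and q = ex_comp[OF a(2,3) d(2)]
    have l: "Dom EC (\<chi> \<star> \<psi>) = Cod EC \<phi>" "Dom EC \<chi> = Cod EC (\<psi> \<star> \<phi>)" using p q d by auto
    note r = ex_comp[OF a(1) q(2) l(1)] and s = ex_comp[OF p(2) a(3) l(2)]
    have "E ((\<chi> \<star> \<psi>) \<star> \<phi>) = E (\<chi> \<star> (\<psi> \<star> \<phi>))"
      unfolding r(1) s(1) p(1) q(1)
      using span_map_comp_assoc[OF ex_arrD(4)[OF a(1)]] ex_arrD[OF a(1)] ex_arrD[OF a(2)] ex_arrD[OF a(3)] d ex_objD by simp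
    then show ?thesis using r s p q by (intro ex_arr_eqI) auto
  qed
qed

abbreviation eqv where "eqv A \<equiv> el C (snd A)"

lemma eqvD:
  assumes "A \<in> Obj EC"
  shows "span_relation C (fst A) (fst A) (eqv A)" "\<And>x. \<lbrakk>x \<in> Arr C; Cod C x = fst A\<rbrakk> \<Longrightarrow> (x, x) \<in> eqv A"
    "\<And>x y. (x, y) \<in> eqv A \<Longrightarrow> (y, x) \<in> eqv A" "\<And>x y z. \<lbrakk>(x, y) \<in> eqv A; (y, z) \<in> eqv A\<rbrakk> \<Longrightarrow> (x, z) \<in> eqv A"
  by (rule span_equivalenceD[OF ex_objD[OF assms]]; assumption)+

lemma ex_rel: "\<phi> \<in> Arr EC \<Longrightarrow> span_relation C (fst (Dom EC \<phi>)) (fst (Cod EC \<phi>)) (E \<phi>)"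
  by (rule span_mapD(1)[OF ex_arrD(4)])

lemma ex_mem:
  assumes "\<phi> \<in> Arr EC" "(x, y) \<in> E \<phi>"
  shows "x \<in> Arr C" "y \<in> Arr C" "Dom C x = Dom C y" "Cod C x = fst (Dom EC \<phi>)" "Cod C y = fst (Cod EC \<phi>)"
  using span_relationD[OF ex_rel[OF assms(1)] assms(2)] .

lemma ex_restrict:
  "\<lbrakk>\<phi> \<in> Arr EC; (x, y) \<in> E \<phi>; e \<in> Arr C; Cod C e = Dom C y\<rbrakk> \<Longrightarrow> (x \<odot> e, y \<odot> e) \<in> E \<phi>"
  using span_relation_restrict[OF ex_rel] .

lemma ex_local:
  "\<lbrakk>\<phi> \<in> Arr EC; (x \<odot> e, y \<odot> e) \<in> E \<phi>; regular_epi C e; Cod C e = Dom C y; x \<in> Arr C; y \<in> Arr C; Dom C x = Dom C y\<rbrakk>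
     \<Longrightarrow> (x, y) \<in> E \<phi>"
  using span_relation_local[OF ex_rel] by blast

lemma ex_left: "\<lbrakk>\<phi> \<in> Arr EC; (x, x') \<in> eqv (Dom EC \<phi>); (x', y) \<in> E \<phi>\<rbrakk> \<Longrightarrow> (x, y) \<in> E \<phi>"
  using span_mapD(2)[OF ex_arrD(4)] by blast

lemma ex_right: "\<lbrakk>\<phi> \<in> Arr EC; (x, y) \<in> E \<phi>; (y, y') \<in> eqv (Cod EC \<phi>)\<rbrakk> \<Longrightarrow> (x, y') \<in> E \<phi>"
  using span_mapD(3)[OF ex_arrD(4)] by blast

lemma ex_single: "\<lbrakk>\<phi> \<in> Arr EC; (x, y) \<in> E \<phi>; (x, y') \<in> E \<phi>\<rbrakk> \<Longrightarrow> (y, y') \<in> eqv (Cod EC \<phi>)"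
  using span_mapD(4)[OF ex_arrD(4)] by blast

lemma ex_total:
  assumes "\<phi> \<in> Arr EC" "x \<in> Arr C" "Cod C x = fst (Dom EC \<phi>)"
  obtains e y where "e \<in> Arr C" "regular_epi C e" "Cod C e = Dom C x" "(x \<odot> e, y) \<in> E \<phi>"
    "y \<in> Arr C" "Dom C y = Dom C e" "Cod C y = fst (Cod EC \<phi>)"
proof -
  obtain e y where e: "e \<in> Arr C" "regular_epi C e" "Cod C e = Dom C x" "(x \<odot> e, y) \<in> E \<phi>"
    using span_map_total[OF ex_arrD(4)[OF assms(1)] assms(2,3)] .
  show ?thesis using that[OF e] ex_mem[OF assms(1) e(4)] e assms by simp
qed

lemma ex_comp_intro:
  "\<lbrakk>\<phi> \<in> Arr EC; \<psi> \<in> Arr EC; Dom EC \<psi> = Cod EC \<phi>; (x, y) \<in> E \<phi>; (y, z) \<in> E \<psi>\<rbrakk> \<Longrightarrow> (x, z) \<in> E (\<psi> \<star> \<phi>)"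
  using relcomp_local_closureI[OF _ _ ex_rel ex_rel] ex_comp(1) by metis

lemma ex_comp_elim:
  assumes "\<phi> \<in> Arr EC" "\<psi> \<in> Arr EC" "Dom EC \<psi> = Cod EC \<phi>" "(x, z) \<in> E (\<psi> \<star> \<phi>)" "(x, y) \<in> E \<phi>"
  shows "(y, z) \<in> E \<psi>"
  using span_map_comp_elim[OF ex_arrD(4)[OF assms(1)] _ _ assms(5)] ex_arrD(4)[OF assms(2)] assms(3,4)
    ex_comp(1)[OF assms(1-3)] by metis

lemma ex_comp_cases:
  assumes "\<phi> \<in> Arr EC" "\<psi> \<in> Arr EC" "Dom EC \<psi> = Cod EC \<phi>" "(x, z) \<in> E (\<psi> \<star> \<phi>)"
  obtains e y where "e \<in> Arr C" "regular_epi C e" "Cod C e = Dom C z" "(x \<odot> e, y) \<in> E \<phi>" "(y, z \<odot> e) \<in> E \<psi>"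
    "x \<in> Arr C" "z \<in> Arr C" "Dom C x = Dom C z" "y \<in> Arr C" "Dom C y = Dom C e"
proof -
  obtain e y where e: "e \<in> Arr C" "regular_epi C e" "Cod C e = Dom C z" "(x \<odot> e, y) \<in> E \<phi>" "(y, z \<odot> e) \<in> E \<psi>"
    "x \<in> Arr C" "z \<in> Arr C" "Dom C x = Dom C z"
    using assms(4) unfolding ex_comp(1)[OF assms(1-3)] by (rule relcomp_local_closureE)
  show ?thesis using that[OF e] ex_mem[OF assms(1) e(4)] e by simp
qed

text \<open>One inclusion is asked, and only for pairs with an explicit middle element: the covers
  hidden in the composite are absorbed because membership in \<open>E \<chi>\<close> is
  local.\<close>

lemma ex_comp_eqI:
  assumes "\<phi> \<in> Arr EC" "\<psi> \<in> Arr EC" "Dom EC \<psi> = Cod EC \<phi>" "\<chi> \<in> Arr EC" "Dom EC \<chi> = Dom EC \<phi>" "Cod EC \<chi> = Cod EC \<psi>"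
    "\<And>x y z. \<lbrakk>(x, y) \<in> E \<phi>; (y, z) \<in> E \<psi>\<rbrakk> \<Longrightarrow> (x, z) \<in> E \<chi>"
  shows "\<psi> \<star> \<phi> = \<chi>"
proof (rule ex_arr_eqI)
  show "E (\<psi> \<star> \<phi>) \<subseteq> E \<chi>"
    unfolding ex_comp(1)[OF assms(1-3)]
    by (rule local_closure_subset[OF ex_rel[OF assms(4)]]) (use assms(7) in blast)
qed (use ex_comp[OF assms(1-3)] assms in auto)

lemma eqv_restrict:
  "\<lbrakk>A \<in> Obj EC; (x, y) \<in> eqv A; e \<in> Arr C; Cod C e = Dom C y\<rbrakk> \<Longrightarrow> (x \<odot> e, y \<odot> e) \<in> eqv A"
  using span_relation_restrict[OF eqvD(1)] .

lemma eqv_local: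
  "\<lbrakk>A \<in> Obj EC; (x \<odot> e, y \<odot> e) \<in> eqv A; regular_epi C e; Cod C e = Dom C y; x \<in> Arr C; y \<in> Arr C; Dom C x = Dom C y\<rbrakk>
     \<Longrightarrow> (x, y) \<in> eqv A"
  using span_relation_local[OF eqvD(1)] by blast

section \<open>Discrete objects, and arrows given on representatives\<close>

abbreviation unit_obj where "unit_obj T \<equiv> fob (ex_reg_unit C) T"

lemma unit_obj:
  assumes "T \<in> Obj C"
  shows "unit_obj T \<in> Obj EC" "fst (unit_obj T) = T" "(a, b) \<in> eqv (unit_obj T) \<longleftrightarrow> a \<in> Arr C \<and> Cod C a = T \<and> b = a"
proof -
  have r: "is_relation C T T (Id C T) (Id C T)" using graph_relation[of "Id C T"] assms by simp
  have s: "(a, b) \<in> spans C (Id C T) (Id C T) \<longleftrightarrow> a \<in> Arr C \<and> Cod C a = T \<and> b = a" for a b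
    using assms unfolding spans_def by force
  have "span_equivalence C T (spans C (Id C T) (Id C T))"
    unfolding span_equivalence_def using span_relationI[OF r] s by (auto intro!: symI transI)
  then show "unit_obj T \<in> Obj EC"
    unfolding ex_reg_simps ex_objects_def ex_reg_unit_def Let_def using equivalence_relation_iff r assms by auto
  show "fst (unit_obj T) = T" unfolding ex_reg_unit_def Let_def by simp
  show "(a, b) \<in> eqv (unit_obj T) \<longleftrightarrow> a \<in> Arr C \<and> Cod C a = T \<and> b = a"
    using s el_rel_class[OF r] unfolding ex_reg_unit_def Let_def by simp
qed

text \<open>An arrow \<open>r\<close> of the base that respects the equivalence relations induces
  the map relating \<open>t\<close> to everything equivalent to \<open>r \<odot> t\<close>. This is
  an inverse image of \<open>eqv A\<close>, hence a relation.\<close>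

lemma ex_arr_along:
  assumes W: "W \<in> Obj EC" and A: "A \<in> Obj EC" and r: "r \<in> Arr C" "Dom C r = fst W" "Cod C r = fst A"
    and le: "\<And>t t'. (t, t') \<in> eqv W \<Longrightarrow> (r \<odot> t, r \<odot> t') \<in> eqv A"
  obtains f where "f \<in> Arr EC" "Dom EC f = W" "Cod EC f = A"
    "\<And>t x. (t, x) \<in> E f \<longleftrightarrow> t \<in> Arr C \<and> Cod C t = fst W \<and> (r \<odot> t, x) \<in> eqv A"
proof -
  note A' = eqvD[OF A]
  have o: "fst A \<in> Obj C" using r cod_obj[of r] by simp
  \<comment> \<open>The identity on the second component brings the set into the form treated by
    \<open>span_relation_inverse_image\<close>.\<close>
  let ?\<rho> = "{(t, x). t \<in> Arr C \<and> x \<in> Arr C \<and> Cod C t = Dom C r \<and> Cod C x = Dom C (Id C (fst A)) \<and>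
      (r \<odot> t, Id C (fst A) \<odot> x) \<in> eqv A}"
  have mem: "(t, x) \<in> ?\<rho> \<longleftrightarrow> t \<in> Arr C \<and> Cod C t = fst W \<and> (r \<odot> t, x) \<in> eqv A" for t x
    using span_relationD[OF A'(1), of "r \<odot> t" x] o r by auto
  have "span_map C (fst W) (eqv W) (fst A) (eqv A) ?\<rho>"
  proof (rule span_mapI)
    show "span_relation C (fst W) (fst A) ?\<rho>"
      using span_relation_inverse_image[OF A'(1) r(1,3), of "Id C (fst A)"] o r by simp
    show "(t, y) \<in> ?\<rho>" if "(t, t') \<in> eqv W" "(t', y) \<in> ?\<rho>" for t t' y
      using that le[OF that(1)] A'(4) span_relationD[OF eqvD(1)[OF W] that(1)] unfolding mem by blast
    show "(t, y') \<in> ?\<rho>" if "(t, y) \<in> ?\<rho>" "(y, y') \<in> eqv A" for t y y'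
      using that A'(4) unfolding mem by blast
    show "(y, y') \<in> eqv A" if "(t, y) \<in> ?\<rho>" "(t, y') \<in> ?\<rho>" for t y y'
      using that A'(3,4) unfolding mem by blast
    show "\<exists>e y. regular_epi C e \<and> Cod C e = Dom C t \<and> (t \<odot> e, y) \<in> ?\<rho>" if t: "t \<in> Arr C" "Cod C t = fst W" for t
    proof -
      have "(r \<odot> t, r \<odot> t) \<in> eqv A" using A'(2)[of "r \<odot> t"] r t by simp
      moreover have "t \<odot> Id C (Dom C t) = t" using t dom_obj by simp
      ultimately have "(t \<odot> Id C (Dom C t), r \<odot> t) \<in> ?\<rho>" unfolding mem using t by simp
      then show ?thesis using regular_epi_Id[OF dom_obj[OF t(1)]] dom_obj[OF t(1)]
        by (intro exI[of _ "Id C (Dom C t)"] exI[of _ "r \<odot> t"]) simp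
    qed
  qed
  then obtain f where f: "f \<in> Arr EC" "Dom EC f = W" "Cod EC f = A" "E f = ?\<rho>"
    by (rule ex_arr_exists[OF W A])
  show ?thesis by (rule that[OF f(1-3)]) (unfold f(4), rule mem)
qed

text \<open>Turns a generalized element into an arrow from the discrete object on its stage, so that
  universal properties of the completion can be applied to elements.\<close>

lemma point_exists:
  assumes A: "A \<in> Obj EC" and x: "x \<in> Arr C" "Cod C x = fst A"
  obtains \<phi> where "\<phi> \<in> Arr EC" "Dom EC \<phi> = unit_obj (Dom C x)" "Cod EC \<phi> = A"
    "\<And>t x'. (t, x') \<in> E \<phi> \<longleftrightarrow> t \<in> Arr C \<and> Cod C t = Dom C x \<and> (x \<odot> t, x') \<in> eqv A"
proof -
  note T = unit_obj[OF dom_obj[OF x(1)]]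
  have le: "(x \<odot> t, x \<odot> t') \<in> eqv A" if "(t, t') \<in> eqv (unit_obj (Dom C x))" for t t'
    using that eqvD(2)[OF A, of "x \<odot> t"] x unfolding T(3) by simp
  show ?thesis using ex_arr_along[OF T(1) A x(1) T(2)[symmetric] x(2) le] that unfolding T(2) by blast
qed

text \<open>When \<open>k\<close> is constant on equivalence classes and the target is discrete,
  closing the graph under equivalence adds nothing.\<close>

lemma graph_arrow:
  assumes A: "A \<in> Obj EC" and k: "k \<in> Arr C" "Dom C k = fst A"
    and inv: "\<And>x x'. (x, x') \<in> eqv A \<Longrightarrow> k \<odot> x = k \<odot> x'"
  obtains f where "f \<in> Arr EC" "Dom EC f = A" "Cod EC f = unit_obj (Cod C k)" "E f = graph C k"
proof -
  note T = unit_obj[OF cod_obj[OF k(1)]]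
  have le: "(k \<odot> x, k \<odot> x') \<in> eqv (unit_obj (Cod C k))" if "(x, x') \<in> eqv A" for x x'
    unfolding T(3) using span_relationD[OF eqvD(1)[OF A] that] inv[OF that] k by simp
  obtain f where f: "f \<in> Arr EC" "Dom EC f = A" "Cod EC f = unit_obj (Cod C k)"
    "\<And>t x. (t, x) \<in> E f \<longleftrightarrow> t \<in> Arr C \<and> Cod C t = fst A \<and> (k \<odot> t, x) \<in> eqv (unit_obj (Cod C k))"
    using ex_arr_along[OF A T(1) k T(2)[symmetric] le] by blast
  have "E f = graph C k"
    by (intro set_eqI; clarify) (unfold f(4) T(3) graph_iff, use k in auto)
  then show ?thesis using that f(1-3) by blast
qed

section \<open>Equality of maps, pullbacks and the terminal object of the completion\<close>

lemma ex_equalI: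
  assumes a: "f \<in> Arr EC" "g \<in> Arr EC" "Dom EC f = Dom EC g" "Cod EC f = Cod EC g"
    and l: "\<And>x y y'. \<lbrakk>(x, y) \<in> E f; (x, y') \<in> E g\<rbrakk> \<Longrightarrow> (y, y') \<in> eqv (Cod EC f)"
  shows "f = g"
proof (rule ex_arr_eqI[OF a]; clarify)
  fix x y assume xy: "(x, y) \<in> E f"
  note ty = ex_mem[OF a(1) xy]
  obtain e y' where e: "e \<in> Arr C" "regular_epi C e" "Cod C e = Dom C x" "(x \<odot> e, y') \<in> E g"
    by (rule ex_total[OF a(2), of x]) (use ty a in auto)
  have "(x \<odot> e, y \<odot> e) \<in> E f" by (rule ex_restrict[OF a(1) xy e(1)]) (use e ty in simp)
  then have "(y \<odot> e, y') \<in> eqv (Cod EC g)" using l e(4) a by simp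
  then have "(x \<odot> e, y \<odot> e) \<in> E g"
    using ex_right[OF a(2) e(4)] eqvD(3)[OF ex_arrD(2)[OF a(2)]] by blast
  then show "(x, y) \<in> E g" by (rule ex_local[OF a(2) _ e(2)]) (use e ty in auto)
qed

text \<open>The pullback of \<open>\<phi>\<close> and \<open>\<psi>\<close> is supported by a tabulation of the relation \<open>\<psi>\<^sup>o \<phi>\<close>, with the
  equivalence relation pulled back from both factors.\<close>

lemma ex_pullback:
  assumes \<phi>: "\<phi> \<in> Arr EC" and \<psi>: "\<psi> \<in> Arr EC" and cod: "Cod EC \<phi> = Cod EC \<psi>"
    and pq: "is_relation C (fst (Dom EC \<phi>)) (fst (Dom EC \<psi>)) p q"
    and sp: "spans C p q = local_closure C (E \<phi> O (E \<psi>)\<inverse>)"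
  obtains f g where "is_pullback EC \<phi> \<psi> f g" "fst (Dom EC f) = Dom C p"
    "\<And>t t'. (t, t') \<in> eqv (Dom EC f) \<longleftrightarrow> t \<in> Arr C \<and> t' \<in> Arr C \<and> Cod C t = Dom C p \<and> Cod C t' = Dom C p \<and>
       (p \<odot> t, p \<odot> t') \<in> eqv (Dom EC \<phi>) \<and> (q \<odot> t, q \<odot> t') \<in> eqv (Dom EC \<psi>)"
    "\<And>t x. (t, x) \<in> E f \<longleftrightarrow> t \<in> Arr C \<and> Cod C t = Dom C p \<and> (p \<odot> t, x) \<in> eqv (Dom EC \<phi>)"
    "\<And>t x. (t, x) \<in> E g \<longleftrightarrow> t \<in> Arr C \<and> Cod C t = Dom C p \<and> (q \<odot> t, x) \<in> eqv (Dom EC \<psi>)"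
proof -
  let ?A = "Dom EC \<phi>" and ?B = "Dom EC \<psi>"
  note P = relationD[OF pq] and A = eqvD[OF ex_arrD(1)[OF \<phi>]] and B = eqvD[OF ex_arrD(1)[OF \<psi>]]
  note Ao = ex_arrD(1)[OF \<phi>] and Bo = ex_arrD(1)[OF \<psi>]
  define K where "K = {(a, b). a \<in> Arr C \<and> b \<in> Arr C \<and> Cod C a = Dom C p \<and> Cod C b = Dom C p \<and> (p \<odot> a, p \<odot> b) \<in> eqv ?A}
     \<inter> {(a, b). a \<in> Arr C \<and> b \<in> Arr C \<and> Cod C a = Dom C p \<and> Cod C b = Dom C p \<and> (q \<odot> a, q \<odot> b) \<in> eqv ?B}"
  have K: "(t, t') \<in> K \<longleftrightarrow> t \<in> Arr C \<and> t' \<in> Arr C \<and> Cod C t = Dom C p \<and> Cod C t' = Dom C p \<and>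
       (p \<odot> t, p \<odot> t') \<in> eqv ?A \<and> (q \<odot> t, q \<odot> t') \<in> eqv ?B" for t t'
    unfolding K_def using P(3) by auto
  have Krel: "span_relation C (Dom C p) (Dom C p) K"
    unfolding K_def
    using span_relation_Int[OF span_relation_inverse_image[OF A(1) P(1,4) P(1,4)] span_relation_inverse_image[OF B(1) P(2,5) P(2,5), folded P(3)]]
      by simp
  have "span_equivalence C (Dom C p) K"
    unfolding span_equivalence_def
  proof (intro conjI ballI impI Krel)
    show "(x, x) \<in> K" if "x \<in> Arr C" "Cod C x = Dom C p" for x
      unfolding K using that A(2)[of "p \<odot> x"] B(2)[of "q \<odot> x"] P by simp
    show "sym K" by (rule symI) (use K A(3) B(3) in blast)
    show "trans K" by (rule transI) (use K A(4) B(4) in blast)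
  qed
  then obtain W where W: "W \<in> Obj EC" "fst W = Dom C p" "eqv W = K" by (rule ex_obj_exists)
  have r: "Dom C p = fst W" "Dom C q = fst W" using W P by simp_all
  obtain f where f: "f \<in> Arr EC" "Dom EC f = W" "Cod EC f = ?A"
    "\<And>t x. (t, x) \<in> E f \<longleftrightarrow> t \<in> Arr C \<and> Cod C t = Dom C p \<and> (p \<odot> t, x) \<in> eqv ?A"
    using ex_arr_along[OF W(1) Ao P(1) r(1) P(4)] unfolding W(2,3) K by blast
  obtain g where g: "g \<in> Arr EC" "Dom EC g = W" "Cod EC g = ?B"
    "\<And>t x. (t, x) \<in> E g \<longleftrightarrow> t \<in> Arr C \<and> Cod C t = Dom C p \<and> (q \<odot> t, x) \<in> eqv ?B"
    using ex_arr_along[OF W(1) Bo P(2) r(2) P(5)] unfolding W(2,3) K by blast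
  have pt: "(t, p \<odot> t) \<in> E f" "(t, q \<odot> t) \<in> E g" if "t \<in> Arr C" "Cod C t = Dom C p" for t
    unfolding f(4) g(4) using that A(2)[of "p \<odot> t"] B(2)[of "q \<odot> t"] P by simp_all
  note cf = ex_comp[OF f(1) \<phi> f(3)[symmetric]] and cg = ex_comp[OF g(1) \<psi> g(3)[symmetric]]
  have "is_pullback EC \<phi> \<psi> f g"
  proof (rule category.pullbackI[OF ex_category])
    show "\<phi> \<star> f = \<psi> \<star> g"
    proof (rule ex_comp_eqI[OF f(1) \<phi>])
      fix t x z assume tx: "(t, x) \<in> E f" and xz: "(x, z) \<in> E \<phi>"
      then have t: "t \<in> Arr C" "Cod C t = Dom C p" "(p \<odot> t, x) \<in> eqv ?A" using f(4) by auto
      then have pz: "(p \<odot> t, z) \<in> E \<phi>" using ex_left[OF \<phi> _ xz] by blast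
      note ty = ex_mem[OF \<phi> pz]
      \<comment> \<open>At the stage of \<open>t\<close> the tabulation provides a common value
        \<open>z'\<close> on a cover. It is equivalent to the given value \<open>z\<close> of
        \<open>\<phi>\<close>, so \<open>z\<close> is a value of \<open>\<psi>\<close> as
        well.\<close>
      have "(p \<odot> t, q \<odot> t) \<in> local_closure C (E \<phi> O (E \<psi>)\<inverse>)"
        unfolding sp[symmetric] using t by (intro spansI) auto
      then obtain e z' where e: "e \<in> Arr C" "regular_epi C e" "Cod C e = Dom C (q \<odot> t)"
        "((p \<odot> t) \<odot> e, z') \<in> E \<phi>" "((q \<odot> t) \<odot> e, z') \<in> E \<psi>"
        by (rule relcomp_local_closureE) auto
      have d: "Dom C (q \<odot> t) = Dom C t" "Dom C z = Dom C t" using ty t P by simp_all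
      have "((p \<odot> t) \<odot> e, z \<odot> e) \<in> E \<phi>" by (rule ex_restrict[OF \<phi> pz e(1)]) (use d e in simp)
      then have "(z', z \<odot> e) \<in> eqv (Cod EC \<psi>)" using ex_single[OF \<phi> e(4)] cod by simp
      then have "((q \<odot> t) \<odot> e, z \<odot> e) \<in> E \<psi>" using ex_right[OF \<psi> e(5)] by blast
      then have "(q \<odot> t, z) \<in> E \<psi>" by (rule ex_local[OF \<psi> _ e(2)]) (use d e ty t P in auto)
      then show "(t, z) \<in> E (\<psi> \<star> g)" using ex_comp_intro[OF g(1) \<psi> g(3)[symmetric] pt(2)[OF t(1,2)]] by blast
    qed (use f g cf cg cod in auto)
  next
    fix a b assume ab: "a \<in> Arr EC" "b \<in> Arr EC" "Dom EC a = Dom EC b" "Cod EC a = ?A" "Cod EC b = ?B"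
      and eq: "\<phi> \<star> a = \<psi> \<star> b"
    let ?T = "Dom EC b"
    have To: "?T \<in> Obj EC" by (rule ex_arrD(1)[OF ab(2)])
    note T = eqvD[OF To]
    have o: "fst ?T \<in> Obj C" using T span_relation_objs by blast
    let ?i = "Id C (fst ?T)"
    \<comment> \<open>The mediating map relates \<open>w\<close> to those \<open>t\<close> whose
      projections are values of \<open>a\<close> and \<open>b\<close> at \<open>w\<close>. It is an
      intersection of two inverse images, hence a relation.\<close>
    define H where "H = {(w, t). w \<in> Arr C \<and> t \<in> Arr C \<and> Cod C w = Dom C ?i \<and> Cod C t = Dom C p \<and> (?i \<odot> w, p \<odot> t) \<in> E a}
      \<inter> {(w, t). w \<in> Arr C \<and> t \<in> Arr C \<and> Cod C w = Dom C ?i \<and> Cod C t = Dom C p \<and> (?i \<odot> w, q \<odot> t) \<in> E b}"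
    have H: "(w, t) \<in> H \<longleftrightarrow> t \<in> Arr C \<and> Cod C t = Dom C p \<and> (w, p \<odot> t) \<in> E a \<and> (w, q \<odot> t) \<in> E b" for w t
      unfolding H_def using P(3) o ex_mem[OF ab(1), of w "p \<odot> t"] ex_mem[OF ab(2), of w "q \<odot> t"] ab by auto
    have arel: "span_relation C (fst ?T) (fst ?A) (E a)" using ex_rel[OF ab(1)] ab by simp
    have brel: "span_relation C (fst ?T) (fst ?B) (E b)" using ex_rel[OF ab(2)] ab by simp
    have "span_map C (fst ?T) (eqv ?T) (fst W) (eqv W) H"
      unfolding W(2,3)
    proof (rule span_mapI)
      have i: "?i \<in> Arr C" "Cod C ?i = fst ?T" "Dom C ?i = fst ?T" using o by simp_all
      show "span_relation C (fst ?T) (Dom C p) H"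
        unfolding H_def
        using span_relation_Int[OF span_relation_inverse_image[OF arel i(1,2) P(1,4)] span_relation_inverse_image[OF brel i(1,2) P(2,5), folded P(3)]]
          i(3) by simp
      show "(w, t) \<in> H" if "(w, w') \<in> eqv ?T" "(w', t) \<in> H" for w w' t
        using that ex_left[OF ab(1)] ex_left[OF ab(2)] ab(3) unfolding H by metis
      show "(w, t') \<in> H" if "(w, t) \<in> H" "(t, t') \<in> K" for w t t'
        using that ex_right[OF ab(1)] ex_right[OF ab(2)] ab(4,5) unfolding H K by metis
      show "(t, t') \<in> K" if "(w, t) \<in> H" "(w, t') \<in> H" for w t t'
        using that ex_single[OF ab(1)] ex_single[OF ab(2)] ab(4,5) unfolding H K by metis
      show "\<exists>e t. regular_epi C e \<and> Cod C e = Dom C w \<and> (w \<odot> e, t) \<in> H" if w: "w \<in> Arr C" "Cod C w = fst ?T" for w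
      proof -
        \<comment> \<open>Successive covers supply a value \<open>x\<close> of \<open>a\<close>, a
          value \<open>y\<close> of \<open>b\<close> and a value \<open>z\<close> of
          \<open>\<phi>\<close> at \<open>x\<close>. The equality of the composites makes
          \<open>z\<close> a value of \<open>\<psi>\<close> at \<open>y\<close> too, so
          \<open>x\<close> and \<open>y\<close> are related by the tabulated relation and determine
          \<open>t\<close>.\<close>
        obtain e x where e: "e \<in> Arr C" "regular_epi C e" "Cod C e = Dom C w" "(w \<odot> e, x) \<in> E a"
          "x \<in> Arr C" "Dom C x = Dom C e" "Cod C x = fst ?A"
          using ex_total[OF ab(1) w(1)] w ab by metis
        obtain d y where d: "d \<in> Arr C" "regular_epi C d" "Cod C d = Dom C (w \<odot> e)" "((w \<odot> e) \<odot> d, y) \<in> E b"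
          "y \<in> Arr C" "Dom C y = Dom C d" "Cod C y = fst ?B"
          by (rule ex_total[OF ab(2), of "w \<odot> e"]) (use w e ab in auto)
        have de: "Cod C d = Dom C e" using d(3) w e by simp
        have ax: "((w \<odot> e) \<odot> d, x \<odot> d) \<in> E a" by (rule ex_restrict[OF ab(1) e(4) d(1)]) (use de e in simp)
        obtain c z where c: "c \<in> Arr C" "regular_epi C c" "Cod C c = Dom C (x \<odot> d)" "((x \<odot> d) \<odot> c, z) \<in> E \<phi>"
          "z \<in> Arr C" "Dom C z = Dom C c"
          by (rule ex_total[OF \<phi>, of "x \<odot> d"]) (use e d de in auto)
        have cd: "Cod C c = Dom C d" using c(3) d e de by simp
        have "(((w \<odot> e) \<odot> d) \<odot> c, (x \<odot> d) \<odot> c) \<in> E a" by (rule ex_restrict[OF ab(1) ax c(1,3)])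
        then have "(((w \<odot> e) \<odot> d) \<odot> c, z) \<in> E (\<psi> \<star> b)"
          unfolding eq[symmetric] by (rule ex_comp_intro[OF ab(1) \<phi> ab(4)[symmetric] _ c(4)])
        moreover have "(((w \<odot> e) \<odot> d) \<odot> c, y \<odot> c) \<in> E b" by (rule ex_restrict[OF ab(2) d(4) c(1)]) (use cd d in simp)
        ultimately have "(y \<odot> c, z) \<in> E \<psi>" by (rule ex_comp_elim[OF ab(2) \<psi> ab(5)[symmetric]])
        then have "((x \<odot> d) \<odot> c, y \<odot> c) \<in> E \<phi> O (E \<psi>)\<inverse>" using c(4) by blast
        then have "(x \<odot> d, y) \<in> spans C p q"
          unfolding sp by - (rule local_closureI[OF _ d(5) _ c(2)], use c(3) cd e(5,6) d(1,6) de in simp_all)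
        then obtain t where t: "t \<in> Arr C" "Cod C t = Dom C p" "p \<odot> t = x \<odot> d" "q \<odot> t = y" by (rule spansE)
        have "((w \<odot> e) \<odot> d, t) \<in> H" unfolding H using t ax d(4) by simp
        then show ?thesis using regular_epi_comp[OF e(2) d(2)] de e d w by (intro exI[of _ "e \<odot> d"] exI[of _ t]) simp
      qed
    qed
    then obtain h where h: "h \<in> Arr EC" "Dom EC h = ?T" "Cod EC h = W" "E h = H" by (rule ex_arr_exists[OF To W(1)])
    have "f \<star> h = a"
    proof (rule ex_comp_eqI[OF h(1) f(1)])
      show "(w, x) \<in> E a" if "(w, t) \<in> E h" "(t, x) \<in> E f" for w t x
        using that ex_right[OF ab(1)] ab(4) unfolding h(4) H f(4) by metis
    qed (use h f ab in auto)
    moreover have "g \<star> h = b"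
    proof (rule ex_comp_eqI[OF h(1) g(1)])
      show "(w, x) \<in> E b" if "(w, t) \<in> E h" "(t, x) \<in> E g" for w t x
        using that ex_right[OF ab(2)] ab(5) unfolding h(4) H g(4) by metis
    qed (use h g ab in auto)
    ultimately show "\<exists>h. h \<in> Arr EC \<and> Dom EC h = Dom EC b \<and> Cod EC h = Dom EC g \<and> f \<star> h = a \<and> g \<star> h = b"
      using h(1-3) g(2) by (intro exI[of _ h]) simp
  next
    fix h h' assume h: "h \<in> Arr EC" "h' \<in> Arr EC" "Dom EC h = Dom EC h'" "Cod EC h = Dom EC g" "Cod EC h' = Dom EC g"
      "f \<star> h = f \<star> h'" "g \<star> h = g \<star> h'"
    show "h = h'"
    proof (rule ex_equalI[OF h(1-3)])
      show "Cod EC h = Cod EC h'" using h by simp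
      fix w t t' assume wt: "(w, t) \<in> E h" and wt': "(w, t') \<in> E h'"
      have hf: "Dom EC f = Cod EC h" "Dom EC f = Cod EC h'" "Dom EC g = Cod EC h" "Dom EC g = Cod EC h'" using h f g by simp_all
      have tt: "t \<in> Arr C" "Cod C t = Dom C p" "t' \<in> Arr C" "Cod C t' = Dom C p"
        using ex_mem[OF h(1) wt] ex_mem[OF h(2) wt'] h g W by simp_all
      have "(w, p \<odot> t) \<in> E (f \<star> h')"
        unfolding h(6)[symmetric] by (rule ex_comp_intro[OF h(1) f(1) hf(1) wt pt(1)[OF tt(1,2)]])
      then have "(t', p \<odot> t) \<in> E f" by (rule ex_comp_elim[OF h(2) f(1) hf(2) _ wt'])
      moreover have "(w, q \<odot> t) \<in> E (g \<star> h')"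
        unfolding h(7)[symmetric] by (rule ex_comp_intro[OF h(1) g(1) hf(3) wt pt(2)[OF tt(1,2)]])
      then have "(t', q \<odot> t) \<in> E g" by (rule ex_comp_elim[OF h(2) g(1) hf(4) _ wt'])
      ultimately have "(t, t') \<in> K" unfolding K f(4) g(4) using tt A(3) B(3) by blast
      then show "(t, t') \<in> eqv (Cod EC h)" using h(4) g(2) W(3) by simp
    qed
  qed (use \<phi> \<psi> cod f g in auto)
  moreover have "fst (Dom EC f) = Dom C p" "eqv (Dom EC f) = K" using f W by simp_all
  ultimately show ?thesis using that[of f g] K f(4) g(4) by simp
qed

lemma ex_pullbacks:
  assumes "\<phi> \<in> Arr EC" "\<psi> \<in> Arr EC" "Cod EC \<phi> = Cod EC \<psi>"
  shows "\<exists>f g. is_pullback EC \<phi> \<psi> f g"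
proof -
  have "span_relation C (fst (Dom EC \<phi>)) (fst (Dom EC \<psi>)) (local_closure C (E \<phi> O (E \<psi>)\<inverse>))"
    using span_relation_comp[OF ex_rel[OF assms(1)]] span_relation_converse[OF ex_rel[OF assms(2)]] assms(3) by simp
  then obtain p q where "is_relation C (fst (Dom EC \<phi>)) (fst (Dom EC \<psi>)) p q"
    "local_closure C (E \<phi> O (E \<psi>)\<inverse>) = spans C p q" by (rule span_relationE)
  then show ?thesis using ex_pullback[OF assms, of p q] by metis
qed

lemma ex_terminal: "\<exists>t \<in> Obj EC. \<forall>A \<in> Obj EC. \<exists>!h. h \<in> hom EC A t"
proof -
  obtain t where t: "t \<in> Obj C" "\<And>A. A \<in> Obj C \<Longrightarrow> \<exists>!h. h \<in> hom C A t" using terminal by auto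
  have uniq: "y = y'" if "y \<in> Arr C" "y' \<in> Arr C" "Cod C y = t" "Cod C y' = t" "Dom C y = Dom C y'" for y y'
    using t(2)[OF dom_obj[OF that(1)]] that in_homI by metis
  note T = unit_obj[OF t(1)]
  have "\<exists>!h. h \<in> hom EC A (unit_obj t)" if A: "A \<in> Obj EC" for A
  proof -
    note R = eqvD[OF A]
    have "fst A \<in> Obj C" using R span_relation_objs by blast
    then obtain u where u: "u \<in> Arr C" "Dom C u = fst A" "Cod C u = t" using t(2) unfolding hom_def by blast
    have inv: "u \<odot> x = u \<odot> x'" if "(x, x') \<in> eqv A" for x x'
      using span_relationD[OF R(1) that] u by (auto intro!: uniq)
    obtain h where h: "h \<in> Arr EC" "Dom EC h = A" "Cod EC h = unit_obj t"
      using graph_arrow[OF A u(1,2) inv] u(3) by metis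
    show ?thesis
    proof (rule ex1I[of _ h])
      show "h \<in> hom EC A (unit_obj t)" using h unfolding hom_def by simp
      fix g assume g: "g \<in> hom EC A (unit_obj t)"
      then have g': "g \<in> Arr EC" "Dom EC g = A" "Cod EC g = unit_obj t" unfolding hom_def by auto
      show "g = h"
      proof (rule ex_equalI)
        fix x y y' assume xy: "(x, y) \<in> E g" "(x, y') \<in> E h"
        have "y = y'" using ex_mem[OF g'(1) xy(1)] ex_mem[OF h(1) xy(2)] g' h T by (intro uniq) auto
        then show "(y, y') \<in> eqv (Cod EC g)" unfolding g'(3) T(3) using ex_mem[OF g'(1) xy(1)] g' T by simp
      qed (use g' h in auto)
    qed
  qed
  then show ?thesis using T(1) by blast
qed

lemma ex_finitely_complete: "finitely_complete_category EC"
proof -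
  interpret EC: category EC by (rule ex_category)
  have "pullback_category EC"
    by unfold_locales (use ex_terminal ex_pullbacks in blast)+
  then show ?thesis by (rule pullback_category.finitely_complete)
qed

section \<open>Regular epimorphisms, images and regularity of the completion\<close>

definition ex_surjective :: "('a, 'b) ex_arr \<Rightarrow> bool" where
  "ex_surjective \<phi> \<longleftrightarrow> (\<forall>y \<in> Arr C. Cod C y = fst (Cod EC \<phi>) \<longrightarrow>
     (\<exists>e x. regular_epi C e \<and> Cod C e = Dom C y \<and> (x, y \<odot> e) \<in> E \<phi>))"

lemma ex_surjectiveE:
  assumes "ex_surjective \<phi>" "\<phi> \<in> Arr EC" "y \<in> Arr C" "Cod C y = fst (Cod EC \<phi>)"
  obtains e x where "e \<in> Arr C" "regular_epi C e" "Cod C e = Dom C y" "(x, y \<odot> e) \<in> E \<phi>"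
    "x \<in> Arr C" "Dom C x = Dom C e" "Cod C x = fst (Dom EC \<phi>)"
proof -
  obtain e x where e: "regular_epi C e" "Cod C e = Dom C y" "(x, y \<odot> e) \<in> E \<phi>"
    using assms unfolding ex_surjective_def by blast
  show ?thesis using that[OF regular_epi_arr[OF e(1)] e] ex_mem[OF assms(2) e(3)] e regular_epi_arr[OF e(1)] assms(3) by simp
qed

text \<open>The universal property concerns arrows only, so \<open>x\<close> and \<open>y\<close>
  are first made into arrows from the discrete object on their common stage. A local value of the
  mediating arrow is the element sought.\<close>

lemma ex_pullback_points:
  assumes pb: "is_pullback EC \<phi> \<psi> f g" and xz: "(x, z) \<in> E \<phi>" and yz: "(y, z) \<in> E \<psi>"
  obtains e w where "e \<in> Arr C" "regular_epi C e" "Cod C e = Dom C z" "(w, x \<odot> e) \<in> E f" "(w, y \<odot> e) \<in> E g"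
    "w \<in> Arr C" "Dom C w = Dom C e"
proof -
  note P = category.pullbackD[OF ex_category pb]
  note tx = ex_mem[OF P(1) xz] and ty = ex_mem[OF P(2) yz]
  let ?A = "Dom EC \<phi>" and ?B = "Dom EC \<psi>"
  have To: "Dom C z \<in> Obj C" using tx dom_obj by simp
  note T = unit_obj[OF To]
  obtain a where a: "a \<in> Arr EC" "Dom EC a = unit_obj (Dom C z)" "Cod EC a = ?A"
    "\<And>t x'. (t, x') \<in> E a \<longleftrightarrow> t \<in> Arr C \<and> Cod C t = Dom C z \<and> (x \<odot> t, x') \<in> eqv ?A"
    using point_exists[OF ex_arrD(1)[OF P(1)] tx(1,4)] tx(3) by metis
  obtain b where b: "b \<in> Arr EC" "Dom EC b = unit_obj (Dom C z)" "Cod EC b = ?B"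
    "\<And>t x'. (t, x') \<in> E b \<longleftrightarrow> t \<in> Arr C \<and> Cod C t = Dom C z \<and> (y \<odot> t, x') \<in> eqv ?B"
    using point_exists[OF ex_arrD(1)[OF P(2)] ty(1,4)] ty(3) by metis
  note A = eqvD[OF ex_arrD(1)[OF P(1)]] and B = eqvD[OF ex_arrD(1)[OF P(2)]]
  have bt: "(t, y \<odot> t) \<in> E b" if "t \<in> Arr C" "Cod C t = Dom C z" for t
    unfolding b(4) using that ty B(2)[of "y \<odot> t"] by simp
  have "\<phi> \<star> a = \<psi> \<star> b"
  proof (rule ex_comp_eqI[OF a(1) P(1)])
    fix t x' v assume tx': "(t, x') \<in> E a" and xv: "(x', v) \<in> E \<phi>"
    then have t: "t \<in> Arr C" "Cod C t = Dom C z" "(x \<odot> t, x') \<in> eqv ?A" using a(4) by auto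
    have "(x \<odot> t, v) \<in> E \<phi>" using ex_left[OF P(1) t(3) xv] .
    moreover have "(x \<odot> t, z \<odot> t) \<in> E \<phi>" using ex_restrict[OF P(1) xz t(1,2)] .
    ultimately have "(z \<odot> t, v) \<in> eqv (Cod EC \<psi>)" using ex_single[OF P(1)] P(5) by simp
    moreover have "(y \<odot> t, z \<odot> t) \<in> E \<psi>" using ex_restrict[OF P(2) yz t(1,2)] .
    ultimately have "(y \<odot> t, v) \<in> E \<psi>" using ex_right[OF P(2)] by blast
    then show "(t, v) \<in> E (\<psi> \<star> b)"
      using ex_comp_intro[OF b(1) P(2) b(3)[symmetric] bt[OF t(1,2)]] by blast
  qed (use a b P ex_comp[OF b(1) P(2)] in auto)
  then obtain h where h: "h \<in> Arr EC" "Dom EC h = Dom EC b" "Cod EC h = Dom EC g" "f \<star> h = a" "g \<star> h = b"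
    using category.pullback_ex[OF ex_category pb a(1) b(1)] a(2,3) b(2,3) by metis
  \<comment> \<open>The mediating arrow is evaluated at the generic element of the stage.\<close>
  let ?i = "Id C (Dom C z)"
  have i: "?i \<in> Arr C" "Cod C ?i = fst (Dom EC h)" "Dom C ?i = Dom C z" "Cod C ?i = Dom C z" using To h(2) b(2) T(2) by simp_all
  obtain e w where e: "e \<in> Arr C" "regular_epi C e" "Cod C e = Dom C ?i" "(?i \<odot> e, w) \<in> E h" "w \<in> Arr C" "Dom C w = Dom C e"
    using ex_total[OF h(1) i(1,2)] by metis
  have ie: "?i \<odot> e = e" "Cod C e = Dom C z" using e i by simp_all
  have "(e, x \<odot> e) \<in> E (f \<star> h)" unfolding h(4) a(4) using e(1) ie A(2)[of "x \<odot> e"] tx by simp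
  then have fw: "(w, x \<odot> e) \<in> E f"
    by (rule ex_comp_elim[OF h(1) P(3), rotated]) (use e(4) ie h P in simp_all)
  have "(e, y \<odot> e) \<in> E (g \<star> h)" unfolding h(5) b(4) using e(1) ie B(2)[of "y \<odot> e"] ty by simp
  then have gw: "(w, y \<odot> e) \<in> E g"
    by (rule ex_comp_elim[OF h(1) P(4), rotated]) (use e(4) ie h P in simp_all)
  show ?thesis using that[OF e(1,2) ie(2) fw gw e(5,6)] .
qed

text \<open>The factorization of \<open>h\<close> sends \<open>y\<close> to the value of
  \<open>h\<close> at any local preimage of \<open>y\<close>. The hypothesis on points makes this
  independent of the preimage, since two preimages come locally from one element of the common
  domain of \<open>p\<close> and \<open>q\<close>.\<close>

lemma ex_surjective_coequalizer:
  assumes \<phi>: "\<phi> \<in> Arr EC" and surj: "ex_surjective \<phi>"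
    and pq: "p \<in> Arr EC" "q \<in> Arr EC" "Dom EC p = Dom EC q" "Cod EC p = Dom EC \<phi>" "Cod EC q = Dom EC \<phi>"
    and eq: "\<phi> \<star> p = \<phi> \<star> q"
    and points: "\<And>x x' y. \<lbrakk>(x, y) \<in> E \<phi>; (x', y) \<in> E \<phi>\<rbrakk>
      \<Longrightarrow> \<exists>e w. regular_epi C e \<and> Cod C e = Dom C y \<and> (w, x \<odot> e) \<in> E p \<and> (w, x' \<odot> e) \<in> E q"
  shows "is_coequalizer EC p q \<phi>"
proof (rule category.coequalizerI[OF ex_category pq(1,2) \<phi> pq(3-5) eq])
  let ?A = "Dom EC \<phi>" and ?B = "Cod EC \<phi>"
  note A = ex_arrD(1)[OF \<phi>] and B = ex_arrD(2)[OF \<phi>]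
  fix h assume h: "h \<in> Arr EC" "Dom EC h = ?A" "h \<star> p = h \<star> q"
  let ?Z = "Cod EC h"
  note Z = ex_arrD(2)[OF h(1)]
  \<comment> \<open>Both preimages of \<open>y\<close> are values at a common \<open>w\<close>, of
    \<open>p\<close> and of \<open>q\<close> respectively, and the composites of \<open>h\<close>
    with \<open>p\<close> and \<open>q\<close> agree there.\<close>
  have key: "(z, z') \<in> eqv ?Z"
    if m: "(x, y) \<in> E \<phi>" "(x', y) \<in> E \<phi>" "(x, z) \<in> E h" "(x', z') \<in> E h" for x x' y z z'
  proof -
    obtain e w where e: "regular_epi C e" "Cod C e = Dom C y" "(w, x \<odot> e) \<in> E p" "(w, x' \<odot> e) \<in> E q"
      using points[OF m(1,2)] by blast
    note ea = regular_epi_arr[OF e(1)]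
    note ty = ex_mem[OF \<phi> m(1)] ex_mem[OF \<phi> m(2)] ex_mem[OF h(1) m(3)] ex_mem[OF h(1) m(4)]
    have d: "Cod C e = Dom C z" "Cod C e = Dom C z'" using e(2) ty by simp_all
    have xz: "(x \<odot> e, z \<odot> e) \<in> E h" "(x' \<odot> e, z' \<odot> e) \<in> E h"
      using ex_restrict[OF h(1) m(3) ea d(1)] ex_restrict[OF h(1) m(4) ea d(2)] by auto
    have hp: "Dom EC h = Cod EC p" "Dom EC h = Cod EC q" using h pq by simp_all
    have "(w, z \<odot> e) \<in> E (h \<star> q)"
      unfolding h(3)[symmetric] by (rule ex_comp_intro[OF pq(1) h(1) hp(1) e(3) xz(1)])
    then have "(x' \<odot> e, z \<odot> e) \<in> E h" by (rule ex_comp_elim[OF pq(2) h(1) hp(2) _ e(4)])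
    then have "(z \<odot> e, z' \<odot> e) \<in> eqv ?Z" by (rule ex_single[OF h(1) _ xz(2)])
    then show ?thesis by (rule eqv_local[OF Z _ e(1) d(2)]) (use ty d in auto)
  qed
  let ?k = "local_closure C ((E \<phi>)\<inverse> O E h)"
  have krel: "span_relation C (fst ?B) (fst ?Z) ?k"
    using span_relation_comp[OF span_relation_converse[OF ex_rel[OF \<phi>]]] ex_rel[OF h(1)] h(2) by simp
  have kI: "(y, z) \<in> ?k" if "(x, y) \<in> E \<phi>" "(x, z) \<in> E h" for x y z
    using relcomp_local_closureI[OF _ _ span_relation_converse[OF ex_rel[OF \<phi>]] ex_rel[OF h(1)], of y x z] that by blast
  have kE: "\<exists>e x. e \<in> Arr C \<and> regular_epi C e \<and> Cod C e = Dom C z \<and> (x, y \<odot> e) \<in> E \<phi> \<and> (x, z \<odot> e) \<in> E h"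
    if "(y, z) \<in> ?k" for y z
    using that by (rule relcomp_local_closureE) blast
  note ktyp = span_relationD[OF krel]
  have "span_map C (fst ?B) (eqv ?B) (fst ?Z) (eqv ?Z) ?k"
  proof (rule span_mapI[OF krel])
    fix y y' z assume yy': "(y, y') \<in> eqv ?B" and yz: "(y', z) \<in> ?k"
    obtain e x where e: "e \<in> Arr C" "regular_epi C e" "Cod C e = Dom C z" "(x, y' \<odot> e) \<in> E \<phi>" "(x, z \<odot> e) \<in> E h"
      using kE[OF yz] by blast
    note ty = ktyp[OF yz] span_relationD[OF eqvD(1)[OF B] yy']
    have "(y' \<odot> e, y \<odot> e) \<in> eqv ?B" 
      using eqvD(3)[OF B eqv_restrict[OF B yy' e(1)]] e ty by simp
    then have "(y \<odot> e, z \<odot> e) \<in> ?k" using kI[OF ex_right[OF \<phi> e(4)] e(5)] by blast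
    then show "(y, z) \<in> ?k" by (rule span_relation_local[OF krel e(2,3), rotated 3]) (use ty in simp_all)
  next
    fix y z z' assume zz': "(z, z') \<in> eqv ?Z" and yz: "(y, z) \<in> ?k"
    obtain e x where e: "e \<in> Arr C" "regular_epi C e" "Cod C e = Dom C z" "(x, y \<odot> e) \<in> E \<phi>" "(x, z \<odot> e) \<in> E h"
      using kE[OF yz] by blast
    note ty = ktyp[OF yz] span_relationD[OF eqvD(1)[OF Z] zz']
    have d: "Cod C e = Dom C z'" using e ty by simp
    have "(z \<odot> e, z' \<odot> e) \<in> eqv ?Z" using eqv_restrict[OF Z zz' e(1) d] .
    then have "(y \<odot> e, z' \<odot> e) \<in> ?k" using kI[OF e(4) ex_right[OF h(1) e(5)]] by blast
    then show "(y, z') \<in> ?k" by (rule span_relation_local[OF krel e(2) d, rotated 3]) (use ty in simp_all)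
  next
    fix y z z' assume yz: "(y, z) \<in> ?k" and yz': "(y, z') \<in> ?k"
    obtain e x where e: "e \<in> Arr C" "regular_epi C e" "Cod C e = Dom C z" "(x, y \<odot> e) \<in> E \<phi>" "(x, z \<odot> e) \<in> E h"
      using kE[OF yz] by blast
    note ty = ktyp[OF yz] ktyp[OF yz'] ex_mem[OF \<phi> e(4)]
    have d: "Cod C e = Dom C z'" using e ty by simp
    have "(y \<odot> e, z' \<odot> e) \<in> ?k" by (rule span_relation_restrict[OF krel yz' e(1) d])
    then obtain c x' where c: "c \<in> Arr C" "regular_epi C c" "Cod C c = Dom C (z' \<odot> e)" "(x', (y \<odot> e) \<odot> c) \<in> E \<phi>" "(x', (z' \<odot> e) \<odot> c) \<in> E h"
      using kE by blast
    have cd: "Cod C c = Dom C e" "Cod C c = Dom C (y \<odot> e)" "Cod C c = Dom C (z \<odot> e)" using c(3) e d ty(1-10) by simp_all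
    have "((z \<odot> e) \<odot> c, (z' \<odot> e) \<odot> c) \<in> eqv ?Z"
      by (rule key[OF ex_restrict[OF \<phi> e(4) c(1) cd(2)] c(4) ex_restrict[OF h(1) e(5) c(1) cd(3)] c(5)])
    then have "(z \<odot> e, z' \<odot> e) \<in> eqv ?Z" by (rule eqv_local[OF Z _ c(2,3)]) (use e d ty(1-10) in simp_all)
    then show "(z, z') \<in> eqv ?Z" by (rule eqv_local[OF Z _ e(2) d]) (use ty(1-10) in simp_all)
  next
    fix y assume y: "y \<in> Arr C" "Cod C y = fst ?B"
    obtain e x where e: "e \<in> Arr C" "regular_epi C e" "Cod C e = Dom C y" "(x, y \<odot> e) \<in> E \<phi>"
      "x \<in> Arr C" "Dom C x = Dom C e" "Cod C x = fst ?A" by (rule ex_surjectiveE[OF surj \<phi> y])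
    obtain d z where d: "d \<in> Arr C" "regular_epi C d" "Cod C d = Dom C x" "(x \<odot> d, z) \<in> E h"
      using ex_total[OF h(1) e(5)] e(7) h(2) by metis
    have "(x \<odot> d, (y \<odot> e) \<odot> d) \<in> E \<phi>" by (rule ex_restrict[OF \<phi> e(4) d(1)]) (use d e y in simp)
    then have "((y \<odot> e) \<odot> d, z) \<in> ?k" using kI d(4) by blast
    then show "\<exists>e z. regular_epi C e \<and> Cod C e = Dom C y \<and> (y \<odot> e, z) \<in> ?k"
      using regular_epi_comp[OF e(2) d(2)] e d y by (intro exI[of _ "e \<odot> d"] exI[of _ z]) simp
  qed
  then obtain k where k: "k \<in> Arr EC" "Dom EC k = ?B" "Cod EC k = ?Z" "E k = ?k" by (rule ex_arr_exists[OF B Z])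
  have "h = k \<star> \<phi>"
  proof (rule ex_arr_eqI; clarify?)
    fix x z assume xz: "(x, z) \<in> E h"
    note ty = ex_mem[OF h(1) xz]
    obtain e y where e: "e \<in> Arr C" "regular_epi C e" "Cod C e = Dom C x" "(x \<odot> e, y) \<in> E \<phi>"
      using ex_total[OF \<phi> ty(1)] ty(4) h(2) by metis
    have d: "Cod C e = Dom C z" using e ty by simp
    have "(y, z \<odot> e) \<in> E k" unfolding k(4) using kI[OF e(4) ex_restrict[OF h(1) xz e(1) d]] .
    then have "(x \<odot> e, z \<odot> e) \<in> E (k \<star> \<phi>)" by (rule ex_comp_intro[OF \<phi> k(1,2) e(4)])
    then show "(x, z) \<in> E (k \<star> \<phi>)"
      by (rule ex_local[OF ex_comp(2)[OF \<phi> k(1,2)] _ e(2) d]) (use ty in simp_all)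
  qed (use h k ex_comp[OF \<phi> k(1,2)] in simp_all)
  then show "\<exists>k. k \<in> Arr EC \<and> Dom EC k = Cod EC \<phi> \<and> Cod EC k = Cod EC h \<and> k \<star> \<phi> = h"
    using k(1-3) by (intro exI[of _ k]) simp
next
  fix k k' assume k: "k \<in> Arr EC" "k' \<in> Arr EC" "Dom EC k = Cod EC \<phi>" "Dom EC k' = Cod EC \<phi>" "Cod EC k = Cod EC k'"
    "k \<star> \<phi> = k' \<star> \<phi>"
  show "k = k'"
  proof (rule ex_arr_eqI; clarify?)
    fix y z assume yz: "(y, z) \<in> E k"
    note ty = ex_mem[OF k(1) yz]
    obtain e x where e: "e \<in> Arr C" "regular_epi C e" "Cod C e = Dom C y" "(x, y \<odot> e) \<in> E \<phi>"
      using ex_surjectiveE[OF surj \<phi> ty(1)] ty(4) k(3) by metis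
    have d: "Cod C e = Dom C z" using e ty by simp
    have "(x, z \<odot> e) \<in> E (k' \<star> \<phi>)"
      unfolding k(6)[symmetric] by (rule ex_comp_intro[OF \<phi> k(1,3) e(4) ex_restrict[OF k(1) yz e(1) d]])
    then have "(y \<odot> e, z \<odot> e) \<in> E k'" by (rule ex_comp_elim[OF \<phi> k(2,4) _ e(4)])
    then show "(y, z) \<in> E k'" by (rule ex_local[OF k(2) _ e(2) d]) (use ty in simp_all)
  qed (use k in simp_all)
qed

lemma ex_injective_monic:
  assumes \<mu>: "\<mu> \<in> Arr EC" and inj: "\<And>x x' y. \<lbrakk>(x, y) \<in> E \<mu>; (x', y) \<in> E \<mu>\<rbrakk> \<Longrightarrow> (x, x') \<in> eqv (Dom EC \<mu>)"
    and f: "f \<in> Arr EC" "g \<in> Arr EC" "Dom EC f = Dom EC g" "Cod EC f = Dom EC \<mu>" "Cod EC g = Dom EC \<mu>"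
    and eq: "\<mu> \<star> f = \<mu> \<star> g"
  shows "f = g"
proof (rule ex_equalI[OF f(1-3)])
  show "Cod EC f = Cod EC g" using f by simp
  fix w x x' assume wx: "(w, x) \<in> E f" and wx': "(w, x') \<in> E g"
  note ty = ex_mem[OF f(1) wx] ex_mem[OF f(2) wx']
  obtain e y where e: "e \<in> Arr C" "regular_epi C e" "Cod C e = Dom C x" "(x \<odot> e, y) \<in> E \<mu>"
    using ex_total[OF \<mu> ty(2)] ty(5) f(4) by metis
  have d: "Cod C e = Dom C x'" using e ty by simp
  have "(w \<odot> e, y) \<in> E (\<mu> \<star> g)"
    unfolding eq[symmetric] by (rule ex_comp_intro[OF f(1) \<mu> f(4)[symmetric] ex_restrict[OF f(1) wx e(1,3)] e(4)])
  then have "(x' \<odot> e, y) \<in> E \<mu>"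
    by (rule ex_comp_elim[OF f(2) \<mu> f(5)[symmetric] _ ex_restrict[OF f(2) wx' e(1) d]])
  then have "(x \<odot> e, x' \<odot> e) \<in> eqv (Dom EC \<mu>)" by (rule inj[OF e(4)])
  then have "(x, x') \<in> eqv (Dom EC \<mu>)"
    by (rule eqv_local[OF ex_arrD(1)[OF \<mu>] _ e(2) d]) (use ty in simp_all)
  then show "(x, x') \<in> eqv (Cod EC f)" using f(4) by simp
qed

text \<open>A quotient keeps the underlying object and enlarges the equivalence relation to
  \<open>K\<close>, which is also the relation of the quotient map.\<close>

lemma ex_quotient:
  assumes A: "A \<in> Obj EC" and K: "span_equivalence C (fst A) K" and le: "eqv A \<subseteq> K"
  obtains \<kappa> where "\<kappa> \<in> Arr EC" "Dom EC \<kappa> = A" "fst (Cod EC \<kappa>) = fst A" "eqv (Cod EC \<kappa>) = K" "E \<kappa> = K"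
    "ex_surjective \<kappa>"
proof -
  note K' = span_equivalenceD[OF K]
  obtain Q where Q: "Q \<in> Obj EC" "fst Q = fst A" "eqv Q = K" using K by (rule ex_obj_exists)
  have surj: "\<exists>e y. regular_epi C e \<and> Cod C e = Dom C x \<and> (x \<odot> e, y) \<in> K" if "x \<in> Arr C" "Cod C x = fst A" for x
    using span_map_total[OF span_map_Id[OF K] that] by metis
  have "span_map C (fst A) (eqv A) (fst Q) (eqv Q) K"
    unfolding Q by (rule span_mapI[OF K'(1)]) (use le K'(3,4) surj in blast)+
  then obtain \<kappa> where \<kappa>: "\<kappa> \<in> Arr EC" "Dom EC \<kappa> = A" "Cod EC \<kappa> = Q" "E \<kappa> = K" by (rule ex_arr_exists[OF A Q(1)])
  have "ex_surjective \<kappa>"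
    unfolding ex_surjective_def \<kappa> Q using surj K'(3) by blast
  then show ?thesis using that \<kappa> Q by metis
qed

text \<open>The image lives on the object underlying the domain of \<open>\<phi>\<close>, with the
  kernel of \<open>\<phi>\<close> as its equivalence relation. The monic part then has the very same
  elements as \<open>\<phi>\<close>, now read as a map out of the quotient.\<close>

lemma ex_image:
  assumes \<phi>: "\<phi> \<in> Arr EC"
  obtains \<kappa> \<mu> where "\<kappa> \<in> Arr EC" "\<mu> \<in> Arr EC" "Dom EC \<kappa> = Dom EC \<phi>" "Dom EC \<mu> = Cod EC \<kappa>" "Cod EC \<mu> = Cod EC \<phi>"
    "\<mu> \<star> \<kappa> = \<phi>" "ex_surjective \<kappa>" "E \<mu> = E \<phi>" "E \<kappa> = local_closure C (E \<phi> O (E \<phi>)\<inverse>)"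
    "\<And>x x' y. \<lbrakk>(x, y) \<in> E \<mu>; (x', y) \<in> E \<mu>\<rbrakk> \<Longrightarrow> (x, x') \<in> eqv (Dom EC \<mu>)"
proof -
  let ?A = "Dom EC \<phi>" and ?B = "Cod EC \<phi>" and ?K = "local_closure C (E \<phi> O (E \<phi>)\<inverse>)"
  note A = ex_arrD(1)[OF \<phi>] and B = ex_arrD(2)[OF \<phi>] and R = ex_rel[OF \<phi>]
  note Rc = span_relation_converse[OF R]
  have Krel: "span_relation C (fst ?A) (fst ?A) ?K" by (rule span_relation_comp[OF R Rc])
  have KI: "(x, x') \<in> ?K" if "(x, y) \<in> E \<phi>" "(x', y) \<in> E \<phi>" for x x' y
    using relcomp_local_closureI[OF _ _ R Rc, of x y x'] that by blast
  have KE: "\<exists>e y. e \<in> Arr C \<and> regular_epi C e \<and> Cod C e = Dom C x' \<and> (x \<odot> e, y) \<in> E \<phi> \<and> (x' \<odot> e, y) \<in> E \<phi>"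
    if "(x, x') \<in> ?K" for x x' using that by (rule relcomp_local_closureE) blast
  note Kty = span_relationD[OF Krel]
  \<comment> \<open>Elements with a common local value have all their values in common.\<close>
  have elim: "(x', y) \<in> E \<phi>" if xx': "(x, x') \<in> ?K" and xy: "(x, y) \<in> E \<phi>" for x x' y
  proof -
    obtain e z where e: "e \<in> Arr C" "regular_epi C e" "Cod C e = Dom C x'" "(x \<odot> e, z) \<in> E \<phi>" "(x' \<odot> e, z) \<in> E \<phi>"
      using KE[OF xx'] by blast
    note ty = Kty[OF xx'] ex_mem[OF \<phi> xy]
    have d: "Cod C e = Dom C y" using e ty by simp
    have "(z, y \<odot> e) \<in> eqv ?B" by (rule ex_single[OF \<phi> e(4) ex_restrict[OF \<phi> xy e(1) d]])
    then have "(x' \<odot> e, y \<odot> e) \<in> E \<phi>" by (rule ex_right[OF \<phi> e(5)])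
    then show ?thesis by (rule ex_local[OF \<phi> _ e(2) d]) (use ty in simp_all)
  qed
  have tot: "\<exists>e y. e \<in> Arr C \<and> regular_epi C e \<and> Cod C e = Dom C x \<and> (x \<odot> e, y) \<in> E \<phi>"
    if "x \<in> Arr C" "Cod C x = fst ?A" for x using ex_total[OF \<phi> that] by metis
  have sym: "(x', x) \<in> ?K" if xx': "(x, x') \<in> ?K" for x x'
  proof -
    obtain e z where e: "e \<in> Arr C" "regular_epi C e" "Cod C e = Dom C x'" "(x \<odot> e, z) \<in> E \<phi>" "(x' \<odot> e, z) \<in> E \<phi>"
      using KE[OF xx'] by blast
    show ?thesis
      by (rule span_relation_local[OF Krel e(2) _ _ _ _ KI[OF e(5,4)]]) (use Kty[OF xx'] e in simp_all)
  qed
  have K: "span_equivalence C (fst ?A) ?K"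
    unfolding span_equivalence_def
  proof (intro conjI ballI impI Krel symI transI)
    fix x assume x: "x \<in> Arr C" "Cod C x = fst ?A"
    obtain e y where e: "e \<in> Arr C" "regular_epi C e" "Cod C e = Dom C x" "(x \<odot> e, y) \<in> E \<phi>" using tot[OF x] by blast
    show "(x, x) \<in> ?K" by (rule span_relation_local[OF Krel e(2) _ _ _ _ KI[OF e(4,4)]]) (use x e in simp_all)
  next
    fix x y z assume xy: "(x, y) \<in> ?K" and yz: "(y, z) \<in> ?K"
    obtain e w where e: "e \<in> Arr C" "regular_epi C e" "Cod C e = Dom C z" "(y \<odot> e, w) \<in> E \<phi>" "(z \<odot> e, w) \<in> E \<phi>"
      using KE[OF yz] by blast
    note ty = Kty[OF xy] Kty[OF yz]
    have d: "Cod C e = Dom C x" using e ty by simp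
    have "(y \<odot> e, x \<odot> e) \<in> ?K" by (rule span_relation_restrict[OF Krel sym[OF xy] e(1) d])
    then have "(x \<odot> e, w) \<in> E \<phi>" using elim e(4) by blast
    then have "(x \<odot> e, z \<odot> e) \<in> ?K" using KI e(5) by blast
    then show "(x, z) \<in> ?K" by (rule span_relation_local[OF Krel e(2,3), rotated 3]) (use ty in simp_all)
  qed (rule sym)
  have le: "eqv ?A \<subseteq> ?K"
  proof clarify
    fix x x' assume xx': "(x, x') \<in> eqv ?A"
    note ty = span_relationD[OF eqvD(1)[OF A] xx']
    obtain e y where e: "e \<in> Arr C" "regular_epi C e" "Cod C e = Dom C x" "(x \<odot> e, y) \<in> E \<phi>" using tot[OF ty(1,4)] by blast
    have d: "Cod C e = Dom C x'" using e ty by simp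
    have "(x' \<odot> e, x \<odot> e) \<in> eqv ?A" by (rule eqvD(3)[OF A eqv_restrict[OF A xx' e(1) d]])
    then have "(x' \<odot> e, y) \<in> E \<phi>" using ex_left[OF \<phi> _ e(4)] by blast
    then show "(x, x') \<in> ?K" by (intro span_relation_local[OF Krel e(2) d _ _ _ KI[OF e(4)]]) (use ty in simp_all)
  qed
  obtain \<kappa> where \<kappa>: "\<kappa> \<in> Arr EC" "Dom EC \<kappa> = ?A" "fst (Cod EC \<kappa>) = fst ?A" "eqv (Cod EC \<kappa>) = ?K" "E \<kappa> = ?K"
    "ex_surjective \<kappa>" using ex_quotient[OF A K le] .
  have "span_map C (fst (Cod EC \<kappa>)) (eqv (Cod EC \<kappa>)) (fst ?B) (eqv ?B) (E \<phi>)"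
    unfolding \<kappa> 
  proof (rule span_mapI[OF R])
    show "(x, y) \<in> E \<phi>" if "(x, x') \<in> ?K" "(x', y) \<in> E \<phi>" for x x' y using elim[OF sym[OF that(1)] that(2)] .
    show "(x, y') \<in> E \<phi>" if "(x, y) \<in> E \<phi>" "(y, y') \<in> eqv ?B" for x y y' using ex_right[OF \<phi> that] .
    show "(y, y') \<in> eqv ?B" if "(x, y) \<in> E \<phi>" "(x, y') \<in> E \<phi>" for x y y' using ex_single[OF \<phi> that] .
    show "\<exists>e y. regular_epi C e \<and> Cod C e = Dom C x \<and> (x \<odot> e, y) \<in> E \<phi>" if "x \<in> Arr C" "Cod C x = fst ?A" for x
      using tot[OF that] by blast
  qed
  then obtain \<mu> where \<mu>: "\<mu> \<in> Arr EC" "Dom EC \<mu> = Cod EC \<kappa>" "Cod EC \<mu> = ?B" "E \<mu> = E \<phi>"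
    by (rule ex_arr_exists[OF ex_arrD(2)[OF \<kappa>(1)] B])
  have "\<mu> \<star> \<kappa> = \<phi>"
  proof (rule ex_comp_eqI[OF \<kappa>(1) \<mu>(1,2) \<phi>])
    show "(x, z) \<in> E \<phi>" if "(x, y) \<in> E \<kappa>" "(y, z) \<in> E \<mu>" for x y z
      using elim[OF sym, of x y z] that \<kappa> \<mu> by simp
  qed (use \<kappa> \<mu> in simp_all)
  moreover have "\<And>x x' y. \<lbrakk>(x, y) \<in> E \<mu>; (x', y) \<in> E \<mu>\<rbrakk> \<Longrightarrow> (x, x') \<in> eqv (Dom EC \<mu>)"
    using KI \<kappa>(4) \<mu>(2,4) by simp
  ultimately show ?thesis using that[of \<kappa> \<mu>] \<kappa> \<mu> by simp
qed

text \<open>If \<open>\<phi>\<close> is a coequalizer, the surjective part of its image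
  factorization factors through \<open>\<phi>\<close>, because the injective part is monic. This
  gives a section of the injective part, which is therefore surjective and has the same elements as
  \<open>\<phi>\<close>. The other direction exhibits \<open>\<phi>\<close> as the coequalizer of
  its kernel pair.\<close>

lemma ex_regular_epi_iff:
  assumes \<phi>: "\<phi> \<in> Arr EC"
  shows "regular_epi EC \<phi> \<longleftrightarrow> ex_surjective \<phi>"
proof
  assume "ex_surjective \<phi>"
  obtain p q where pb: "is_kernel_pair EC \<phi> p q" using ex_pullbacks[OF \<phi> \<phi>] by auto
  note P = category.pullbackD[OF ex_category pb]
  have "is_coequalizer EC p q \<phi>"
  proof (rule ex_surjective_coequalizer[OF \<phi> \<open>ex_surjective \<phi>\<close>])
    fix x x' y assume "(x, y) \<in> E \<phi>" "(x', y) \<in> E \<phi>"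
    then show "\<exists>e w. regular_epi C e \<and> Cod C e = Dom C y \<and> (w, x \<odot> e) \<in> E p \<and> (w, x' \<odot> e) \<in> E q"
      using ex_pullback_points[OF pb] by metis
  qed (use P in simp_all)
  then show "regular_epi EC \<phi>" unfolding regular_epi_def by blast
next
  assume "regular_epi EC \<phi>"
  then obtain a b where co: "is_coequalizer EC a b \<phi>" unfolding regular_epi_def by blast
  note co' = category.coequalizerD[OF ex_category co]
  obtain \<kappa> \<mu> where im: "\<kappa> \<in> Arr EC" "\<mu> \<in> Arr EC" "Dom EC \<kappa> = Dom EC \<phi>" "Dom EC \<mu> = Cod EC \<kappa>" "Cod EC \<mu> = Cod EC \<phi>"
    "\<mu> \<star> \<kappa> = \<phi>" "ex_surjective \<kappa>" "E \<mu> = E \<phi>"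
    and inj: "\<And>x x' y. \<lbrakk>(x, y) \<in> E \<mu>; (x', y) \<in> E \<mu>\<rbrakk> \<Longrightarrow> (x, x') \<in> eqv (Dom EC \<mu>)"
    using ex_image[OF \<phi>] by metis
  note ca = ex_comp[OF co'(1) im(1)] and cb = ex_comp[OF co'(2) im(1)]
  have "\<mu> \<star> (\<kappa> \<star> a) = \<phi> \<star> a" "\<mu> \<star> (\<kappa> \<star> b) = \<phi> \<star> b"
    by (rule category.extend1[OF ex_category im(6)]; use co' im in simp)+
  then have "\<kappa> \<star> a = \<kappa> \<star> b"
    using co'(7) ca cb co' im(1-4) by - (rule ex_injective_monic[OF im(2) inj], simp_all)
  then obtain \<nu> where \<nu>: "\<nu> \<in> Arr EC" "Dom EC \<nu> = Cod EC \<phi>" "Cod EC \<nu> = Cod EC \<kappa>" "\<nu> \<star> \<phi> = \<kappa>"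
    using category.coequalizer_ex[OF ex_category co im(1,3)] by metis
  note i = ex_Id[OF ex_arrD(2)[OF \<phi>]]
  have dm: "Dom EC \<mu> = Cod EC \<nu>" using im(4) \<nu>(3) by simp
  note mn = ex_comp[OF \<nu>(1) im(2) dm]
  have "(\<mu> \<star> \<nu>) \<star> \<phi> = \<mu> \<star> (\<nu> \<star> \<phi>)"
    by (rule category.assoc[OF ex_category \<phi> \<nu>(1) im(2) \<nu>(2) dm])
  also have "\<dots> = Id EC (Cod EC \<phi>) \<star> \<phi>"
    using \<nu>(4) im(6) category.comp_id_simps(1)[OF ex_category \<phi> refl] by simp
  finally have "\<mu> \<star> \<nu> = Id EC (Cod EC \<phi>)"
    by (rule category.coequalizer_epi[OF ex_category co mn(2) i(2), rotated 2]) (use mn i \<nu>(2) in simp_all)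
  show "ex_surjective \<phi>"
    unfolding ex_surjective_def
  proof (intro ballI impI)
    fix y assume y: "y \<in> Arr C" "Cod C y = fst (Cod EC \<phi>)"
    have "(y, y) \<in> E (\<mu> \<star> \<nu>)"
      unfolding \<open>\<mu> \<star> \<nu> = Id EC (Cod EC \<phi>)\<close> i(1) by (rule eqvD(2)[OF ex_arrD(2)[OF \<phi>] y])
    then obtain e x where "regular_epi C e" "Cod C e = Dom C y" "(x, y \<odot> e) \<in> E \<mu>"
      by (rule ex_comp_cases[OF \<nu>(1) im(2) dm])
    then show "\<exists>e x. regular_epi C e \<and> Cod C e = Dom C y \<and> (x, y \<odot> e) \<in> E \<phi>" using im(8) by auto
  qed
qed

text \<open>A kernel pair is coequalized by the surjective part of the image factorization.
  Stability of regular epimorphisms is the stability of local surjectivity, which follows from the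
  description of the elements of a pullback in \<open>ex_pullback_points\<close>.\<close>

theorem ex_regular: "regular_category EC"
proof -
  interpret fc: finitely_complete_category EC by (rule ex_finitely_complete)
  show ?thesis
  proof
    fix \<phi> p q assume pb: "is_kernel_pair EC \<phi> p q"
    note P = fc.pullbackD[OF pb]
    note \<phi> = P(1)
    obtain \<kappa> \<mu> where im: "\<kappa> \<in> Arr EC" "\<mu> \<in> Arr EC" "Dom EC \<kappa> = Dom EC \<phi>" "Dom EC \<mu> = Cod EC \<kappa>" "Cod EC \<mu> = Cod EC \<phi>"
      "\<mu> \<star> \<kappa> = \<phi>" "ex_surjective \<kappa>" "E \<mu> = E \<phi>" "E \<kappa> = local_closure C (E \<phi> O (E \<phi>)\<inverse>)"
      and inj: "\<And>x x' y. \<lbrakk>(x, y) \<in> E \<mu>; (x', y) \<in> E \<mu>\<rbrakk> \<Longrightarrow> (x, x') \<in> eqv (Dom EC \<mu>)"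
      using ex_image[OF \<phi>] by metis
    have dp: "Dom EC \<kappa> = Cod EC p" "Dom EC \<kappa> = Cod EC q" using P im by simp_all
    note cp = ex_comp[OF P(3) im(1) dp(1)] and cq = ex_comp[OF P(4) im(1) dp(2)]
    have "\<mu> \<star> (\<kappa> \<star> p) = \<phi> \<star> p" "\<mu> \<star> (\<kappa> \<star> q) = \<phi> \<star> q"
      by (rule fc.extend1[OF im(6)]; use P im in simp)+
    then have kk: "\<kappa> \<star> p = \<kappa> \<star> q"
      using P cp cq im(1-4) by - (rule ex_injective_monic[OF im(2) inj], simp_all)
    have "is_coequalizer EC p q \<kappa>"
    proof (rule ex_surjective_coequalizer[OF im(1,7) P(3,4,6) _ _ kk])
      show "Cod EC p = Dom EC \<kappa>" "Cod EC q = Dom EC \<kappa>" using P im by simp_all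
      fix x x' y assume xy: "(x, y) \<in> E \<kappa>" and x'y: "(x', y) \<in> E \<kappa>"
      note ty = ex_mem[OF im(1) xy] ex_mem[OF im(1) x'y]
      \<comment> \<open>Elements with the same class in the image have a common local value under
        \<open>\<phi>\<close>, so the points of the kernel pair of \<open>\<phi>\<close> apply to
        them.\<close>
      obtain e z where e: "e \<in> Arr C" "regular_epi C e" "Cod C e = Dom C x'" "(x \<odot> e, z) \<in> E \<mu>"
      proof -
        obtain e z where "e \<in> Arr C" "regular_epi C e" "Cod C e = Dom C x" "(x \<odot> e, z) \<in> E \<phi>"
          using ex_total[OF \<phi> ty(1)] ty(4) im(3) by metis
        then show ?thesis using that im(8) ty by simp
      qed
      have d: "Cod C e = Dom C y" using e ty by simp
      have xz: "(x \<odot> e, z) \<in> E \<phi>" "(x \<odot> e, z) \<in> E (\<mu> \<star> \<kappa>)" using e(4) im(6,8) by simp_all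
      have "(y \<odot> e, z) \<in> E \<mu>" by (rule ex_comp_elim[OF im(1,2,4) xz(2) ex_restrict[OF im(1) xy e(1) d]])
      then have "(x' \<odot> e, z) \<in> E (\<mu> \<star> \<kappa>)" by (rule ex_comp_intro[OF im(1,2,4) ex_restrict[OF im(1) x'y e(1) d]])
      then have "(x' \<odot> e, z) \<in> E \<phi>" using im(6) by simp
      then obtain c w where c: "c \<in> Arr C" "regular_epi C c" "Cod C c = Dom C z" "(w, (x \<odot> e) \<odot> c) \<in> E p" "(w, (x' \<odot> e) \<odot> c) \<in> E q"
        using ex_pullback_points[OF pb xz(1)] by metis
      have dz: "Dom C z = Dom C e" using ex_mem(3)[OF \<phi> xz(1)] e ty by simp
      show "\<exists>e w. regular_epi C e \<and> Cod C e = Dom C y \<and> (w, x \<odot> e) \<in> E p \<and> (w, x' \<odot> e) \<in> E q"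
        using regular_epi_comp[OF e(2) c(2)] c e d dz ty by (intro exI[of _ "e \<odot> c"] exI[of _ w]) simp
    qed
    then show "\<exists>e. is_coequalizer EC p q e" by blast
  next
    fix e f p q assume e: "regular_epi EC e" and pb: "is_pullback EC e f p q"
    note P = fc.pullbackD[OF pb]
    have se: "ex_surjective e" using ex_regular_epi_iff[OF P(1)] e by simp
    have "ex_surjective q"
      unfolding ex_surjective_def
    proof (intro ballI impI)
      fix y assume y: "y \<in> Arr C" "Cod C y = fst (Cod EC q)"
      obtain d z where d: "d \<in> Arr C" "regular_epi C d" "Cod C d = Dom C y" "(y \<odot> d, z) \<in> E f"
        "z \<in> Arr C" "Dom C z = Dom C d" "Cod C z = fst (Cod EC f)"
        using ex_total[OF P(2) y(1)] y P(8) by metis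
      obtain c x where c: "c \<in> Arr C" "regular_epi C c" "Cod C c = Dom C z" "(x, z \<odot> c) \<in> E e"
        using ex_surjectiveE[OF se P(1) d(5)] d(7) P(5) by metis
      have "((y \<odot> d) \<odot> c, z \<odot> c) \<in> E f" by (rule ex_restrict[OF P(2) d(4) c(1,3)])
      then obtain b w where b: "b \<in> Arr C" "regular_epi C b" "Cod C b = Dom C (z \<odot> c)" "(w, ((y \<odot> d) \<odot> c) \<odot> b) \<in> E q"
        using ex_pullback_points[OF pb c(4)] by metis
      have t: "Cod C b = Dom C c" "Cod C c = Dom C d" using b(3) c d by simp_all
      have "regular_epi C (d \<odot> c \<odot> b)"
        by (rule regular_epi_comp[OF d(2) regular_epi_comp[OF c(2) b(2)]]) (use t b(1) c(1) in simp_all)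
      then show "\<exists>e x. regular_epi C e \<and> Cod C e = Dom C y \<and> (x, y \<odot> e) \<in> E q"
        using t b(1,4) c(1) d(1,3) y by (intro exI[of _ "d \<odot> c \<odot> b"] exI[of _ w]) simp
    qed
    then show "regular_epi EC q" using ex_regular_epi_iff[OF P(4)] by simp
  qed
qed

text \<open>\<open>K\<close> is the relation that \<open>r1, r2\<close> induce on the underlying object of \<open>A\<close>.\<close>

lemma ex_relation_factors:
  assumes rel: "is_relation EC A A r1 r2" and K: "K = local_closure C ((E r1)\<inverse> O E r2)"
    and ab: "a \<in> Arr EC" "b \<in> Arr EC" "Dom EC a = Dom EC b" "Cod EC a = A" "Cod EC b = A"
  shows "(\<exists>h. h \<in> Arr EC \<and> Dom EC h = Dom EC b \<and> Cod EC h = Dom EC r1 \<and> r1 \<star> h = a \<and> r2 \<star> h = b)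
     \<longleftrightarrow> (\<forall>t x x'. (t, x) \<in> E a \<longrightarrow> (t, x') \<in> E b \<longrightarrow> (x, x') \<in> K)"
proof -
  note R = category.relationD[OF ex_category rel]
  let ?W = "Dom EC r1" and ?T = "Dom EC b"
  note W = ex_arrD(1)[OF R(1)] and To = ex_arrD(1)[OF ab(2)]
  note r1c = span_relation_converse[OF ex_rel[OF R(1)]]
  have Krel: "span_relation C (fst A) (fst A) K"
    unfolding K using span_relation_comp[OF r1c] ex_rel[OF R(2)] R(3-5) by simp
  note Kty = span_relationD[OF Krel]
  have KI: "(x, x') \<in> K" if "(w, x) \<in> E r1" "(w, x') \<in> E r2" for w x x'
    unfolding K using relcomp_local_closureI[OF _ _ r1c ex_rel[OF R(2)], of x w x'] that by blast
  show ?thesis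
  proof
    assume "\<exists>h. h \<in> Arr EC \<and> Dom EC h = Dom EC b \<and> Cod EC h = Dom EC r1 \<and> r1 \<star> h = a \<and> r2 \<star> h = b"
    then obtain h where h: "h \<in> Arr EC" "Dom EC h = Dom EC b" "Cod EC h = Dom EC r1" "r1 \<star> h = a" "r2 \<star> h = b" by blast
    have dh: "Dom EC r1 = Cod EC h" "Dom EC r2 = Cod EC h" using h R by simp_all
    show "\<forall>t x x'. (t, x) \<in> E a \<longrightarrow> (t, x') \<in> E b \<longrightarrow> (x, x') \<in> K"
    proof (intro allI impI)
      fix t x x' assume tx: "(t, x) \<in> E a" and tx': "(t, x') \<in> E b"
      note ty = ex_mem[OF ab(1) tx] ex_mem[OF ab(2) tx']
      obtain e w where e: "e \<in> Arr C" "regular_epi C e" "Cod C e = Dom C t" "(t \<odot> e, w) \<in> E h"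
        using ex_total[OF h(1) ty(1)] ty(4) h(2) ab(3) by metis
      have d: "Cod C e = Dom C x" "Cod C e = Dom C x'" using e ty by simp_all
      have "(t \<odot> e, x \<odot> e) \<in> E (r1 \<star> h)" unfolding h(4) by (rule ex_restrict[OF ab(1) tx e(1) d(1)])
      then have 1: "(w, x \<odot> e) \<in> E r1" by (rule ex_comp_elim[OF h(1) R(1) dh(1) _ e(4)])
      have "(t \<odot> e, x' \<odot> e) \<in> E (r2 \<star> h)" unfolding h(5) by (rule ex_restrict[OF ab(2) tx' e(1) d(2)])
      then have 2: "(w, x' \<odot> e) \<in> E r2" by (rule ex_comp_elim[OF h(1) R(2) dh(2) _ e(4)])
      show "(x, x') \<in> K" by (rule span_relation_local[OF Krel e(2) d(2) _ _ _ KI[OF 1 2]]) (use ty in simp_all)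
    qed
  next
    assume le: "\<forall>t x x'. (t, x) \<in> E a \<longrightarrow> (t, x') \<in> E b \<longrightarrow> (x, x') \<in> K"
    \<comment> \<open>Joint monicity concerns arrows, so \<open>w\<close> and \<open>w'\<close> are
      turned into arrows \<open>f\<close> and \<open>f'\<close> from their common stage; these agree
      after \<open>r1\<close> and after \<open>r2\<close>, hence are equal.\<close>
    have mono: "(w, w') \<in> eqv ?W"
      if m: "(w, x) \<in> E r1" "(w', x) \<in> E r1" "(w, x') \<in> E r2" "(w', x') \<in> E r2" for w w' x x'
    proof -
      note ty = ex_mem[OF R(1) m(1)] ex_mem[OF R(1) m(2)] ex_mem[OF R(2) m(3)] ex_mem[OF R(2) m(4)]
      have wo: "Dom C w \<in> Obj C" using ty dom_obj by simp
      have dw: "Dom C w' = Dom C w" using ty by simp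
      obtain f where f: "f \<in> Arr EC" "Dom EC f = unit_obj (Dom C w)" "Cod EC f = ?W"
        "\<And>t x'. (t, x') \<in> E f \<longleftrightarrow> t \<in> Arr C \<and> Cod C t = Dom C w \<and> (w \<odot> t, x') \<in> eqv ?W"
        using point_exists[OF W ty(1,4)] by metis
      obtain f' where f': "f' \<in> Arr EC" "Dom EC f' = unit_obj (Dom C w)" "Cod EC f' = ?W"
        "\<And>t x'. (t, x') \<in> E f' \<longleftrightarrow> t \<in> Arr C \<and> Cod C t = Dom C w \<and> (w' \<odot> t, x') \<in> eqv ?W"
        using point_exists[OF W ty(6,9)] dw by metis
      have comp: "r \<star> f = r \<star> f'" if r: "r \<in> Arr EC" "Dom EC r = ?W" "(w, y) \<in> E r" "(w', y) \<in> E r" for r y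
      proof (rule ex_comp_eqI[OF f(1) r(1)])
        note yt = ex_mem[OF r(1,3)]
        fix t v z assume tv: "(t, v) \<in> E f" and vz: "(v, z) \<in> E r"
        have t: "t \<in> Arr C" "Cod C t = Dom C w" "(w \<odot> t, v) \<in> eqv ?W" using tv f(4) by auto
        have ty': "Cod C t = Dom C y" using t yt by simp
        have "(w \<odot> t, z) \<in> E r" using ex_left[OF r(1)] t(3) vz r(2) by simp
        then have "(y \<odot> t, z) \<in> eqv (Cod EC r)" using ex_single[OF r(1) ex_restrict[OF r(1,3) t(1) ty']] by blast
        then have "(w' \<odot> t, z) \<in> E r" using ex_right[OF r(1) ex_restrict[OF r(1,4) t(1) ty']] by blast
        moreover have "(t, w' \<odot> t) \<in> E f'" unfolding f'(4) using t(1,2) dw ty eqvD(2)[OF W, of "w' \<odot> t"] by simp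
        ultimately show "(t, z) \<in> E (r \<star> f')" using ex_comp_intro[OF f'(1) r(1)] r(2) f'(3) by metis
      qed (use f f' r ex_comp[OF f'(1) r(1)] in simp_all)
      have "f = f'"
        by (rule category.relation_unique[OF ex_category rel f(1) f'(1) _ _ _ comp[OF R(1) refl m(1,2)] comp[OF R(2) R(3)[symmetric] m(3,4)]])
          (use f f' R in simp_all)
      moreover have "(Id C (Dom C w), w) \<in> E f" unfolding f(4) using wo ty eqvD(2)[OF W, of w] by simp
      ultimately have "(w' \<odot> Id C (Dom C w), w) \<in> eqv ?W" using f'(4) by blast
      then show ?thesis using ty dw eqvD(3)[OF W] by simp
    qed
    \<comment> \<open>The factorization relates \<open>t\<close> to those \<open>w\<close> that
      \<open>r1\<close> and \<open>r2\<close> send, locally, to values of \<open>a\<close> and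
      \<open>b\<close> at \<open>t\<close>.\<close>
    let ?H = "local_closure C (E a O (E r1)\<inverse>) \<inter> local_closure C (E b O (E r2)\<inverse>)"
    have Hrel1: "span_relation C (fst ?T) (fst ?W) (local_closure C (E a O (E r1)\<inverse>))"
      using span_relation_comp[OF ex_rel[OF ab(1)]] r1c ab R by simp
    have Hrel2: "span_relation C (fst ?T) (fst ?W) (local_closure C (E b O (E r2)\<inverse>))"
      using span_relation_comp[OF ex_rel[OF ab(2)]] span_relation_converse[OF ex_rel[OF R(2)]] ab R by simp
    have Hrel: "span_relation C (fst ?T) (fst ?W) ?H" by (rule span_relation_Int[OF Hrel1 Hrel2])
    have HI: "(t, w) \<in> local_closure C (E c O (E r)\<inverse>)"
      if "(t, x) \<in> E c" "(w, x) \<in> E r" "c \<in> Arr EC" "r \<in> Arr EC" for t w x c r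
      using relcomp_local_closureI[OF _ _ ex_rel[OF that(3)] span_relation_converse[OF ex_rel[OF that(4)]], of t x w] that(1,2) by blast
    have HD: "(w, x) \<in> E r"
      if m: "(t, w) \<in> local_closure C (E c O (E r)\<inverse>)" "(t, x) \<in> E c" and cr: "c \<in> Arr EC" "r \<in> Arr EC" "Cod EC c = Cod EC r" for t w x c r
    proof -
      obtain e x' where e: "e \<in> Arr C" "regular_epi C e" "Cod C e = Dom C w" "(t \<odot> e, x') \<in> E c" "(x', w \<odot> e) \<in> (E r)\<inverse>"
        "t \<in> Arr C" "w \<in> Arr C" "Dom C t = Dom C w" using m(1) by (rule relcomp_local_closureE)
      note ty = ex_mem[OF cr(1) m(2)]
      have d: "Cod C e = Dom C x" using e ty by simp
      have "(x', x \<odot> e) \<in> eqv (Cod EC r)" using ex_single[OF cr(1) e(4) ex_restrict[OF cr(1) m(2) e(1) d]] cr(3) by simp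
      then have "(w \<odot> e, x \<odot> e) \<in> E r" using ex_right[OF cr(2)] e(5) by blast
      then show ?thesis by (rule ex_local[OF cr(2) _ e(2) d]) (use e ty in simp_all)
    qed
    have car: "Cod EC a = Cod EC r1" "Cod EC b = Cod EC r2" using ab R by simp_all
    \<comment> \<open>Once values of \<open>a\<close> and \<open>b\<close> at \<open>t\<close> are
      fixed, no further cover is needed to describe \<open>?H\<close>.\<close>
    have Hmem: "(t, w) \<in> ?H \<longleftrightarrow> (w, x) \<in> E r1 \<and> (w, x') \<in> E r2"
      if "(t, x) \<in> E a" "(t, x') \<in> E b" for t w x x'
      using HI[OF that(1) _ ab(1) R(1)] HI[OF that(2) _ ab(2) R(2)] HD[OF _ that(1) ab(1) R(1) car(1)] HD[OF _ that(2) ab(2) R(2) car(2)]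
      by blast
    have pts: "\<exists>e x x'. e \<in> Arr C \<and> regular_epi C e \<and> Cod C e = Dom C t \<and> (t \<odot> e, x) \<in> E a \<and> (t \<odot> e, x') \<in> E b"
      if t: "t \<in> Arr C" "Cod C t = fst ?T" for t
    proof -
      obtain e x where e: "e \<in> Arr C" "regular_epi C e" "Cod C e = Dom C t" "(t \<odot> e, x) \<in> E a" "Dom C x = Dom C e"
        using ex_total[OF ab(1) t(1)] t(2) ab(3) by metis
      obtain d x' where d: "d \<in> Arr C" "regular_epi C d" "Cod C d = Dom C (t \<odot> e)" "((t \<odot> e) \<odot> d, x') \<in> E b"
        by (rule ex_total[OF ab(2), of "t \<odot> e"]) (use t e in simp_all)
      have "((t \<odot> e) \<odot> d, x \<odot> d) \<in> E a" by (rule ex_restrict[OF ab(1) e(4) d(1)]) (use d e t in simp)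
      then show ?thesis
        using regular_epi_comp[OF e(2) d(2)] e d t by (intro exI[of _ "e \<odot> d"] exI[of _ "x \<odot> d"] exI[of _ x']) simp
    qed
    have "span_map C (fst ?T) (eqv ?T) (fst ?W) (eqv ?W) ?H"
    proof (rule span_mapI[OF Hrel])
      fix t t' w assume tt': "(t, t') \<in> eqv ?T" and tw: "(t', w) \<in> ?H"
      note ty = span_relationD[OF eqvD(1)[OF To] tt'] span_relationD[OF Hrel tw]
      obtain e x x' where e: "e \<in> Arr C" "regular_epi C e" "Cod C e = Dom C t'" "(t' \<odot> e, x) \<in> E a" "(t' \<odot> e, x') \<in> E b"
        using pts[OF ty(2,5)] by blast
      have d: "Cod C e = Dom C w" using e ty by simp
      have w: "(w \<odot> e, x) \<in> E r1 \<and> (w \<odot> e, x') \<in> E r2"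
        using Hmem[OF e(4,5)] span_relation_restrict[OF Hrel tw e(1) d] by blast
      have te: "(t \<odot> e, t' \<odot> e) \<in> eqv ?T" using eqv_restrict[OF To tt' e(1,3)] .
      have "(t \<odot> e, x) \<in> E a" "(t \<odot> e, x') \<in> E b"
        using ex_left[OF ab(1) _ e(4)] ex_left[OF ab(2) _ e(5)] te ab(3) by auto
      then have "(t \<odot> e, w \<odot> e) \<in> ?H" using Hmem w by blast
      then show "(t, w) \<in> ?H" by (rule span_relation_local[OF Hrel e(2) d, rotated 3]) (use ty in simp_all)
    next
      fix t w w' assume tw: "(t, w) \<in> ?H" and ww': "(w, w') \<in> eqv ?W"
      note ty = span_relationD[OF eqvD(1)[OF W] ww'] span_relationD[OF Hrel tw]
      obtain e x x' where e: "e \<in> Arr C" "regular_epi C e" "Cod C e = Dom C t" "(t \<odot> e, x) \<in> E a" "(t \<odot> e, x') \<in> E b"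
        using pts[OF ty(6,9)] by blast
      have d: "Cod C e = Dom C w" "Cod C e = Dom C w'" using e ty by simp_all
      have w: "(w \<odot> e, x) \<in> E r1" "(w \<odot> e, x') \<in> E r2"
        using Hmem[OF e(4,5)] span_relation_restrict[OF Hrel tw e(1) d(1)] by blast+
      have we: "(w' \<odot> e, w \<odot> e) \<in> eqv ?W" using eqvD(3)[OF W eqv_restrict[OF W ww' e(1) d(2)]] .
      have "(w' \<odot> e, x) \<in> E r1" "(w' \<odot> e, x') \<in> E r2"
        using ex_left[OF R(1) _ w(1)] ex_left[OF R(2) _ w(2)] we R(3) by auto
      then have "(t \<odot> e, w' \<odot> e) \<in> ?H" using Hmem[OF e(4,5)] by blast
      then show "(t, w') \<in> ?H" by (rule span_relation_local[OF Hrel e(2) d(2), rotated 3]) (use ty in simp_all)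
    next
      fix t w w' assume tw: "(t, w) \<in> ?H" and tw': "(t, w') \<in> ?H"
      note ty = span_relationD[OF Hrel tw] span_relationD[OF Hrel tw']
      obtain e x x' where e: "e \<in> Arr C" "regular_epi C e" "Cod C e = Dom C t" "(t \<odot> e, x) \<in> E a" "(t \<odot> e, x') \<in> E b"
        using pts[OF ty(1,4)] by blast
      have d: "Cod C e = Dom C w" "Cod C e = Dom C w'" using e ty by simp_all
      have "(w \<odot> e, w' \<odot> e) \<in> eqv ?W"
        using Hmem[OF e(4,5)] span_relation_restrict[OF Hrel tw e(1) d(1)] span_relation_restrict[OF Hrel tw' e(1) d(2)] mono by blast
      then show "(w, w') \<in> eqv ?W" by (rule eqv_local[OF W _ e(2) d(2)]) (use ty in simp_all)
    next
      fix t assume t: "t \<in> Arr C" "Cod C t = fst ?T"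
      obtain e x x' where e: "e \<in> Arr C" "regular_epi C e" "Cod C e = Dom C t" "(t \<odot> e, x) \<in> E a" "(t \<odot> e, x') \<in> E b"
        using pts[OF t] by blast
      \<comment> \<open>The hypothesis enters here: the values \<open>x\<close> and
        \<open>x'\<close> are locally linked by an element \<open>w\<close> of the span.\<close>
      have xx': "(x, x') \<in> K" using le e(4,5) by blast
      then obtain d w where d: "d \<in> Arr C" "regular_epi C d" "Cod C d = Dom C x'" "(x \<odot> d, w) \<in> (E r1)\<inverse>" "(w, x' \<odot> d) \<in> E r2"
        unfolding K by (rule relcomp_local_closureE)
      note ty = ex_mem[OF ab(1) e(4)] ex_mem[OF ab(2) e(5)]
      have dd: "Cod C d = Dom C x" "Cod C d = Dom C e" using d ty e t by simp_all
      have "((t \<odot> e) \<odot> d, w) \<in> ?H"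
        using Hmem[OF ex_restrict[OF ab(1) e(4) d(1) dd(1)] ex_restrict[OF ab(2) e(5) d(1,3)]] d(4,5) by blast
      then show "\<exists>e w. regular_epi C e \<and> Cod C e = Dom C t \<and> (t \<odot> e, w) \<in> ?H"
        using regular_epi_comp[OF e(2) d(2) dd(2)[symmetric]] e d(1) t dd by (intro exI[of _ "e \<odot> d"] exI[of _ w]) simp
    qed
    then obtain h where h: "h \<in> Arr EC" "Dom EC h = ?T" "Cod EC h = ?W" "E h = ?H" by (rule ex_arr_exists[OF To W])
    have "a = r1 \<star> h \<and> b = r2 \<star> h"
    proof (intro conjI)
      have fac: "r \<star> h = c"
        if c: "c \<in> Arr EC" "Dom EC c = ?T" "r \<in> Arr EC" "Dom EC r = ?W" "Cod EC c = Cod EC r"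
          and sub: "?H \<subseteq> local_closure C (E c O (E r)\<inverse>)" for c r
      proof (rule ex_comp_eqI[OF h(1) c(3)])
        fix t w x assume tw: "(t, w) \<in> E h" and wx: "(w, x) \<in> E r"
        then have "(t, w) \<in> local_closure C (E c O (E r)\<inverse>)" using h(4) sub by blast
        then obtain e x' where e: "e \<in> Arr C" "regular_epi C e" "Cod C e = Dom C w" "(t \<odot> e, x') \<in> E c" "(x', w \<odot> e) \<in> (E r)\<inverse>"
          "t \<in> Arr C" "w \<in> Arr C" "Dom C t = Dom C w" by (rule relcomp_local_closureE)
        note ty = ex_mem[OF c(3) wx]
        have d: "Cod C e = Dom C x" using e ty by simp
        have "(x', x \<odot> e) \<in> eqv (Cod EC c)"
          using ex_single[OF c(3) _ ex_restrict[OF c(3) wx e(1) d]] e(5) c(5) by simp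
        then have "(t \<odot> e, x \<odot> e) \<in> E c" using ex_right[OF c(1) e(4)] by blast
        then show "(t, x) \<in> E c" by (rule ex_local[OF c(1) _ e(2) d]) (use e ty in simp_all)
      qed (use c h in simp_all)
      show "a = r1 \<star> h" by (rule fac[symmetric]) (use ab R in auto)
      show "b = r2 \<star> h" by (rule fac[symmetric]) (use ab R in auto)
    qed
    then show "\<exists>h. h \<in> Arr EC \<and> Dom EC h = Dom EC b \<and> Cod EC h = Dom EC r1 \<and> r1 \<star> h = a \<and> r2 \<star> h = b"
      using h(1-3) by (intro exI[of _ h]) simp
  qed
qed

section \<open>Transfer of relations between the completion and the base\<close>

lemma ex_relation_spans:
  assumes rel: "is_relation EC A A r1 r2" and K: "K = local_closure C ((E r1)\<inverse> O E r2)"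
  shows "(a, b) \<in> spans EC r1 r2 \<longleftrightarrow> a \<in> Arr EC \<and> b \<in> Arr EC \<and> Dom EC a = Dom EC b \<and> Cod EC a = A \<and> Cod EC b = A
     \<and> (\<forall>t x x'. (t, x) \<in> E a \<longrightarrow> (t, x') \<in> E b \<longrightarrow> (x, x') \<in> K)"
proof -
  note R = category.relationD[OF ex_category rel]
  show ?thesis
  proof
    assume m: "(a, b) \<in> spans EC r1 r2"
    note ty = category.spansD[OF ex_category rel m]
    obtain h where h: "h \<in> Arr EC" "Cod EC h = Dom EC r1" "r1 \<star> h = a" "r2 \<star> h = b"
      using m by (rule category.spansE[OF ex_category])
    have "Dom EC h = Dom EC b" using h(4) ex_comp(3)[OF h(1) R(2)] h(2) R(3) by simp
    then show "a \<in> Arr EC \<and> b \<in> Arr EC \<and> Dom EC a = Dom EC b \<and> Cod EC a = A \<and> Cod EC b = A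
       \<and> (\<forall>t x x'. (t, x) \<in> E a \<longrightarrow> (t, x') \<in> E b \<longrightarrow> (x, x') \<in> K)"
      using ex_relation_factors[OF rel K ty] h ty by blast
  next
    assume a: "a \<in> Arr EC \<and> b \<in> Arr EC \<and> Dom EC a = Dom EC b \<and> Cod EC a = A \<and> Cod EC b = A
       \<and> (\<forall>t x x'. (t, x) \<in> E a \<longrightarrow> (t, x') \<in> E b \<longrightarrow> (x, x') \<in> K)"
    then obtain h where "h \<in> Arr EC" "Cod EC h = Dom EC r1" "r1 \<star> h = a" "r2 \<star> h = b"
      using ex_relation_factors[OF rel K, of a b] by blast
    then show "(a, b) \<in> spans EC r1 r2" using category.spansI[OF ex_category] by metis
  qed
qed

text \<open>Evaluating the represented relation at points recovers \<open>K\<close>. This uses that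
  \<open>K\<close> absorbs \<open>eqv A\<close>, since a point takes every value equivalent to the
  element it comes from.\<close>

lemma ex_relation_points:
  assumes rel: "is_relation EC A A r1 r2" and K: "K = local_closure C ((E r1)\<inverse> O E r2)"
    and A: "A \<in> Obj EC" and x: "x \<in> Arr C" "Cod C x = fst A" and x': "x' \<in> Arr C" "Cod C x' = fst A" and d: "Dom C x = Dom C x'"
    and a: "a \<in> Arr EC" "Dom EC a = unit_obj (Dom C x)" "Cod EC a = A"
      "\<And>t y. (t, y) \<in> E a \<longleftrightarrow> t \<in> Arr C \<and> Cod C t = Dom C x \<and> (x \<odot> t, y) \<in> eqv A"
    and b: "b \<in> Arr EC" "Dom EC b = unit_obj (Dom C x')" "Cod EC b = A"
      "\<And>t y. (t, y) \<in> E b \<longleftrightarrow> t \<in> Arr C \<and> Cod C t = Dom C x' \<and> (x' \<odot> t, y) \<in> eqv A"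
  shows "(a, b) \<in> spans EC r1 r2 \<longleftrightarrow> (x, x') \<in> K"
proof -
  note R = category.relationD[OF ex_category rel] and A' = eqvD[OF A]
  note r1c = span_relation_converse[OF ex_rel[OF R(1)]]
  have Krel: "span_relation C (fst A) (fst A) K"
    unfolding K using span_relation_comp[OF r1c] ex_rel[OF R(2)] R(3-5) by simp
  have inv: "(y, y') \<in> K" if m: "(z, z') \<in> K" "(z, y) \<in> eqv A" "(z', y') \<in> eqv A" for z z' y y'
  proof -
    obtain e w where e: "e \<in> Arr C" "regular_epi C e" "Cod C e = Dom C z'" "(z \<odot> e, w) \<in> (E r1)\<inverse>" "(w, z' \<odot> e) \<in> E r2"
      "z \<in> Arr C" "z' \<in> Arr C" "Dom C z = Dom C z'" using m(1) unfolding K by (rule relcomp_local_closureE)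
    note ty = span_relationD[OF A'(1) m(2)] span_relationD[OF A'(1) m(3)]
    have dd: "Cod C e = Dom C y" "Cod C e = Dom C y'" using e ty by simp_all
    have "(w, y \<odot> e) \<in> E r1" "(w, y' \<odot> e) \<in> E r2"
      using ex_right[OF R(1), of w "z \<odot> e" "y \<odot> e"] eqv_restrict[OF A m(2) e(1) dd(1)]
        ex_right[OF R(2) e(5), of "y' \<odot> e"] eqv_restrict[OF A m(3) e(1) dd(2)] e(4) R(4,5) by simp_all
    then have "(y \<odot> e, y' \<odot> e) \<in> K"
      unfolding K using relcomp_local_closureI[OF _ _ r1c ex_rel[OF R(2)], of "y \<odot> e" w "y' \<odot> e"] by blast
    then show ?thesis by (rule span_relation_local[OF Krel e(2) dd(2), rotated 3]) (use ty e in simp_all)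
  qed
  have "(a, b) \<in> spans EC r1 r2 \<longleftrightarrow> (\<forall>t y y'. (t, y) \<in> E a \<longrightarrow> (t, y') \<in> E b \<longrightarrow> (y, y') \<in> K)"
    using ex_relation_spans[OF rel K] a(1-3) b(1-3) d by simp
  also have "\<dots> \<longleftrightarrow> (x, x') \<in> K"
  proof
    assume l: "\<forall>t y y'. (t, y) \<in> E a \<longrightarrow> (t, y') \<in> E b \<longrightarrow> (y, y') \<in> K"
    have o: "Dom C x \<in> Obj C" using x dom_obj by simp
    have "(Id C (Dom C x), x) \<in> E a" "(Id C (Dom C x), x') \<in> E b"
      unfolding a(4) b(4) using o d x x' A'(2)[of x] A'(2)[of x'] by simp_all
    then show "(x, x') \<in> K" using l by blast
  next
    assume xx': "(x, x') \<in> K"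
    show "\<forall>t y y'. (t, y) \<in> E a \<longrightarrow> (t, y') \<in> E b \<longrightarrow> (y, y') \<in> K"
    proof (intro allI impI)
      fix t y y' assume "(t, y) \<in> E a" "(t, y') \<in> E b"
      then have t: "t \<in> Arr C" "Cod C t = Dom C x'" "(x \<odot> t, y) \<in> eqv A" "(x' \<odot> t, y') \<in> eqv A" using a(4) b(4) by auto
      show "(y, y') \<in> K" using inv[OF span_relation_restrict[OF Krel xx' t(1,2)] t(3,4)] .
    qed
  qed
  finally show ?thesis .
qed

text \<open>The relation \<open>K\<close> induced on the underlying object is an equivalence
  relation containing \<open>eqv A\<close>. The quotient \<open>\<kappa>\<close> of \<open>A\<close>
  by \<open>K\<close> has the right kernel pair: arrows agree after \<open>\<kappa>\<close> exactly
  when their values are related by \<open>K\<close>, that is, when they factor through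
  \<open>r1, r2\<close>.\<close>

theorem ex_exact: "exact_category EC"
proof -
  interpret rc: regular_category EC by (rule ex_regular)
  show ?thesis
  proof
    fix A r1 r2 assume er: "equivalence_relation EC A r1 r2"
    have rel: "is_relation EC A A r1 r2" and seq: "span_equivalence EC A (spans EC r1 r2)"
      using er rc.equivalence_relation_iff by blast+
    note R = rc.relationD[OF rel]
    define K where "K = local_closure C ((E r1)\<inverse> O E r2)"
    note sp = ex_relation_spans[OF rel K_def]
    have A: "A \<in> Obj EC" by (rule R(6))
    note A' = eqvD[OF A]
    have Krel: "span_relation C (fst A) (fst A) K"
      unfolding K_def using span_relation_comp[OF span_relation_converse[OF ex_rel[OF R(1)]]] ex_rel[OF R(2)] R(3-5) by simp
    note Kty = span_relationD[OF Krel]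
    \<comment> \<open>One point is fixed for each element: transitivity has to meet the same middle
      arrow in both pairs.\<close>
    define pt where "pt x = (SOME a. a \<in> Arr EC \<and> Dom EC a = unit_obj (Dom C x) \<and> Cod EC a = A \<and>
      (\<forall>t y. (t, y) \<in> E a \<longleftrightarrow> t \<in> Arr C \<and> Cod C t = Dom C x \<and> (x \<odot> t, y) \<in> eqv A))" for x
    have pt: "pt x \<in> Arr EC" "Dom EC (pt x) = unit_obj (Dom C x)" "Cod EC (pt x) = A"
      "\<And>t y. (t, y) \<in> E (pt x) \<longleftrightarrow> t \<in> Arr C \<and> Cod C t = Dom C x \<and> (x \<odot> t, y) \<in> eqv A"
      if "x \<in> Arr C" "Cod C x = fst A" for x
    proof -
      have "\<exists>a. a \<in> Arr EC \<and> Dom EC a = unit_obj (Dom C x) \<and> Cod EC a = A \<and>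
        (\<forall>t y. (t, y) \<in> E a \<longleftrightarrow> t \<in> Arr C \<and> Cod C t = Dom C x \<and> (x \<odot> t, y) \<in> eqv A)"
        using point_exists[OF A that] by metis
      from someI_ex[OF this] show "pt x \<in> Arr EC" "Dom EC (pt x) = unit_obj (Dom C x)" "Cod EC (pt x) = A"
        "\<And>t y. (t, y) \<in> E (pt x) \<longleftrightarrow> t \<in> Arr C \<and> Cod C t = Dom C x \<and> (x \<odot> t, y) \<in> eqv A"
        unfolding pt_def[symmetric] by blast+
    qed
    have Kiff: "(pt x, pt x') \<in> spans EC r1 r2 \<longleftrightarrow> (x, x') \<in> K"
      if "x \<in> Arr C" "Cod C x = fst A" "x' \<in> Arr C" "Cod C x' = fst A" "Dom C x = Dom C x'" for x x'
      by (rule ex_relation_points[OF rel K_def A that pt[OF that(1,2)] pt[OF that(3,4)]])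
    note S = span_equivalence_def[of EC A "spans EC r1 r2"]
    have sref: "\<And>a. a \<in> Arr EC \<Longrightarrow> Cod EC a = A \<Longrightarrow> (a, a) \<in> spans EC r1 r2"
      and ssym: "\<And>a b. (a, b) \<in> spans EC r1 r2 \<Longrightarrow> (b, a) \<in> spans EC r1 r2"
      and strans: "\<And>a b c. (a, b) \<in> spans EC r1 r2 \<Longrightarrow> (b, c) \<in> spans EC r1 r2 \<Longrightarrow> (a, c) \<in> spans EC r1 r2"
      using seq unfolding S by (auto dest: symD transD)
    have Kref: "(x, x) \<in> K" if "x \<in> Arr C" "Cod C x = fst A" for x
      using Kiff[OF that that refl] sref[OF pt(1,3)[OF that]] by blast
    have K: "span_equivalence C (fst A) K"
      unfolding span_equivalence_def
    proof (intro conjI ballI impI symI transI Krel Kref)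
      fix x y assume xy: "(x, y) \<in> K"
      note ty = Kty[OF xy]
      show "(y, x) \<in> K" using Kiff[OF ty(1,4,2,5,3)] Kiff[OF ty(2,5,1,4) ty(3)[symmetric]] ssym xy by blast
    next
      fix x y z assume xy: "(x, y) \<in> K" and yz: "(y, z) \<in> K"
      note ty = Kty[OF xy] and tz = Kty[OF yz]
      have d: "Dom C x = Dom C z" using ty tz by simp
      show "(x, z) \<in> K" using Kiff[OF ty(1,4,2,5,3)] Kiff[OF tz(1,4,2,5,3)] Kiff[OF ty(1,4) tz(2,5) d] strans xy yz by blast
    qed auto
    \<comment> \<open>Reflexivity is applied to the point of \<open>x\<close>, which has both
      \<open>x\<close> and \<open>x'\<close> among its values at the generic element.\<close>
    have le: "eqv A \<subseteq> K"
    proof clarify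
      fix x x' assume xx': "(x, x') \<in> eqv A"
      note ty = span_relationD[OF A'(1) xx']
      have "\<forall>t y y'. (t, y) \<in> E (pt x) \<longrightarrow> (t, y') \<in> E (pt x) \<longrightarrow> (y, y') \<in> K"
        using sp[of "pt x" "pt x"] sref[OF pt(1,3)[OF ty(1,4)]] by blast
      moreover have "(Id C (Dom C x), x) \<in> E (pt x)" "(Id C (Dom C x), x') \<in> E (pt x)"
        unfolding pt(4)[OF ty(1,4)] using ty dom_obj[OF ty(1)] xx' A'(2)[of x] by simp_all
      ultimately show "(x, x') \<in> K" by blast
    qed
    obtain \<kappa> where \<kappa>: "\<kappa> \<in> Arr EC" "Dom EC \<kappa> = A" "fst (Cod EC \<kappa>) = fst A" "eqv (Cod EC \<kappa>) = K" "E \<kappa> = K"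
      using ex_quotient[OF A K le] by metis
    note K' = span_equivalenceD[OF K]
    have eqiff: "\<kappa> \<star> a = \<kappa> \<star> b \<longleftrightarrow> (a, b) \<in> spans EC r1 r2"
      if ab: "a \<in> Arr EC" "b \<in> Arr EC" "Dom EC a = Dom EC b" "Cod EC a = A" "Cod EC b = A" for a b
    proof
      have d: "Dom EC \<kappa> = Cod EC a" "Dom EC \<kappa> = Cod EC b" using ab \<kappa> by simp_all
      {
        assume eq: "\<kappa> \<star> a = \<kappa> \<star> b"
        have "(x, x') \<in> K" if m: "(t, x) \<in> E a" "(t, x') \<in> E b" for t x x'
        proof -
          have "(x, x) \<in> E \<kappa>" unfolding \<kappa>(5) using Kref ex_mem[OF ab(1) m(1)] ab(4) by simp
          then have "(t, x) \<in> E (\<kappa> \<star> b)" unfolding eq[symmetric] by (rule ex_comp_intro[OF ab(1) \<kappa>(1) d(1) m(1)])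
          then have "(x', x) \<in> E \<kappa>" by (rule ex_comp_elim[OF ab(2) \<kappa>(1) d(2) _ m(2)])
          then show ?thesis using K'(3) \<kappa>(5) by simp
        qed
        then show "(a, b) \<in> spans EC r1 r2" using sp ab by blast
      next
        assume "(a, b) \<in> spans EC r1 r2"
        then have l: "\<And>t x x'. (t, x) \<in> E a \<Longrightarrow> (t, x') \<in> E b \<Longrightarrow> (x, x') \<in> K" using sp by blast
        show "\<kappa> \<star> a = \<kappa> \<star> b"
        proof (rule ex_comp_eqI[OF ab(1) \<kappa>(1) d(1) ex_comp(2)[OF ab(2) \<kappa>(1) d(2)]])
          fix t x z assume tx: "(t, x) \<in> E a" and xz: "(x, z) \<in> E \<kappa>"
          note ty = ex_mem[OF ab(1) tx] ex_mem[OF \<kappa>(1) xz]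
          obtain e x' where e: "e \<in> Arr C" "regular_epi C e" "Cod C e = Dom C t" "(t \<odot> e, x') \<in> E b"
            using ex_total[OF ab(2) ty(1)] ty(4) ab(3) by metis
          have dd: "Cod C e = Dom C x" "Cod C e = Dom C z" using e ty by simp_all
          have "(x \<odot> e, x') \<in> K" using l[OF ex_restrict[OF ab(1) tx e(1) dd(1)] e(4)] .
          moreover have "(x \<odot> e, z \<odot> e) \<in> K" using ex_restrict[OF \<kappa>(1) xz e(1) dd(2)] \<kappa>(5) by simp
          ultimately have "(x', z \<odot> e) \<in> E \<kappa>" using K'(3,4) \<kappa>(5) by blast
          then have "(t \<odot> e, z \<odot> e) \<in> E (\<kappa> \<star> b)" by (rule ex_comp_intro[OF ab(2) \<kappa>(1) d(2) e(4)])
          then show "(t, z) \<in> E (\<kappa> \<star> b)"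
            by (rule ex_local[OF ex_comp(2)[OF ab(2) \<kappa>(1) d(2)] _ e(2) dd(2)]) (use ty in simp_all)
        qed (use ab ex_comp[OF ab(2) \<kappa>(1) d(2)] in simp_all)
      }
    qed
    have "is_kernel_pair EC \<kappa> r1 r2"
    proof (rule rc.pullbackI)
      have "(r1, r2) \<in> spans EC r1 r2"
        using R rc.dom_obj[OF R(1)] by (intro rc.spansI[of "Id EC (Dom EC r1)"]) simp_all
      then show "\<kappa> \<star> r1 = \<kappa> \<star> r2" using eqiff R by simp
      fix a b assume ab: "a \<in> Arr EC" "b \<in> Arr EC" "Dom EC a = Dom EC b" "Cod EC a = Dom EC \<kappa>" "Cod EC b = Dom EC \<kappa>"
        "\<kappa> \<star> a = \<kappa> \<star> b"
      then have m: "(a, b) \<in> spans EC r1 r2" using eqiff \<kappa>(2) by simp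
      obtain h where h: "h \<in> Arr EC" "Cod EC h = Dom EC r1" "r1 \<star> h = a" "r2 \<star> h = b"
        using m by (rule rc.spansE)
      have "Dom EC h = Dom EC b" using h(4) ex_comp(3)[OF h(1) R(2)] h(2) R(3) by simp
      then show "\<exists>h. h \<in> Arr EC \<and> Dom EC h = Dom EC b \<and> Cod EC h = Dom EC r2 \<and> r1 \<star> h = a \<and> r2 \<star> h = b"
        using h R(3) by (intro exI[of _ h]) simp
    next
      show "h = h'" if "h \<in> Arr EC" "h' \<in> Arr EC" "Dom EC h = Dom EC h'" "Cod EC h = Dom EC r2" "Cod EC h' = Dom EC r2"
        "r1 \<star> h = r1 \<star> h'" "r2 \<star> h = r2 \<star> h'" for h h'
        using rc.relation_unique[OF rel that] .
    qed (use R \<kappa> in simp_all)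
    then show "\<exists>f. is_kernel_pair EC f r1 r2" by blast
  qed
qed

text \<open>Reflexivity on arrows, tested at points, makes \<open>K\<close> reflexive in the base.
  There it is symmetric and transitive, and these properties are lifted back elementwise through
  \<open>ex_relation_spans\<close>.\<close>

theorem ex_maltsev:
  assumes "maltsev_category C"
  shows "maltsev_category EC"
proof -
  interpret mc: maltsev_category C by (rule assms)
  interpret fc: finitely_complete_category EC by (rule ex_finitely_complete)
  show ?thesis
  proof
    fix A r1 r2 assume rr: "reflexive_relation EC A r1 r2"
    have rel: "is_relation EC A A r1 r2" and sref: "\<And>a. a \<in> Arr EC \<Longrightarrow> Cod EC a = A \<Longrightarrow> (a, a) \<in> spans EC r1 r2"
      using rr fc.reflexive_relation_iff by blast+
    note R = fc.relationD[OF rel]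
    define K where "K = local_closure C ((E r1)\<inverse> O E r2)"
    note sp = ex_relation_spans[OF rel K_def]
    have A: "A \<in> Obj EC" by (rule R(6))
    have Krel: "span_relation C (fst A) (fst A) K"
      unfolding K_def using span_relation_comp[OF span_relation_converse[OF ex_rel[OF R(1)]]] ex_rel[OF R(2)] R(3-5) by simp
    have Kref: "(x, x) \<in> K" if x: "x \<in> Arr C" "Cod C x = fst A" for x
    proof -
      obtain a where a: "a \<in> Arr EC" "Dom EC a = unit_obj (Dom C x)" "Cod EC a = A"
        "\<And>t y. (t, y) \<in> E a \<longleftrightarrow> t \<in> Arr C \<and> Cod C t = Dom C x \<and> (x \<odot> t, y) \<in> eqv A"
        using point_exists[OF A x] by metis
      show ?thesis using ex_relation_points[OF rel K_def A x x refl a a] sref[OF a(1,3)] by blast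
    qed
    obtain k1 k2 where k: "is_relation C (fst A) (fst A) k1 k2" "K = spans C k1 k2" using Krel by (rule span_relationE)
    then have "reflexive_relation C (fst A) k1 k2" unfolding reflexive_relation_iff using Kref by blast
    then have "equivalence_relation C (fst A) k1 k2" by (rule mc.reflexive_equivalence)
    then have "span_equivalence C (fst A) K" using equivalence_relation_iff k(2) by simp
    note K = span_equivalenceD[OF this]
    have "span_equivalence EC A (spans EC r1 r2)"
      unfolding span_equivalence_def
    proof (intro conjI ballI impI symI transI)
      show "span_relation EC A A (spans EC r1 r2)" using rel by (rule fc.span_relationI)
      show "(a, a) \<in> spans EC r1 r2" if "a \<in> Arr EC" "Cod EC a = A" for a using sref[OF that] .
      show "(b, a) \<in> spans EC r1 r2" if "(a, b) \<in> spans EC r1 r2" for a b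
        using that K(3) unfolding sp by auto
      fix a b c assume ab: "(a, b) \<in> spans EC r1 r2" and bc: "(b, c) \<in> spans EC r1 r2"
      have "(x, z) \<in> K" if tx: "(t, x) \<in> E a" and tz: "(t, z) \<in> E c" for t x z
      proof -
        have a: "a \<in> Arr EC" "b \<in> Arr EC" "c \<in> Arr EC" "Dom EC a = Dom EC b" using ab bc sp by auto
        note ty = ex_mem[OF a(1) tx] ex_mem[OF a(3) tz]
        obtain e y where e: "e \<in> Arr C" "regular_epi C e" "Cod C e = Dom C t" "(t \<odot> e, y) \<in> E b"
          using ex_total[OF a(2) ty(1)] ty(4) a(4) by metis
        have dd: "Cod C e = Dom C x" "Cod C e = Dom C z" using e ty by simp_all
        have "(x \<odot> e, y) \<in> K" "(y, z \<odot> e) \<in> K"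
          using ab bc sp ex_restrict[OF a(1) tx e(1) dd(1)] ex_restrict[OF a(3) tz e(1) dd(2)] e(4) by blast+
        then have "(x \<odot> e, z \<odot> e) \<in> K" by (rule K(4))
        then show ?thesis by (rule span_relation_local[OF Krel e(2) dd(2), rotated 3]) (use ty in simp_all)
      qed
      then show "(a, c) \<in> spans EC r1 r2" using ab bc unfolding sp by auto
    qed
    then show "equivalence_relation EC A r1 r2" using fc.equivalence_relation_iff rel by blast
  qed
qed

end


section \<open>Semi-left-exactness\<close>

lemma full_subcat_simps [simp]:
  "Obj (full_subcat C S) = S" "Arr (full_subcat C S) = {f \<in> Arr C. Dom C f \<in> S \<and> Cod C f \<in> S}"
  "Dom (full_subcat C S) = Dom C" "Cod (full_subcat C S) = Cod C" "Id (full_subcat C S) = Id C"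
  "Comp (full_subcat C S) = Comp C"
  unfolding full_subcat_def by simp_all

context category
begin

lemma full_subcat_category:
  assumes "S \<subseteq> Obj C"
  shows "category (full_subcat C S)"
  by unfold_locales (use assms in \<open>auto simp: hom_def subset_iff\<close>)

lemma full_subcat_iso:
  assumes "S \<subseteq> Obj C"
  shows "is_iso (full_subcat C S) f \<longleftrightarrow> is_iso C f \<and> Dom C f \<in> S \<and> Cod C f \<in> S"
  unfolding is_iso_def hom_def by auto

lemma iso_Id: "A \<in> Obj C \<Longrightarrow> is_iso C (Id C A)"
  by (rule isoI[of _ "Id C A"]) auto

lemma iso_inverse:
  assumes "is_iso C f"
  obtains g where "is_iso C g" "Dom C g = Cod C f" "Cod C g = Dom C f"
    "g \<odot> f = Id C (Dom C f)" "f \<odot> g = Id C (Cod C f)"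
proof -
  have "f \<in> Arr C" using assms unfolding is_iso_def by auto
  obtain g where g: "g \<in> Arr C" "Dom C g = Cod C f" "Cod C g = Dom C f"
    "g \<odot> f = Id C (Dom C f)" "f \<odot> g = Id C (Cod C f)" using assms by (rule isoE)
  then have "is_iso C g" using \<open>f \<in> Arr C\<close> by (intro isoI[of g f]) simp_all
  then show ?thesis using that g by blast
qed

lemma universal_arrow_Id:
  assumes "S \<subseteq> Obj C" "B \<in> S"
  shows "universal_arrow_to C S (Id C B)"
proof -
  have B: "B \<in> Obj C" using assms by auto
  show ?thesis
  proof (rule universal_arrowI)
    fix h assume "h \<in> Arr C" "Dom C h = Dom C (Id C B)" "Cod C h \<in> S"
    then show "\<exists>k. k \<in> Arr C \<and> Dom C k = Cod C (Id C B) \<and> Cod C k = Cod C h \<and> k \<odot> Id C B = h"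
      using B by (intro exI[of _ h]) simp
  qed (use B assms in auto)
qed

text \<open>Compare with the identity, which is universal at an object of \<open>S\<close>.\<close>

lemma universal_arrow_iso_of_mem:
  assumes "S \<subseteq> Obj C" "universal_arrow_to C S m" "Dom C m \<in> S"
  shows "is_iso C m"
proof -
  have D: "Dom C m \<in> Obj C" using assms by auto
  obtain i where i: "is_iso C i" "Dom C i = Cod C (Id C (Dom C m))" "Cod C i = Cod C m" "i \<odot> Id C (Dom C m) = m"
    by (rule universal_arrow_iso[OF universal_arrow_Id[OF assms(1,3)] assms(2)]) (use D in simp)
  have "i \<in> Arr C" using i(1) unfolding is_iso_def by auto
  then show ?thesis using i D by simp
qed

text \<open>The functor is forced by the universal arrows. The predicate \<open>P\<close> lets the
  caller work with a particular choice of them, with extra data attached, and check stability under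
  pullback only for those.\<close>

lemma semi_localizationI:
  assumes S: "S \<subseteq> Obj C"
    and ex: "\<And>A. A \<in> Obj C \<Longrightarrow> \<exists>m. universal_arrow_to C S m \<and> Dom C m = A \<and> P m"
    and sle: "\<And>m f p q. \<lbrakk>universal_arrow_to C S m; P m; Dom C f \<in> S; is_pullback C f m p q\<rbrakk>
      \<Longrightarrow> universal_arrow_to C S p"
  shows "\<exists>L \<eta>. semi_localization C S L \<eta> \<and> (\<forall>A \<in> Obj C. P (\<eta> A))"
proof -
  obtain \<eta> where \<eta>: "\<And>A. A \<in> Obj C \<Longrightarrow> universal_arrow_to C S (\<eta> A) \<and> Dom C (\<eta> A) = A \<and> P (\<eta> A)"
    using ex by metis
  have u: "universal_arrow_to C S (\<eta> A)" and d: "Dom C (\<eta> A) = A" and Pm: "P (\<eta> A)" if "A \<in> Obj C" for A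
    using \<eta>[OF that] by auto
  have uA: "\<eta> A \<in> Arr C" "Cod C (\<eta> A) \<in> S" if "A \<in> Obj C" for A using universal_arrowD[OF u[OF that]] by auto
  have "\<forall>f. \<exists>g. f \<in> Arr C \<longrightarrow> g \<in> Arr C \<and> Dom C g = Cod C (\<eta> (Dom C f)) \<and> Cod C g = Cod C (\<eta> (Cod C f)) \<and>
      g \<odot> \<eta> (Dom C f) = \<eta> (Cod C f) \<odot> f"
  proof
    fix f
    show "\<exists>g. f \<in> Arr C \<longrightarrow> g \<in> Arr C \<and> Dom C g = Cod C (\<eta> (Dom C f)) \<and> Cod C g = Cod C (\<eta> (Cod C f)) \<and>
      g \<odot> \<eta> (Dom C f) = \<eta> (Cod C f) \<odot> f"
    proof (cases "f \<in> Arr C")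
      case True
      note o = dom_obj[OF True] cod_obj[OF True]
      have "\<eta> (Cod C f) \<odot> f \<in> Arr C" "Dom C (\<eta> (Cod C f) \<odot> f) = Dom C (\<eta> (Dom C f))"
        "Cod C (\<eta> (Cod C f) \<odot> f) = Cod C (\<eta> (Cod C f))"
        using True o uA d by simp_all
      then show ?thesis using universal_arrow_ex[OF u[OF o(1)], of "\<eta> (Cod C f) \<odot> f"] uA[OF o(2)] by metis
    qed simp
  qed
  then obtain l where l: "\<And>f. f \<in> Arr C \<Longrightarrow> l f \<in> Arr C \<and> Dom C (l f) = Cod C (\<eta> (Dom C f)) \<and>
      Cod C (l f) = Cod C (\<eta> (Cod C f)) \<and> l f \<odot> \<eta> (Dom C f) = \<eta> (Cod C f) \<odot> f" by metis
  have l_unique: "l f = g"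
    if "f \<in> Arr C" "g \<in> Arr C" "Dom C g = Cod C (\<eta> (Dom C f))" "Cod C g = Cod C (\<eta> (Cod C f))"
      "g \<odot> \<eta> (Dom C f) = \<eta> (Cod C f) \<odot> f" for f g
    using universal_arrow_unique[OF u[OF dom_obj[OF that(1)]], of "l f" g] l[OF that(1)] that uA[OF cod_obj[OF that(1)]] by simp
  define L where "L = \<lparr>fob = (\<lambda>A. Cod C (\<eta> A)), far = l\<rparr>"
  have l_Id: "l (Id C A) = Id C (Cod C (\<eta> A))" if A: "A \<in> Obj C" for A
    using A uA[OF A] S d[OF A] by (intro l_unique) auto
  have l_comp: "l (g \<odot> f) = l g \<odot> l f" if fg: "f \<in> Arr C" "g \<in> Arr C" "Dom C g = Cod C f" for f g
  proof -
    note o = dom_obj[OF fg(1)] cod_obj[OF fg(1)] cod_obj[OF fg(2)]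
    have lf: "l f \<in> Arr C" "Dom C (l f) = Cod C (\<eta> (Dom C f))" "Cod C (l f) = Cod C (\<eta> (Cod C f))" "l f \<odot> \<eta> (Dom C f) = \<eta> (Cod C f) \<odot> f"
      using l[OF fg(1)] by auto
    have lg: "l g \<in> Arr C" "Dom C (l g) = Cod C (\<eta> (Cod C f))" "Cod C (l g) = Cod C (\<eta> (Cod C g))" "l g \<odot> \<eta> (Cod C f) = \<eta> (Cod C g) \<odot> g"
      using l[OF fg(2)] fg(3) by auto
    have "(l g \<odot> l f) \<odot> \<eta> (Dom C f) = l g \<odot> \<eta> (Cod C f) \<odot> f"
      using lf lg uA[OF o(1)] d[OF o(1)] by simp
    also have "\<dots> = \<eta> (Cod C g) \<odot> g \<odot> f"
      by (rule extend[OF lg(4)]) (use lg fg uA[OF o(2)] uA[OF o(3)] d[OF o(2)] d[OF o(3)] in simp_all)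
    finally show ?thesis using lf lg fg by (intro l_unique) simp_all
  qed
  have refl: "reflective_subcategory C S L \<eta>"
    unfolding reflective_subcategory_def
  proof (intro conjI ballI S)
    show "is_functor C (full_subcat C S) L"
      unfolding is_functor_def L_def using uA l l_Id l_comp dom_obj cod_obj by (auto simp: hom_def)
    show "natural_transformation C C id_func L \<eta>"
      unfolding natural_transformation_def L_def id_func_def using uA d l by (auto simp: hom_def)
    show "\<exists>!g. g \<in> hom C (fob L A) B \<and> g \<odot> \<eta> A = f" if "A \<in> Obj C" "B \<in> S" "f \<in> hom C A B" for A B f
      using u[OF that(1)] that d[OF that(1)] unfolding universal_arrow_to_def L_def by simp
  qed
  have "is_pullback (full_subcat C S) (l f) (l (\<eta> Q)) (l p) (l q)"
    if Q: "Q \<in> Obj C" and X: "X \<in> S" and f: "f \<in> hom C X (Cod C (\<eta> Q))" and pb: "is_pullback C f (\<eta> Q) p q" for Q X f p q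
  proof -
    interpret FS: category "full_subcat C S" using full_subcat_category[OF S] .
    note PB = pullbackD[OF pb]
    have f': "Dom C f = X" using f by (auto simp: hom_def)
    have Xo: "X \<in> Obj C" using X S by auto
    have up: "universal_arrow_to C S p" using sle[OF u[OF Q] Pm[OF Q] _ pb] f' X by simp
    \<comment> \<open>The functor inverts every universal arrow \<open>g\<close>: composed with the
      invertible unit at its codomain, \<open>g\<close> is again universal, so it differs from the
      unit at its domain by an isomorphism, which must be \<open>l g\<close>.\<close>
    have iso_l: "is_iso C (l g)" if g: "universal_arrow_to C S g" for g
    proof -
      note G = universal_arrowD[OF g]
      have o: "Cod C g \<in> Obj C" "Dom C g \<in> Obj C" using G S dom_obj by auto
      have "is_iso C (\<eta> (Cod C g))" using universal_arrow_iso_of_mem[OF S u[OF o(1)]] d[OF o(1)] G by simp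
      then have "universal_arrow_to C S (\<eta> (Cod C g) \<odot> g)"
        by (rule universal_arrow_comp_iso[OF g]) (use d[OF o(1)] uA[OF o(1)] in simp_all)
      then obtain i where i: "is_iso C i" "Dom C i = Cod C (\<eta> (Dom C g))" "Cod C i = Cod C (\<eta> (Cod C g) \<odot> g)"
        "i \<odot> \<eta> (Dom C g) = \<eta> (Cod C g) \<odot> g"
        by (rule universal_arrow_iso[OF u[OF o(2)]]) (use G d[OF o(1)] d[OF o(2)] uA[OF o(1)] in simp)
      have "i \<in> Arr C" using i(1) unfolding is_iso_def by auto
      then have "l g = i" using G i uA[OF o(1)] d[OF o(1)] by (intro l_unique) simp_all
      then show ?thesis using i by simp
    qed
    have eq: "l f \<odot> l p = l (\<eta> Q) \<odot> l q"
      using l_comp[OF PB(3,1)] l_comp[OF PB(4,2)] PB by simp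
    have arr: "l g \<in> Arr C" "Dom C (l g) \<in> S" "Cod C (l g) \<in> S" if "g \<in> Arr C" for g
      using l[OF that] uA dom_obj[OF that] cod_obj[OF that] by simp_all
    have lD: "Dom C (l g) = Cod C (\<eta> (Dom C g))" "Cod C (l g) = Cod C (\<eta> (Cod C g))" if "g \<in> Arr C" for g
      using l[OF that] by simp_all
    show ?thesis
    proof (rule FS.pullback_of_isos)
      show "l f \<in> Arr (full_subcat C S)" "l q \<in> Arr (full_subcat C S)" using arr[OF PB(1)] arr[OF PB(4)] by simp_all
      show "is_iso (full_subcat C S) (l (\<eta> Q))" "is_iso (full_subcat C S) (l p)"
        using full_subcat_iso[OF S] iso_l[OF up] iso_l[OF u[OF Q]] arr[OF PB(2)] arr[OF PB(3)] by simp_all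
    qed (use lD[OF PB(1)] lD[OF PB(2)] lD[OF PB(3)] lD[OF PB(4)] PB(5-8) eq in simp_all)
  qed
  then have "semi_localization C S L \<eta>"
    unfolding semi_localization_def using refl unfolding L_def by simp
  then show ?thesis using Pm by blast
qed

text \<open>The functor inverts the unit at \<open>Q\<close>, so the preserved pullback makes
  \<open>far L p\<close> invertible. By naturality \<open>\<eta> (Cod C p) \<odot> p\<close> is then
  universal, and the unit at this codomain, an object of \<open>S\<close>, can be cancelled.\<close>

lemma semi_localizationD:
  assumes sl: "semi_localization C S L \<eta>"
  shows "S \<subseteq> Obj C" "\<And>A. A \<in> Obj C \<Longrightarrow> universal_arrow_to C S (\<eta> A)" "\<And>A. A \<in> Obj C \<Longrightarrow> Dom C (\<eta> A) = A"
    and semi_localization_semi_left_exact: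
      "\<And>m f p q. \<lbrakk>universal_arrow_to C S m; Dom C f \<in> S; is_pullback C f m p q\<rbrakk> \<Longrightarrow> universal_arrow_to C S p"
proof -
  have re: "reflective_subcategory C S L \<eta>"
    and pres: "\<And>Q X f p q. \<lbrakk>Q \<in> Obj C; X \<in> S; f \<in> hom C X (fob L Q); is_pullback C f (\<eta> Q) p q\<rbrakk>
      \<Longrightarrow> is_pullback (full_subcat C S) (far L f) (far L (\<eta> Q)) (far L p) (far L q)"
    using sl unfolding semi_localization_def by blast+
  show S: "S \<subseteq> Obj C" using re unfolding reflective_subcategory_def by blast
  have nt: "natural_transformation C C id_func L \<eta>" and fu: "is_functor C (full_subcat C S) L"
    and un: "\<And>A B f. \<lbrakk>A \<in> Obj C; B \<in> S; f \<in> hom C A B\<rbrakk> \<Longrightarrow> \<exists>!g. g \<in> hom C (fob L A) B \<and> g \<odot> \<eta> A = f"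
    using re unfolding reflective_subcategory_def by blast+
  have \<eta>: "\<eta> A \<in> Arr C" "Dom C (\<eta> A) = A" "Cod C (\<eta> A) = fob L A" if "A \<in> Obj C" for A
    using nt that unfolding natural_transformation_def id_func_def hom_def by auto
  have LS: "fob L A \<in> S" if "A \<in> Obj C" for A
    using fu that unfolding is_functor_def by simp
  have nat: "\<eta> (Cod C f) \<odot> f = far L f \<odot> \<eta> (Dom C f)" if "f \<in> Arr C" for f
    using nt that unfolding natural_transformation_def id_func_def by auto
  have Larr: "far L f \<in> Arr C" "Dom C (far L f) = fob L (Dom C f)" "Cod C (far L f) = fob L (Cod C f)" if "f \<in> Arr C" for f
    using fu that dom_obj[OF that] cod_obj[OF that] unfolding is_functor_def hom_def by auto
  show u: "universal_arrow_to C S (\<eta> A)" if A: "A \<in> Obj C" for A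
    unfolding universal_arrow_to_def using un[OF A] \<eta>[OF A] LS[OF A] by simp
  show "Dom C (\<eta> A) = A" if "A \<in> Obj C" for A using \<eta>[OF that] by simp
  show "universal_arrow_to C S p"
    if m: "universal_arrow_to C S m" and fS: "Dom C f \<in> S" and pb: "is_pullback C f m p q" for m f p q
  proof -
    note PB = pullbackD[OF pb]
    let ?Q = "Dom C m"
    have Q: "?Q \<in> Obj C" using PB(2) dom_obj by simp
    obtain i where i: "is_iso C i" "Dom C i = Cod C m" "Cod C i = Cod C (\<eta> ?Q)" "i \<odot> m = \<eta> ?Q"
      by (rule universal_arrow_iso[OF m u[OF Q]]) (use \<eta>[OF Q] in simp)
    have ia: "i \<in> Arr C" using i(1) unfolding is_iso_def by auto
    obtain j where j: "j \<in> Arr C" "Dom C j = Cod C i" "Cod C j = Dom C i"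
      "j \<odot> i = Id C (Dom C i)" "i \<odot> j = Id C (Cod C i)" using i(1) by (rule isoE)
    have cancel: "x = y" if xy: "x \<in> Arr C" "y \<in> Arr C" "Cod C x = Dom C i" "Cod C y = Dom C i" "i \<odot> x = i \<odot> y" for x y
    proof -
      have "z = j \<odot> i \<odot> z" if "z \<in> Arr C" "Cod C z = Dom C i" for z
        using extend1[OF j(4), of z] that ia j(1-3) by simp
      then show ?thesis using xy by metis
    qed
    have im: "i \<odot> m \<odot> x = \<eta> ?Q \<odot> x" if "x \<in> Arr C" "Cod C x = ?Q" for x
      by (rule extend1[OF i(4)]) (use that PB(2) ia i(2) in simp_all)
    \<comment> \<open>Preservation is assumed for the unit; an arbitrary universal arrow
      \<open>m\<close> is the unit up to the isomorphism \<open>i\<close>, which moves over to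
      \<open>f\<close>.\<close>
    have pb': "is_pullback C (i \<odot> f) (\<eta> ?Q) p q"
    proof (rule pullbackI)
      show "(i \<odot> f) \<odot> p = \<eta> ?Q \<odot> q"
        using im[of q] PB ia i(2) by simp
      fix a b assume ab: "a \<in> Arr C" "b \<in> Arr C" "Dom C a = Dom C b" "Cod C a = Dom C (i \<odot> f)" "Cod C b = Dom C (\<eta> ?Q)"
        "(i \<odot> f) \<odot> a = \<eta> ?Q \<odot> b"
      have ab': "Cod C a = Dom C f" "Cod C b = ?Q" using ab PB ia i(2) \<eta>[OF Q] by simp_all
      then have "i \<odot> f \<odot> a = i \<odot> m \<odot> b" using ab(1,2,6) im[of b] PB(1,2,5) ia i(2) by simp
      then have "f \<odot> a = m \<odot> b"
        by (rule cancel[rotated 4]) (use ab(1,2) ab' PB(1,2,5) i(2) in simp_all)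
      then show "\<exists>h. h \<in> Arr C \<and> Dom C h = Dom C b \<and> Cod C h = Dom C q \<and> p \<odot> h = a \<and> q \<odot> h = b"
        using pullback_ex[OF pb ab(1-3) ab'] by metis
    next
      show "h = h'" if "h \<in> Arr C" "h' \<in> Arr C" "Dom C h = Dom C h'" "Cod C h = Dom C q" "Cod C h' = Dom C q"
        "p \<odot> h = p \<odot> h'" "q \<odot> h = q \<odot> h'" for h h' using pullback_unique[OF pb that] .
    qed (use PB ia i(2,3) \<eta>[OF Q] in simp_all)
    have "i \<odot> f \<in> hom C (Dom C f) (fob L ?Q)"
      using PB(1,5) ia i(2,3) \<eta>[OF Q] by (simp add: hom_def)
    note lpb = pres[OF Q fS this pb']
    interpret FS: category "full_subcat C S" using full_subcat_category[OF S] .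
    have LQ: "fob L ?Q \<in> Obj C" using LS[OF Q] S by auto
    have iso_mem: "is_iso C (\<eta> B)" if "B \<in> S" for B
      using universal_arrow_iso_of_mem[OF S u] \<eta>(2) that S by auto
    \<comment> \<open>By naturality both sides agree after precomposition with the unit at
      \<open>?Q\<close>.\<close>
    have "far L (\<eta> ?Q) = \<eta> (fob L ?Q)"
      using nat[OF \<eta>(1)[OF Q]] \<eta>[OF Q] \<eta>[OF LQ] Larr[OF \<eta>(1)[OF Q]] LS[OF LQ]
      by - (rule universal_arrow_unique[OF u[OF Q]], simp_all)
    then have "is_iso (full_subcat C S) (far L (\<eta> ?Q))"
      using iso_mem[OF LS[OF Q]] full_subcat_iso[OF S] \<eta>[OF LQ] LS[OF Q] LS[OF LQ] by simp
    then have Lp: "is_iso C (far L p)"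
      using FS.pullback_iso[OF lpb] full_subcat_iso[OF S] by blast
    have po: "Dom C p \<in> Obj C" "Cod C p \<in> Obj C" using PB(3) dom_obj cod_obj by auto
    have 1: "universal_arrow_to C S (far L p \<odot> \<eta> (Dom C p))"
      by (rule universal_arrow_comp_iso[OF u[OF po(1)] Lp]) (use Larr[OF PB(3)] \<eta>[OF po(1)] LS[OF po(2)] in simp_all)
    have cS: "Cod C p \<in> S" using PB(7) fS by simp
    obtain k where k: "is_iso C k" "Dom C k = Cod C (\<eta> (Cod C p))" "Cod C k = Dom C (\<eta> (Cod C p))"
      "k \<odot> \<eta> (Cod C p) = Id C (Dom C (\<eta> (Cod C p)))" using iso_inverse[OF iso_mem[OF cS]] by metis
    have ka: "k \<in> Arr C" using k(1) unfolding is_iso_def by auto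
    have 2: "universal_arrow_to C S (\<eta> (Cod C p) \<odot> p)" using 1 nat[OF PB(3)] by simp
    have "universal_arrow_to C S (k \<odot> \<eta> (Cod C p) \<odot> p)"
      by (rule universal_arrow_comp_iso[OF 2 k(1)]) (use k(2,3) \<eta>[OF po(2)] PB(3) cS in simp_all)
    moreover have "k \<odot> \<eta> (Cod C p) \<odot> p = p"
      using extend1[OF k(4), of p] ka k(2,3) \<eta>[OF po(2)] PB(3) by simp
    ultimately show ?thesis by simp
  qed
qed

end


section \<open>The embedding into the exact completion and its reflector\<close>

context regular_category
begin

abbreviation unit_arr where "unit_arr f \<equiv> far (ex_reg_unit C) f"

lemma unit_arr_simps:
  "unit_arr f = (unit_obj (Dom C f), rel_class C (Id C (Dom C f)) f, unit_obj (Cod C f))"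
  unfolding ex_reg_unit_def Let_def by simp

lemma unit_arr:
  assumes f: "f \<in> Arr C"
  shows "unit_arr f \<in> Arr EC" "Dom EC (unit_arr f) = unit_obj (Dom C f)" "Cod EC (unit_arr f) = unit_obj (Cod C f)"
    "E (unit_arr f) = graph C f"
proof -
  note D = unit_obj[OF dom_obj[OF f]] and T = unit_obj[OF cod_obj[OF f]]
  show E: "E (unit_arr f) = graph C f"
    unfolding unit_arr_simps using el_rel_class[OF graph_relation[OF f]] graph_eq_spans[OF f] by simp
  show d: "Dom EC (unit_arr f) = unit_obj (Dom C f)" "Cod EC (unit_arr f) = unit_obj (Cod C f)"
    unfolding unit_arr_simps ex_reg_simps by simp_all
  obtain \<phi> where \<phi>: "\<phi> \<in> Arr EC" "Dom EC \<phi> = unit_obj (Dom C f)" "Cod EC \<phi> = unit_obj (Cod C f)" "E \<phi> = graph C f"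
    by (rule graph_arrow[OF D(1) f D(2)[symmetric]]) (auto simp: D(3))
  have "fst (snd (unit_arr f)) \<in> Rel C (Dom C f) (Cod C f)"
    using graph_relation[OF f] unfolding Rel_def unit_arr_simps by auto
  then have "fst (snd (unit_arr f)) = fst (snd \<phi>)"
    using ex_arrD(3)[OF \<phi>(1)] \<phi> E D(2) T(2) Rel_iff by metis
  then have "unit_arr f = \<phi>" using d \<phi>(2,3) unfolding ex_reg_simps by (simp add: prod_eq_iff)
  then show "unit_arr f \<in> Arr EC" using \<phi>(1) by simp
qed

text \<open>A map into a discrete object is single-valued on the nose. Its value at the generic
  element exists at first only on a cover \<open>e\<close>, but single-valuedness makes that value
  compatible with the pair coequalized by \<open>e\<close>, so it descends to an arrow
  \<open>k\<close>.\<close>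

lemma to_unit:
  assumes \<phi>: "\<phi> \<in> Arr EC" "Cod EC \<phi> = unit_obj Y" and Y: "Y \<in> Obj C"
  obtains k where "k \<in> Arr C" "Dom C k = fst (Dom EC \<phi>)" "Cod C k = Y" "E \<phi> = graph C k"
    "\<And>x x'. (x, x') \<in> eqv (Dom EC \<phi>) \<Longrightarrow> k \<odot> x = k \<odot> x'"
proof -
  let ?A = "Dom EC \<phi>"
  note T = unit_obj[OF Y] and A = ex_arrD(1)[OF \<phi>(1)]
  note R = eqvD[OF A]
  have o: "fst ?A \<in> Obj C" using span_relation_objs(1)[OF R(1)] .
  let ?i = "Id C (fst ?A)"
  have i: "?i \<in> Arr C" "Cod C ?i = fst ?A" "Dom C ?i = fst ?A" using o by simp_all
  obtain e y where e: "e \<in> Arr C" "regular_epi C e" "Cod C e = Dom C ?i" "(?i \<odot> e, y) \<in> E \<phi>"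
    using ex_total[OF \<phi>(1) i(1,2)] by metis
  then have ey: "(e, y) \<in> E \<phi>" "Cod C e = fst ?A" using i by simp_all
  note ty = ex_mem[OF \<phi>(1) ey(1)]
  obtain f g where c: "is_coequalizer C f g e" using e(2) unfolding regular_epi_def by blast
  note c' = coequalizerD[OF c]
  have "(e \<odot> f, y \<odot> f) \<in> E \<phi>" "(e \<odot> g, y \<odot> g) \<in> E \<phi>"
    by (rule ex_restrict[OF \<phi>(1) ey(1)]; use c' ty in simp)+
  then have "(y \<odot> f, y \<odot> g) \<in> eqv (Cod EC \<phi>)" using ex_single[OF \<phi>(1)] c'(7) by simp
  then have "y \<odot> f = y \<odot> g" unfolding \<phi>(2) T(3) by simp
  then obtain k where k: "k \<in> Arr C" "Dom C k = Cod C e" "Cod C k = Cod C y" "k \<odot> e = y"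
    using coequalizer_ex[OF c ty(2)] ty(3) by metis
  have kY: "Cod C k = Y" using k(3) ty(5) \<phi>(2) T(2) by simp
  have "(?i \<odot> e, k \<odot> e) \<in> E \<phi>" using e(4) k(4) by simp
  then have ik: "(?i, k) \<in> E \<phi>" by (rule ex_local[OF \<phi>(1) _ e(2)]) (use k ey i in simp_all)
  have xk: "(x, k \<odot> x) \<in> E \<phi>" if "x \<in> Arr C" "Cod C x = fst ?A" for x
    using ex_restrict[OF \<phi>(1) ik that(1)] that k(2) ey(2) by simp
  have g: "E \<phi> = graph C k"
  proof (intro set_eqI iffI; clarify)
    fix x z assume xz: "(x, z) \<in> E \<phi>"
    note tx = ex_mem[OF \<phi>(1) xz]
    have "(k \<odot> x, z) \<in> eqv (Cod EC \<phi>)" using ex_single[OF \<phi>(1) xk[OF tx(1,4)] xz] .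
    then have "z = k \<odot> x" unfolding \<phi>(2) T(3) by simp
    then show "(x, z) \<in> graph C k" unfolding graph_iff using tx k(2) ey(2) by simp
  next
    fix x z assume "(x, z) \<in> graph C k"
    then show "(x, z) \<in> E \<phi>" unfolding graph_iff using xk k(2) ey(2) by auto
  qed
  have "k \<odot> x = k \<odot> x'" if xx': "(x, x') \<in> eqv ?A" for x x'
  proof -
    note tx = span_relationD[OF R(1) xx']
    have "(x, k \<odot> x') \<in> E \<phi>" using ex_left[OF \<phi>(1) xx' xk[OF tx(2,5)]] .
    then show ?thesis unfolding g graph_iff by simp
  qed
  then show ?thesis using that k kY ey(2) g by simp
qed

lemma graph_inj:
  assumes "f \<in> Arr C" "g \<in> Arr C" "Dom C f = Dom C g" "graph C f = graph C g"
  shows "f = g"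
proof -
  have "(Id C (Dom C f), f) \<in> graph C f" unfolding graph_iff using assms dom_obj[OF assms(1)] by simp
  then show ?thesis unfolding assms(4) graph_iff using assms dom_obj[OF assms(2)] by simp
qed

lemma unit_fully_faithful: "fully_faithful C EC (ex_reg_unit C)"
  unfolding fully_faithful_def
proof (intro conjI ballI)
  show "is_functor C EC (ex_reg_unit C)"
    unfolding is_functor_def
  proof (intro conjI ballI impI)
    show "unit_obj A \<in> Obj EC" if "A \<in> Obj C" for A using unit_obj(1)[OF that] .
    show "unit_arr f \<in> hom EC (unit_obj A) (unit_obj B)" if "f \<in> hom C A B" for f A B
      using unit_arr[of f] that by (auto simp: hom_def)
    show "unit_arr (Id C A) = Id EC (unit_obj A)" if "A \<in> Obj C" for A
      unfolding ex_reg_simps ex_reg_unit_def Let_def using that by simp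
    show "unit_arr (g \<odot> f) = unit_arr g \<star> unit_arr f" if fg: "f \<in> Arr C" "g \<in> Arr C" "Dom C g = Cod C f" for f g
    proof -
      have a: "g \<odot> f \<in> Arr C" using fg by simp
      note u = unit_arr[OF fg(1)] unit_arr[OF fg(2)] unit_arr[OF a]
      have "unit_arr g \<star> unit_arr f = unit_arr (g \<odot> f)"
      proof (rule ex_comp_eqI)
        show "(x, z) \<in> E (unit_arr (g \<odot> f))" if "(x, y) \<in> E (unit_arr f)" "(y, z) \<in> E (unit_arr g)" for x y z
          using that fg unfolding u graph_iff by auto
      qed (use u fg in simp_all)
      then show ?thesis by simp
    qed
  qed
  fix A B assume AB: "A \<in> Obj C" "B \<in> Obj C"
  show "bij_betw unit_arr (hom C A B) (hom EC (unit_obj A) (unit_obj B))"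
    unfolding bij_betw_def
  proof
    show "inj_on unit_arr (hom C A B)"
    proof (rule inj_onI)
      fix f g assume fg: "f \<in> hom C A B" "g \<in> hom C A B" "unit_arr f = unit_arr g"
      then have "graph C f = graph C g" using unit_arr(4)[of f] unit_arr(4)[of g] by (auto simp: hom_def)
      then show "f = g" using fg by (intro graph_inj) (auto simp: hom_def)
    qed
    show "unit_arr ` hom C A B = hom EC (unit_obj A) (unit_obj B)"
    proof
      show "unit_arr ` hom C A B \<subseteq> hom EC (unit_obj A) (unit_obj B)"
        using unit_arr by (auto simp: hom_def)
      show "hom EC (unit_obj A) (unit_obj B) \<subseteq> unit_arr ` hom C A B"
      proof
        fix \<phi> assume "\<phi> \<in> hom EC (unit_obj A) (unit_obj B)"
        then have \<phi>: "\<phi> \<in> Arr EC" "Dom EC \<phi> = unit_obj A" "Cod EC \<phi> = unit_obj B" by (auto simp: hom_def)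
        obtain k where k: "k \<in> Arr C" "Dom C k = A" "Cod C k = B" "E \<phi> = graph C k"
          using to_unit[OF \<phi>(1,3) AB(2)] unit_obj(2)[OF AB(1)] \<phi>(2) by metis
        have "\<phi> = unit_arr k" by (rule ex_arr_eqI) (use \<phi> k unit_arr[OF k(1)] in simp_all)
        then show "\<phi> \<in> unit_arr ` hom C A B" using k by (auto simp: hom_def)
      qed
    qed
  qed
qed

text \<open>By \<open>to_unit\<close>, a map to a discrete object is an arrow \<open>k\<close> of
  the base invariant under the equivalence. As \<open>(s1, s2)\<close> is an element of the
  equivalence, \<open>k\<close> factors through \<open>q\<close>. Stating this for a mere element
  makes it apply directly to the pulled-back pair in the stability argument.\<close>

lemma universal_from_coequalizer:
  assumes m: "m \<in> Arr EC" "E m = graph C q" "Cod EC m = unit_obj (Cod C q)"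
    and q: "is_coequalizer C s1 s2 q" "Dom C q = fst (Dom EC m)"
    and s: "(s1, s2) \<in> eqv (Dom EC m)"
  shows "universal_arrow_to EC (unit_obj ` Obj C) m"
proof -
  let ?A = "Dom EC m"
  note q' = coequalizerD[OF q(1)] and A = ex_arrD(1)[OF m(1)]
  have Qo: "Cod C q \<in> Obj C" using q' cod_obj by simp
  have im: "(x, q \<odot> x) \<in> E m" if "x \<in> Arr C" "Cod C x = Dom C q" for x
    unfolding m(2) graph_iff using that by simp
  show ?thesis
  proof (rule category.universal_arrowI[OF ex_category m(1)])
    show "Cod EC m \<in> unit_obj ` Obj C" using m(3) Qo by simp
    fix h assume h: "h \<in> Arr EC" "Dom EC h = ?A" "Cod EC h \<in> unit_obj ` Obj C"
    then obtain Y where Y: "Y \<in> Obj C" "Cod EC h = unit_obj Y" by auto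
    obtain k where k: "k \<in> Arr C" "Dom C k = fst ?A" "Cod C k = Y" "E h = graph C k"
      "\<And>x x'. (x, x') \<in> eqv ?A \<Longrightarrow> k \<odot> x = k \<odot> x'" using to_unit[OF h(1) Y(2,1)] h(2) by metis
    obtain l where l: "l \<in> Arr C" "Dom C l = Cod C q" "Cod C l = Cod C k" "l \<odot> q = k"
      using coequalizer_ex[OF q(1) k(1) _ k(5)[OF s]] k(2) q(2) by metis
    note u = unit_arr[OF l(1)]
    have "unit_arr l \<star> m = h"
    proof (rule ex_comp_eqI)
      show "(x, z) \<in> E h" if "(x, y) \<in> E m" "(y, z) \<in> E (unit_arr l)" for x y z
        using that unfolding m(2) k(4) u(4) graph_iff using l q' q(2) k(2) by auto
    qed (use u m h l k Y in simp_all)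
    then show "\<exists>k. k \<in> Arr EC \<and> Dom EC k = Cod EC m \<and> Cod EC k = Cod EC h \<and> k \<star> m = h"
      using u l k(3) Y m(3) by (intro exI[of _ "unit_arr l"]) simp
  next
    fix k k' assume k: "k \<in> Arr EC" "k' \<in> Arr EC" "Dom EC k = Cod EC m" "Dom EC k' = Cod EC m"
      "Cod EC k = Cod EC k'" "Cod EC k' \<in> unit_obj ` Obj C" "k \<star> m = k' \<star> m"
    then obtain Y where Y: "Y \<in> Obj C" "Cod EC k' = unit_obj Y" by auto
    obtain l where l: "l \<in> Arr C" "Dom C l = Cod C q" "E k = graph C l"
      using to_unit[OF k(1) _ Y(1)] k(3,5) m(3) Y(2) unit_obj(2)[OF Qo] by metis
    obtain l' where l': "l' \<in> Arr C" "Dom C l' = Cod C q" "E k' = graph C l'"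
      using to_unit[OF k(2) Y(2,1)] k(4) m(3) unit_obj(2)[OF Qo] by metis
    have o: "Dom C q \<in> Obj C" using q' dom_obj by simp
    have "(Id C (Dom C q), q) \<in> E m" using im[of "Id C (Dom C q)"] q' o by simp
    moreover have "(q, l \<odot> q) \<in> E k" unfolding l(3) graph_iff using q' l by simp
    ultimately have "(Id C (Dom C q), l \<odot> q) \<in> E (k' \<star> m)"
      unfolding k(7)[symmetric] by (rule ex_comp_intro[OF m(1) k(1,3)])
    then have "(q, l \<odot> q) \<in> E k'"
      by (rule ex_comp_elim[OF m(1) k(2,4)]) (use im[of "Id C (Dom C q)"] q' o in simp)
    then have "l \<odot> q = l' \<odot> q" unfolding l'(3) graph_iff by simp
    then have "l = l'" using coequalizer_epi[OF q(1) l(1) l'(1) l(2) l'(2)] by simp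
    then show "k = k'" using l l' k by (intro ex_arr_eqI) simp_all
  qed
qed

theorem unit_semi_localization:
  assumes st: "has_stable_coequalizers_of_equivalence_relations C"
  shows "\<exists>L \<eta>. semi_localization EC (unit_obj ` Obj C) L \<eta> \<and> (\<forall>A \<in> Obj EC. regular_epi EC (\<eta> A))"
proof -
  interpret EC: category EC by (rule ex_category)
  \<comment> \<open>Besides regular epimorphy, \<open>P\<close> records that the universal arrow is
    the graph of a chosen coequalizer of the equivalence relation; stability under pullback is
    checked from this description.\<close>
  define P where "P m \<longleftrightarrow> regular_epi EC m \<and> (\<exists>q r1 r2. is_coequalizer C r1 r2 q \<and> Dom C q = fst (Dom EC m) \<and>
    equivalence_relation C (Dom C q) r1 r2 \<and> eqv (Dom EC m) = spans C r1 r2 \<and> E m = graph C q \<and>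
    Cod EC m = unit_obj (Cod C q))" for m
  have "\<exists>L \<eta>. semi_localization EC (unit_obj ` Obj C) L \<eta> \<and> (\<forall>A \<in> Obj EC. P (\<eta> A))"
  proof (rule EC.semi_localizationI)
    show "unit_obj ` Obj C \<subseteq> Obj EC" using unit_obj(1) by blast
  next
    fix A assume A: "A \<in> Obj EC"
    then obtain r1 r2 where r: "A = (fst A, rel_class C r1 r2)" "equivalence_relation C (fst A) r1 r2"
      unfolding ex_reg_simps ex_objects_def by auto
    have rel: "is_relation C (fst A) (fst A) r1 r2" using r(2) equivalence_relation_iff by blast
    have sp: "eqv A = spans C r1 r2" using el_rel_class[OF rel] r(1) by (metis snd_conv)
    obtain q where q: "is_coequalizer C r1 r2 q"
      using st r(2) unfolding has_stable_coequalizers_of_equivalence_relations_def by blast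
    note q' = coequalizerD[OF q] and R = relationD[OF rel]
    have dq: "Dom C q = fst A" using q' R by simp
    have inv: "q \<odot> x = q \<odot> x'" if xx': "(x, x') \<in> eqv A" for x x'
    proof -
      obtain t where t: "t \<in> Arr C" "Cod C t = Dom C r1" "r1 \<odot> t = x" "r2 \<odot> t = x'"
        using xx' unfolding sp by (rule spansE)
      have "q \<odot> r1 \<odot> t = q \<odot> r2 \<odot> t" by (rule extend[OF q'(7)]) (use t(1,2) q' in simp_all)
      then show ?thesis using t by simp
    qed
    obtain m where m: "m \<in> Arr EC" "Dom EC m = A" "Cod EC m = unit_obj (Cod C q)" "E m = graph C q"
      using graph_arrow[OF A q'(3) dq inv] .
    have "(r1, r2) \<in> eqv A"
      unfolding sp using R dom_obj[OF R(1)] by (intro spansI[of "Id C (Dom C r1)"]) simp_all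
    then have u: "universal_arrow_to EC (unit_obj ` Obj C) m"
      using universal_from_coequalizer[OF m(1,4,3) q] dq m(2) by simp
    have "ex_surjective m"
      unfolding ex_surjective_def
    proof (intro ballI impI)
      fix y assume y: "y \<in> Arr C" "Cod C y = fst (Cod EC m)"
      have re: "regular_epi C q" using q unfolding regular_epi_def by blast
      have "Cod C y = Cod C q" using y m(3) unit_obj(2)[OF cod_obj[OF q'(3)]] by simp
      then obtain d x where d: "regular_epi C d" "Cod C d = Dom C y" "x \<in> Arr C" "Dom C x = Dom C d"
        "Cod C x = Dom C q" "q \<odot> x = y \<odot> d" by (rule cover_pullback[OF re y(1)])
      then show "\<exists>e x. regular_epi C e \<and> Cod C e = Dom C y \<and> (x, y \<odot> e) \<in> E m"
        unfolding m(4) graph_iff by (intro exI[of _ d] exI[of _ x]) simp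
    qed
    then have "regular_epi EC m" using ex_regular_epi_iff[OF m(1)] by simp
    then have "P m" unfolding P_def using q dq m r(2) sp by (intro conjI exI[of _ q] exI[of _ r1] exI[of _ r2]) simp_all
    then show "\<exists>m. universal_arrow_to EC (unit_obj ` Obj C) m \<and> Dom EC m = A \<and> P m"
      using u m(2) by blast
  next
    fix m f p' q' assume um: "universal_arrow_to EC (unit_obj ` Obj C) m" and Pm: "P m"
      and fS: "Dom EC f \<in> unit_obj ` Obj C" and pb: "is_pullback EC f m p' q'"
    note PB = EC.pullbackD[OF pb]
    obtain q r1 r2 where q: "is_coequalizer C r1 r2 q" "Dom C q = fst (Dom EC m)" and er: "equivalence_relation C (Dom C q) r1 r2"
      and sp: "eqv (Dom EC m) = spans C r1 r2" and m: "E m = graph C q" "Cod EC m = unit_obj (Cod C q)"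
      using Pm unfolding P_def by blast
    note co = coequalizerD[OF q(1)]
    have Qo: "Cod C q \<in> Obj C" using co cod_obj by simp
    obtain Y where Y: "Y \<in> Obj C" "Dom EC f = unit_obj Y" using fS by auto
    obtain f0 where f0: "f0 \<in> Arr C" "Dom C f0 = Y" "Cod C f0 = Cod C q" "E f = graph C f0"
      using to_unit[OF PB(1) _ Qo] PB(5) m(2) unit_obj(2)[OF Y(1)] Y(2) by metis
    obtain p0 q0 where pb0: "is_pullback C q f0 p0 q0" using pullbacks[OF co(3) f0(1)] f0(3) by auto
    note P0 = pullbackD[OF pb0]
    have rel0: "is_relation C (fst (Dom EC f)) (fst (Dom EC m)) q0 p0"
      by (rule relationI) (use P0 f0(2) q(2) Y unit_obj(2)[OF Y(1)] pullback_unique[OF pb0] in auto)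
    \<comment> \<open>The pullback of \<open>q\<close> along \<open>f0\<close> taken in the base
      tabulates the relation required by \<open>ex_pullback\<close>, so the pullback in the
      completion is carried by the same object.\<close>
    have sp0: "spans C q0 p0 = local_closure C (E f O (E m)\<inverse>)"
    proof
      show "spans C q0 p0 \<subseteq> local_closure C (E f O (E m)\<inverse>)"
      proof clarify
        fix y x assume yx: "(y, x) \<in> spans C q0 p0"
        note ty = spansD[OF rel0 yx]
        obtain t where t: "t \<in> Arr C" "Cod C t = Dom C q0" "q0 \<odot> t = y" "p0 \<odot> t = x" using yx by (rule spansE)
        have "q \<odot> p0 \<odot> t = f0 \<odot> q0 \<odot> t" by (rule extend[OF P0(9)]) (use t(1,2) P0 in simp_all)
        then have "q \<odot> x = f0 \<odot> y" using t by simp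
        then have "(y, x) \<in> E f O (E m)\<inverse>"
          unfolding f0(4) m(1) using ty q(2) f0(2) Y unit_obj(2)[OF Y(1)] by (intro relcompI[of _ "f0 \<odot> y"]) (simp_all add: graph_iff)
        then show "(y, x) \<in> local_closure C (E f O (E m)\<inverse>)" by (rule subset_local_closure[OF _ ty(1-3)])
      qed
      show "local_closure C (E f O (E m)\<inverse>) \<subseteq> spans C q0 p0"
      proof (rule local_closure_subset[OF span_relationI[OF rel0]]; clarify)
        fix y z x assume yz: "(y, z) \<in> E f" and xz: "(x, z) \<in> E m"
        then have yx: "y \<in> Arr C" "Cod C y = Dom C f0" "z = f0 \<odot> y" "x \<in> Arr C" "Cod C x = Dom C q" "z = q \<odot> x"
          unfolding f0(4) m(1) graph_iff by simp_all
        have "Dom C x = Dom C y" using ex_mem(3)[OF PB(1) yz] ex_mem(3)[OF PB(2) xz] by simp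
        then obtain t where "t \<in> Arr C" "Cod C t = Dom C q0" "p0 \<odot> t = x" "q0 \<odot> t = y"
          using pullback_ex[OF pb0 yx(4,1) _ yx(5,2)] yx(3,6) by metis
        then show "(y, x) \<in> spans C q0 p0" using spansI by blast
      qed
    qed
    obtain \<pi>1 \<pi>2 where \<pi>: "is_pullback EC f m \<pi>1 \<pi>2" "fst (Dom EC \<pi>1) = Dom C q0"
      "\<And>t t'. (t, t') \<in> eqv (Dom EC \<pi>1) \<longleftrightarrow> t \<in> Arr C \<and> t' \<in> Arr C \<and> Cod C t = Dom C q0 \<and> Cod C t' = Dom C q0 \<and>
       (q0 \<odot> t, q0 \<odot> t') \<in> eqv (Dom EC f) \<and> (p0 \<odot> t, p0 \<odot> t') \<in> eqv (Dom EC m)"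
      "\<And>t x. (t, x) \<in> E \<pi>1 \<longleftrightarrow> t \<in> Arr C \<and> Cod C t = Dom C q0 \<and> (q0 \<odot> t, x) \<in> eqv (Dom EC f)"
      using ex_pullback[OF PB(1,2,5) rel0 sp0] by metis
    note \<Pi> = EC.pullbackD[OF \<pi>(1)]
    \<comment> \<open>The domain of \<open>f\<close> is discrete, so the first projection is exactly
      the graph of \<open>q0\<close>.\<close>
    have g1: "E \<pi>1 = graph C q0"
    proof (intro set_eqI; clarify)
      fix t x show "(t, x) \<in> E \<pi>1 \<longleftrightarrow> (t, x) \<in> graph C q0"
        unfolding \<pi>(4) graph_iff Y(2) unit_obj(3)[OF Y(1)] using P0(4,8) f0(2) by auto
    qed
    have qr: "q \<odot> r1 \<in> Arr C" "Cod C (q \<odot> r1) = Cod C f0" "Dom C (q \<odot> r1) = Dom C r1" using co f0(3) by simp_all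
    obtain u v where uv: "is_pullback C (q \<odot> r1) f0 u v" using pullbacks[OF qr(1) f0(1) qr(2)] by blast
    note UV = pullbackD[OF uv]
    have uvt: "u \<in> Arr C" "v \<in> Arr C" "Dom C u = Dom C v" "Cod C u = Dom C r1" "Cod C v = Dom C f0"
      using UV qr by simp_all
    have e1: "q \<odot> r1 \<odot> u = f0 \<odot> v" using UV(9) uvt co(1-6) by simp
    have "q \<odot> r1 \<odot> u = q \<odot> r2 \<odot> u" by (rule extend[OF co(7)]) (use co(1-6) uvt in simp_all)
    then have e2: "q \<odot> r2 \<odot> u = f0 \<odot> v" using e1 by simp
    obtain s1 where s1: "s1 \<in> Arr C" "Dom C s1 = Dom C v" "Cod C s1 = Dom C q0" "p0 \<odot> s1 = r1 \<odot> u" "q0 \<odot> s1 = v"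
      by (rule pullback_ex[OF pb0 _ _ _ _ _ e1]) (use uvt co in simp_all)
    obtain s2 where s2: "s2 \<in> Arr C" "Dom C s2 = Dom C v" "Cod C s2 = Dom C q0" "p0 \<odot> s2 = r2 \<odot> u" "q0 \<odot> s2 = v"
      by (rule pullback_ex[OF pb0 _ _ _ _ _ e2]) (use uvt co in simp_all)
    have "s1 \<in> hom C (Dom C u) (Dom C p0)" "s2 \<in> hom C (Dom C u) (Dom C p0)"
      using s1 s2 uvt P0(6) by (simp_all add: hom_def)
    then have cq0: "is_coequalizer C s1 s2 q0"
      using st er q(1) pb0 uv s1 s2 unfolding has_stable_coequalizers_of_equivalence_relations_def by blast
    have "(r1 \<odot> u, r2 \<odot> u) \<in> spans C r1 r2" using uvt by (intro spansI[of u]) simp_all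
    then have ss: "(s1, s2) \<in> eqv (Dom EC \<pi>1)"
      unfolding \<pi>(3) Y(2) unit_obj(3)[OF Y(1)] sp using s1 s2 uvt f0(2) by simp
    have "universal_arrow_to EC (unit_obj ` Obj C) \<pi>1"
      by (rule universal_from_coequalizer[OF \<Pi>(3) g1 _ cq0 _ ss]) (use \<Pi>(7) P0(8) f0(2) Y(2) \<pi>(2) in simp_all)
    moreover obtain i where "is_iso EC i" "Cod EC i = Dom EC \<pi>1" "\<pi>1 \<star> i = p'"
      using EC.pullback_comparison_iso[OF \<pi>(1) pb] by metis
    ultimately show "universal_arrow_to EC (unit_obj ` Obj C) p'"
      using EC.universal_arrow_precomp_iso by metis
  qed
  then show ?thesis unfolding P_def by blast
qed

end


section \<open>Semi-localizations of exact Mal'tsev categories\<close>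

context category
begin

text \<open>The elements of a kernel pair are the pairs with equal composites under
  \<open>f\<close>, and equality is an equivalence relation.\<close>

lemma kernel_pair_equivalence:
  assumes pb: "is_kernel_pair C f p q"
  shows "equivalence_relation C (Dom C f) p q"
proof -
  note P = pullbackD[OF pb]
  have rel: "is_relation C (Dom C f) (Dom C f) p q"
    by (rule relationI) (use P pullback_unique[OF pb] in auto)
  have sp: "(a, b) \<in> spans C p q \<longleftrightarrow> a \<in> Arr C \<and> b \<in> Arr C \<and> Dom C a = Dom C b \<and> Cod C a = Dom C f \<and> Cod C b = Dom C f \<and>
      f \<odot> a = f \<odot> b" for a b
  proof
    assume ab: "(a, b) \<in> spans C p q"
    then obtain x where x: "x \<in> Arr C" "Cod C x = Dom C p" "p \<odot> x = a" "q \<odot> x = b" by (rule spansE)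
    have "f \<odot> p \<odot> x = f \<odot> q \<odot> x" by (rule extend[OF P(9)]) (use x(1,2) P in simp_all)
    then show "a \<in> Arr C \<and> b \<in> Arr C \<and> Dom C a = Dom C b \<and> Cod C a = Dom C f \<and> Cod C b = Dom C f \<and> f \<odot> a = f \<odot> b"
      using spansD[OF rel ab] x by simp
  next
    assume "a \<in> Arr C \<and> b \<in> Arr C \<and> Dom C a = Dom C b \<and> Cod C a = Dom C f \<and> Cod C b = Dom C f \<and> f \<odot> a = f \<odot> b"
    then obtain h where "h \<in> Arr C" "Cod C h = Dom C q" "p \<odot> h = a" "q \<odot> h = b"
      using pullback_ex[OF pb, of a b] by blast
    then show "(a, b) \<in> spans C p q" using spansI[of h p a b q] P(6) by simp
  qed
  have "span_equivalence C (Dom C f) (spans C p q)"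
    unfolding span_equivalence_def
  proof (intro conjI ballI impI span_relationI[OF rel])
    show "sym (spans C p q)" by (rule symI) (unfold sp, auto)
    show "trans (spans C p q)" by (rule transI) (unfold sp, auto)
  qed (unfold sp, auto)
  then show ?thesis unfolding equivalence_relation_iff using rel by blast
qed

end

text \<open>Applies stability to the kernel pair of \<open>e\<close>, an equivalence relation whose
  coequalizer is \<open>e\<close> itself.\<close>

lemma (in finitely_complete_category) regular_from_stable_coequalizers:
  assumes st: "has_stable_coequalizers_of_equivalence_relations C"
  shows "regular_category C"
proof
  show "\<exists>e. is_coequalizer C p q e" if "is_kernel_pair C f p q" for f p q
    using st kernel_pair_equivalence[OF that] unfolding has_stable_coequalizers_of_equivalence_relations_def by blast
next
  fix e f p q assume e: "regular_epi C e" and pb: "is_pullback C e f p q"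
  note P = pullbackD[OF pb]
  obtain r1 r2 where r: "is_kernel_pair C e r1 r2" using pullbacks[OF P(1,1)] by blast
  note R = pullbackD[OF r]
  have co: "is_coequalizer C r1 r2 e" by (rule regular_epi_coequalizer_kernel_pair[OF e r])
  have er: "e \<odot> r1 \<in> Arr C" "Cod C (e \<odot> r1) = Cod C f" "Dom C (e \<odot> r1) = Dom C r1" using R P by simp_all
  obtain u v where uv: "is_pullback C (e \<odot> r1) f u v" using pullbacks[OF er(1) P(2) er(2)] by blast
  note UV = pullbackD[OF uv]
  have uvt: "u \<in> Arr C" "v \<in> Arr C" "Dom C u = Dom C v" "Cod C u = Dom C r1" "Cod C v = Dom C f" using UV er by simp_all
  have e1: "e \<odot> r1 \<odot> u = f \<odot> v" using UV(9) uvt R(1-8) by simp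
  have "e \<odot> r1 \<odot> u = e \<odot> r2 \<odot> u" by (rule extend[OF R(9)]) (use R uvt in simp_all)
  then have e2: "e \<odot> r2 \<odot> u = f \<odot> v" using e1 by simp
  obtain s1 where s1: "s1 \<in> Arr C" "Dom C s1 = Dom C v" "Cod C s1 = Dom C q" "p \<odot> s1 = r1 \<odot> u" "q \<odot> s1 = v"
    by (rule pullback_ex[OF pb _ _ _ _ _ e1]) (use uvt R in simp_all)
  obtain s2 where s2: "s2 \<in> Arr C" "Dom C s2 = Dom C v" "Cod C s2 = Dom C q" "p \<odot> s2 = r2 \<odot> u" "q \<odot> s2 = v"
    by (rule pullback_ex[OF pb _ _ _ _ _ e2]) (use uvt R in simp_all)
  have "s1 \<in> hom C (Dom C u) (Dom C p)" "s2 \<in> hom C (Dom C u) (Dom C p)"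
    using s1 s2 uvt P(6) by (simp_all add: hom_def)
  then have "is_coequalizer C s1 s2 q"
    using st kernel_pair_equivalence[OF r] co pb uv s1 s2 unfolding has_stable_coequalizers_of_equivalence_relations_def by blast
  then show "regular_epi C q" unfolding regular_epi_def by blast
qed

text \<open>Common setting for (b) and (d): in the first \<open>U\<close> is an equivalence followed
  by an inclusion, in the second the unit of the completion. Universality refers to the literal
  image of \<open>U\<close>, which need not be closed under isomorphism.\<close>

locale semi_left_exact_embedding = X: category X + D: category D
  for X :: "('o, 'm) cat" and D :: "('p, 'n) cat" and U :: "('o, 'm, 'p, 'n) func" +
  assumes ff: "fully_faithful X D U"
    and units: "\<And>Q. Q \<in> Obj D \<Longrightarrow> \<exists>m. universal_arrow_to D (fob U ` Obj X) m \<and> Dom D m = Q"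
    and semi_left_exact: "\<And>m f p q. \<lbrakk>universal_arrow_to D (fob U ` Obj X) m; Dom D f \<in> fob U ` Obj X;
       is_pullback D f m p q\<rbrakk> \<Longrightarrow> universal_arrow_to D (fob U ` Obj X) p"
begin

abbreviation comp_X (infixr \<open>\<odot>\<close> 70) where "g \<odot> f \<equiv> g \<cdot>\<^bsub>X\<^esub> f"
abbreviation comp_D (infixr \<open>\<bullet>\<close> 70) where "g \<bullet> f \<equiv> g \<cdot>\<^bsub>D\<^esub> f"
abbreviation "universal \<equiv> universal_arrow_to D (fob U ` Obj X)"

lemma U_arr:
  assumes "f \<in> Arr X"
  shows "far U f \<in> Arr D" "Dom D (far U f) = fob U (Dom X f)" "Cod D (far U f) = fob U (Cod X f)"
  using ff assms X.dom_obj[OF assms] X.cod_obj[OF assms] unfolding fully_faithful_def is_functor_def hom_def by blast+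

lemma U_comp: "\<lbrakk>f \<in> Arr X; g \<in> Arr X; Dom X g = Cod X f\<rbrakk> \<Longrightarrow> far U (g \<odot> f) = far U g \<bullet> far U f"
  using ff unfolding fully_faithful_def is_functor_def by blast

lemma U_obj: "A \<in> Obj X \<Longrightarrow> fob U A \<in> Obj D"
  using ff unfolding fully_faithful_def is_functor_def by blast

lemma U_inj:
  assumes "f \<in> Arr X" "g \<in> Arr X" "Dom X f = Dom X g" "Cod X f = Cod X g" "far U f = far U g"
  shows "f = g"
proof -
  have "inj_on (far U) (hom X (Dom X f) (Cod X f))"
    using ff X.dom_obj[OF assms(1)] X.cod_obj[OF assms(1)] unfolding fully_faithful_def bij_betw_def by blast
  then show ?thesis using assms unfolding inj_on_def hom_def by auto
qed

lemma U_full: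
  assumes "A \<in> Obj X" "B \<in> Obj X" "h \<in> Arr D" "Dom D h = fob U A" "Cod D h = fob U B"
  obtains f where "f \<in> Arr X" "Dom X f = A" "Cod X f = B" "far U f = h"
proof -
  have "far U ` hom X A B = hom D (fob U A) (fob U B)"
    using ff assms(1,2) unfolding fully_faithful_def bij_betw_def by blast
  moreover have "h \<in> hom D (fob U A) (fob U B)" using assms by (simp add: hom_def)
  ultimately have "h \<in> far U ` hom X A B" by simp
  then show ?thesis using that by (auto simp: hom_def)
qed

lemma universal_exists:
  assumes "Q \<in> Obj D"
  obtains m A where "universal m" "m \<in> Arr D" "Dom D m = Q" "A \<in> Obj X" "Cod D m = fob U A"
  using units[OF assms] D.universal_arrowD by blast

text \<open>Transposition along the universal arrow \<open>m\<close>; fullness of \<open>U\<close>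
  brings the factorization down to \<open>X\<close>.\<close>

lemma transpose:
  assumes m: "universal m" "Cod D m = fob U A" "A \<in> Obj X"
    and h: "h \<in> Arr D" "Dom D h = Dom D m" "Cod D h = fob U B" "B \<in> Obj X"
  obtains k where "k \<in> Arr X" "Dom X k = A" "Cod X k = B" "far U k \<bullet> m = h"
proof -
  have "Cod D h \<in> fob U ` Obj X" using h by simp
  then obtain l where l: "l \<in> Arr D" "Dom D l = Cod D m" "Cod D l = Cod D h" "l \<bullet> m = h"
    using D.universal_arrow_ex[OF m(1) h(1,2)] by metis
  obtain k where "k \<in> Arr X" "Dom X k = A" "Cod X k = B" "far U k = l"
    by (rule U_full[OF m(3) h(4) l(1)]) (use l m h in simp_all)
  then show ?thesis using that l by blast
qed

lemma transpose_unique: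
  assumes m: "universal m" "Cod D m = fob U A"
    and k: "k \<in> Arr X" "k' \<in> Arr X" "Dom X k = A" "Dom X k' = A" "Cod X k = Cod X k'"
    and eq: "far U k \<bullet> m = far U k' \<bullet> m"
  shows "k = k'"
proof -
  have "far U k = far U k'"
    by (rule D.universal_arrow_unique[OF m(1) _ _ _ _ _ eq]) (use m k U_arr[OF k(1)] U_arr[OF k(2)] X.cod_obj[OF k(1)] in simp_all)
  then show ?thesis using U_inj k by simp
qed

text \<open>Both \<open>m \<bullet> s\<close> and the identity give \<open>m\<close> when
  precomposed with \<open>m\<close>, so universality identifies them. A universal arrow is thus
  invertible as soon as it has a retraction.\<close>

lemma universal_retract:
  assumes m: "universal m" "Cod D m = fob U A" "A \<in> Obj X"
    and s: "s \<in> Arr D" "Dom D s = fob U A" "Cod D s = Dom D m" "s \<bullet> m = Id D (Dom D m)"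
  shows "m \<bullet> s = Id D (fob U A)"
proof -
  note M = D.universal_arrowD[OF m(1)]
  have "m \<bullet> s \<bullet> m = m" using s M D.dom_obj[OF M(1)] by simp
  moreover have "Id D (fob U A) \<bullet> m = m" using M m by simp
  ultimately show ?thesis
    by - (rule D.universal_arrow_unique[OF m(1)], use m s M U_obj[OF m(3)] in simp_all)
qed

text \<open>A cone in \<open>D\<close> with arbitrary vertex is transposed along the universal arrow
  at that vertex to a cone in \<open>X\<close>. This is the preservation of limits by a right
  adjoint, carried out for pullbacks.\<close>

lemma U_pullback:
  assumes pb: "is_pullback X f g p q"
  shows "is_pullback D (far U f) (far U g) (far U p) (far U q)"
proof -
  note P = X.pullbackD[OF pb]
  note uf = U_arr[OF P(1)] and ug = U_arr[OF P(2)] and up = U_arr[OF P(3)] and uq = U_arr[OF P(4)]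
  note o = X.dom_obj[OF P(1)] X.dom_obj[OF P(2)] X.dom_obj[OF P(4)]
  have cp: "far U (p \<odot> k) = far U p \<bullet> far U k" "far U (q \<odot> k) = far U q \<bullet> far U k"
    if "k \<in> Arr X" "Cod X k = Dom X q" for k using U_comp that P by simp_all
  show ?thesis
  proof (rule D.pullbackI)
    show "far U f \<bullet> far U p = far U g \<bullet> far U q"
      using U_comp[OF P(3,1)] U_comp[OF P(4,2)] P by simp
    fix a b assume ab: "a \<in> Arr D" "b \<in> Arr D" "Dom D a = Dom D b" "Cod D a = Dom D (far U f)" "Cod D b = Dom D (far U g)"
      "far U f \<bullet> a = far U g \<bullet> b"
    obtain m A where m: "universal m" "m \<in> Arr D" "Dom D m = Dom D b" "A \<in> Obj X" "Cod D m = fob U A"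
      using universal_exists[OF D.dom_obj[OF ab(2)]] .
    obtain a' where a': "a' \<in> Arr X" "Dom X a' = A" "Cod X a' = Dom X f" "far U a' \<bullet> m = a"
      by (rule transpose[OF m(1,5,4) ab(1) _ _ o(1)]) (use ab m uf in simp_all)
    obtain b' where b': "b' \<in> Arr X" "Dom X b' = A" "Cod X b' = Dom X g" "far U b' \<bullet> m = b"
      by (rule transpose[OF m(1,5,4) ab(2) _ _ o(2)]) (use ab m ug in simp_all)
    note ua = U_arr[OF a'(1)] and ub = U_arr[OF b'(1)]
    have fa: "far U (f \<odot> a') \<bullet> m = far U f \<bullet> a"
      using U_comp[OF a'(1) P(1)] a' ua uf m by simp
    have gb: "far U (g \<odot> b') \<bullet> m = far U g \<bullet> b"
      using U_comp[OF b'(1) P(2)] b' ub ug m by simp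
    have "f \<odot> a' = g \<odot> b'"
      by (rule transpose_unique[OF m(1,5)]) (use fa gb ab(6) P a' b' in simp_all)
    then obtain h' where h': "h' \<in> Arr X" "Dom X h' = A" "Cod X h' = Dom X q" "p \<odot> h' = a'" "q \<odot> h' = b'"
      using X.pullback_ex[OF pb a'(1) b'(1)] a' b' by metis
    note uh = U_arr[OF h'(1)]
    have "far U p \<bullet> far U h' \<bullet> m = a" "far U q \<bullet> far U h' \<bullet> m = b"
      using a'(4) b'(4) unfolding h'(4,5)[symmetric] cp[OF h'(1,3)] using uh up uq m P h' by simp_all
    then show "\<exists>h. h \<in> Arr D \<and> Dom D h = Dom D b \<and> Cod D h = Dom D (far U q) \<and> far U p \<bullet> h = a \<and> far U q \<bullet> h = b"
      using uh m h' uq by (intro exI[of _ "far U h' \<bullet> m"]) simp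
  next
    fix h k assume hk: "h \<in> Arr D" "k \<in> Arr D" "Dom D h = Dom D k" "Cod D h = Dom D (far U q)" "Cod D k = Dom D (far U q)"
      "far U p \<bullet> h = far U p \<bullet> k" "far U q \<bullet> h = far U q \<bullet> k"
    obtain m A where m: "universal m" "m \<in> Arr D" "Dom D m = Dom D k" "A \<in> Obj X" "Cod D m = fob U A"
      using universal_exists[OF D.dom_obj[OF hk(2)]] .
    obtain h' where h': "h' \<in> Arr X" "Dom X h' = A" "Cod X h' = Dom X q" "far U h' \<bullet> m = h"
      by (rule transpose[OF m(1,5,4) hk(1) _ _ o(3)]) (use hk m uq in simp_all)
    obtain k' where k': "k' \<in> Arr X" "Dom X k' = A" "Cod X k' = Dom X q" "far U k' \<bullet> m = k"
      by (rule transpose[OF m(1,5,4) hk(2) _ _ o(3)]) (use hk m uq in simp_all)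
    note uh = U_arr[OF h'(1)] and uk = U_arr[OF k'(1)]
    have e: "far U (r \<odot> l) \<bullet> m = far U r \<bullet> far U l \<bullet> m"
      if "r \<in> Arr X" "l \<in> Arr X" "Dom X r = Cod X l" "Dom X l = A" for r l
      using U_comp[OF that(2,1,3)] U_arr[OF that(1)] U_arr[OF that(2)] that m by simp
    have "p \<odot> h' = p \<odot> k'"
      by (rule transpose_unique[OF m(1,5)]) (use e[OF P(3) h'(1)] e[OF P(3) k'(1)] h' k' hk P in simp_all)
    moreover have "q \<odot> h' = q \<odot> k'"
      by (rule transpose_unique[OF m(1,5)]) (use e[OF P(4) h'(1)] e[OF P(4) k'(1)] h' k' hk P in simp_all)
    ultimately have "h' = k'" by - (rule X.pullback_unique[OF pb], use h' k' P in simp_all)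
    then show "h = k" using h'(4) k'(4) by simp
  qed (use uf ug up uq P in simp_all)
qed

lemma U_relation:
  assumes rel: "is_relation X A B r1 r2"
  shows "is_relation D (fob U A) (fob U B) (far U r1) (far U r2)"
proof -
  note R = X.relationD[OF rel]
  note u1 = U_arr[OF R(1)] and u2 = U_arr[OF R(2)]
  show ?thesis
  proof (rule D.relationI)
    fix h k assume hk: "h \<in> Arr D" "k \<in> Arr D" "Dom D h = Dom D k" "Cod D h = Dom D (far U r2)" "Cod D k = Dom D (far U r2)"
      "far U r1 \<bullet> h = far U r1 \<bullet> k" "far U r2 \<bullet> h = far U r2 \<bullet> k"
    obtain m B where m: "universal m" "m \<in> Arr D" "Dom D m = Dom D k" "B \<in> Obj X" "Cod D m = fob U B"
      using universal_exists[OF D.dom_obj[OF hk(2)]] .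
    note o = X.dom_obj[OF R(2)]
    obtain h' where h': "h' \<in> Arr X" "Dom X h' = B" "Cod X h' = Dom X r2" "far U h' \<bullet> m = h"
      by (rule transpose[OF m(1,5,4) hk(1) _ _ o]) (use hk m u2 in simp_all)
    obtain k' where k': "k' \<in> Arr X" "Dom X k' = B" "Cod X k' = Dom X r2" "far U k' \<bullet> m = k"
      by (rule transpose[OF m(1,5,4) hk(2) _ _ o]) (use hk m u2 in simp_all)
    have e: "far U (r \<odot> l) \<bullet> m = far U r \<bullet> far U l \<bullet> m"
      if "r \<in> Arr X" "l \<in> Arr X" "Dom X r = Cod X l" "Dom X l = B" for r l
      using U_comp[OF that(2,1,3)] U_arr[OF that(1)] U_arr[OF that(2)] that m by simp
    have "r1 \<odot> h' = r1 \<odot> k'"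
      by (rule transpose_unique[OF m(1,5)]) (use e[OF R(1) h'(1)] e[OF R(1) k'(1)] h' k' hk R in simp_all)
    moreover have "r2 \<odot> h' = r2 \<odot> k'"
      by (rule transpose_unique[OF m(1,5)]) (use e[OF R(2) h'(1)] e[OF R(2) k'(1)] h' k' hk R in simp_all)
    ultimately have "h' = k'" by - (rule X.relation_unique[OF rel], use h' k' R in simp_all)
    then show "h = k" using h'(4) k'(4) by simp
  qed (use u1 u2 R in simp_all)
qed

text \<open>Elements of the image relation at a stage correspond to elements of the original one at
  the reflection of that stage, so properties quantified over all stages pass between
  \<open>X\<close> and \<open>D\<close>.\<close>

lemma U_spans:
  assumes rel: "is_relation X A B r1 r2" and m: "universal m" "Cod D m = fob U T" "T \<in> Obj X"
    and ab: "a \<in> Arr X" "b \<in> Arr X" "Dom X a = T" "Dom X b = T" "Cod X a = A" "Cod X b = B"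
  shows "(far U a \<bullet> m, far U b \<bullet> m) \<in> spans D (far U r1) (far U r2) \<longleftrightarrow> (a, b) \<in> spans X r1 r2"
proof -
  note R = X.relationD[OF rel] and M = D.universal_arrowD[OF m(1)]
  note u1 = U_arr[OF R(1)] and u2 = U_arr[OF R(2)]
  have e: "far U (r \<odot> l) \<bullet> m = far U r \<bullet> far U l \<bullet> m"
    if "r \<in> Arr X" "l \<in> Arr X" "Dom X r = Cod X l" "Dom X l = T" for r l
    using U_comp[OF that(2,1,3)] U_arr[OF that(1)] U_arr[OF that(2)] that m M by simp
  show ?thesis
  proof
    assume "(a, b) \<in> spans X r1 r2"
    then obtain x where x: "x \<in> Arr X" "Cod X x = Dom X r1" "r1 \<odot> x = a" "r2 \<odot> x = b" by (rule X.spansE)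
    have "Dom X x = T" using x ab R by auto
    then show "(far U a \<bullet> m, far U b \<bullet> m) \<in> spans D (far U r1) (far U r2)"
      using e[OF R(1) x(1)] e[OF R(2) x(1)] x R u1 U_arr[OF x(1)] M m by (intro D.spansI[of "far U x \<bullet> m"]) simp_all
  next
    assume s: "(far U a \<bullet> m, far U b \<bullet> m) \<in> spans D (far U r1) (far U r2)"
    then obtain y where y: "y \<in> Arr D" "Cod D y = Dom D (far U r1)" "far U r1 \<bullet> y = far U a \<bullet> m"
      "far U r2 \<bullet> y = far U b \<bullet> m" by (rule D.spansE)
    have dy: "Dom D y = Dom D m"
      using arg_cong[OF y(3), of "Dom D"] y(1,2) u1 U_arr[OF ab(1)] ab m M by simp
    obtain x where x: "x \<in> Arr X" "Dom X x = T" "Cod X x = Dom X r1" "far U x \<bullet> m = y"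
      by (rule transpose[OF m y(1) dy _ X.dom_obj[OF R(1)]]) (use y u1 in simp)
    have "r1 \<odot> x = a"
      by (rule transpose_unique[OF m(1,2)]) (use e[OF R(1) x(1)] x y ab R in simp_all)
    moreover have "r2 \<odot> x = b"
      by (rule transpose_unique[OF m(1,2)]) (use e[OF R(2) x(1)] x y ab R in simp_all)
    ultimately show "(a, b) \<in> spans X r1 r2" using x by (intro X.spansI[of x]) simp_all
  qed
qed

lemma element_transpose:
  assumes "a \<in> Arr D" "Cod D a = fob U A" "A \<in> Obj X" "universal m" "Cod D m = fob U T" "T \<in> Obj X" "Dom D m = Dom D a"
  obtains a' where "a' \<in> Arr X" "Dom X a' = T" "Cod X a' = A" "far U a' \<bullet> m = a"
  using transpose[OF assms(4-6) assms(1) assms(7)[symmetric] assms(2,3)] .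

lemma U_equivalence:
  assumes er: "equivalence_relation X A r1 r2"
  shows "equivalence_relation D (fob U A) (far U r1) (far U r2)"
proof -
  have rel: "is_relation X A A r1 r2" and "span_equivalence X A (spans X r1 r2)"
    using er X.equivalence_relation_iff by blast+
  then have ref: "\<And>x. x \<in> Arr X \<Longrightarrow> Cod X x = A \<Longrightarrow> (x, x) \<in> spans X r1 r2"
    and sy: "sym (spans X r1 r2)" and tr: "trans (spans X r1 r2)" unfolding span_equivalence_def by auto
  note Ur = U_relation[OF rel] and A = X.relationD(6)[OF rel]
  note ty = D.spansD[OF Ur]
  have "span_equivalence D (fob U A) (spans D (far U r1) (far U r2))"
    unfolding span_equivalence_def
  proof (intro conjI ballI impI D.span_relationI[OF Ur] symI transI)
    fix a assume a: "a \<in> Arr D" "Cod D a = fob U A"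
    obtain m T where m: "universal m" "m \<in> Arr D" "Dom D m = Dom D a" "T \<in> Obj X" "Cod D m = fob U T"
      using universal_exists[OF D.dom_obj[OF a(1)]] .
    obtain a' where a': "a' \<in> Arr X" "Dom X a' = T" "Cod X a' = A" "far U a' \<bullet> m = a"
      using element_transpose[OF a A m(1,5,4,3)] .
    show "(a, a) \<in> spans D (far U r1) (far U r2)"
      using U_spans[OF rel m(1,5,4) a'(1,1,2,2,3,3)] ref[OF a'(1,3)] a'(4) by simp
  next
    fix a b assume ab: "(a, b) \<in> spans D (far U r1) (far U r2)"
    note t = ty[OF ab]
    obtain m T where m: "universal m" "m \<in> Arr D" "Dom D m = Dom D a" "T \<in> Obj X" "Cod D m = fob U T"
      using universal_exists[OF D.dom_obj[OF t(1)]] .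
    obtain a' where a': "a' \<in> Arr X" "Dom X a' = T" "Cod X a' = A" "far U a' \<bullet> m = a"
      using element_transpose[OF t(1,4) A m(1,5,4,3)] .
    obtain b' where b': "b' \<in> Arr X" "Dom X b' = T" "Cod X b' = A" "far U b' \<bullet> m = b"
      by (rule element_transpose[OF t(2,5) A m(1,5,4)]) (use m(3) t in simp)
    have "(a', b') \<in> spans X r1 r2"
      using U_spans[OF rel m(1,5,4) a'(1) b'(1) a'(2) b'(2) a'(3) b'(3)] ab a'(4) b'(4) by simp
    then have "(b', a') \<in> spans X r1 r2" using sy by (auto dest: symD)
    then show "(b, a) \<in> spans D (far U r1) (far U r2)"
      using U_spans[OF rel m(1,5,4) b'(1) a'(1) b'(2) a'(2) b'(3) a'(3)] a'(4) b'(4) by simp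
  next
    fix a b c assume ab: "(a, b) \<in> spans D (far U r1) (far U r2)" and bc: "(b, c) \<in> spans D (far U r1) (far U r2)"
    note t = ty[OF ab] and t' = ty[OF bc]
    \<comment> \<open>The three elements share a stage, so one universal arrow transposes them
      all.\<close>
    obtain m T where m: "universal m" "m \<in> Arr D" "Dom D m = Dom D a" "T \<in> Obj X" "Cod D m = fob U T"
      using universal_exists[OF D.dom_obj[OF t(1)]] .
    obtain a' where a': "a' \<in> Arr X" "Dom X a' = T" "Cod X a' = A" "far U a' \<bullet> m = a"
      using element_transpose[OF t(1,4) A m(1,5,4,3)] .
    obtain b' where b': "b' \<in> Arr X" "Dom X b' = T" "Cod X b' = A" "far U b' \<bullet> m = b"
      by (rule element_transpose[OF t(2,5) A m(1,5,4)]) (use m(3) t in simp)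
    obtain c' where c': "c' \<in> Arr X" "Dom X c' = T" "Cod X c' = A" "far U c' \<bullet> m = c"
      by (rule element_transpose[OF t'(2,5) A m(1,5,4)]) (use m(3) t t' in simp)
    have "(a', b') \<in> spans X r1 r2"
      using U_spans[OF rel m(1,5,4) a'(1) b'(1) a'(2) b'(2) a'(3) b'(3)] ab a'(4) b'(4) by simp
    moreover have "(b', c') \<in> spans X r1 r2"
      using U_spans[OF rel m(1,5,4) b'(1) c'(1) b'(2) c'(2) b'(3) c'(3)] bc b'(4) c'(4) by simp
    ultimately have "(a', c') \<in> spans X r1 r2" using tr by (auto dest: transD)
    then show "(a, c) \<in> spans D (far U r1) (far U r2)"
      using U_spans[OF rel m(1,5,4) a'(1) c'(1) a'(2) c'(2) a'(3) c'(3)] a'(4) c'(4) by simp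
  qed
  then show ?thesis unfolding D.equivalence_relation_iff using Ur by blast
qed

end

locale semi_left_exact_in_exact = semi_left_exact_embedding X D U + D: exact_category D for X D U
begin

text \<open>Limits are computed in \<open>D\<close> and reflected. The cone on the reflected vertex
  induces an arrow \<open>s\<close> back to the limit, which is a retraction of \<open>m\<close> by
  uniqueness and hence inverse to it by \<open>universal_retract\<close>; so the reflected cone is a
  limit cone too.\<close>

lemma X_pullback_category: "pullback_category X"
proof
  obtain t where t: "t \<in> Obj D" "\<And>A. A \<in> Obj D \<Longrightarrow> \<exists>!h. h \<in> hom D A t" using D.terminal by auto
  have uniq: "x = y" if "x \<in> Arr D" "y \<in> Arr D" "Dom D x = Dom D y" "Cod D x = t" "Cod D y = t" for x y
    using t(2)[OF D.dom_obj[OF that(1)]] that D.in_homI by metis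
  obtain m A where m: "universal m" "m \<in> Arr D" "Dom D m = t" "A \<in> Obj X" "Cod D m = fob U A"
    using universal_exists[OF t(1)] .
  obtain s where s: "s \<in> Arr D" "Dom D s = fob U A" "Cod D s = t"
    using t(2)[OF U_obj[OF m(4)]] by (auto simp: hom_def)
  have "s \<bullet> m = Id D (Dom D m)" by (rule uniq) (use s m t in simp_all)
  then have ms: "m \<bullet> s = Id D (fob U A)" by - (rule universal_retract[OF m(1,5,4)], use s m in simp_all)
  show "\<exists>t \<in> Obj X. \<forall>A \<in> Obj X. \<exists>!h. h \<in> hom X A t"
  proof (intro bexI[OF _ m(4)] ballI)
    fix B assume B: "B \<in> Obj X"
    obtain b where b: "b \<in> Arr D" "Dom D b = fob U B" "Cod D b = t" using t(2)[OF U_obj[OF B]] by (auto simp: hom_def)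
    obtain k where k: "k \<in> Arr X" "Dom X k = B" "Cod X k = A" "far U k = m \<bullet> b"
      by (rule U_full[OF B m(4), of "m \<bullet> b"]) (use b m in simp_all)
    show "\<exists>!h. h \<in> hom X B A"
    proof (rule ex1I[of _ k])
      show "k \<in> hom X B A" using k by (simp add: hom_def)
      fix l assume "l \<in> hom X B A"
      then have l: "l \<in> Arr X" "Dom X l = B" "Cod X l = A" by (simp_all add: hom_def)
      note ul = U_arr[OF l(1)]
      \<comment> \<open>Since \<open>m \<bullet> s\<close> is the identity, \<open>l\<close> is
        determined by \<open>s \<bullet> far U l\<close>, an arrow to the terminal object.\<close>
      have "far U l = m \<bullet> s \<bullet> far U l"
        using D.extend1[OF ms ul(1)] ul l s m by simp
      also have "s \<bullet> far U l = b" by (rule uniq) (use ul l s b in simp_all)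
      finally show "l = k" using U_inj[OF l(1) k(1)] l k by simp
    qed
  qed
next
  fix f g assume fg: "f \<in> Arr X" "g \<in> Arr X" "Cod X f = Cod X g"
  note uf = U_arr[OF fg(1)] and ug = U_arr[OF fg(2)]
  obtain p q where pb: "is_pullback D (far U f) (far U g) p q" using D.pullbacks[OF uf(1) ug(1)] uf ug fg by auto
  note P = D.pullbackD[OF pb]
  obtain m A where m: "universal m" "m \<in> Arr D" "Dom D m = Dom D q" "A \<in> Obj X" "Cod D m = fob U A"
    using universal_exists[OF D.dom_obj[OF P(4)]] .
  obtain p' where p': "p' \<in> Arr X" "Dom X p' = A" "Cod X p' = Dom X f" "far U p' \<bullet> m = p"
    by (rule transpose[OF m(1,5,4) P(3) _ _ X.dom_obj[OF fg(1)]]) (use m P uf in simp_all)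
  obtain q' where q': "q' \<in> Arr X" "Dom X q' = A" "Cod X q' = Dom X g" "far U q' \<bullet> m = q"
    by (rule transpose[OF m(1,5,4) P(4) _ _ X.dom_obj[OF fg(2)]]) (use m P ug in simp_all)
  note up = U_arr[OF p'(1)] and uq = U_arr[OF q'(1)]
  have e: "far U (r \<odot> l) \<bullet> m = far U r \<bullet> far U l \<bullet> m"
    if "r \<in> Arr X" "l \<in> Arr X" "Dom X r = Cod X l" "Dom X l = A" for r l
    using U_comp[OF that(2,1,3)] U_arr[OF that(1)] U_arr[OF that(2)] that m by simp
  have comm: "f \<odot> p' = g \<odot> q'"
    by (rule transpose_unique[OF m(1,5)]) (use e[OF fg(1) p'(1)] e[OF fg(2) q'(1)] p' q' P(9) fg in simp_all)
  have "far U f \<bullet> far U p' = far U g \<bullet> far U q'"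
    using U_comp[OF p'(1) fg(1)] U_comp[OF q'(1) fg(2)] p' q' comm by simp
  then obtain s where s: "s \<in> Arr D" "Dom D s = fob U A" "Cod D s = Dom D q" "p \<bullet> s = far U p'" "q \<bullet> s = far U q'"
    using D.pullback_ex[OF pb up(1) uq(1)] up uq uf ug p' q' by metis
  have "s \<bullet> m = Id D (Dom D m)"
    by (rule D.pullback_unique[OF pb])
      (use D.extend1[OF s(4) m(2)] D.extend1[OF s(5) m(2)] p'(4) q'(4) s m P D.dom_obj[OF P(4)] in simp_all)
  then have ms: "m \<bullet> s = Id D (fob U A)" by - (rule universal_retract[OF m(1,5,4)], use s m in simp_all)
  have "is_pullback X f g p' q'"
  proof (rule X.pullbackI)
    fix a b assume ab: "a \<in> Arr X" "b \<in> Arr X" "Dom X a = Dom X b" "Cod X a = Dom X f" "Cod X b = Dom X g"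
      "f \<odot> a = g \<odot> b"
    note ua = U_arr[OF ab(1)] and ub = U_arr[OF ab(2)]
    have "far U f \<bullet> far U a = far U g \<bullet> far U b"
      using U_comp[OF ab(1) fg(1)] U_comp[OF ab(2) fg(2)] ab by simp
    then obtain h where h: "h \<in> Arr D" "Dom D h = fob U (Dom X b)" "Cod D h = Dom D q" "p \<bullet> h = far U a" "q \<bullet> h = far U b"
      using D.pullback_ex[OF pb ua(1) ub(1)] ua ub uf ug ab by metis
    obtain k where k: "k \<in> Arr X" "Dom X k = Dom X b" "Cod X k = A" "far U k = m \<bullet> h"
      by (rule U_full[OF X.dom_obj[OF ab(2)] m(4), of "m \<bullet> h"]) (use h m in simp_all)
    have "far U p' \<bullet> m \<bullet> h = p \<bullet> h"
      by (rule D.extend1[OF p'(4)]) (use h m up p' in simp_all)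
    then have "far U (p' \<odot> k) = far U a" using U_comp[OF k(1) p'(1)] k p' h by simp
    then have 1: "p' \<odot> k = a" by - (rule U_inj, use k p' ab in simp_all)
    have "far U q' \<bullet> m \<bullet> h = q \<bullet> h"
      by (rule D.extend1[OF q'(4)]) (use h m uq q' in simp_all)
    then have "far U (q' \<odot> k) = far U b" using U_comp[OF k(1) q'(1)] k q' h by simp
    then have 2: "q' \<odot> k = b" by - (rule U_inj, use k q' ab in simp_all)
    show "\<exists>h. h \<in> Arr X \<and> Dom X h = Dom X b \<and> Cod X h = Dom X q' \<and> p' \<odot> h = a \<and> q' \<odot> h = b"
      using k 1 2 q' by (intro exI[of _ k]) simp
  next
    fix h k assume hk: "h \<in> Arr X" "k \<in> Arr X" "Dom X h = Dom X k" "Cod X h = Dom X q'" "Cod X k = Dom X q'"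
      "p' \<odot> h = p' \<odot> k" "q' \<odot> h = q' \<odot> k"
    note uh = U_arr[OF hk(1)] and uk = U_arr[OF hk(2)]
    \<comment> \<open>The arrow \<open>s \<bullet> far U z\<close> is determined by its projections,
      and \<open>s\<close> can be cancelled because \<open>m \<bullet> s\<close> is the
      identity.\<close>
    have z: "p \<bullet> s \<bullet> far U z = far U (p' \<odot> z)" "q \<bullet> s \<bullet> far U z = far U (q' \<odot> z)"
      "m \<bullet> s \<bullet> far U z = far U z"
      if "z \<in> Arr X" "Cod X z = Dom X q'" for z
      using D.extend1[OF s(4), of "far U z"] D.extend1[OF s(5), of "far U z"] D.extend1[OF ms, of "far U z"]
        U_comp[OF that(1) p'(1)] U_comp[OF that(1) q'(1)] U_arr[OF that(1)] that p' q' s P m by simp_all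
    have "s \<bullet> far U h = s \<bullet> far U k"
      by (rule D.pullback_unique[OF pb]) (use z(1,2)[OF hk(1,4)] z(1,2)[OF hk(2,5)] hk(3,6,7) uh uk s hk(4,5) q'(2) in simp_all)
    then have "far U h = far U k" using z(3)[OF hk(1,4)] z(3)[OF hk(2,5)] by metis
    then show "h = k" using U_inj hk by simp
  qed (use fg p' q' comm in simp_all)
  then show "\<exists>p q. is_pullback X f g p q" by blast
qed

lemma X_finitely_complete: "finitely_complete_category X"
  using X_pullback_category by (rule pullback_category.finitely_complete)

text \<open>Reflexivity is carried up by transposing each element. On the way down the identity of
  \<open>fob U T\<close> serves as universal arrow, so symmetry and transitivity upstairs are read
  off directly on arrows in the image of \<open>U\<close>.\<close>

lemma X_maltsev:
  assumes "maltsev_category D"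
  shows "maltsev_category X"
proof -
  interpret FX: finitely_complete_category X by (rule X_finitely_complete)
  interpret MD: maltsev_category D by (rule assms)
  show ?thesis
  proof
    fix A r1 r2 assume "reflexive_relation X A r1 r2"
    then have rel: "is_relation X A A r1 r2" and ref: "\<And>x. x \<in> Arr X \<Longrightarrow> Cod X x = A \<Longrightarrow> (x, x) \<in> spans X r1 r2"
      using X.reflexive_relation_iff by blast+
    note Ur = U_relation[OF rel] and A = X.relationD(6)[OF rel]
    have "(a, a) \<in> spans D (far U r1) (far U r2)" if a: "a \<in> Arr D" "Cod D a = fob U A" for a
    proof -
      obtain m T where m: "universal m" "m \<in> Arr D" "Dom D m = Dom D a" "T \<in> Obj X" "Cod D m = fob U T"
        using universal_exists[OF D.dom_obj[OF a(1)]] .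
      obtain a' where a': "a' \<in> Arr X" "Dom X a' = T" "Cod X a' = A" "far U a' \<bullet> m = a"
        using element_transpose[OF a A m(1,5,4,3)] .
      show ?thesis
        using U_spans[OF rel m(1,5,4) a'(1,1,2,2,3,3)] ref[OF a'(1,3)] a'(4) by simp
    qed
    then have "reflexive_relation D (fob U A) (far U r1) (far U r2)"
      using D.reflexive_relation_iff Ur by blast
    then have "equivalence_relation D (fob U A) (far U r1) (far U r2)" by (rule MD.reflexive_equivalence)
    then have sy: "sym (spans D (far U r1) (far U r2))" and tr: "trans (spans D (far U r1) (far U r2))"
      unfolding D.equivalence_relation_iff span_equivalence_def by auto
    have iff: "(far U a, far U b) \<in> spans D (far U r1) (far U r2) \<longleftrightarrow> (a, b) \<in> spans X r1 r2"
      if ab: "a \<in> Arr X" "b \<in> Arr X" "Dom X a = Dom X b" "Cod X a = A" "Cod X b = A" for a b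
    proof -
      let ?T = "Dom X b"
      have T: "?T \<in> Obj X" using X.dom_obj[OF ab(2)] .
      have "fob U ` Obj X \<subseteq> Obj D" using U_obj by auto
      then have "universal (Id D (fob U ?T))" using T by (intro D.universal_arrow_Id) auto
      from U_spans[OF rel this _ T ab(1,2,3) refl ab(4,5)] show ?thesis
        using U_obj[OF T] U_arr[OF ab(1)] U_arr[OF ab(2)] ab by simp
    qed
    note ty = X.spansD[OF rel]
    have "span_equivalence X A (spans X r1 r2)"
      unfolding span_equivalence_def
    proof (intro conjI ballI impI X.span_relationI[OF rel] symI transI)
      show "(x, x) \<in> spans X r1 r2" if "x \<in> Arr X" "Cod X x = A" for x using ref[OF that] .
      show "(b, a) \<in> spans X r1 r2" if ab: "(a, b) \<in> spans X r1 r2" for a b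
        using iff[OF ty[OF ab]] iff[OF ty(2,1)[OF ab] ty(3)[OF ab, symmetric] ty(5,4)[OF ab]] ab symD[OF sy] by blast
      show "(a, c) \<in> spans X r1 r2" if ab: "(a, b) \<in> spans X r1 r2" and bc: "(b, c) \<in> spans X r1 r2" for a b c
      proof -
        have "Dom X a = Dom X c" using ty(3)[OF ab] ty(3)[OF bc] by simp
        from iff[OF ty(1)[OF ab] ty(2)[OF bc] this ty(4)[OF ab] ty(5)[OF bc]] show ?thesis
          using iff[OF ty[OF ab]] iff[OF ty[OF bc]] ab bc transD[OF tr] by blast
      qed
    qed
    then show "equivalence_relation X A r1 r2" unfolding X.equivalence_relation_iff using rel by blast
  qed
qed

text \<open>A left adjoint preserves coequalizers: upstairs the image of \<open>h\<close> factors
  through \<open>e\<close>, and the factor then extends along the universal arrow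
  \<open>m\<close>.\<close>

lemma reflected_coequalizer:
  assumes r: "r1 \<in> Arr X" "r2 \<in> Arr X" "Dom X r1 = Dom X r2" "Cod X r1 = Dom X q" "Cod X r2 = Dom X q"
    and e: "is_coequalizer D (far U r1) (far U r2) e"
    and m: "universal m" "Dom D m = Cod D e" "Cod D m = fob U (Cod X q)"
    and q: "q \<in> Arr X" "far U q = m \<bullet> e"
  shows "is_coequalizer X r1 r2 q"
proof -
  note M = D.universal_arrowD[OF m(1)] and E = D.coequalizerD[OF e]
  note u1 = U_arr[OF r(1)] and u2 = U_arr[OF r(2)] and uq = U_arr[OF q(1)]
  have eD: "Dom D e = fob U (Dom X q)" using E(5) u1 r by simp
  show ?thesis
  proof (rule X.coequalizerI[OF r(1,2) q(1) r(3-5)])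
    have "far U (q \<odot> r1) = m \<bullet> e \<bullet> far U r1" "far U (q \<odot> r2) = m \<bullet> e \<bullet> far U r2"
      using U_comp[OF r(1) q(1)] U_comp[OF r(2) q(1)] q(2) r E M m by simp_all
    then show "q \<odot> r1 = q \<odot> r2" using E(7) by - (rule U_inj, use r q(1) in simp_all)
  next
    fix h assume h: "h \<in> Arr X" "Dom X h = Dom X q" "h \<odot> r1 = h \<odot> r2"
    note uh = U_arr[OF h(1)]
    have "far U h \<bullet> far U r1 = far U h \<bullet> far U r2"
      using U_comp[OF r(1) h(1)] U_comp[OF r(2) h(1)] r h by simp
    then obtain k where k: "k \<in> Arr D" "Dom D k = Cod D e" "Cod D k = fob U (Cod X h)" "k \<bullet> e = far U h"
      using D.coequalizer_ex[OF e uh(1)] uh eD h(2) by metis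
    obtain l where l: "l \<in> Arr X" "Dom X l = Cod X q" "Cod X l = Cod X h" "far U l \<bullet> m = k"
      by (rule transpose[OF m(1,3) X.cod_obj[OF q(1)] k(1) _ k(3) X.cod_obj[OF h(1)]]) (use k m in simp)
    note ul = U_arr[OF l(1)]
    have "far U l \<bullet> m \<bullet> e = k \<bullet> e" by (rule D.extend1[OF l(4)]) (use E M m ul l in simp_all)
    then have "far U (l \<odot> q) = far U h" using U_comp[OF q(1) l(1,2)] q(2) k(4) by simp
    then have "l \<odot> q = h" by - (rule U_inj, use l q(1) h in simp_all)
    then show "\<exists>k. k \<in> Arr X \<and> Dom X k = Cod X q \<and> Cod X k = Cod X h \<and> k \<odot> q = h" using l by blast
  next
    fix k k' assume k: "k \<in> Arr X" "k' \<in> Arr X" "Dom X k = Cod X q" "Dom X k' = Cod X q" "Cod X k = Cod X k'"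
      "k \<odot> q = k' \<odot> q"
    note uk = U_arr[OF k(1)] and uk' = U_arr[OF k(2)]
    have "far U k \<bullet> m \<bullet> e = far U k' \<bullet> m \<bullet> e"
      using U_comp[OF q(1) k(1,3)] U_comp[OF q(1) k(2,4)] k(6) q(2) by simp
    then have "(far U k \<bullet> m) \<bullet> e = (far U k' \<bullet> m) \<bullet> e" using uk uk' k M m E by simp
    then have "far U k \<bullet> m = far U k' \<bullet> m"
      by - (rule D.coequalizer_epi[OF e], use uk uk' k M m E in simp_all)
    then show "k = k'" by (rule transpose_unique[OF m(1,3) k(1-5)])
  qed
qed

theorem X_stable_coequalizers: "has_stable_coequalizers_of_equivalence_relations X"
  unfolding has_stable_coequalizers_of_equivalence_relations_def
proof (intro allI impI conjI; (elim conjE)?)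
  fix A r1 r2 assume er: "equivalence_relation X A r1 r2"
  have rel: "is_relation X A A r1 r2" using er X.equivalence_relation_iff by blast
  note R = X.relationD[OF rel]
  note u1 = U_arr[OF R(1)] and u2 = U_arr[OF R(2)]
  \<comment> \<open>Exactness makes the relation a kernel pair upstairs, and it is then the kernel
    pair of its own coequalizer \<open>e\<close>.\<close>
  obtain g where "is_kernel_pair D g (far U r1) (far U r2)"
    using D.equivalence_effective[OF U_equivalence[OF er]] by blast
  then obtain e where kp: "is_kernel_pair D e (far U r1) (far U r2)" and e: "is_coequalizer D (far U r1) (far U r2) e"
    using D.kernel_pair_coequalizer D.kernel_pair_of_coequalizer by blast
  note E = D.coequalizerD[OF e]
  have eD: "Dom D e = fob U A" using E(5) u1 R by simp
  {
    obtain m Q where m: "universal m" "m \<in> Arr D" "Dom D m = Cod D e" "Q \<in> Obj X" "Cod D m = fob U Q"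
      using universal_exists[OF D.cod_obj[OF E(3)]] .
    obtain q where q: "q \<in> Arr X" "Dom X q = A" "Cod X q = Q" "far U q = m \<bullet> e"
      by (rule U_full[OF R(6) m(4), of "m \<bullet> e"]) (use m E eD in simp_all)
    have "is_coequalizer X r1 r2 q"
      by (rule reflected_coequalizer[OF R(1-3) _ _ e m(1,3)]) (use q R m in simp_all)
    then show "\<exists>q. is_coequalizer X r1 r2 q" by blast
  }
  fix q f p q' u v s1 s2
  assume q: "is_coequalizer X r1 r2 q" and pb: "is_pullback X q f p q'" and pbu: "is_pullback X (q \<odot> r1) f u v"
    and s1: "s1 \<in> hom X (Dom X u) (Dom X p)" "p \<odot> s1 = r1 \<odot> u" "q' \<odot> s1 = v"
    and s2: "s2 \<in> hom X (Dom X u) (Dom X p)" "p \<odot> s2 = r2 \<odot> u" "q' \<odot> s2 = v"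
  note Q = X.coequalizerD[OF q] and P = X.pullbackD[OF pb] and V = X.pullbackD[OF pbu]
  have dq: "Dom X q = A" using Q R by simp
  have s1a: "s1 \<in> Arr X" "Dom X s1 = Dom X u" "Cod X s1 = Dom X p" using s1(1) by (simp_all add: hom_def)
  have s2a: "s2 \<in> Arr X" "Dom X s2 = Dom X u" "Cod X s2 = Dom X p" using s2(1) by (simp_all add: hom_def)
  have qr: "Dom X (q \<odot> r1) = Dom X r1" using Q by simp
  note uqa = U_arr[OF Q(3)] and ufa = U_arr[OF P(2)] and upa = U_arr[OF P(3)] and uq'a = U_arr[OF P(4)]
    and uua = U_arr[OF V(3)] and uva = U_arr[OF V(4)] and us1a = U_arr[OF s1a(1)] and us2a = U_arr[OF s2a(1)]
  \<comment> \<open>The whole diagram is moved to \<open>D\<close> together with its typing and its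
    equations; the chase then takes place there, and \<open>X\<close> is needed again only for
    universality.\<close>
  define \<q> \<f> \<p> \<q>' \<r> \<r>' \<u> \<v> \<s> \<s>' where defs: "\<q> = far U q" "\<f> = far U f" "\<p> = far U p" "\<q>' = far U q'"
    "\<r> = far U r1" "\<r>' = far U r2" "\<u> = far U u" "\<v> = far U v" "\<s> = far U s1" "\<s>' = far U s2"
  have arr: "\<q> \<in> Arr D" "\<f> \<in> Arr D" "\<p> \<in> Arr D" "\<q>' \<in> Arr D" "\<r> \<in> Arr D" "\<r>' \<in> Arr D" "\<u> \<in> Arr D" "\<v> \<in> Arr D" "\<s> \<in> Arr D" "\<s>' \<in> Arr D" "e \<in> Arr D"
    unfolding defs using uqa ufa upa uq'a u1 u2 uua uva us1a us2a E by simp_all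
  have dc: "Cod D \<f> = Cod D \<q>" "Dom D \<q> = fob U A" "Cod D \<p> = fob U A" "Cod D \<q>' = Dom D \<f>" "Dom D \<p> = Dom D \<q>'"
     "Cod D \<r> = fob U A" "Cod D \<r>' = fob U A" "Dom D \<r> = Dom D \<r>'" "Cod D \<u> = Dom D \<r>'" "Dom D \<u> = Dom D \<v>" "Cod D \<v> = Dom D \<f>"
     "Dom D \<s> = Dom D \<v>" "Cod D \<s> = Dom D \<q>'" "Dom D \<s>' = Dom D \<v>" "Cod D \<s>' = Dom D \<q>'" "Dom D e = fob U A"
    unfolding defs using uqa ufa upa uq'a u1 u2 uua uva us1a us2a P(5-8) V(6-8) R s1a s2a dq qr eD by simp_all
  have eqs: "\<q> \<bullet> \<p> = \<f> \<bullet> \<q>'" "\<p> \<bullet> \<s> = \<r> \<bullet> \<u>" "\<p> \<bullet> \<s>' = \<r>' \<bullet> \<u>" "\<q>' \<bullet> \<s> = \<v>" "\<q>' \<bullet> \<s>' = \<v>"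
    "\<q> \<bullet> \<r> = \<q> \<bullet> \<r>'"
    unfolding defs
    using U_comp[OF P(3,1)] U_comp[OF P(4,2)] U_comp[OF s1a(1) P(3)] U_comp[OF s2a(1) P(3)] U_comp[OF s1a(1) P(4)] U_comp[OF s2a(1) P(4)]
      U_comp[OF V(3) R(1)] U_comp[OF V(3) R(2)] U_comp[OF R(1) Q(3)] U_comp[OF R(2) Q(3)] P(5-9) V(6-8) s1a s2a s1(2,3) s2(2,3) R qr Q(4-7)
    by simp_all
  have upb: "is_pullback D \<q> \<f> \<p> \<q>'" unfolding defs by (rule U_pullback[OF pb])
  have vpb: "is_pullback D (\<q> \<bullet> \<r>) \<f> \<u> \<v>"
    unfolding defs using U_pullback[OF pbu] U_comp[OF R(1) Q(3)] Q by simp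
  have kp': "is_kernel_pair D e \<r> \<r>'" and e': "is_coequalizer D \<r> \<r>' e" unfolding defs by (rule kp, rule e)
  have er': "e \<bullet> \<r> = e \<bullet> \<r>'" using D.coequalizerD(7)[OF e'] .
  obtain m where m: "m \<in> Arr D" "Dom D m = Cod D e" "Cod D m = Cod D \<q>" "m \<bullet> e = \<q>"
    using D.coequalizer_ex[OF e' arr(1) _ eqs(6)] dc by metis
  \<comment> \<open>Here \<open>q\<close> is an arbitrary coequalizer. An arrow from the domain of
    \<open>m\<close> to the image of \<open>U\<close> corresponds, through \<open>e\<close>, to an
    arrow of \<open>X\<close> that coequalizes the relation, hence to an arrow out of the codomain
    of \<open>q\<close>.\<close>
  have um: "universal m"
  proof (rule D.universal_arrowI[OF m(1)])
    show "Cod D m \<in> fob U ` Obj X" using m(3) uqa X.cod_obj[OF Q(3)] unfolding defs by simp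
    fix h assume h: "h \<in> Arr D" "Dom D h = Dom D m" "Cod D h \<in> fob U ` Obj X"
    then obtain B where B: "B \<in> Obj X" "Cod D h = fob U B" by auto
    obtain l where l: "l \<in> Arr X" "Dom X l = A" "Cod X l = B" "far U l = h \<bullet> e"
      by (rule U_full[OF R(6) B(1), of "h \<bullet> e"]) (use h B m arr dc in simp_all)
    have "far U l \<bullet> \<r> = far U l \<bullet> \<r>'"
      unfolding l(4) using er' h m arr dc by simp
    then have "far U (l \<odot> r1) = far U (l \<odot> r2)"
      unfolding defs using U_comp[OF R(1) l(1)] U_comp[OF R(2) l(1)] R l by simp
    then have "l \<odot> r1 = l \<odot> r2" by - (rule U_inj, use l R in simp_all)
    then obtain k where k: "k \<in> Arr X" "Dom X k = Cod X q" "Cod X k = B" "k \<odot> q = l"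
      using X.coequalizer_ex[OF q l(1)] l dq by metis
    note uk = U_arr[OF k(1)]
    have "far U k \<bullet> m \<bullet> e = h \<bullet> e"
      using U_comp[OF Q(3) k(1,2)] k(4) l(4) m(4) unfolding defs by simp
    then have "(far U k \<bullet> m) \<bullet> e = h \<bullet> e" using uk k m arr uqa unfolding defs by simp
    then have "far U k \<bullet> m = h"
      by - (rule D.coequalizer_epi[OF e'], use uk k m h uqa in \<open>simp_all add: defs\<close>)
    then show "\<exists>k. k \<in> Arr D \<and> Dom D k = Cod D m \<and> Cod D k = Cod D h \<and> k \<bullet> m = h"
      using uk k B m uqa by (intro exI[of _ "far U k"]) (simp add: defs)
  next
    fix k k' assume k: "k \<in> Arr D" "k' \<in> Arr D" "Dom D k = Cod D m" "Dom D k' = Cod D m" "Cod D k = Cod D k'"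
      "Cod D k' \<in> fob U ` Obj X" "k \<bullet> m = k' \<bullet> m"
    then obtain B where B: "B \<in> Obj X" "Cod D k' = fob U B" by auto
    have Qo: "Cod X q \<in> Obj X" using X.cod_obj[OF Q(3)] .
    obtain l where l: "l \<in> Arr X" "Dom X l = Cod X q" "Cod X l = B" "far U l = k"
      by (rule U_full[OF Qo B(1) k(1)]) (use k m B uqa in \<open>simp_all add: defs\<close>)
    obtain l' where l': "l' \<in> Arr X" "Dom X l' = Cod X q" "Cod X l' = B" "far U l' = k'"
      by (rule U_full[OF Qo B(1) k(2)]) (use k m B uqa in \<open>simp_all add: defs\<close>)
    have "k \<bullet> m \<bullet> e = k' \<bullet> m \<bullet> e"
      by (rule D.extend[OF k(7)]) (use arr m k in simp_all)
    then have "far U (l \<odot> q) = far U (l' \<odot> q)"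
      using U_comp[OF Q(3) l(1,2)] U_comp[OF Q(3) l'(1,2)] l(4) l'(4) m(4) unfolding defs by simp
    then have "l \<odot> q = l' \<odot> q" by - (rule U_inj, use l l' Q in simp_all)
    then have "l = l'" by (rule X.coequalizer_epi[OF q l(1) l'(1) l(2) l'(2)])
    then show "k = k'" using l l' by simp
  qed
  have fm: "Cod D \<f> = Cod D m" using m dc by simp
  \<comment> \<open>The pullback of \<q> along \<f> is taken in two stages, first of
    \<open>m\<close> and then of \<open>e\<close>, so that semi-left-exactness treats one factor and
    regularity the other.\<close>
  obtain m' fi where pbm: "is_pullback D \<f> m m' fi" using D.pullbacks[OF arr(2) m(1) fm] by blast
  note M' = D.pullbackD[OF pbm]
  have um': "universal m'"
    by (rule semi_left_exact[OF um _ pbm]) (use ufa X.dom_obj[OF P(2)] in \<open>simp add: defs\<close>)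
  have "\<f> \<bullet> \<q>' = m \<bullet> e \<bullet> \<p>"
    using eqs(1) D.extend1[OF m(4) arr(3)] arr m dc by simp
  then obtain d where d: "d \<in> Arr D" "Dom D d = Dom D \<q>'" "Cod D d = Dom D fi" "m' \<bullet> d = \<q>'" "fi \<bullet> d = e \<bullet> \<p>"
    using D.pullback_ex[OF pbm arr(4), of "e \<bullet> \<p>"] arr dc m by auto
  have mt: "m' \<in> Arr D" "fi \<in> Arr D" "Dom D m' = Dom D fi" "Cod D m' = Dom D \<f>" "Cod D fi = Cod D e" using M' m by simp_all
  \<comment> \<open>Pasting: the outer rectangle and the square over \<open>m\<close> are pullbacks,
    hence so is the square over \<open>e\<close>.\<close>
  have pbd: "is_pullback D e fi \<p> d"
  proof (rule D.pullbackI)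
    fix a b assume ab: "a \<in> Arr D" "b \<in> Arr D" "Dom D a = Dom D b" "Cod D a = Dom D e" "Cod D b = Dom D fi"
      "e \<bullet> a = fi \<bullet> b"
    have "\<q> \<bullet> a = m \<bullet> e \<bullet> a" using D.extend1[OF m(4) ab(1)] ab m arr by simp
    also have "\<dots> = m \<bullet> fi \<bullet> b" using ab(6) by simp
    also have "\<dots> = \<f> \<bullet> m' \<bullet> b" by (rule D.extend[OF M'(9)[symmetric]]) (use ab mt arr m dc in simp_all)
    finally have "\<q> \<bullet> a = \<f> \<bullet> (m' \<bullet> b)" .
    then obtain h where h: "h \<in> Arr D" "Dom D h = Dom D b" "Cod D h = Dom D \<q>'" "\<p> \<bullet> h = a" "\<q>' \<bullet> h = m' \<bullet> b"
      using D.pullback_ex[OF upb ab(1), of "m' \<bullet> b"] ab mt dc by auto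
    have "m' \<bullet> d \<bullet> h = \<q>' \<bullet> h" by (rule D.extend1[OF d(4)]) (use h d mt in simp_all)
    moreover have "fi \<bullet> d \<bullet> h = e \<bullet> \<p> \<bullet> h"
      by (rule D.extend[OF d(5)]) (use h d mt arr dc in simp_all)
    ultimately have "d \<bullet> h = b"
      using h(4,5) ab(6) by - (rule D.pullback_unique[OF pbm], use h(1-3) d(1-3) ab(1-5) mt in simp_all)
    then show "\<exists>h. h \<in> Arr D \<and> Dom D h = Dom D b \<and> Cod D h = Dom D d \<and> \<p> \<bullet> h = a \<and> d \<bullet> h = b"
      using h d by (intro exI[of _ h]) simp
  next
    fix h k assume hk: "h \<in> Arr D" "k \<in> Arr D" "Dom D h = Dom D k" "Cod D h = Dom D d" "Cod D k = Dom D d"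
      "\<p> \<bullet> h = \<p> \<bullet> k" "d \<bullet> h = d \<bullet> k"
    have z: "m' \<bullet> d \<bullet> z = \<q>' \<bullet> z" if "z \<in> Arr D" "Cod D z = Dom D d" for z
      by (rule D.extend1[OF d(4)]) (use that d mt in simp_all)
    have "\<q>' \<bullet> h = \<q>' \<bullet> k" using z[OF hk(1,4)] z[OF hk(2,5)] hk(7) by simp
    then show "h = k" using hk(6) by - (rule D.pullback_unique[OF upb], use hk(1-5) d in simp_all)
  qed (use arr mt d dc in simp_all)
  have "regular_epi D e" using e unfolding regular_epi_def by blast
  then have rd: "regular_epi D d" using pbd by (rule D.regular_epi_stable)
  \<comment> \<open>A pair identified by \<open>d\<close> is identified by \<open>\<q>'\<close> and,
    after \<p>, by \<open>e\<close>. The latter yields an element \<open>t\<close> of the relation,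
    the former its compatibility with \<f>, and together they factor through the pulled-back
    relation.\<close>
  have "is_kernel_pair D d \<s> \<s>'"
  proof (rule D.pullbackI)
    have "\<p> \<bullet> \<s> = \<r> \<bullet> \<u>" "\<p> \<bullet> \<s>' = \<r>' \<bullet> \<u>" using eqs by simp_all
    moreover have "e \<bullet> \<r> \<bullet> \<u> = e \<bullet> \<r>' \<bullet> \<u>" by (rule D.extend[OF er']) (use arr dc in simp_all)
    moreover have "fi \<bullet> d \<bullet> z = e \<bullet> \<p> \<bullet> z" "m' \<bullet> d \<bullet> z = \<q>' \<bullet> z"
      if "z \<in> Arr D" "Cod D z = Dom D \<q>'" for z
      by (rule D.extend[OF d(5)] D.extend1[OF d(4)]; use that d(1-3) mt arr dc in simp)+
    note this[OF arr(9) dc(13)] this[OF arr(10) dc(15)]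
    ultimately show "d \<bullet> \<s> = d \<bullet> \<s>'"
      using eqs(4,5) by - (rule D.pullback_unique[OF pbm], use arr dc d(1-3) in simp_all)
  next
    fix a b assume ab: "a \<in> Arr D" "b \<in> Arr D" "Dom D a = Dom D b" "Cod D a = Dom D d" "Cod D b = Dom D d"
      "d \<bullet> a = d \<bullet> b"
    have z: "fi \<bullet> d \<bullet> z = e \<bullet> \<p> \<bullet> z" "m' \<bullet> d \<bullet> z = \<q>' \<bullet> z" "\<q> \<bullet> \<p> \<bullet> z = \<f> \<bullet> \<q>' \<bullet> z"
      if "z \<in> Arr D" "Cod D z = Dom D d" for z
      by (rule D.extend[OF d(5)] D.extend1[OF d(4)] D.extend[OF eqs(1)]; use that d(1-3) mt arr dc in simp)+
    have epab: "e \<bullet> \<p> \<bullet> a = e \<bullet> \<p> \<bullet> b" and qab: "\<q>' \<bullet> a = \<q>' \<bullet> b"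
      using z[OF ab(1,4)] z[OF ab(2,5)] ab(6) by simp_all
    obtain t where t: "t \<in> Arr D" "Dom D t = Dom D b" "Cod D t = Dom D \<r>'" "\<r> \<bullet> t = \<p> \<bullet> a" "\<r>' \<bullet> t = \<p> \<bullet> b"
      by (rule D.pullback_ex[OF kp', of "\<p> \<bullet> a" "\<p> \<bullet> b"]) (use ab(1-5) epab arr dc d(2) in simp_all)
    have "(\<q> \<bullet> \<r>) \<bullet> t = \<q> \<bullet> \<p> \<bullet> a" using t arr dc by simp
    also have "\<dots> = \<f> \<bullet> \<q>' \<bullet> a" using z(3)[OF ab(1,4)] .
    finally obtain h where h: "h \<in> Arr D" "Dom D h = Dom D a" "Cod D h = Dom D \<v>" "\<u> \<bullet> h = t" "\<v> \<bullet> h = \<q>' \<bullet> a"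
      using D.pullback_ex[OF vpb t(1), of "\<q>' \<bullet> a"] t(2,3) ab arr dc d(2) by auto
    have w: "\<p> \<bullet> \<s> \<bullet> h = \<r> \<bullet> \<u> \<bullet> h" "\<p> \<bullet> \<s>' \<bullet> h = \<r>' \<bullet> \<u> \<bullet> h" "\<q>' \<bullet> \<s> \<bullet> h = \<v> \<bullet> h" "\<q>' \<bullet> \<s>' \<bullet> h = \<v> \<bullet> h"
      by (rule D.extend[OF eqs(2)] D.extend[OF eqs(3)] D.extend1[OF eqs(4)] D.extend1[OF eqs(5)]; use h(1-3) arr dc in simp)+
    have "\<s> \<bullet> h = a" by (rule D.pullback_unique[OF upb]) (use w h t(4) ab(1-5) arr dc d(2) in simp_all)
    moreover have "\<s>' \<bullet> h = b" by (rule D.pullback_unique[OF upb]) (use w h t(5) ab(1-5) qab arr dc d(2) in simp_all)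
    ultimately show "\<exists>h. h \<in> Arr D \<and> Dom D h = Dom D b \<and> Cod D h = Dom D \<s>' \<and> \<s> \<bullet> h = a \<and> \<s>' \<bullet> h = b"
      using h(1-3) ab(3) dc by (intro exI[of _ h]) simp
  next
    fix h k assume hk: "h \<in> Arr D" "k \<in> Arr D" "Dom D h = Dom D k" "Cod D h = Dom D \<s>'" "Cod D k = Dom D \<s>'"
      "\<s> \<bullet> h = \<s> \<bullet> k" "\<s>' \<bullet> h = \<s>' \<bullet> k"
    have w: "\<p> \<bullet> \<s> \<bullet> z = \<r> \<bullet> \<u> \<bullet> z" "\<p> \<bullet> \<s>' \<bullet> z = \<r>' \<bullet> \<u> \<bullet> z" "\<q>' \<bullet> \<s> \<bullet> z = \<v> \<bullet> z"
      if "z \<in> Arr D" "Cod D z = Dom D \<s>'" for z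
      by (rule D.extend[OF eqs(2)] D.extend[OF eqs(3)] D.extend1[OF eqs(4)]; use that arr dc in simp)+
    have "\<r> \<bullet> \<u> \<bullet> h = \<r> \<bullet> \<u> \<bullet> k" "\<r>' \<bullet> \<u> \<bullet> h = \<r>' \<bullet> \<u> \<bullet> k" and v: "\<v> \<bullet> h = \<v> \<bullet> k"
      using w[OF hk(1,4)] w[OF hk(2,5)] hk(6,7) by simp_all
    then have "\<u> \<bullet> h = \<u> \<bullet> k" by - (rule D.pullback_unique[OF kp'], use hk(1-5) arr dc in simp_all)
    then show "h = k" using v by - (rule D.pullback_unique[OF vpb], use hk(1-5) arr dc in simp_all)
  qed (use arr dc d(1-3) in simp_all)
  then have "is_coequalizer D \<s> \<s>' d" by (rule D.regular_epi_coequalizer_kernel_pair[OF rd])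
  then have cs: "is_coequalizer D (far U s1) (far U s2) d" unfolding defs .
  show "is_coequalizer X s1 s2 q'"
    by (rule reflected_coequalizer[OF s1a(1) s2a(1) _ _ _ cs um' _ _ P(4)])
      (use s1a s2a P d(3,4) mt dc(4) uq'a in \<open>simp_all add: defs\<close>)
qed

end


section \<open>Transfer along equivalences\<close>

lemma functor_arr:
  assumes "category X" "is_functor X Y F" "f \<in> Arr X"
  shows "far F f \<in> Arr Y" "Dom Y (far F f) = fob F (Dom X f)" "Cod Y (far F f) = fob F (Cod X f)"
  using assms category.dom_obj[OF assms(1,3)] category.cod_obj[OF assms(1,3)]
  unfolding is_functor_def hom_def by blast+

lemma functor_comp:
  "\<lbrakk>is_functor X Y F; f \<in> Arr X; g \<in> Arr X; Dom X g = Cod X f\<rbrakk>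
     \<Longrightarrow> far F (g \<cdot>\<^bsub>X\<^esub> f) = far F g \<cdot>\<^bsub>Y\<^esub> far F f"
  unfolding is_functor_def by blast

text \<open>Naturality expresses the composite of the unit component at the codomain with
  \<open>f\<close> through \<open>far F f\<close>, and that component is invertible.\<close>

lemma natural_iso_faithful:
  assumes X: "category X" and Y: "category Y" and F: "is_functor X Y F" and G: "is_functor Y X G"
    and nt: "natural_transformation X X id_func (comp_func G F) \<alpha>" and iso: "\<forall>A \<in> Obj X. is_iso X (\<alpha> A)"
    and fg: "f \<in> Arr X" "g \<in> Arr X" "Dom X f = Dom X g" "Cod X f = Cod X g" "far F f = far F g"
  shows "f = g"
proof -
  interpret X: category X by (rule X)
  note o = X.dom_obj[OF fg(1)] X.cod_obj[OF fg(1)]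
  let ?a = "\<alpha> (Cod X f)"
  have a: "?a \<in> Arr X" "Dom X ?a = Cod X f" using nt o unfolding natural_transformation_def hom_def id_func_def by auto
  have "?a \<cdot>\<^bsub>X\<^esub> f = far G (far F f) \<cdot>\<^bsub>X\<^esub> \<alpha> (Dom X f)" "?a \<cdot>\<^bsub>X\<^esub> g = far G (far F g) \<cdot>\<^bsub>X\<^esub> \<alpha> (Dom X f)"
    using nt fg unfolding natural_transformation_def id_func_def comp_func_def by auto
  then have eq: "?a \<cdot>\<^bsub>X\<^esub> f = ?a \<cdot>\<^bsub>X\<^esub> g" using fg(5) by simp
  have "is_iso X ?a" using iso o by blast
  then obtain j where j: "j \<in> Arr X" "Dom X j = Cod X ?a" "Cod X j = Dom X ?a" "j \<cdot>\<^bsub>X\<^esub> ?a = Id X (Dom X ?a)"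
    by (rule X.isoE)
  have "j \<cdot>\<^bsub>X\<^esub> ?a \<cdot>\<^bsub>X\<^esub> z = z" if "z \<in> Arr X" "Cod X z = Cod X f" for z
    using X.extend1[OF j(4), of z] that a j o by simp
  then show ?thesis using eq fg by metis
qed

text \<open>For fullness, conjugating \<open>far G h\<close> by components of \<alpha> gives the
  preimage of \<open>h\<close>. That its image is \<open>h\<close> is checked after applying
  \<open>G\<close>, which is faithful because of \<beta>.\<close>

lemma equivalence_fully_faithful:
  assumes X: "category X" and Y: "category Y" and F: "is_functor X Y F" and G: "is_functor Y X G"
    and GF: "naturally_isomorphic X X id_func (comp_func G F)"
    and FG: "naturally_isomorphic Y Y (comp_func F G) id_func"
  shows "fully_faithful X Y F" "\<And>B. B \<in> Obj Y \<Longrightarrow> \<exists>A \<in> Obj X. \<exists>i. is_iso Y i \<and> Dom Y i = B \<and> Cod Y i = fob F A"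
proof -
  interpret X: category X by (rule X)
  interpret Y: category Y by (rule Y)
  obtain \<alpha> where \<alpha>: "natural_transformation X X id_func (comp_func G F) \<alpha>" "\<forall>A \<in> Obj X. is_iso X (\<alpha> A)"
    using GF unfolding naturally_isomorphic_def by blast
  obtain \<beta> where \<beta>: "natural_transformation Y Y (comp_func F G) id_func \<beta>" "\<forall>B \<in> Obj Y. is_iso Y (\<beta> B)"
    using FG unfolding naturally_isomorphic_def by blast
  have bt: "\<beta> B \<in> Arr Y" "Dom Y (\<beta> B) = fob F (fob G B)" "Cod Y (\<beta> B) = B" if "B \<in> Obj Y" for B
    using \<beta>(1) that unfolding natural_transformation_def hom_def id_func_def comp_func_def by auto
  have at: "\<alpha> A \<in> Arr X" "Dom X (\<alpha> A) = A" "Cod X (\<alpha> A) = fob G (fob F A)" if "A \<in> Obj X" for A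
    using \<alpha>(1) that unfolding natural_transformation_def hom_def id_func_def comp_func_def by auto
  have G_faithful: "h = k"
    if hk: "h \<in> Arr Y" "k \<in> Arr Y" "Dom Y h = Dom Y k" "Cod Y h = Cod Y k" "far G h = far G k" for h k
  proof -
    let ?b = "\<beta> (Dom Y h)"
    note o = Y.dom_obj[OF hk(1)]
    have nat: "l \<cdot>\<^bsub>Y\<^esub> \<beta> (Dom Y l) = \<beta> (Cod Y l) \<cdot>\<^bsub>Y\<^esub> far F (far G l)" if "l \<in> Arr Y" for l
      using \<beta>(1) that unfolding natural_transformation_def id_func_def comp_func_def by simp
    have eq: "h \<cdot>\<^bsub>Y\<^esub> ?b = k \<cdot>\<^bsub>Y\<^esub> ?b" using nat[OF hk(1)] nat[OF hk(2)] hk(3-5) by simp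
    have "is_iso Y ?b" using \<beta>(2) o by blast
    then obtain j where j: "j \<in> Arr Y" "Dom Y j = Cod Y ?b" "Cod Y j = Dom Y ?b" "?b \<cdot>\<^bsub>Y\<^esub> j = Id Y (Cod Y ?b)"
      by (rule Y.isoE)
    have "h \<cdot>\<^bsub>Y\<^esub> ?b \<cdot>\<^bsub>Y\<^esub> j = k \<cdot>\<^bsub>Y\<^esub> ?b \<cdot>\<^bsub>Y\<^esub> j"
      by (rule Y.extend[OF eq]) (use hk j bt[OF o] in simp_all)
    then show ?thesis using j(4) bt[OF o] hk by simp
  qed
  show "fully_faithful X Y F"
    unfolding fully_faithful_def bij_betw_def
  proof (intro conjI ballI F)
    fix A B assume AB: "A \<in> Obj X" "B \<in> Obj X"
    show "inj_on (far F) (hom X A B)"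
    proof (rule inj_onI)
      fix f g assume "f \<in> hom X A B" "g \<in> hom X A B" "far F f = far F g"
      then show "f = g" by (intro natural_iso_faithful[OF X Y F G \<alpha>]) (auto simp: hom_def)
    qed
    show "far F ` hom X A B = hom Y (fob F A) (fob F B)"
    proof
      show "far F ` hom X A B \<subseteq> hom Y (fob F A) (fob F B)"
        using F AB unfolding is_functor_def by blast
      show "hom Y (fob F A) (fob F B) \<subseteq> far F ` hom X A B"
      proof
        fix h assume "h \<in> hom Y (fob F A) (fob F B)"
        then have h: "h \<in> Arr Y" "Dom Y h = fob F A" "Cod Y h = fob F B" by (simp_all add: hom_def)
        note gh = functor_arr[OF Y G h(1)]
        have "is_iso X (\<alpha> B)" using \<alpha>(2) AB by blast
        then obtain j where j: "j \<in> Arr X" "Dom X j = Cod X (\<alpha> B)" "Cod X j = Dom X (\<alpha> B)" "\<alpha> B \<cdot>\<^bsub>X\<^esub> j = Id X (Cod X (\<alpha> B))"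
          by (rule X.isoE)
        have "is_iso X (\<alpha> A)" using \<alpha>(2) AB by blast
        then obtain i where i: "i \<in> Arr X" "Dom X i = Cod X (\<alpha> A)" "Cod X i = Dom X (\<alpha> A)" "\<alpha> A \<cdot>\<^bsub>X\<^esub> i = Id X (Cod X (\<alpha> A))"
          by (rule X.isoE)
        let ?f = "j \<cdot>\<^bsub>X\<^esub> far G h \<cdot>\<^bsub>X\<^esub> \<alpha> A"
        note aA = at[OF AB(1)] and aB = at[OF AB(2)]
        have f: "?f \<in> Arr X" "Dom X ?f = A" "Cod X ?f = B" using j gh h aA aB by simp_all
        note Ff = functor_arr[OF X F f(1)]
        note GFf = functor_arr[OF Y G Ff(1)]
        have "far G (far F ?f) \<cdot>\<^bsub>X\<^esub> \<alpha> A = \<alpha> B \<cdot>\<^bsub>X\<^esub> ?f"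
          using \<alpha>(1) f unfolding natural_transformation_def id_func_def comp_func_def by auto
        also have "\<dots> = far G h \<cdot>\<^bsub>X\<^esub> \<alpha> A"
          using X.extend1[OF j(4), of "far G h \<cdot>\<^bsub>X\<^esub> \<alpha> A"] j gh h aA aB by simp
        finally have eq: "far G (far F ?f) \<cdot>\<^bsub>X\<^esub> \<alpha> A = far G h \<cdot>\<^bsub>X\<^esub> \<alpha> A" .
        have "far G (far F ?f) \<cdot>\<^bsub>X\<^esub> \<alpha> A \<cdot>\<^bsub>X\<^esub> i = far G h \<cdot>\<^bsub>X\<^esub> \<alpha> A \<cdot>\<^bsub>X\<^esub> i"
          by (rule X.extend[OF eq]) (use GFf Ff f i gh h aA in simp_all)
        then have "far G (far F ?f) = far G h" using i(4) GFf Ff f gh h aA by simp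
        then have "far F ?f = h" by - (rule G_faithful, use Ff f h in simp_all)
        moreover have "?f \<in> hom X A B" using f by (simp add: hom_def)
        ultimately show "h \<in> far F ` hom X A B" by (metis imageI)
      qed
    qed
  qed
  fix B assume B: "B \<in> Obj Y"
  then have "is_iso Y (\<beta> B)" using \<beta>(2) by blast
  then obtain i where "is_iso Y i" "Dom Y i = Cod Y (\<beta> B)" "Cod Y i = Dom Y (\<beta> B)" using Y.iso_inverse by metis
  moreover have "fob G B \<in> Obj X" using G B unfolding is_functor_def by blast
  ultimately show "\<exists>A \<in> Obj X. \<exists>i. is_iso Y i \<and> Dom Y i = B \<and> Cod Y i = fob F A" using bt[OF B] by auto
qed

text \<open>The equivalence meets each object of \<open>S\<close> only up to isomorphism, so
  universal arrows to \<open>S\<close> and to the image of \<open>F\<close> have to be exchanged: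
  the former are corrected by an isomorphism of the target, the latter are compared with such a
  corrected one.\<close>

lemma semi_localization_embedding:
  assumes X: "category X" and D: "category D" and sl: "is_semi_localization_of X D"
  shows "\<exists>U. semi_left_exact_embedding X D U"
proof -
  interpret X: category X by (rule X)
  interpret D: category D by (rule D)
  obtain S L \<eta> where sl: "semi_localization D S L \<eta>" and eqv: "equivalent_categories X (full_subcat D S)"
    using sl unfolding is_semi_localization_of_def by blast
  note S = D.semi_localizationD(1)[OF sl] and u = D.semi_localizationD(2,3)[OF sl]
  obtain F G where FG: "is_functor X (full_subcat D S) F" "is_functor (full_subcat D S) X G"
    "naturally_isomorphic X X id_func (comp_func G F)"
    "naturally_isomorphic (full_subcat D S) (full_subcat D S) (comp_func F G) id_func"
    using eqv unfolding equivalent_categories_def by blast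
  note ff = equivalence_fully_faithful[OF X D.full_subcat_category[OF S] FG]
  have FS: "fob F A \<in> S" if "A \<in> Obj X" for A using FG(1) that unfolding is_functor_def by simp
  have homS: "hom (full_subcat D S) A B = hom D A B" if "A \<in> S" "B \<in> S" for A B
    using that unfolding hom_def by auto
  have ffD: "fully_faithful X D F"
    using ff(1) FS S homS unfolding fully_faithful_def is_functor_def by (simp add: subset_iff)
  have restrict: "universal_arrow_to D (fob F ` Obj X) m" if "universal_arrow_to D S m" "Cod D m \<in> fob F ` Obj X" for m
    using that FS unfolding universal_arrow_to_def by blast
  have ex: "\<exists>m. universal_arrow_to D S m \<and> Cod D m \<in> fob F ` Obj X \<and> Dom D m = Q" if Q: "Q \<in> Obj D" for Q
  proof -
    note M = D.universal_arrowD[OF u(1)[OF Q]]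
    obtain A i where A: "A \<in> Obj X" "is_iso (full_subcat D S) i" "Dom D i = Cod D (\<eta> Q)" "Cod D i = fob F A"
      using ff(2)[of "Cod D (\<eta> Q)"] M by auto
    have i: "is_iso D i" using A(2) D.full_subcat_iso[OF S] by blast
    then have "i \<in> Arr D" unfolding is_iso_def by blast
    then show ?thesis
      using D.universal_arrow_comp_iso[OF u(1)[OF Q] i A(3)] A FS M u(2)[OF Q] by (intro exI[of _ "i \<cdot>\<^bsub>D\<^esub> \<eta> Q"]) simp
  qed
  have extend: "universal_arrow_to D S m" if m: "universal_arrow_to D (fob F ` Obj X) m" for m
  proof -
    note M = D.universal_arrowD[OF m]
    obtain m' where m': "universal_arrow_to D S m'" "Cod D m' \<in> fob F ` Obj X" "Dom D m' = Dom D m"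
      using ex[OF D.dom_obj[OF M(1)]] by blast
    obtain i where i: "is_iso D i" "Dom D i = Cod D m'" "Cod D i = Cod D m" "i \<cdot>\<^bsub>D\<^esub> m' = m"
      using D.universal_arrow_iso[OF restrict[OF m'(1,2)] m m'(3)] .
    have "Cod D i \<in> S" using i(3) M FS by auto
    then show ?thesis using D.universal_arrow_comp_iso[OF m'(1) i(1,2)] i(4) by simp
  qed
  have "semi_left_exact_embedding X D F"
  proof
    show "fully_faithful X D F" by (rule ffD)
    show "\<exists>m. universal_arrow_to D (fob F ` Obj X) m \<and> Dom D m = Q" if "Q \<in> Obj D" for Q
      using ex[OF that] restrict by blast
    fix m f p q assume m: "universal_arrow_to D (fob F ` Obj X) m" and f: "Dom D f \<in> fob F ` Obj X" and pb: "is_pullback D f m p q"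
    have "Dom D f \<in> S" using f FS by auto
    then have "universal_arrow_to D S p"
      using D.semi_localization_semi_left_exact[OF sl extend[OF m] _ pb] by blast
    then show "universal_arrow_to D (fob F ` Obj X) p" using restrict f D.pullbackD(7)[OF pb] by simp
  qed
  then show ?thesis by blast
qed

text \<open>Since \<open>U\<close> is injective on objects, the inverse functor can be chosen
  strict, and both natural isomorphisms are identities.\<close>

lemma equivalent_to_full_image:
  assumes X: "category X" and D: "category D" and ff: "fully_faithful X D U" and inj: "inj_on (fob U) (Obj X)"
  shows "equivalent_categories X (full_subcat D (fob U ` Obj X))"
proof -
  interpret X: category X by (rule X)
  interpret D: category D by (rule D)
  let ?S = "fob U ` Obj X" and ?D = "full_subcat D (fob U ` Obj X)"
  have F: "is_functor X D U" using ff unfolding fully_faithful_def by blast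
  note ua = functor_arr[OF X F]
  have F': "is_functor X ?D U"
    using F ua unfolding is_functor_def by (simp add: hom_def)
  define g where "g B = inv_into (Obj X) (fob U) B" for B
  have g: "g (fob U A) = A" if "A \<in> Obj X" for A unfolding g_def using inv_into_f_f[OF inj that] .
  define G where "G = \<lparr>fob = g, far = (\<lambda>h. inv_into (hom X (g (Dom D h)) (g (Cod D h))) (far U) h)\<rparr>"
  have bij: "bij_betw (far U) (hom X A B) (hom D (fob U A) (fob U B))" if "A \<in> Obj X" "B \<in> Obj X" for A B
    using ff that unfolding fully_faithful_def by blast
  have GU: "far G (far U f) = f" if f: "f \<in> Arr X" for f
  proof -
    have "f \<in> hom X (Dom X f) (Cod X f)" using f by (simp add: hom_def)
    then show ?thesis
      unfolding G_def using ua[OF f] g[OF X.dom_obj[OF f]] g[OF X.cod_obj[OF f]]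
        bij_betw_inv_into_left[OF bij[OF X.dom_obj[OF f] X.cod_obj[OF f]]] by simp
  qed
  have U_surj: "\<exists>f. f \<in> Arr X \<and> Dom X f = g (Dom D h) \<and> Cod X f = g (Cod D h) \<and> far U f = h" if h: "h \<in> Arr ?D" for h
  proof -
    obtain A B where AB: "A \<in> Obj X" "B \<in> Obj X" "Dom D h = fob U A" "Cod D h = fob U B" using h by auto
    have "h \<in> hom D (fob U A) (fob U B)" using h AB by (simp add: hom_def)
    then have "h \<in> far U ` hom X A B" using bij[OF AB(1,2)] unfolding bij_betw_def by simp
    then obtain f where "f \<in> hom X A B" "far U f = h" by blast
    then show ?thesis using AB g by (auto simp: hom_def)
  qed
  have fobG: "fob G = g" unfolding G_def by simp
  have gX: "g B \<in> Obj X" "fob U (g B) = B" if "B \<in> ?S" for B using that g by auto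
  have G: "is_functor ?D X G"
    unfolding is_functor_def fobG
  proof (intro conjI ballI impI)
    show "g A \<in> Obj X" if "A \<in> Obj ?D" for A using gX(1) that by simp
    show "far G h \<in> hom X (g A) (g B)" if "h \<in> hom ?D A B" for h A B
    proof -
      have h: "h \<in> Arr ?D" "Dom D h = A" "Cod D h = B" using that by (auto simp: hom_def)
      obtain f where "f \<in> Arr X" "Dom X f = g A" "Cod X f = g B" "far U f = h"
        using U_surj[OF h(1)] unfolding h(2,3) by blast
      then show ?thesis using GU[of f] by (auto simp: hom_def)
    qed
    show "far G (Id ?D A) = Id X (g A)" if "A \<in> Obj ?D" for A
    proof -
      have A: "g A \<in> Obj X" "fob U (g A) = A" using gX that by simp_all
      have "far U (Id X (g A)) = Id D A" using F A unfolding is_functor_def by metis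
      then show ?thesis using GU[of "Id X (g A)"] A by simp
    qed
    show "far G (k \<cdot>\<^bsub>?D\<^esub> h) = far G k \<cdot>\<^bsub>X\<^esub> far G h"
      if hk: "h \<in> Arr ?D" "k \<in> Arr ?D" "Dom ?D k = Cod ?D h" for h k
    proof -
      obtain f where f: "f \<in> Arr X" "Dom X f = g (Dom D h)" "Cod X f = g (Cod D h)" "far U f = h" using U_surj[OF hk(1)] by auto
      obtain f' where f': "f' \<in> Arr X" "Dom X f' = g (Dom D k)" "Cod X f' = g (Cod D k)" "far U f' = k" using U_surj[OF hk(2)] by auto
      have d: "Dom X f' = Cod X f" using f f' hk(3) by simp
      have "far U (f' \<cdot>\<^bsub>X\<^esub> f) = k \<cdot>\<^bsub>D\<^esub> h" using functor_comp[OF F f(1) f'(1) d] f f' by simp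
      then show ?thesis using GU[of "f' \<cdot>\<^bsub>X\<^esub> f"] GU[OF f(1)] GU[OF f'(1)] f f' d by simp
    qed
  qed
  have 1: "naturally_isomorphic X X id_func (comp_func G U)"
    unfolding naturally_isomorphic_def
  proof (intro exI[of _ "Id X"] conjI ballI)
    show "natural_transformation X X id_func (comp_func G U) (Id X)"
      unfolding natural_transformation_def id_func_def comp_func_def
      using GU g fobG X.dom_obj X.cod_obj by (auto simp: hom_def)
  qed (rule X.iso_Id)
  have UG: "far U (far G h) = h" if "h \<in> Arr ?D" for h using U_surj[OF that] GU by metis
  have S: "?S \<subseteq> Obj D" using F unfolding is_functor_def by blast
  have 2: "naturally_isomorphic ?D ?D (comp_func U G) id_func"
    unfolding naturally_isomorphic_def
  proof (intro exI[of _ "Id D"] conjI ballI)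
    show "natural_transformation ?D ?D (comp_func U G) id_func (Id D)"
      unfolding natural_transformation_def id_func_def comp_func_def
    proof (intro conjI ballI)
      show "Id D A \<in> hom ?D (fob \<lparr>fob = fob U \<circ> fob G, far = far U \<circ> far G\<rparr> A) (fob \<lparr>fob = \<lambda>A. A, far = \<lambda>f. f\<rparr> A)"
        if "A \<in> Obj ?D" for A using that S gX[of A] fobG by (auto simp: hom_def)
      show "Id D (Cod ?D f) \<cdot>\<^bsub>?D\<^esub> far \<lparr>fob = fob U \<circ> fob G, far = far U \<circ> far G\<rparr> f =
         far \<lparr>fob = \<lambda>A. A, far = \<lambda>f. f\<rparr> f \<cdot>\<^bsub>?D\<^esub> Id D (Dom ?D f)" if "f \<in> Arr ?D" for f
        using UG[OF that] that by simp
    qed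
  qed (use S D.full_subcat_iso[OF S] D.iso_Id in auto)
  show ?thesis unfolding equivalent_categories_def using F' G 1 2 by blast
qed


section \<open>The equivalence of the four conditions\<close>

lemma semi_left_exact_in_exact_maltsev:
  assumes "semi_left_exact_embedding X D U" "exact_category D" "maltsev_category D"
  shows "regular_category X \<and> maltsev_category X \<and> has_stable_coequalizers_of_equivalence_relations X"
proof -
  interpret semi_left_exact_in_exact X D U
    using assms unfolding semi_left_exact_in_exact_def by blast
  show ?thesis
    using X_maltsev[OF assms(3)] X_stable_coequalizers
      finitely_complete_category.regular_from_stable_coequalizers[OF X_finitely_complete X_stable_coequalizers] by blast
qed

lemma semi_localization_of_exact_maltsev:
  assumes "category X" "exact_category D" "maltsev_category D" "is_semi_localization_of X D"
  shows "regular_category X \<and> maltsev_category X \<and> has_stable_coequalizers_of_equivalence_relations X"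
proof -
  interpret D: exact_category D by (rule assms(2))
  show ?thesis
    using semi_localization_embedding[OF assms(1) D.category_axioms assms(4)] semi_left_exact_in_exact_maltsev assms(2,3) by blast
qed

lemma semi_localization_with_units_is_semi_localization:
  "is_semi_localization_with_regular_epi_units_of X D \<Longrightarrow> is_semi_localization_of X D"
  unfolding is_semi_localization_with_regular_epi_units_of_def is_semi_localization_of_def by blast

context regular_category
begin

text \<open>The reflective subcategory is the literal image of the unit, so
  \<open>semi_left_exact_embedding\<close> applies without passing through an equivalence.\<close>

lemma semi_localization_along_unit_stable:
  assumes "maltsev_category C" "is_semi_localization_along C EC (ex_reg_unit C)"
  shows "has_stable_coequalizers_of_equivalence_relations C"
proof -
  interpret EC: category EC by (rule ex_category)
  obtain L \<eta> where sl: "semi_localization EC (unit_obj ` Obj C) L \<eta>"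
    using assms(2) unfolding is_semi_localization_along_def by blast
  have "semi_left_exact_embedding C EC (ex_reg_unit C)"
  proof
    show "fully_faithful C EC (ex_reg_unit C)" by (rule unit_fully_faithful)
    show "\<exists>m. universal_arrow_to EC (unit_obj ` Obj C) m \<and> Dom EC m = Q" if "Q \<in> Obj EC" for Q
      using EC.semi_localizationD(2,3)[OF sl that] by blast
  qed (rule EC.semi_localization_semi_left_exact[OF sl])
  then show ?thesis using semi_left_exact_in_exact_maltsev[OF _ ex_exact ex_maltsev[OF assms(1)]] by blast
qed

text \<open>One construction serves (c) and (d): the reflection onto the image of the unit has
  regular epimorphic units, and this image is equivalent to the base because the unit is injective
  on objects.\<close>

lemma stable_semi_localization_of_ex_reg:
  assumes "has_stable_coequalizers_of_equivalence_relations C"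
  shows "is_semi_localization_along C EC (ex_reg_unit C)" "is_semi_localization_with_regular_epi_units_of C EC"
proof -
  obtain L \<eta> where sl: "semi_localization EC (unit_obj ` Obj C) L \<eta>" "\<forall>A \<in> Obj EC. regular_epi EC (\<eta> A)"
    using unit_semi_localization[OF assms] by blast
  show "is_semi_localization_along C EC (ex_reg_unit C)"
    unfolding is_semi_localization_along_def using sl(1) unit_fully_faithful by blast
  have "inj_on unit_obj (Obj C)" using unit_obj(2) by (metis inj_onI)
  then have "equivalent_categories C (full_subcat EC (unit_obj ` Obj C))"
    by (rule equivalent_to_full_image[OF category_axioms ex_category unit_fully_faithful])
  then show "is_semi_localization_with_regular_epi_units_of C EC"
    unfolding is_semi_localization_with_regular_epi_units_of_def using sl by blast
qed

end

text \<open>A formula cannot quantify over types. The existential statements (b) and (c) are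
  therefore read over the types of the exact completion, where the witness lives, and
  \<open>b_D\<close> and \<open>c_D\<close> add the implications to (a) for a category on arbitrary
  types.\<close>

theorem theorem3p6:
  fixes X :: "('o, 'm) cat" and D :: "('p, 'n) cat"
  assumes "category X"
  shows
    "(let a = regular_category X \<and> maltsev_category X \<and>
              has_stable_coequalizers_of_equivalence_relations X;
          b = (\<exists>C :: (('o, 'm) ex_obj, ('o, 'm) ex_arr) cat.
                 exact_category C \<and> maltsev_category C \<and> is_semi_localization_of X C);
          c = (\<exists>C :: (('o, 'm) ex_obj, ('o, 'm) ex_arr) cat.
                 exact_category C \<and> maltsev_category C \<and>
                 is_semi_localization_with_regular_epi_units_of X C);
          d = (regular_category X \<and> maltsev_category X \<and>
               is_semi_localization_along X (ex_reg X) (ex_reg_unit X));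
          b_D = (exact_category D \<and> maltsev_category D \<and> is_semi_localization_of X D);
          c_D = (exact_category D \<and> maltsev_category D \<and>
                 is_semi_localization_with_regular_epi_units_of X D)
      in (a \<longleftrightarrow> b) \<and> (a \<longleftrightarrow> c) \<and> (a \<longleftrightarrow> d) \<and> (b_D \<longrightarrow> a) \<and> (c_D \<longrightarrow> a))"
proof -
  let ?a = "regular_category X \<and> maltsev_category X \<and> has_stable_coequalizers_of_equivalence_relations X"
  let ?b = "\<exists>C :: (('o, 'm) ex_obj, ('o, 'm) ex_arr) cat.
    exact_category C \<and> maltsev_category C \<and> is_semi_localization_of X C"
  let ?c = "\<exists>C :: (('o, 'm) ex_obj, ('o, 'm) ex_arr) cat.
    exact_category C \<and> maltsev_category C \<and> is_semi_localization_with_regular_epi_units_of X C"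
  let ?d = "regular_category X \<and> maltsev_category X \<and> is_semi_localization_along X (ex_reg X) (ex_reg_unit X)"
  have cb: "?c \<Longrightarrow> ?b"
    using semi_localization_with_units_is_semi_localization by blast
  have ba: "?b \<Longrightarrow> ?a"
    using semi_localization_of_exact_maltsev[OF assms] by blast
  have ac: ?c and ad: ?d if a: ?a
  proof -
    interpret regular_category X using a by blast
    have M: "maltsev_category X" and St: "has_stable_coequalizers_of_equivalence_relations X" using a by blast+
    note st = stable_semi_localization_of_ex_reg[OF St]
    show ?c by (intro exI[of _ "ex_reg X"] conjI ex_exact ex_maltsev M st(2))
    show ?d using a st(1) by blast
  qed
  have da: "?d \<Longrightarrow> ?a"
    using regular_category.semi_localization_along_unit_stable by blast
  have bD: "exact_category D \<and> maltsev_category D \<and> is_semi_localization_of X D \<longrightarrow> ?a"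
    using semi_localization_of_exact_maltsev[OF assms] by blast
  have cD: "exact_category D \<and> maltsev_category D \<and> is_semi_localization_with_regular_epi_units_of X D \<longrightarrow> ?a"
    using bD semi_localization_with_units_is_semi_localization by blast
  have "?a = ?b" by (rule iffI[OF cb[OF ac] ba])
  moreover have "?a = ?c" by (rule iffI[OF ac ba[OF cb]])
  moreover have "?a = ?d" by (rule iffI[OF ad da])
  ultimately show ?thesis
    unfolding Let_def using bD cD by (intro conjI)
qed

end
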